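(* Let $\mathbf{P}$ be an operad with $\mathbf{P}(0)=(0)$ and all $\mathbf{P}(n)$ finite-dimensional. 1. (a) The monoid of characters of both $\mathbf{D}'_{\mathbf{P}}$ and its abelianization is identified with $(\overline{\mathbf{P}},\lozenge')$, where for all $x=\sum x_n\in\overline{\mathbf{P}}$, $y\in\overline{\mathbf{P}}$: $$x\lozenge'y=y+\sum_{n\ge1}\ \sum_{1\le i_1<\cdots<i_k\le n}x_n\circ_{i_1,\ldots,i_k}(y,\ldots,y)$$ (the inner sum being over all subsets $\{i_1<\cdots<i_k\}$ of $[n]$, including the empty one). (b) The monoid of characters of both $\mathbf{D}^*_{\mathbf{P}}$ and its abelianization is identified with $(\overline{\mathbf{P}},\lozenge)$, where for all $x=\sum x_n\in\overline{\mathbf{P}}$, $y\in\overline{\mathbf{P}}$: $$x\lozenge y=\sum_{n\ge1}x_n\circ(y,\ldots,y).$$ (c) The monoids $(\overline{\mathbf{P}},\lozenge')$ and $(\overline{\mathbf{P}},\lozenge)$ are isomorphic. (d) $M^D_{\mathbf{P}}=\overline{\mathrm{coinv}\,\mathbf{P}}$ is a quotient of the monoids $(\overline{\mathbf{P}},\lozenge)$ and $(\overline{\mathbf{P}},\lozenge')$, and (as quotient of $(\overline{\mathbf{P}},\lozenge)$) is identified with the monoid of characters of $D^*_{\mathbf{P}}$. 2. (a) The group of characters of both $\mathbf{B}^*_{\mathbf{P}}$ and its abelianization is identified with $(\overline{\mathbf{P}_+},\lozenge)$, where for all $x=\sum x_n$, $y\in\overline{\mathbf{P}_+}$: $$x\lozenge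 y=y+\sum_{n\ge1}x_n\circ(I+y,\ldots,I+y).$$ (b) $G^B_{\mathbf{P}}=\overline{\mathrm{coinv}\,\mathbf{P}_+}$ is a quotient group of $(\overline{\mathbf{P}_+},\lozenge)$, identified with the group of characters of $B^*_{\mathbf{P}}$.
   Context: $K$ is a field of characteristic zero. $\mathbf{P}=\bigoplus_{n\ge1}\mathbf{P}(n)$, $\overline{\mathbf{P}}=\prod_{n\ge1}\mathbf{P}(n)$, $\overline{\mathbf{P}_+}=\prod_{n\ge2}\mathbf{P}(n)$, and similarly $\overline{\mathrm{coinv}\,\mathbf{P}}$, $\overline{\mathrm{coinv}\,\mathbf{P}_+}$ for the spaces of $\mathfrak{S}_n$-coinvariants; $x_n$ denotes the component of $x$ in $\mathbf{P}(n)$. $I\in\mathbf{P}(1)$ is the unit; $x_n\circ_{i_1,\ldots,i_k}(y,\ldots,y)$ is the composition with $y$ in positions $i_1,\ldots,i_k$ and $I$ elsewhere, extended multilinearly to infinite sums. $\mathbf{P}^*=\bigoplus_n\mathbf{P}(n)^*$. Characters are algebra morphisms to $K$ with convolution product; the identifications send $x\in\overline{\mathbf{P}}$ to the character $f_1\cdots f_k\mapsto f_1(x)\cdots f_k(x)$ (with the $f_i$ taken in $\mathbf{P}^*$, $\mathbf{P}_+^*$ or their invariant parts, accordingly). $\mathbf{D}^*_{\mathbf{P}}=(T(\mathbf{P}^* ),m_{conc},\Delta_* )$: $\Delta_*$ is the algebra morphism whose value on $f\in\mathbf{P}^*$ is the transpose of the operadic composition in $\mathbf{P}^*\otimes T(\mathbf{P}^*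 )$, $\Delta_*(f)(q\otimes q_1\cdots q_p)=f(q\circ(q_1,\ldots,q_p))$. Its abelianization is $S(\mathbf{P}^* )$ and $D^*_{\mathbf{P}}=S(\mathrm{inv}\,\mathbf{P}^* )$ is a subbialgebra of it ($\mathrm{inv}$: $\mathfrak{S}_n$-invariants). $\mathbf{D}'_{\mathbf{P}}=(T(\mathbf{P}^* ),m_{conc},\Delta'_* )$: $\Delta'_*$ is the algebra morphism with $\ll\Delta'_*(f),X\otimes Y\gg'=f(\langle X,Y\rangle)$ for $f\in\mathbf{P}^*$, $X,Y\in T(\mathbf{P})$, where $\ll f_1\cdots f_k,x_1\cdots x_l\gg'=\delta_{k,l}\prod f_i(x_i)$, $\langle p,p_1\cdots p_k\rangle=\sum_{1\le i_1<\cdots<i_k\le n}p\circ_{i_1,\ldots,i_k}(p_1,\ldots,p_k)$ for $p\in\mathbf{P}(n)$, $\langle1,x\rangle=x$ for $x\in\mathbf{P}$, $\langle1,v\rangle=0$ for $v$ of length $\ne1$, $\langle u,v\rangle=0$ for $u$ of length $\ge2$. $\mathbf{B}^*_{\mathbf{P}}=\mathbf{D}^*_{\mathbf{P}}/I_0$, where $I_0$ is the ideal generated by $f-f(I)1$, $f\in\mathbf{P}(1)^*$; as an algebra it is $T(\mathbf{P}_+^* )$. $B^*_{\mathbf{P}}=D^*_{\mathbf{P}}/(J_0\cap D^*_{\mathbf{P}})$ with $J_0$ the ideal of $S(\mathbf{P}^* )$ generated by the same elements; as an algebra it is $S(\mathrm{inv}\,\mathbf{P}_+^* )$. *)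

theory Defs
  imports Complex_Main "HOL-Combinatorics.Permutations" "HOL-Algebra.QuotRing" "HOL-Algebra.Module"
begin

section \<open>Algebras over a field\<close>

text \<open>
  Scalars range over a type \<open>'k\<close> of class \<open>field\<close>. Vector spaces and associative unital algebras that
  arise as constructions are module records of HOL-Algebra; for a mere vector space the
  multiplicative fields are left undefined.
\<close>

definition linear_form :: "('k::field, 'a, 'm) module_scheme \<Rightarrow> ('a \<Rightarrow> 'k) \<Rightarrow> bool"
  where "linear_form A \<phi> \<longleftrightarrow>
    (\<forall>a\<in>carrier A. \<forall>b\<in>carrier A. \<phi> (a \<oplus>\<^bsub>A\<^esub> b) = \<phi> a + \<phi> b) \<and>
    (\<forall>c. \<forall>a\<in>carrier A. \<phi> (c \<odot>\<^bsub>A\<^esub> a) = c * \<phi> a)"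

definition alg_hom ::
    "('k::field, 'a, 'm) module_scheme \<Rightarrow> ('k, 'b, 'n) module_scheme \<Rightarrow> ('a \<Rightarrow> 'b) set"
  where "alg_hom A B =
    {h \<in> ring_hom A B. \<forall>c. \<forall>a\<in>carrier A. h (c \<odot>\<^bsub>A\<^esub> a) = c \<odot>\<^bsub>B\<^esub> h a}"

definition scalars :: "('k::field, 'k) module"
  where "scalars = \<lparr>carrier = UNIV, mult = (*), one = 1, zero = 0, add = (+), smult = (*)\<rparr>"

definition quot_alg :: "('k::field, 'a, 'm) module_scheme \<Rightarrow> 'a set \<Rightarrow> ('k, 'a set) module"
  where "quot_alg A J = (let Q = A Quot J in
    \<lparr>carrier = carrier Q, mult = mult Q, one = one Q, zero = zero Q, add = add Q,
     smult = (\<lambda>c X. \<Union>x\<in>X. J +>\<^bsub>A\<^esub> (c \<odot>\<^bsub>A\<^esub> x))\<rparr>)"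

inductive_set subalgebra_gen :: "('k::field, 'a, 'm) module_scheme \<Rightarrow> 'a set \<Rightarrow> 'a set"
  for A :: "('k::field, 'a, 'm) module_scheme" and X :: "'a set" where
  "x \<in> X \<Longrightarrow> x \<in> subalgebra_gen A X"
| "\<one>\<^bsub>A\<^esub> \<in> subalgebra_gen A X"
| "a \<in> subalgebra_gen A X \<Longrightarrow> b \<in> subalgebra_gen A X \<Longrightarrow> a \<oplus>\<^bsub>A\<^esub> b \<in> subalgebra_gen A X"
| "a \<in> subalgebra_gen A X \<Longrightarrow> b \<in> subalgebra_gen A X \<Longrightarrow> a \<otimes>\<^bsub>A\<^esub> b \<in> subalgebra_gen A X"
| "a \<in> subalgebra_gen A X \<Longrightarrow> c \<odot>\<^bsub>A\<^esub> a \<in> subalgebra_gen A X"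

definition commutator_ideal :: "('k::field, 'a, 'm) module_scheme \<Rightarrow> 'a set"
  where "commutator_ideal A =
    Idl\<^bsub>A\<^esub> {(a \<otimes>\<^bsub>A\<^esub> b) \<ominus>\<^bsub>A\<^esub> (b \<otimes>\<^bsub>A\<^esub> a) | a b. a \<in> carrier A \<and> b \<in> carrier A}"


section \<open>Tensor products\<close>

text \<open>
  Over a field, the canonical map from \<open>A \<otimes> B\<close> to the dual of the space of bilinear forms on
  \<open>A \<times> B\<close> is injective. We take its image as the tensor product: the pure tensor of \<open>a\<close> and \<open>b\<close> is
  the evaluation \<open>\<beta> \<mapsto> \<beta>(a,b)\<close>, and a tensor is a finite sum of pure ones. Thus
  \<open>(\<phi> \<otimes> \<psi>)(t)\<close>, for linear forms \<open>\<phi>\<close> and \<open>\<psi>\<close>, is \<open>t (\<lambda>x y. \<phi> x * \<psi> y)\<close>. The lemma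
  \<open>tensor_universal\<close> below is the universal property. Bilinear forms are unconstrained off the
  carriers; functionals vanish off the bilinear forms, so that they are equal as soon as they agree
  on those.
\<close>

type_synonym ('k, 'a, 'b) tensor = "('a \<Rightarrow> 'b \<Rightarrow> 'k) \<Rightarrow> 'k"

definition bilinear_forms ::
    "('k::field, 'a, 'm) module_scheme \<Rightarrow> ('k, 'b, 'n) module_scheme \<Rightarrow> ('a \<Rightarrow> 'b \<Rightarrow> 'k) set"
  where "bilinear_forms A B =
    {\<beta>. (\<forall>a\<in>carrier A. linear_form B (\<beta> a)) \<and> (\<forall>b\<in>carrier B. linear_form A (\<lambda>a. \<beta> a b))}"

definition pure_tensor ::
    "('k::field, 'a, 'm) module_scheme \<Rightarrow> ('k, 'b, 'n) module_scheme \<Rightarrow> 'a \<Rightarrow> 'b \<Rightarrow> ('k, 'a, 'b) tensor"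
  where "pure_tensor A B a b = (\<lambda>\<beta>. if \<beta> \<in> bilinear_forms A B then \<beta> a b else 0)"

definition tensors ::
    "('k::field, 'a, 'm) module_scheme \<Rightarrow> ('k, 'b, 'n) module_scheme \<Rightarrow> 'a set \<Rightarrow> 'b set
      \<Rightarrow> ('k, 'a, 'b) tensor set"
  where "tensors A B X Y =
    {\<lambda>\<beta>. \<Sum>(a, b)\<leftarrow>ps. pure_tensor A B a b \<beta> | ps. set ps \<subseteq> X \<times> Y}"

definition tensor_prod ::
    "('k::field, 'a, 'm) module_scheme \<Rightarrow> ('k, 'b, 'n) module_scheme
      \<Rightarrow> ('k, ('k, 'a, 'b) tensor) module"
  where "tensor_prod A B =
    \<lparr>carrier = tensors A B (carrier A) (carrier B),
     mult = (\<lambda>s t \<beta>. if \<beta> \<in> bilinear_forms A B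
                   then s (\<lambda>a b. t (\<lambda>c d. \<beta> (a \<otimes>\<^bsub>A\<^esub> c) (b \<otimes>\<^bsub>B\<^esub> d))) else 0),
     one = pure_tensor A B \<one>\<^bsub>A\<^esub> \<one>\<^bsub>B\<^esub>,
     zero = (\<lambda>_. 0),
     add = (\<lambda>s t \<beta>. s \<beta> + t \<beta>),
     smult = (\<lambda>c s \<beta>. c * s \<beta>)\<rparr>"

text \<open>\<open>tensor_map A B h k\<close> is \<open>h \<otimes> k\<close>, where \<open>A\<close> and \<open>B\<close> are the codomains of the linear maps
  \<open>h\<close> and \<open>k\<close>.\<close>

definition tensor_map ::
    "('k::field, 'c, 'm) module_scheme \<Rightarrow> ('k, 'd, 'n) module_scheme \<Rightarrow> ('a \<Rightarrow> 'c) \<Rightarrow> ('b \<Rightarrow> 'd)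
      \<Rightarrow> ('k, 'a, 'b) tensor \<Rightarrow> ('k, 'c, 'd) tensor"
  where "tensor_map A B h k t =
    (\<lambda>\<beta>. if \<beta> \<in> bilinear_forms A B then t (\<lambda>a b. \<beta> (h a) (k b)) else 0)"


lemma vector_space_scalars: "vector_space ((*) :: 'k \<Rightarrow> 'k \<Rightarrow> 'k::field)"
  by unfold_locales (auto simp: algebra_simps)

lemma separating_functional:
  fixes sc :: "'k::field \<Rightarrow> 'w::ab_group_add \<Rightarrow> 'w"
  assumes "vector_space sc" "w \<noteq> 0"
  obtains f where "Vector_Spaces.linear sc (*) f" "f w = (1 :: 'k)"
proof -
  interpret vector_space_pair sc "(*) :: 'k \<Rightarrow> 'k \<Rightarrow> 'k"
    using assms(1) vector_space_scalars by (rule vector_space_pair.intro)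
  have "vs1.independent {w}" using assms(2) by (simp add: vs1.dependent_single)
  from linear_independent_extend[OF this, of "\<lambda>_. 1"] that show thesis by blast
qed

lemma linear_sum_list:
  assumes "Vector_Spaces.linear sc (*) f"
  shows "f (sum_list (map g xs)) = (\<Sum>x\<leftarrow>xs. f (g x))"
proof -
  interpret Vector_Spaces.linear sc "(*)" f by fact
  show ?thesis by (induction xs) (simp_all add: zero add)
qed

lemma tensor_universal:
  fixes sc :: "'k::field \<Rightarrow> 'w::ab_group_add \<Rightarrow> 'w" and F :: "'a \<Rightarrow> 'b \<Rightarrow> 'w"
  assumes "vector_space sc"
    and "\<And>f. Vector_Spaces.linear sc (*) f \<Longrightarrow> (\<lambda>a b. f (F a b)) \<in> bilinear_forms A B"
  shows "\<exists>L. \<forall>ps. L (\<lambda>\<beta>. \<Sum>(a, b)\<leftarrow>ps. pure_tensor A B a b \<beta>) = (\<Sum>(a, b)\<leftarrow>ps. F a b)"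
proof -
  define T where "T ps = (\<lambda>\<beta>. \<Sum>(a, b)\<leftarrow>ps. pure_tensor A B a b \<beta>)" for ps
  define S where "S ps = (\<Sum>(a, b)\<leftarrow>ps. F a b)" for ps
  have "S ps = S qs" if eq: "T ps = T qs" for ps qs
  proof (rule ccontr)
    assume "S ps \<noteq> S qs"
    then obtain f where f: "Vector_Spaces.linear sc (*) f" "f (S ps - S qs) = (1 :: 'k)"
      using separating_functional[OF assms(1), of "S ps - S qs"] by auto
    have "f (S xs) = T xs (\<lambda>a b. f (F a b))" for xs
      using assms(2)[OF f(1)]
      by (auto simp: S_def T_def pure_tensor_def linear_sum_list[OF f(1)] case_prod_unfold)
    then have "f (S ps) = f (S qs)" using eq by simp
    with f show False
      by (simp add: linear_iff_module_hom module_hom.diff)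
  qed
  then have "S (SOME ps'. T ps' = T ps) = S ps" for ps
    by (metis (mono_tags, lifting) someI)
  then have "\<exists>L. \<forall>ps. L (T ps) = S ps"
    by (intro exI[of _ "\<lambda>t. S (SOME ps'. T ps' = t)"]) blast
  then show ?thesis unfolding S_def T_def .
qed


section \<open>The tensor algebra\<close>

text \<open>
  The same construction with multilinear forms of all arities: \<open>word V [v\<^sub>1, \<dots>, v\<^sub>k]\<close> is
  \<open>v\<^sub>1 \<otimes> \<dots> \<otimes> v\<^sub>k\<close>, i.e. evaluation at \<open>(v\<^sub>1, \<dots>, v\<^sub>k)\<close>, and the product concatenates words.
\<close>

type_synonym ('k, 'v) tens = "('v list \<Rightarrow> 'k) \<Rightarrow> 'k"

definition multilinear_forms :: "('k::field, 'v, 'm) module_scheme \<Rightarrow> ('v list \<Rightarrow> 'k) set"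
  where "multilinear_forms V =
    {\<phi>. \<forall>u\<in>lists (carrier V). \<forall>w\<in>lists (carrier V). linear_form V (\<lambda>v. \<phi> (u @ v # w))}"

definition word :: "('k::field, 'v, 'm) module_scheme \<Rightarrow> 'v list \<Rightarrow> ('k, 'v) tens"
  where "word V vs = (\<lambda>\<phi>. if \<phi> \<in> multilinear_forms V then \<phi> vs else 0)"

definition tensor_algebra :: "('k::field, 'v, 'm) module_scheme \<Rightarrow> ('k, ('k, 'v) tens) module"
  where "tensor_algebra V =
    \<lparr>carrier = {\<lambda>\<phi>. \<Sum>(c, vs)\<leftarrow>ts. c * word V vs \<phi> | ts. snd ` set ts \<subseteq> lists (carrier V)},
     mult = (\<lambda>s t \<phi>. if \<phi> \<in> multilinear_forms V then s (\<lambda>u. t (\<lambda>v. \<phi> (u @ v))) else 0),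
     one = word V [],
     zero = (\<lambda>_. 0),
     add = (\<lambda>s t \<phi>. s \<phi> + t \<phi>),
     smult = (\<lambda>c s \<phi>. c * s \<phi>)\<rparr>"

lemma tensor_algebra_universal:
  fixes sc :: "'k::field \<Rightarrow> 'w::ab_group_add \<Rightarrow> 'w" and F :: "'v list \<Rightarrow> 'w"
  assumes "vector_space sc"
    and "\<And>f. Vector_Spaces.linear sc (*) f \<Longrightarrow> (\<lambda>vs. f (F vs)) \<in> multilinear_forms V"
  shows "\<exists>L. \<forall>ts. L (\<lambda>\<phi>. \<Sum>(c, vs)\<leftarrow>ts. c * word V vs \<phi>) = (\<Sum>(c, vs)\<leftarrow>ts. sc c (F vs))"
proof -
  define T where "T ts = (\<lambda>\<phi>. \<Sum>(c, vs)\<leftarrow>ts. c * word V vs \<phi>)" for ts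
  define S where "S ts = (\<Sum>(c, vs)\<leftarrow>ts. sc c (F vs))" for ts
  have "S ps = S qs" if eq: "T ps = T qs" for ps qs
  proof (rule ccontr)
    assume "S ps \<noteq> S qs"
    then obtain f where f: "Vector_Spaces.linear sc (*) f" "f (S ps - S qs) = (1 :: 'k)"
      using separating_functional[OF assms(1), of "S ps - S qs"] by auto
    have "f (S xs) = T xs (\<lambda>vs. f (F vs))" for xs
      using assms(2)[OF f(1)] f(1)
      by (auto simp: S_def T_def word_def linear_sum_list[OF f(1)] case_prod_unfold
          linear_iff_module_hom module_hom.scale)
    then have "f (S ps) = f (S qs)" using eq by simp
    with f show False
      by (simp add: linear_iff_module_hom module_hom.diff)
  qed
  then have "S (SOME ts'. T ts' = T ts) = S ts" for ts
    by (metis (mono_tags, lifting) someI)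
  then have "\<exists>L. \<forall>ts. L (T ts) = S ts"
    by (intro exI[of _ "\<lambda>t. S (SOME ts'. T ts' = t)"]) blast
  then show ?thesis unfolding S_def T_def .
qed


section \<open>Bialgebras and their characters\<close>

record ('k, 'a) bialgebra = "('k, 'a) module" +
  coprod :: "'a \<Rightarrow> ('k, 'a, 'a) tensor"

definition with_coprod ::
    "('k::field, 'a) module \<Rightarrow> ('a \<Rightarrow> ('k, 'a, 'a) tensor) \<Rightarrow> ('k, 'a) bialgebra"
  where "with_coprod A \<delta> =
    \<lparr>carrier = carrier A, mult = mult A, one = one A, zero = zero A, add = add A,
     smult = smult A, coprod = \<delta>\<rparr>"

definition quot_bialgebra :: "('k::field, 'a) bialgebra \<Rightarrow> 'a set \<Rightarrow> ('k, 'a set) bialgebra"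
  where "quot_bialgebra H J = (let Q = quot_alg H J; \<pi> = (\<lambda>a. J +>\<^bsub>H\<^esub> a) in
    with_coprod Q (THE \<delta>. \<delta> \<in> extensional (carrier Q) \<and>
      (\<forall>a\<in>carrier H. \<delta> (\<pi> a) = tensor_map Q Q \<pi> \<pi> (coprod H a))))"

definition sub_bialgebra :: "('k::field, 'a) bialgebra \<Rightarrow> 'a set \<Rightarrow> ('k, 'a) bialgebra"
  where "sub_bialgebra H S = (let B = H\<lparr>carrier := S\<rparr> in
    H\<lparr>carrier := S, coprod := (THE \<delta>. \<delta> \<in> extensional S \<and>
      (\<forall>a\<in>S. \<delta> a \<in> carrier (tensor_prod B B) \<and>
             tensor_map H H (\<lambda>x. x) (\<lambda>x. x) (\<delta> a) = coprod H a))\<rparr>)"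

definition abelianization :: "('k::field, 'a) bialgebra \<Rightarrow> ('k, 'a set) bialgebra"
  where "abelianization H = quot_bialgebra H (commutator_ideal H)"

definition characters :: "('k::field, 'a) bialgebra \<Rightarrow> ('a \<Rightarrow> 'k) set"
  where "characters H = alg_hom H scalars \<inter> extensional (carrier H)"

text \<open>The counit is determined by the coproduct. As linear forms separate points, the equation
  \<open>(\<epsilon> \<otimes> id) \<circ> \<Delta> = id = (id \<otimes> \<epsilon>) \<circ> \<Delta>\<close> is tested against all linear forms.\<close>

definition counit :: "('k::field, 'a) bialgebra \<Rightarrow> 'a \<Rightarrow> 'k"
  where "counit H = (THE \<epsilon>. \<epsilon> \<in> characters H \<and>
    (\<forall>\<psi> a. linear_form H \<psi> \<longrightarrow> a \<in> carrier H \<longrightarrow>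
      coprod H a (\<lambda>x y. \<epsilon> x * \<psi> y) = \<psi> a \<and> coprod H a (\<lambda>x y. \<psi> x * \<epsilon> y) = \<psi> a))"

definition char_monoid :: "('k::field, 'a) bialgebra \<Rightarrow> ('a \<Rightarrow> 'k) monoid"
  where "char_monoid H =
    \<lparr>carrier = characters H,
     mult = (\<lambda>\<phi> \<psi>. \<lambda>a\<in>carrier H. coprod H a (\<lambda>x y. \<phi> x * \<psi> y)),
     one = counit H\<rparr>"


section \<open>Operads\<close>

text \<open>
  A family of vector spaces is given as subspaces \<open>ops \<P> n\<close> of one ambient space with scalar
  multiplication \<open>scal \<P>\<close>; the subspaces need not be independent. As the arity of an operation
  cannot be read off the operation, composition takes a list of inputs tagged with
  their arities: \<open>comp \<P> p [(m\<^sub>1, q\<^sub>1), \<dots>, (m\<^sub>n, q\<^sub>n)]\<close> is \<open>p \<circ> (q\<^sub>1, \<dots>, q\<^sub>n)\<close> for \<open>p\<close> of arity \<open>n\<close>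
  and \<open>q\<^sub>i\<close> of arity \<open>m\<^sub>i\<close>. Positions are numbered from 0.

  Symmetric groups act on the right. In the model case of an endomorphism operad the action is
  \<open>(p \<cdot> \<sigma>)(v\<^sub>0, \<dots>, v\<^bsub>n-1\<^esub>) = p(w\<^sub>0, \<dots>, w\<^bsub>n-1\<^esub>)\<close> with \<open>w\<^sub>i = v\<^sub>j\<close>, where \<open>\<sigma> j = i\<close>.
\<close>

record ('k, 'a) operad_data =
  scal :: "'k \<Rightarrow> 'a \<Rightarrow> 'a"
  ops :: "nat \<Rightarrow> 'a set"
  act :: "nat \<Rightarrow> (nat \<Rightarrow> nat) \<Rightarrow> 'a \<Rightarrow> 'a"
  comp :: "'a \<Rightarrow> (nat \<times> 'a) list \<Rightarrow> 'a"
  unt :: 'a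

definition tagged :: "('k, 'a) operad_data \<Rightarrow> (nat \<times> 'a) set"
  where "tagged \<P> = (SIGMA m:UNIV. ops \<P> m)"

definition block_start :: "(nat \<times> 'a) list \<Rightarrow> nat \<Rightarrow> nat"
  where "block_start xs j = (\<Sum>i<j. fst (xs ! i))"

locale operad =
  fixes \<P> :: "('k::field, 'a::ab_group_add) operad_data"
  assumes vs: "vector_space (scal \<P>)"
    and ops_subspace: "module.subspace (scal \<P>) (ops \<P> n)"
    and comp_closed: "p \<in> ops \<P> (length xs) \<Longrightarrow> set xs \<subseteq> tagged \<P> \<Longrightarrow>
      comp \<P> p xs \<in> ops \<P> (\<Sum>(m, q)\<leftarrow>xs. m)"
    and comp_add_left: "p \<in> ops \<P> (length xs) \<Longrightarrow> p' \<in> ops \<P> (length xs) \<Longrightarrow>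
      set xs \<subseteq> tagged \<P> \<Longrightarrow> comp \<P> (p + p') xs = comp \<P> p xs + comp \<P> p' xs"
    and comp_scale_left: "p \<in> ops \<P> (length xs) \<Longrightarrow> set xs \<subseteq> tagged \<P> \<Longrightarrow>
      comp \<P> (scal \<P> c p) xs = scal \<P> c (comp \<P> p xs)"
    and comp_add_right: "p \<in> ops \<P> (length (xs @ (m, q) # ys)) \<Longrightarrow> set xs \<subseteq> tagged \<P> \<Longrightarrow>
      set ys \<subseteq> tagged \<P> \<Longrightarrow> q \<in> ops \<P> m \<Longrightarrow> q' \<in> ops \<P> m \<Longrightarrow>
      comp \<P> p (xs @ (m, q + q') # ys) = comp \<P> p (xs @ (m, q) # ys) + comp \<P> p (xs @ (m, q') # ys)"
    and comp_scale_right: "p \<in> ops \<P> (length (xs @ (m, q) # ys)) \<Longrightarrow> set xs \<subseteq> tagged \<P> \<Longrightarrow>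
      set ys \<subseteq> tagged \<P> \<Longrightarrow> q \<in> ops \<P> m \<Longrightarrow>
      comp \<P> p (xs @ (m, scal \<P> c q) # ys) = scal \<P> c (comp \<P> p (xs @ (m, q) # ys))"
    and unt_closed: "unt \<P> \<in> ops \<P> 1"
    and comp_unt_left: "p \<in> ops \<P> n \<Longrightarrow> comp \<P> (unt \<P>) [(n, p)] = p"
    and comp_unt_right: "p \<in> ops \<P> n \<Longrightarrow> comp \<P> p (replicate n (1, unt \<P>)) = p"
    and comp_assoc: "p \<in> ops \<P> (length xs) \<Longrightarrow> set xs \<subseteq> tagged \<P> \<Longrightarrow>
      map length yss = map fst xs \<Longrightarrow> \<forall>ys\<in>set yss. set ys \<subseteq> tagged \<P> \<Longrightarrow>
      comp \<P> (comp \<P> p xs) (concat yss) =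
      comp \<P> p (map (\<lambda>((m, q), ys). ((\<Sum>(l, r)\<leftarrow>ys. l), comp \<P> q ys)) (zip xs yss))"
    and act_closed: "\<sigma> permutes {..<n} \<Longrightarrow> p \<in> ops \<P> n \<Longrightarrow> act \<P> n \<sigma> p \<in> ops \<P> n"
    and act_add: "\<sigma> permutes {..<n} \<Longrightarrow> p \<in> ops \<P> n \<Longrightarrow> p' \<in> ops \<P> n \<Longrightarrow>
      act \<P> n \<sigma> (p + p') = act \<P> n \<sigma> p + act \<P> n \<sigma> p'"
    and act_scale: "\<sigma> permutes {..<n} \<Longrightarrow> p \<in> ops \<P> n \<Longrightarrow>
      act \<P> n \<sigma> (scal \<P> c p) = scal \<P> c (act \<P> n \<sigma> p)"
    and act_id: "p \<in> ops \<P> n \<Longrightarrow> act \<P> n id p = p"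
    and act_act: "\<sigma> permutes {..<n} \<Longrightarrow> \<tau> permutes {..<n} \<Longrightarrow> p \<in> ops \<P> n \<Longrightarrow>
      act \<P> n \<tau> (act \<P> n \<sigma> p) = act \<P> n (\<sigma> \<circ> \<tau>) p"
    and comp_act_left: "p \<in> ops \<P> n \<Longrightarrow> length xs = n \<Longrightarrow> set xs \<subseteq> tagged \<P> \<Longrightarrow>
      \<sigma> permutes {..<n} \<Longrightarrow> \<beta> permutes {..<block_start xs n} \<Longrightarrow>
      (\<And>j r. j < n \<Longrightarrow> r < fst (xs ! j) \<Longrightarrow>
        \<beta> (block_start xs j + r) = (\<Sum>i | i < n \<and> \<sigma> i < \<sigma> j. fst (xs ! i)) + r) \<Longrightarrow>
      comp \<P> (act \<P> n \<sigma> p) xs =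
      act \<P> (block_start xs n) \<beta> (comp \<P> p (map (\<lambda>i. xs ! inv_into UNIV \<sigma> i) [0..<n]))"
      \<comment> \<open>\<open>\<beta>\<close> moves the block of inputs of \<open>q\<^sub>j\<close> to place \<open>\<sigma> j\<close>\<close>
    and comp_act_right: "p \<in> ops \<P> n \<Longrightarrow> length xs = n \<Longrightarrow> set xs \<subseteq> tagged \<P> \<Longrightarrow>
      (\<And>j. j < n \<Longrightarrow> \<tau>s j permutes {..<fst (xs ! j)}) \<Longrightarrow> \<beta> permutes {..<block_start xs n} \<Longrightarrow>
      (\<And>j r. j < n \<Longrightarrow> r < fst (xs ! j) \<Longrightarrow>
        \<beta> (block_start xs j + r) = block_start xs j + \<tau>s j r) \<Longrightarrow>
      comp \<P> p (map (\<lambda>j. (fst (xs ! j), act \<P> (fst (xs ! j)) (\<tau>s j) (snd (xs ! j)))) [0..<n]) =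
      act \<P> (block_start xs n) \<beta> (comp \<P> p xs)"

definition finite_dim :: "('k::field, 'a::ab_group_add) operad_data \<Rightarrow> 'a set \<Rightarrow> bool"
  where "finite_dim \<P> V \<longleftrightarrow> (\<exists>B. finite B \<and> module.span (scal \<P>) B = V)"


section \<open>The spaces attached to an operad\<close>

type_synonym 'a fam = "nat \<Rightarrow> 'a"
type_synonym ('k, 'a) dual = "nat \<Rightarrow> 'a \<Rightarrow> 'k"
type_synonym ('k, 'a) dual_tens = "('k, ('k, 'a) dual) tens"

definition plus_ops :: "('k, 'a::zero) operad_data \<Rightarrow> nat \<Rightarrow> 'a set"
  where "plus_ops \<P> n = (if n \<ge> 2 then ops \<P> n else {0})"

text \<open>The product over \<open>n \<ge> 1\<close> of the spaces \<open>V n\<close>; in all uses \<open>V 0\<close> has exactly one element.\<close>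

definition completion :: "(nat \<Rightarrow> 'b set) \<Rightarrow> 'b fam set"
  where "completion V = {x. \<forall>n. x n \<in> V n}"

definition finite_fams :: "('k, 'a::zero) operad_data \<Rightarrow> 'a fam set"
  where "finite_fams \<P> = {x \<in> completion (ops \<P>). finite {n. x n \<noteq> 0}}"

text \<open>\<open>W\<^sub>n\<close> with \<open>coinv V(n) = V(n) / W\<^sub>n\<close>\<close>

definition coinv_kernel ::
    "('k::field, 'a::ab_group_add) operad_data \<Rightarrow> (nat \<Rightarrow> 'a set) \<Rightarrow> nat \<Rightarrow> 'a set"
  where "coinv_kernel \<P> V n =
    module.span (scal \<P>) {act \<P> n \<sigma> p - p | \<sigma> p. \<sigma> permutes {..<n} \<and> p \<in> V n}"

definition coinv_class ::
    "('k::field, 'a::ab_group_add) operad_data \<Rightarrow> (nat \<Rightarrow> 'a set) \<Rightarrow> 'a fam \<Rightarrow> 'a set fam"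
  where "coinv_class \<P> V x = (\<lambda>n. {x n + w | w. w \<in> coinv_kernel \<P> V n})"

definition coinv ::
    "('k::field, 'a::ab_group_add) operad_data \<Rightarrow> (nat \<Rightarrow> 'a set) \<Rightarrow> nat \<Rightarrow> 'a set set"
  where "coinv \<P> V n = {{p + w | w. w \<in> coinv_kernel \<P> V n} | p. p \<in> V n}"

text \<open>The graded dual \<open>\<Oplus>\<^sub>n V(n)\<^sup>*\<close>; a linear form on \<open>V(n)\<close> is set to 0 off \<open>V(n)\<close>.\<close>

definition graded_dual ::
    "('k::field, 'a::ab_group_add) operad_data \<Rightarrow> (nat \<Rightarrow> 'a set) \<Rightarrow> ('k, ('k, 'a) dual) module"
  where "graded_dual \<P> V =
    \<lparr>carrier = {f. finite {n. f n \<noteq> (\<lambda>_. 0)} \<and>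
       (\<forall>n. (\<forall>p\<in>V n. \<forall>q\<in>V n. f n (p + q) = f n p + f n q) \<and>
            (\<forall>c. \<forall>p\<in>V n. f n (scal \<P> c p) = c * f n p) \<and>
            (\<forall>p. p \<notin> V n \<longrightarrow> f n p = 0))},
     mult = undefined, one = undefined,
     zero = (\<lambda>_ _. 0),
     add = (\<lambda>f g n p. f n p + g n p),
     smult = (\<lambda>c f n p. c * f n p)\<rparr>"

definition inv_dual ::
    "('k::field, 'a::ab_group_add) operad_data \<Rightarrow> (nat \<Rightarrow> 'a set) \<Rightarrow> ('k, 'a) dual set"
  where "inv_dual \<P> V = {f \<in> carrier (graded_dual \<P> V).
    \<forall>n \<sigma> p. \<sigma> permutes {..<n} \<longrightarrow> p \<in> V n \<longrightarrow> f n (act \<P> n \<sigma> p) = f n p}"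

definition eval :: "('k::field, 'a) dual \<Rightarrow> 'a fam \<Rightarrow> 'k"
  where "eval f x = (\<Sum>n | f n \<noteq> (\<lambda>_. 0). f n (x n))"


section \<open>Compositions of families\<close>

definition unit_fam :: "('k, 'a::zero) operad_data \<Rightarrow> 'a fam"
  where "unit_fam \<P> = (\<lambda>n. if n = 1 then unt \<P> else 0)"

text \<open>\<open>fam_comp \<P> x [y\<^sub>1, \<dots>, y\<^sub>n]\<close> is \<open>x\<^sub>n \<circ> (y\<^sub>1, \<dots>, y\<^sub>n)\<close>, extended multilinearly.\<close>

definition fam_comp :: "('k, 'a::ab_group_add) operad_data \<Rightarrow> 'a fam \<Rightarrow> 'a fam list \<Rightarrow> 'a fam"
  where "fam_comp \<P> x ys = (\<lambda>N. \<Sum>ms | length ms = length ys \<and> sum_list ms = N.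
    comp \<P> (x (length ys)) (map (\<lambda>(m, y). (m, y m)) (zip ms ys)))"

text \<open>\<open>circ_at \<P> x n S ys\<close> is \<open>x\<^sub>n \<circ>\<^sub>S ys\<close>: the entries of \<open>ys\<close> are inserted in order
  at the positions in \<open>S \<subseteq> {..<n}\<close>, and the unit elsewhere.\<close>

definition circ_at ::
    "('k, 'a::ab_group_add) operad_data \<Rightarrow> 'a fam \<Rightarrow> nat \<Rightarrow> nat set \<Rightarrow> 'a fam list \<Rightarrow> 'a fam"
  where "circ_at \<P> x n S ys =
    fam_comp \<P> x (map (\<lambda>i. if i \<in> S then ys ! card {j \<in> S. j < i} else unit_fam \<P>) [0..<n])"

text \<open>In the sums over \<open>n \<ge> 1\<close> below, the terms with \<open>n > N\<close> have no component in arity \<open>N\<close>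
  because the families vanish in arity 0.\<close>

definition diamond :: "('k, 'a::ab_group_add) operad_data \<Rightarrow> 'a fam \<Rightarrow> 'a fam \<Rightarrow> 'a fam"
  where "diamond \<P> x y = (\<lambda>N. \<Sum>n=1..N. fam_comp \<P> x (replicate n y) N)"

definition diamond' :: "('k, 'a::ab_group_add) operad_data \<Rightarrow> 'a fam \<Rightarrow> 'a fam \<Rightarrow> 'a fam"
  where "diamond' \<P> x y = (\<lambda>N. y N +
    (\<Sum>n=1..N. \<Sum>S\<in>Pow {..<n}. circ_at \<P> x n S (replicate (card S) y) N))"

definition diamond_plus :: "('k, 'a::ab_group_add) operad_data \<Rightarrow> 'a fam \<Rightarrow> 'a fam \<Rightarrow> 'a fam"
  where "diamond_plus \<P> x y = (\<lambda>N. y N +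
    (\<Sum>n=1..N. fam_comp \<P> x (replicate n (\<lambda>m. unit_fam \<P> m + y m)) N))"

definition M :: "('k, 'a::ab_group_add) operad_data \<Rightarrow> 'a fam monoid"
  where "M \<P> = \<lparr>carrier = completion (ops \<P>), mult = diamond \<P>, one = unit_fam \<P>\<rparr>"

definition M' :: "('k, 'a::ab_group_add) operad_data \<Rightarrow> 'a fam monoid"
  where "M' \<P> = \<lparr>carrier = completion (ops \<P>), mult = diamond' \<P>, one = (\<lambda>_. 0)\<rparr>"

definition M_plus :: "('k, 'a::ab_group_add) operad_data \<Rightarrow> 'a fam monoid"
  where "M_plus \<P> = \<lparr>carrier = completion (plus_ops \<P>), mult = diamond_plus \<P>, one = (\<lambda>_. 0)\<rparr>"

text \<open>Multiplication of representatives along a map \<open>\<pi>\<close> onto \<open>C\<close>. It does not depend on the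
  representatives as soon as \<open>\<pi>\<close> is a homomorphism into this structure.\<close>

definition quotient_monoid :: "'a monoid \<Rightarrow> ('a \<Rightarrow> 'b) \<Rightarrow> 'b set \<Rightarrow> 'b monoid"
  where "quotient_monoid G \<pi> C =
    \<lparr>carrier = C,
     mult = (\<lambda>X Y. \<pi> (inv_into (carrier G) \<pi> X \<otimes>\<^bsub>G\<^esub> inv_into (carrier G) \<pi> Y)),
     one = \<pi> \<one>\<^bsub>G\<^esub>\<rparr>"


section \<open>The bialgebras\<close>

abbreviation T_dual ::
    "('k::field, 'a::ab_group_add) operad_data \<Rightarrow> ('k, ('k, 'a) dual_tens) module"
  where "T_dual \<P> \<equiv> tensor_algebra (graded_dual \<P> (ops \<P>))"

abbreviation gen ::
    "('k::field, 'a::ab_group_add) operad_data \<Rightarrow> ('k, 'a) dual \<Rightarrow> ('k, 'a) dual_tens"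
  where "gen \<P> f \<equiv> word (graded_dual \<P> (ops \<P>)) [f]"

text \<open>\<open>pairing t X Y\<close> is the value of \<open>t \<in> T(P\<^sup>*) \<otimes> T(P\<^sup>*)\<close> on \<open>X \<otimes> Y\<close>, for words \<open>X\<close> and \<open>Y\<close>
  over \<open>P\<close>.\<close>

definition word_form :: "'a fam list \<Rightarrow> ('k::field, 'a) dual list \<Rightarrow> 'k"
  where "word_form xs fs =
    (if length fs = length xs then \<Prod>(f, x)\<leftarrow>zip fs xs. eval f x else 0)"

definition pairing ::
    "('k::field, ('k, 'a) dual_tens, ('k, 'a) dual_tens) tensor \<Rightarrow> 'a fam list \<Rightarrow> 'a fam list \<Rightarrow> 'k"
  where "pairing t X Y = t (\<lambda>a b. a (word_form X) * b (word_form Y))"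

definition coprod_star ::
    "('k::field, 'a::ab_group_add) operad_data
      \<Rightarrow> ('k, 'a) dual_tens \<Rightarrow> ('k, ('k, 'a) dual_tens, ('k, 'a) dual_tens) tensor"
  where "coprod_star \<P> = (let T = T_dual \<P>; F = carrier (graded_dual \<P> (ops \<P>)) in
    THE \<Delta>. \<Delta> \<in> extensional (carrier T) \<and> \<Delta> \<in> alg_hom T (tensor_prod T T) \<and>
      (\<forall>f\<in>F. \<Delta> (gen \<P> f) \<in> tensors T T (gen \<P> ` F) (carrier T) \<and>
        (\<forall>q\<in>finite_fams \<P>. \<forall>qs\<in>lists (finite_fams \<P>).
          pairing (\<Delta> (gen \<P> f)) [q] qs = eval f (fam_comp \<P> q qs))))"

text \<open>\<open>bracket \<P> X Y\<close> is \<open>\<langle>X, Y\<rangle>\<close> for words \<open>X\<close> and \<open>Y\<close> over \<open>P\<close>.\<close>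

fun bracket :: "('k, 'a::ab_group_add) operad_data \<Rightarrow> 'a fam list \<Rightarrow> 'a fam list \<Rightarrow> 'a fam"
  where
    "bracket \<P> [] [y] = y"
  | "bracket \<P> [p] ps = (\<lambda>N. \<Sum>n=1..N. \<Sum>S | S \<subseteq> {..<n} \<and> card S = length ps.
       circ_at \<P> p n S ps N)"
  | "bracket \<P> _ _ = (\<lambda>_. 0)"

definition coprod_prime ::
    "('k::field, 'a::ab_group_add) operad_data
      \<Rightarrow> ('k, 'a) dual_tens \<Rightarrow> ('k, ('k, 'a) dual_tens, ('k, 'a) dual_tens) tensor"
  where "coprod_prime \<P> = (let T = T_dual \<P>; F = carrier (graded_dual \<P> (ops \<P>)) in
    THE \<Delta>. \<Delta> \<in> extensional (carrier T) \<and> \<Delta> \<in> alg_hom T (tensor_prod T T) \<and>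
      (\<forall>f\<in>F. \<forall>X\<in>lists (finite_fams \<P>). \<forall>Y\<in>lists (finite_fams \<P>).
        pairing (\<Delta> (gen \<P> f)) X Y = eval f (bracket \<P> X Y)))"

text \<open>A bold letter is rendered as \<open>bold\<close>: \<open>boldD_star\<close> is \<open>\<^bold>D\<^sup>*\<close>, the quotient of which by
  commutators is \<open>S(P\<^sup>*)\<close>, and \<open>D_star\<close> is the subbialgebra \<open>D\<^sup>* = S(inv P\<^sup>*)\<close> of the latter.\<close>

definition boldD_star ::
    "('k::field, 'a::ab_group_add) operad_data \<Rightarrow> ('k, ('k, 'a) dual_tens) bialgebra"
  where "boldD_star \<P> = with_coprod (T_dual \<P>) (coprod_star \<P>)"

definition boldD_prime ::
    "('k::field, 'a::ab_group_add) operad_data \<Rightarrow> ('k, ('k, 'a) dual_tens) bialgebra"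
  where "boldD_prime \<P> = with_coprod (T_dual \<P>) (coprod_prime \<P>)"

definition ab_class ::
    "('k::field, 'a) bialgebra \<Rightarrow> 'a \<Rightarrow> 'a set"
  where "ab_class H a = commutator_ideal H +>\<^bsub>H\<^esub> a"

definition S_dual ::
    "('k::field, 'a::ab_group_add) operad_data \<Rightarrow> ('k, ('k, 'a) dual_tens set) bialgebra"
  where "S_dual \<P> = abelianization (boldD_star \<P>)"

definition S_gen ::
    "('k::field, 'a::ab_group_add) operad_data \<Rightarrow> ('k, 'a) dual \<Rightarrow> ('k, 'a) dual_tens set"
  where "S_gen \<P> f = ab_class (boldD_star \<P>) (gen \<P> f)"

definition D_star ::
    "('k::field, 'a::ab_group_add) operad_data \<Rightarrow> ('k, ('k, 'a) dual_tens set) bialgebra"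
  where "D_star \<P> =
    sub_bialgebra (S_dual \<P>) (subalgebra_gen (S_dual \<P>) (S_gen \<P> ` inv_dual \<P> (ops \<P>)))"

text \<open>\<open>unit_ideal \<P> A g\<close> is the ideal of \<open>A\<close> generated by all \<open>g f - f(I) 1\<close> with \<open>f \<in> P(1)\<^sup>*\<close>.\<close>

definition unit_ideal ::
    "('k::field, 'a::ab_group_add) operad_data \<Rightarrow> ('k, 'b) bialgebra \<Rightarrow> (('k, 'a) dual \<Rightarrow> 'b) \<Rightarrow> 'b set"
  where "unit_ideal \<P> A g = Idl\<^bsub>A\<^esub> {g f \<ominus>\<^bsub>A\<^esub> (f 1 (unt \<P>) \<odot>\<^bsub>A\<^esub> \<one>\<^bsub>A\<^esub>) | f.
    f \<in> carrier (graded_dual \<P> (ops \<P>)) \<and> (\<forall>n. n \<noteq> 1 \<longrightarrow> f n = (\<lambda>_. 0))}"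

definition boldB_star ::
    "('k::field, 'a::ab_group_add) operad_data \<Rightarrow> ('k, ('k, 'a) dual_tens set) bialgebra"
  where "boldB_star \<P> = quot_bialgebra (boldD_star \<P>) (unit_ideal \<P> (boldD_star \<P>) (gen \<P>))"

definition boldB_gen ::
    "('k::field, 'a::ab_group_add) operad_data \<Rightarrow> ('k, 'a) dual \<Rightarrow> ('k, 'a) dual_tens set"
  where "boldB_gen \<P> f = unit_ideal \<P> (boldD_star \<P>) (gen \<P>) +>\<^bsub>boldD_star \<P>\<^esub> gen \<P> f"

definition B_ideal ::
    "('k::field, 'a::ab_group_add) operad_data \<Rightarrow> ('k, 'a) dual_tens set set"
  where "B_ideal \<P> = unit_ideal \<P> (S_dual \<P>) (S_gen \<P>) \<inter> carrier (D_star \<P>)"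

definition B_star ::
    "('k::field, 'a::ab_group_add) operad_data \<Rightarrow> ('k, ('k, 'a) dual_tens set set) bialgebra"
  where "B_star \<P> = quot_bialgebra (D_star \<P>) (B_ideal \<P>)"

definition B_gen ::
    "('k::field, 'a::ab_group_add) operad_data \<Rightarrow> ('k, 'a) dual \<Rightarrow> ('k, 'a) dual_tens set set"
  where "B_gen \<P> f = B_ideal \<P> +>\<^bsub>D_star \<P>\<^esub> S_gen \<P> f"

text \<open>\<open>point_char H g F x\<close> is the character \<open>f\<^sub>1 \<cdots> f\<^sub>k \<mapsto> f\<^sub>1(x) \<cdots> f\<^sub>k(x)\<close> of \<open>H\<close>, with the \<open>f\<^sub>i\<close> taken
  in \<open>F\<close> and embedded into \<open>H\<close> by \<open>g\<close>.\<close>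

definition point_char ::
    "('k::field, 'b) bialgebra \<Rightarrow> (('k, 'a) dual \<Rightarrow> 'b) \<Rightarrow> ('k, 'a) dual set \<Rightarrow> 'a fam \<Rightarrow> 'b \<Rightarrow> 'k"
  where "point_char H g F x = (THE \<chi>. \<chi> \<in> characters H \<and>
    (\<forall>fs\<in>lists F. \<chi> (foldr (mult H) (map g fs) \<one>\<^bsub>H\<^esub>) = (\<Prod>f\<leftarrow>fs. eval f x)))"

end

theory Submission
  imports Defs "HOL-Library.Function_Algebras" "HOL-Computational_Algebra.Polynomial"
begin

text \<open>
  All the bialgebras involved are recovered from their points. A family \<open>x\<close> gives a character of
  \<open>T(P\<^sup>*)\<close>, every character arises this way because the \<open>P(n)\<close> are finite-dimensional, and pairing
  the coproduct with two such characters gives the operadic composition of the families. These data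
  pass to quotients and subbialgebras: the characters of a quotient by a bialgebra ideal are the
  points killing the ideal. The ideal generated by \<open>f - f(I) 1\<close> is killed by the points
  \<open>I + y\<close> with \<open>y\<close> in the completion of \<open>P\<^sub>+\<close>, and \<open>y \<mapsto> I + y\<close> is also the isomorphism of (c).
  In characteristic 0, points separate the elements of the symmetric algebra. Hence identities
  there, in particular that the invariants form a subbialgebra, can be checked on points, where they
  reduce to the compatibility of the composition with the action of the symmetric groups; and
  averaging over these groups extends each character of the invariants to \<open>S(P\<^sup>*)\<close>.
\<close>

section \<open>Vector spaces and algebras as module records\<close>

text \<open>Coproducts, counits and the characters of points are all definite descriptions, so
  nothing can be computed before existence and uniqueness are settled; much of the length comes from
  there. Points cannot give uniqueness in the noncommutative algebra \<open>T\<close>, since a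
  character does not see the order of the letters. There, tensors are compared through their
  pairings with words in finitely supported families. General families are infinite, and a character
  is an infinite sum of homogeneous word pairings; but every element of \<open>T\<close> sees only
  finitely many lengths and arities, and the bound \<open>N\<close> that recurs throughout records
  this. The same obstacle shapes the passage to quotients. For \<open>Jb\<close> the coideal
  property is computed on the generators of arity one. For \<open>Jd\<close>, the intersection of an
  ideal with a subalgebra, no generators are at hand, and the argument needs instead that the points
  I + y cut out \<open>Ju\<close> exactly. The laws of the convolution monoids are transported from
  the monoids of families through the predicate \<open>points\<close>.\<close>

locale kspace = abelian_group V for V :: "('k::field, 'v, 'm) module_scheme" (structure) +
  assumes smult_closed [simp, intro]: "v \<in> carrier V \<Longrightarrow> c \<odot> v \<in> carrier V"
    and smult_l_distr: "v \<in> carrier V \<Longrightarrow> (c + d) \<odot> v = c \<odot> v \<oplus> d \<odot> v"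
    and smult_r_distr: "v \<in> carrier V \<Longrightarrow> w \<in> carrier V \<Longrightarrow> c \<odot> (v \<oplus> w) = c \<odot> v \<oplus> c \<odot> w"
    and smult_assoc: "v \<in> carrier V \<Longrightarrow> (c * d) \<odot> v = c \<odot> (d \<odot> v)"
    and smult_one: "v \<in> carrier V \<Longrightarrow> 1 \<odot> v = v"

locale kalg = kspace A + ring A for A :: "('k::field, 'v, 'm) module_scheme" (structure) +
  assumes smult_mult_left: "a \<in> carrier A \<Longrightarrow> b \<in> carrier A \<Longrightarrow> (c \<odot> a) \<otimes> b = c \<odot> (a \<otimes> b)"
    and smult_mult_right: "a \<in> carrier A \<Longrightarrow> b \<in> carrier A \<Longrightarrow> a \<otimes> (c \<odot> b) = c \<odot> (a \<otimes> b)"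

lemma linear_formD:
  assumes "linear_form A \<phi>"
  shows "a \<in> carrier A \<Longrightarrow> b \<in> carrier A \<Longrightarrow> \<phi> (a \<oplus>\<^bsub>A\<^esub> b) = \<phi> a + \<phi> b"
    and "a \<in> carrier A \<Longrightarrow> \<phi> (c \<odot>\<^bsub>A\<^esub> a) = c * \<phi> a"
  using assms by (auto simp: linear_form_def)

lemma linear_form_add: "linear_form A \<phi> \<Longrightarrow> linear_form A \<psi> \<Longrightarrow> linear_form A (\<lambda>a. \<phi> a + \<psi> a)"
  and linear_form_scale: "linear_form A \<phi> \<Longrightarrow> linear_form A (\<lambda>a. c * \<phi> a)"
  and linear_form_scale': "linear_form A \<phi> \<Longrightarrow> linear_form A (\<lambda>a. \<phi> a * c)"
  and linear_form_zero: "linear_form A (\<lambda>a. 0)"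
  by (auto simp: linear_form_def algebra_simps)

lemma linear_form_sum: "(\<And>i. i \<in> I \<Longrightarrow> linear_form A (\<phi> i)) \<Longrightarrow> linear_form A (\<lambda>a. \<Sum>i\<in>I. \<phi> i a)"
  by (induction I rule: infinite_finite_induct) (auto intro!: linear_form_zero linear_form_add)

context kspace
begin

lemma linear_form_at_zero [simp]: "linear_form V \<phi> \<Longrightarrow> \<phi> \<zero> = 0"
  using linear_formD(1)[of V \<phi> \<zero> \<zero>] by (metis add_cancel_left_right l_zero zero_closed)

lemma linear_form_uminus: "linear_form V \<phi> \<Longrightarrow> v \<in> carrier V \<Longrightarrow> \<phi> (\<ominus> v) = - \<phi> v"
  using linear_formD(1)[of V \<phi> v "\<ominus> v"] r_neg[of v]
  by (simp add: eq_neg_iff_add_eq_0 add.commute)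

lemma linear_form_minus:
  "linear_form V \<phi> \<Longrightarrow> v \<in> carrier V \<Longrightarrow> w \<in> carrier V \<Longrightarrow> \<phi> (v \<ominus> w) = \<phi> v - \<phi> w"
  by (simp add: a_minus_def linear_formD linear_form_uminus)

lemma smult_zero [simp]: "c \<odot> \<zero> = \<zero>"
  using smult_r_distr[of \<zero> \<zero> c] add.l_cancel_one'[of "c \<odot> \<zero>" "c \<odot> \<zero>"] by simp

lemma zero_smult [simp]: "v \<in> carrier V \<Longrightarrow> 0 \<odot> v = \<zero>"
  using smult_l_distr[of v 0 0] add.l_cancel_one'[of "0 \<odot> v" "0 \<odot> v"] by simp

lemma uminus_smult: "v \<in> carrier V \<Longrightarrow> (- 1) \<odot> v = \<ominus> v"
proof -
  assume v: "v \<in> carrier V"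
  then have "(- 1) \<odot> v \<oplus> v = \<zero>"
    using smult_l_distr[of v "- 1" 1] by (simp add: smult_one)
  with v show ?thesis by (metis smult_closed minus_equality)
qed

definition list_sum :: "('i \<Rightarrow> 'v) \<Rightarrow> 'i list \<Rightarrow> 'v"
  where "list_sum f xs = foldr (\<lambda>x s. f x \<oplus> s) xs \<zero>"

lemma list_sum_simps [simp]: "list_sum f [] = \<zero>" "list_sum f (x # xs) = f x \<oplus> list_sum f xs"
  by (simp_all add: list_sum_def)

lemma list_sum_closed: "(\<And>x. x \<in> set xs \<Longrightarrow> f x \<in> carrier V) \<Longrightarrow> list_sum f xs \<in> carrier V"
  by (induction xs) auto

lemma linear_form_list_sum:
  "linear_form V \<phi> \<Longrightarrow> (\<And>x. x \<in> set xs \<Longrightarrow> f x \<in> carrier V) \<Longrightarrow>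
    \<phi> (list_sum f xs) = (\<Sum>x\<leftarrow>xs. \<phi> (f x))"
  by (induction xs) (auto simp: linear_formD list_sum_closed)

end

text \<open>The additive inverse of \<open>v\<close> is obtained as \<open>(- 1) \<odot> v\<close>,
  by distributivity and \<open>0 \<odot> v = \<zero>\<close>; the concrete spaces of functionals
  then have to supply pointwise identities only.\<close>

lemma kspaceI:
  fixes V :: "('k::field, 'v, 'm) module_scheme" (structure)
  assumes "\<And>v w. v \<in> carrier V \<Longrightarrow> w \<in> carrier V \<Longrightarrow> v \<oplus> w \<in> carrier V"
    and "\<zero> \<in> carrier V"
    and "\<And>u v w. u \<in> carrier V \<Longrightarrow> v \<in> carrier V \<Longrightarrow> w \<in> carrier V \<Longrightarrow> (u \<oplus> v) \<oplus> w = u \<oplus> (v \<oplus> w)"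
    and "\<And>v w. v \<in> carrier V \<Longrightarrow> w \<in> carrier V \<Longrightarrow> v \<oplus> w = w \<oplus> v"
    and zero: "\<And>v. v \<in> carrier V \<Longrightarrow> \<zero> \<oplus> v = v"
    and zero': "\<And>v. v \<in> carrier V \<Longrightarrow> 0 \<odot> v = \<zero>"
    and sm: "\<And>c v. v \<in> carrier V \<Longrightarrow> c \<odot> v \<in> carrier V"
      "\<And>c d v. v \<in> carrier V \<Longrightarrow> (c + d) \<odot> v = c \<odot> v \<oplus> d \<odot> v"
      "\<And>c v w. v \<in> carrier V \<Longrightarrow> w \<in> carrier V \<Longrightarrow> c \<odot> (v \<oplus> w) = c \<odot> v \<oplus> c \<odot> w"
      "\<And>c d v. v \<in> carrier V \<Longrightarrow> (c * d) \<odot> v = c \<odot> (d \<odot> v)"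
      "\<And>v. v \<in> carrier V \<Longrightarrow> 1 \<odot> v = v"
  shows "kspace V"
proof -
  have "\<exists>w\<in>carrier V. w \<oplus> v = \<zero>" if "v \<in> carrier V" for v
    using sm(1)[OF that, of "- 1"] sm(2)[OF that, of "- 1" 1] that by (auto simp: zero' sm(5))
  then have "abelian_group V"
    using assms by (intro abelian_groupI) auto
  then show ?thesis
    using sm by (intro kspace.intro kspace_axioms.intro) auto
qed

lemma kalgI:
  fixes A :: "('k::field, 'v, 'm) module_scheme" (structure)
  assumes "kspace A"
    and "\<And>a b. a \<in> carrier A \<Longrightarrow> b \<in> carrier A \<Longrightarrow> a \<otimes> b \<in> carrier A"
    and "\<one> \<in> carrier A"
    and "\<And>a b c. a \<in> carrier A \<Longrightarrow> b \<in> carrier A \<Longrightarrow> c \<in> carrier A \<Longrightarrow> (a \<otimes> b) \<otimes> c = a \<otimes> (b \<otimes> c)"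
    and "\<And>a. a \<in> carrier A \<Longrightarrow> \<one> \<otimes> a = a"
    and "\<And>a. a \<in> carrier A \<Longrightarrow> a \<otimes> \<one> = a"
    and "\<And>a b c. a \<in> carrier A \<Longrightarrow> b \<in> carrier A \<Longrightarrow> c \<in> carrier A \<Longrightarrow> (a \<oplus> b) \<otimes> c = a \<otimes> c \<oplus> b \<otimes> c"
    and "\<And>a b c. a \<in> carrier A \<Longrightarrow> b \<in> carrier A \<Longrightarrow> c \<in> carrier A \<Longrightarrow> c \<otimes> (a \<oplus> b) = c \<otimes> a \<oplus> c \<otimes> b"
    and "\<And>a b c. a \<in> carrier A \<Longrightarrow> b \<in> carrier A \<Longrightarrow> (c \<odot> a) \<otimes> b = c \<odot> (a \<otimes> b)"
    and "\<And>a b c. a \<in> carrier A \<Longrightarrow> b \<in> carrier A \<Longrightarrow> a \<otimes> (c \<odot> b) = c \<odot> (a \<otimes> b)"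
  shows "kalg A"
proof -
  interpret kspace A by fact
  have "ring A"
    using assms by (intro ringI monoidI abelian_group_axioms) auto
  then show ?thesis
    using assms by (intro kalg.intro kalg_axioms.intro) auto
qed

text \<open>Bialgebra records extend module records, so the same algebra occurs under several record
  types; this carries the laws from one to the other.\<close>

lemma kalg_cong:
  assumes "kalg A" "carrier B = carrier A" "mult B = mult A" "one B = one A" "zero B = zero A"
    "add B = add A" "module.smult B = module.smult A"
  shows "kalg B"
proof -
  interpret kalg A by fact
  show ?thesis
    by (intro kalgI kspaceI; simp add: assms(2-) smult_l_distr smult_r_distr smult_assoc smult_one
        a_ac m_assoc l_distr r_distr smult_mult_left smult_mult_right)
qed

lemma scalars_simps [simp]:
  "carrier scalars = UNIV" "mult scalars = (*)" "one scalars = 1" "zero scalars = 0"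
  "add scalars = (+)" "module.smult scalars = (*)"
  by (simp_all add: scalars_def)

lemma kalg_scalars: "kalg (scalars :: ('k::field, 'k) module)"
  by (intro kalgI kspaceI) (simp_all add: algebra_simps)

lemma alg_homD:
  assumes "h \<in> alg_hom A B"
  shows "a \<in> carrier A \<Longrightarrow> h a \<in> carrier B"
    and "a \<in> carrier A \<Longrightarrow> b \<in> carrier A \<Longrightarrow> h (a \<oplus>\<^bsub>A\<^esub> b) = h a \<oplus>\<^bsub>B\<^esub> h b"
    and "a \<in> carrier A \<Longrightarrow> b \<in> carrier A \<Longrightarrow> h (a \<otimes>\<^bsub>A\<^esub> b) = h a \<otimes>\<^bsub>B\<^esub> h b"
    and "h \<one>\<^bsub>A\<^esub> = \<one>\<^bsub>B\<^esub>"
    and "a \<in> carrier A \<Longrightarrow> h (c \<odot>\<^bsub>A\<^esub> a) = c \<odot>\<^bsub>B\<^esub> h a"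
  using assms by (auto simp: alg_hom_def ring_hom_def)

lemma alg_homI:
  assumes "\<And>a. a \<in> carrier A \<Longrightarrow> h a \<in> carrier B"
    and "\<And>a b. a \<in> carrier A \<Longrightarrow> b \<in> carrier A \<Longrightarrow> h (a \<oplus>\<^bsub>A\<^esub> b) = h a \<oplus>\<^bsub>B\<^esub> h b"
    and "\<And>a b. a \<in> carrier A \<Longrightarrow> b \<in> carrier A \<Longrightarrow> h (a \<otimes>\<^bsub>A\<^esub> b) = h a \<otimes>\<^bsub>B\<^esub> h b"
    and "h \<one>\<^bsub>A\<^esub> = \<one>\<^bsub>B\<^esub>"
    and "\<And>a c. a \<in> carrier A \<Longrightarrow> h (c \<odot>\<^bsub>A\<^esub> a) = c \<odot>\<^bsub>B\<^esub> h a"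
  shows "h \<in> alg_hom A B"
  using assms by (auto simp: alg_hom_def ring_hom_def)

lemma alg_hom_comp: "h \<in> alg_hom A B \<Longrightarrow> k \<in> alg_hom B C \<Longrightarrow> (\<lambda>a. k (h a)) \<in> alg_hom A C"
  by (rule alg_homI) (simp_all add: alg_homD)

lemma alg_hom_scalars_linear: "h \<in> alg_hom A scalars \<Longrightarrow> linear_form A h"
  by (auto simp: linear_form_def dest: alg_homD)

lemma linear_form_comp:
  "linear_form B \<psi> \<Longrightarrow> h \<in> alg_hom A B \<Longrightarrow> linear_form A (\<lambda>a. \<psi> (h a))"
  by (simp add: linear_form_def alg_homD)

lemma (in kalg) alg_hom_minus:
  assumes "h \<in> alg_hom A B" "kspace B" "a \<in> carrier A" "b \<in> carrier A"
  shows "h (a \<ominus> b) = h a \<ominus>\<^bsub>B\<^esub> h b"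
proof -
  interpret B: kspace B by fact
  show ?thesis
    using assms alg_homD(1)[OF assms(1)] alg_homD(5)[OF assms(1), of b "- 1"]
    by (simp add: a_minus_def alg_homD(2) B.uminus_smult uminus_smult)
qed


section \<open>Tensor products\<close>

text \<open>The guard stands once in front of the sum instead of inside each pure tensor, so that on
  a bilinear form a tensor is simply a finite sum of values.\<close>

definition tsum ::
    "('k::field, 'a, 'm) module_scheme \<Rightarrow> ('k, 'b, 'n) module_scheme \<Rightarrow> ('a \<times> 'b) list \<Rightarrow> ('k, 'a, 'b) tensor"
  where "tsum A B ps = (\<lambda>\<beta>. if \<beta> \<in> bilinear_forms A B then \<Sum>(a, b)\<leftarrow>ps. \<beta> a b else 0)"

lemma tsum_pure: "(\<lambda>\<beta>. \<Sum>(a, b)\<leftarrow>ps. pure_tensor A B a b \<beta>) = tsum A B ps"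
  by (rule ext) (induction ps; auto simp: tsum_def pure_tensor_def)

lemma tensors_tsum: "tensors A B X Y = {tsum A B ps |ps. set ps \<subseteq> X \<times> Y}"
  by (simp add: tensors_def tsum_pure)

lemma tp_simps [simp]:
  "carrier (tensor_prod A B) = tensors A B (carrier A) (carrier B)"
  "mult (tensor_prod A B) = (\<lambda>s t \<beta>. if \<beta> \<in> bilinear_forms A B
      then s (\<lambda>a b. t (\<lambda>c d. \<beta> (a \<otimes>\<^bsub>A\<^esub> c) (b \<otimes>\<^bsub>B\<^esub> d))) else 0)"
  "one (tensor_prod A B) = pure_tensor A B \<one>\<^bsub>A\<^esub> \<one>\<^bsub>B\<^esub>"
  "zero (tensor_prod A B) = (\<lambda>_. 0)"
  "add (tensor_prod A B) = (\<lambda>s t \<beta>. s \<beta> + t \<beta>)"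
  "module.smult (tensor_prod A B) = (\<lambda>c s \<beta>. c * s \<beta>)"
  by (simp_all add: tensor_prod_def)

lemma bilD:
  assumes "\<beta> \<in> bilinear_forms A B"
  shows "a \<in> carrier A \<Longrightarrow> linear_form B (\<beta> a)"
    and "b \<in> carrier B \<Longrightarrow> linear_form A (\<lambda>a. \<beta> a b)"
  using assms by (auto simp: bilinear_forms_def)

lemma bil_prod: "linear_form A \<phi> \<Longrightarrow> linear_form B \<psi> \<Longrightarrow> (\<lambda>a b. \<phi> a * \<psi> b) \<in> bilinear_forms A B"
  by (auto simp: bilinear_forms_def intro: linear_form_scale linear_form_scale')

lemma bil_add: "\<beta> \<in> bilinear_forms A B \<Longrightarrow> \<gamma> \<in> bilinear_forms A B \<Longrightarrow>
    (\<lambda>a b. \<beta> a b + \<gamma> a b) \<in> bilinear_forms A B"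
  and bil_scale: "\<beta> \<in> bilinear_forms A B \<Longrightarrow> (\<lambda>a b. c * \<beta> a b) \<in> bilinear_forms A B"
  by (auto simp: bilinear_forms_def intro: linear_form_add linear_form_scale)

lemma bil_sum: "(\<And>i. i \<in> I \<Longrightarrow> \<beta> i \<in> bilinear_forms A B) \<Longrightarrow>
    (\<lambda>a b. \<Sum>i\<in>I. \<beta> i a b) \<in> bilinear_forms A B"
  by (auto simp: bilinear_forms_def intro: linear_form_sum)

lemma tensorsE:
  assumes "t \<in> tensors A B X Y"
  obtains ps where "set ps \<subseteq> X \<times> Y" "t = tsum A B ps"
  using assms by (auto simp: tensors_tsum)

lemma tensors_off: "t \<in> tensors A B X Y \<Longrightarrow> \<beta> \<notin> bilinear_forms A B \<Longrightarrow> t \<beta> = 0"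
  by (auto simp: tensors_tsum tsum_def)

lemma tensors_eqI:
  assumes "s \<in> tensors A B X Y" "t \<in> tensors A B X' Y'"
    and "\<And>\<beta>. \<beta> \<in> bilinear_forms A B \<Longrightarrow> s \<beta> = t \<beta>"
  shows "s = t"
  using assms tensors_off by (metis ext)

lemma tensors_mono: "X \<subseteq> X' \<Longrightarrow> Y \<subseteq> Y' \<Longrightarrow> tensors A B X Y \<subseteq> tensors A B X' Y'"
  unfolding tensors_tsum by blast

lemma tsum_cong:
  assumes "set ps \<subseteq> X \<times> Y" "\<And>a b. a \<in> X \<Longrightarrow> b \<in> Y \<Longrightarrow> \<beta> a b = \<gamma> a b"
  shows "(\<Sum>(a, b)\<leftarrow>ps. \<beta> a b) = (\<Sum>(a, b)\<leftarrow>ps. \<gamma> a b)"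
  by (rule arg_cong[where f = sum_list], rule map_cong) (use assms in auto)

text \<open>Bilinear forms are arbitrary off the carriers, so forms that agree in substance are
  often different functions. A tensor with factors in \<open>X\<close> and \<open>Y\<close> sees
  only their values there, which allows rewriting under a tensor.\<close>

lemma tensors_cong:
  assumes "t \<in> tensors A B X Y" "\<beta> \<in> bilinear_forms A B" "\<gamma> \<in> bilinear_forms A B"
    and "\<And>a b. a \<in> X \<Longrightarrow> b \<in> Y \<Longrightarrow> \<beta> a b = \<gamma> a b"
  shows "t \<beta> = t \<gamma>"
  using assms(1)
proof (rule tensorsE)
  fix ps assume "set ps \<subseteq> X \<times> Y" "t = tsum A B ps"
  with tsum_cong[of ps X Y \<beta> \<gamma>] assms(2-) show ?thesis by (simp add: tsum_def)
qed

lemma tensors_add_form: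
  "t \<in> tensors A B X Y \<Longrightarrow> \<beta> \<in> bilinear_forms A B \<Longrightarrow> \<gamma> \<in> bilinear_forms A B \<Longrightarrow>
    t (\<lambda>a b. \<beta> a b + \<gamma> a b) = t \<beta> + t \<gamma>"
  by (erule tensorsE) (simp add: tsum_def bil_add case_prod_unfold sum_list_addf)

lemma tensors_scale_form:
  "t \<in> tensors A B X Y \<Longrightarrow> \<beta> \<in> bilinear_forms A B \<Longrightarrow> t (\<lambda>a b. c * \<beta> a b) = c * t \<beta>"
  by (erule tensorsE) (simp add: tsum_def bil_scale case_prod_unfold sum_list_const_mult)

lemma tensors_sum_form:
  "t \<in> tensors A B X Y \<Longrightarrow> (\<And>i. i \<in> I \<Longrightarrow> \<beta> i \<in> bilinear_forms A B) \<Longrightarrow>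
    t (\<lambda>a b. \<Sum>i\<in>I. \<beta> i a b) = (\<Sum>i\<in>I. t (\<beta> i))"
proof (induction I rule: infinite_finite_induct)
  case (insert i I)
  then have "t (\<lambda>a b. \<beta> i a b + (\<Sum>i\<in>I. \<beta> i a b)) = t (\<beta> i) + t (\<lambda>a b. \<Sum>i\<in>I. \<beta> i a b)"
    by (intro tensors_add_form[OF insert.prems(1)] bil_sum) auto
  with insert show ?case by simp
qed (elim tensorsE, simp add: tsum_def case_prod_unfold)+

lemma pure_tensor_in: "a \<in> X \<Longrightarrow> b \<in> Y \<Longrightarrow> pure_tensor A B a b \<in> tensors A B X Y"
  by (auto simp: tensors_tsum pure_tensor_def tsum_def intro!: exI[of _ "[(a, b)]"])

lemma tensors_add: "s \<in> tensors A B X Y \<Longrightarrow> t \<in> tensors A B X Y \<Longrightarrow> (\<lambda>\<beta>. s \<beta> + t \<beta>) \<in> tensors A B X Y"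
proof (elim tensorsE)
  fix ps qs assume "set ps \<subseteq> X \<times> Y" "set qs \<subseteq> X \<times> Y" "s = tsum A B ps" "t = tsum A B qs"
  then show ?thesis
    by (auto simp: tensors_tsum tsum_def intro!: exI[of _ "ps @ qs"])
qed

lemma tensors_zero: "(\<lambda>\<beta>. 0) \<in> tensors A B X Y"
  by (auto simp: tensors_tsum tsum_def intro!: exI[of _ "[]"])

lemma tensors_tsumI: "set ps \<subseteq> X \<times> Y \<Longrightarrow> tsum A B ps \<in> tensors A B X Y"
  by (auto simp: tensors_tsum)

lemma tensors_sum: "(\<And>i. i \<in> I \<Longrightarrow> t i \<in> tensors A B X Y) \<Longrightarrow> (\<lambda>\<beta>. \<Sum>i\<in>I. t i \<beta>) \<in> tensors A B X Y"
  by (induction I rule: infinite_finite_induct) (auto intro!: tensors_zero tensors_add)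

text \<open>The scalar is absorbed by the first factor of every term, hence the stability of
  \<open>X\<close>.\<close>

lemma tensors_scale:
  assumes "\<And>a. a \<in> X \<Longrightarrow> c \<odot>\<^bsub>A\<^esub> a \<in> X" "X \<subseteq> carrier A" "Y \<subseteq> carrier B" "t \<in> tensors A B X Y"
  shows "(\<lambda>\<beta>. c * t \<beta>) \<in> tensors A B X Y"
proof -
  obtain ps where ps: "set ps \<subseteq> X \<times> Y" "t = tsum A B ps" using assms(4) by (rule tensorsE)
  have "(\<Sum>(a, b)\<leftarrow>map (\<lambda>(a, b). (c \<odot>\<^bsub>A\<^esub> a, b)) ps. \<beta> a b) = c * (\<Sum>(a, b)\<leftarrow>ps. \<beta> a b)"
    if "\<beta> \<in> bilinear_forms A B" for \<beta>
    using ps(1) assms(2,3) by (induction ps) (auto simp: algebra_simps linear_formD[OF bilD(2)[OF that]] subset_iff)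
  then have "(\<lambda>\<beta>. c * t \<beta>) = tsum A B (map (\<lambda>(a, b). (c \<odot>\<^bsub>A\<^esub> a, b)) ps)"
    by (auto simp: ps(2) tsum_def)
  moreover have "set (map (\<lambda>(a, b). (c \<odot>\<^bsub>A\<^esub> a, b)) ps) \<subseteq> X \<times> Y" using ps(1) assms(1) by fastforce
  ultimately show ?thesis by (simp add: tensors_tsumI)
qed

lemma kspace_tensor_prod:
  assumes "kspace A" "kspace B" shows "kspace (tensor_prod A B)"
proof -
  interpret A: kspace A by fact
  interpret B: kspace B by fact
  show ?thesis
    by (intro kspaceI) (auto simp: algebra_simps intro!: tensors_add tensors_zero tensors_scale)
qed

section \<open>The tensor product of two algebras\<close>

locale two_algs = A: kalg A + B: kalg B
  for A :: "('k::field, 'a, 'm) module_scheme" and B :: "('k, 'b, 'n) module_scheme"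
begin

lemma bil_shift:
  assumes "\<beta> \<in> bilinear_forms A B" "a \<in> carrier A" "b \<in> carrier B"
  shows "(\<lambda>c d. \<beta> (a \<otimes>\<^bsub>A\<^esub> c) (b \<otimes>\<^bsub>B\<^esub> d)) \<in> bilinear_forms A B"
  using assms linear_formD[OF bilD(1)[OF assms(1)]] linear_formD[OF bilD(2)[OF assms(1)]]
  by (simp add: bilinear_forms_def linear_form_def A.r_distr B.r_distr A.smult_mult_right B.smult_mult_right)

text \<open>The product of tensors is a nested evaluation, and a tensor has meaning only on bilinear
  forms: the inner evaluation must be one in the variables of the outer tensor. The computations
  with products of tensors rest on this.\<close>

lemma tensor_mult_inner:
  assumes t: "t \<in> tensors A B (carrier A) (carrier B)" and \<beta>: "\<beta> \<in> bilinear_forms A B"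
  shows "(\<lambda>a b. t (\<lambda>c d. \<beta> (a \<otimes>\<^bsub>A\<^esub> c) (b \<otimes>\<^bsub>B\<^esub> d))) \<in> bilinear_forms A B"
proof -
  note lin = linear_formD[OF bilD(1)[OF \<beta>]] linear_formD[OF bilD(2)[OF \<beta>]]
  have L: "linear_form B (\<lambda>b. t (\<lambda>c d. \<beta> (a \<otimes>\<^bsub>A\<^esub> c) (b \<otimes>\<^bsub>B\<^esub> d)))" if a: "a \<in> carrier A" for a
    unfolding linear_form_def
  proof (intro conjI ballI allI)
    fix b b' assume b: "b \<in> carrier B" "b' \<in> carrier B"
    have "t (\<lambda>c d. \<beta> (a \<otimes>\<^bsub>A\<^esub> c) ((b \<oplus>\<^bsub>B\<^esub> b') \<otimes>\<^bsub>B\<^esub> d)) =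
        t (\<lambda>c d. \<beta> (a \<otimes>\<^bsub>A\<^esub> c) (b \<otimes>\<^bsub>B\<^esub> d) + \<beta> (a \<otimes>\<^bsub>A\<^esub> c) (b' \<otimes>\<^bsub>B\<^esub> d))"
      using a b by (intro tensors_cong[OF t] bil_add bil_shift \<beta>) (auto simp: B.l_distr lin)
    then show "t (\<lambda>c d. \<beta> (a \<otimes>\<^bsub>A\<^esub> c) ((b \<oplus>\<^bsub>B\<^esub> b') \<otimes>\<^bsub>B\<^esub> d)) =
        t (\<lambda>c d. \<beta> (a \<otimes>\<^bsub>A\<^esub> c) (b \<otimes>\<^bsub>B\<^esub> d)) + t (\<lambda>c d. \<beta> (a \<otimes>\<^bsub>A\<^esub> c) (b' \<otimes>\<^bsub>B\<^esub> d))"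
      using tensors_add_form[OF t bil_shift[OF \<beta> a b(1)] bil_shift[OF \<beta> a b(2)]] by simp
  next
    fix k b assume b: "b \<in> carrier B"
    have "t (\<lambda>c d. \<beta> (a \<otimes>\<^bsub>A\<^esub> c) ((k \<odot>\<^bsub>B\<^esub> b) \<otimes>\<^bsub>B\<^esub> d)) =
        t (\<lambda>c d. k * \<beta> (a \<otimes>\<^bsub>A\<^esub> c) (b \<otimes>\<^bsub>B\<^esub> d))"
      using a b by (intro tensors_cong[OF t] bil_scale bil_shift \<beta>) (auto simp: B.smult_mult_left lin)
    then show "t (\<lambda>c d. \<beta> (a \<otimes>\<^bsub>A\<^esub> c) ((k \<odot>\<^bsub>B\<^esub> b) \<otimes>\<^bsub>B\<^esub> d)) =
        k * t (\<lambda>c d. \<beta> (a \<otimes>\<^bsub>A\<^esub> c) (b \<otimes>\<^bsub>B\<^esub> d))"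
      using tensors_scale_form[OF t bil_shift[OF \<beta> a b]] by simp
  qed
  have R: "linear_form A (\<lambda>a. t (\<lambda>c d. \<beta> (a \<otimes>\<^bsub>A\<^esub> c) (b \<otimes>\<^bsub>B\<^esub> d)))" if b: "b \<in> carrier B" for b
    unfolding linear_form_def
  proof (intro conjI ballI allI)
    fix a a' assume a: "a \<in> carrier A" "a' \<in> carrier A"
    have "t (\<lambda>c d. \<beta> ((a \<oplus>\<^bsub>A\<^esub> a') \<otimes>\<^bsub>A\<^esub> c) (b \<otimes>\<^bsub>B\<^esub> d)) =
        t (\<lambda>c d. \<beta> (a \<otimes>\<^bsub>A\<^esub> c) (b \<otimes>\<^bsub>B\<^esub> d) + \<beta> (a' \<otimes>\<^bsub>A\<^esub> c) (b \<otimes>\<^bsub>B\<^esub> d))"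
      using a b by (intro tensors_cong[OF t] bil_add bil_shift \<beta>) (auto simp: A.l_distr lin)
    then show "t (\<lambda>c d. \<beta> ((a \<oplus>\<^bsub>A\<^esub> a') \<otimes>\<^bsub>A\<^esub> c) (b \<otimes>\<^bsub>B\<^esub> d)) =
        t (\<lambda>c d. \<beta> (a \<otimes>\<^bsub>A\<^esub> c) (b \<otimes>\<^bsub>B\<^esub> d)) + t (\<lambda>c d. \<beta> (a' \<otimes>\<^bsub>A\<^esub> c) (b \<otimes>\<^bsub>B\<^esub> d))"
      using tensors_add_form[OF t bil_shift[OF \<beta> a(1) b] bil_shift[OF \<beta> a(2) b]] by simp
  next
    fix k a assume a: "a \<in> carrier A"
    have "t (\<lambda>c d. \<beta> ((k \<odot>\<^bsub>A\<^esub> a) \<otimes>\<^bsub>A\<^esub> c) (b \<otimes>\<^bsub>B\<^esub> d)) =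
        t (\<lambda>c d. k * \<beta> (a \<otimes>\<^bsub>A\<^esub> c) (b \<otimes>\<^bsub>B\<^esub> d))"
      using a b by (intro tensors_cong[OF t] bil_scale bil_shift \<beta>) (auto simp: A.smult_mult_left lin)
    then show "t (\<lambda>c d. \<beta> ((k \<odot>\<^bsub>A\<^esub> a) \<otimes>\<^bsub>A\<^esub> c) (b \<otimes>\<^bsub>B\<^esub> d)) =
        k * t (\<lambda>c d. \<beta> (a \<otimes>\<^bsub>A\<^esub> c) (b \<otimes>\<^bsub>B\<^esub> d))"
      using tensors_scale_form[OF t bil_shift[OF \<beta> a b]] by simp
  qed
  show ?thesis using L R by (auto simp: bilinear_forms_def)
qed

lemma tensor_mult_closed:
  assumes s: "s \<in> tensors A B (carrier A) (carrier B)" and t: "t \<in> tensors A B (carrier A) (carrier B)"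
  shows "s \<otimes>\<^bsub>tensor_prod A B\<^esub> t \<in> tensors A B (carrier A) (carrier B)"
proof -
  obtain ps where ps: "set ps \<subseteq> carrier A \<times> carrier B" "s = tsum A B ps" using s by (rule tensorsE)
  obtain qs where qs: "set qs \<subseteq> carrier A \<times> carrier B" "t = tsum A B qs" using t by (rule tensorsE)
  define rs where "rs = concat (map (\<lambda>(a, b). map (\<lambda>(c, d). (a \<otimes>\<^bsub>A\<^esub> c, b \<otimes>\<^bsub>B\<^esub> d)) qs) ps)"
  have "set rs \<subseteq> carrier A \<times> carrier B" using ps(1) qs(1) by (fastforce simp: rs_def)
  moreover have "s \<otimes>\<^bsub>tensor_prod A B\<^esub> t = tsum A B rs"
  proof
    fix \<beta> show "(s \<otimes>\<^bsub>tensor_prod A B\<^esub> t) \<beta> = tsum A B rs \<beta>"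
    proof (cases "\<beta> \<in> bilinear_forms A B")
      case True
      have "(s \<otimes>\<^bsub>tensor_prod A B\<^esub> t) \<beta> =
          (\<Sum>(a, b)\<leftarrow>ps. t (\<lambda>c d. \<beta> (a \<otimes>\<^bsub>A\<^esub> c) (b \<otimes>\<^bsub>B\<^esub> d)))"
        using True tensor_mult_inner[OF t True] by (simp add: ps(2) tsum_def)
      also have "\<dots> = (\<Sum>(a, b)\<leftarrow>ps. \<Sum>(c, d)\<leftarrow>qs. \<beta> (a \<otimes>\<^bsub>A\<^esub> c) (b \<otimes>\<^bsub>B\<^esub> d))"
        by (rule tsum_cong[OF ps(1)]) (simp add: qs(2) tsum_def bil_shift True)
      also have "\<dots> = (\<Sum>(a, b)\<leftarrow>rs. \<beta> a b)"
        unfolding rs_def by (induction ps) (simp_all add: case_prod_unfold o_def)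
      finally show ?thesis using True by (simp add: tsum_def)
    qed (simp add: tsum_def)
  qed
  ultimately show ?thesis by (auto intro: tensors_tsumI)
qed

lemma kalg_tensor_prod: "kalg (tensor_prod A B)"
proof (rule kalgI)
  let ?T = "tensor_prod A B"
  show "kspace ?T" by (rule kspace_tensor_prod) unfold_locales
  have one: "\<one>\<^bsub>?T\<^esub> \<in> tensors A B (carrier A) (carrier B)" by (simp add: pure_tensor_in)
  then show "\<one>\<^bsub>?T\<^esub> \<in> carrier ?T" by simp
  fix r assume "r \<in> carrier ?T"
  then have r: "r \<in> tensors A B (carrier A) (carrier B)" by simp
  show "\<one>\<^bsub>?T\<^esub> \<otimes>\<^bsub>?T\<^esub> r = r"
  proof (rule tensors_eqI[OF tensor_mult_closed[OF one r] r])
    fix \<beta> assume \<beta>: "\<beta> \<in> bilinear_forms A B"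
    then have "(\<one>\<^bsub>?T\<^esub> \<otimes>\<^bsub>?T\<^esub> r) \<beta> = r (\<lambda>c d. \<beta> (\<one>\<^bsub>A\<^esub> \<otimes>\<^bsub>A\<^esub> c) (\<one>\<^bsub>B\<^esub> \<otimes>\<^bsub>B\<^esub> d))"
      using tensor_mult_inner[OF r] by (simp add: pure_tensor_def)
    also have "\<dots> = r \<beta>" by (rule tensors_cong[OF r]) (auto intro: bil_shift \<beta>)
    finally show "(\<one>\<^bsub>?T\<^esub> \<otimes>\<^bsub>?T\<^esub> r) \<beta> = r \<beta>" .
  qed
  show "r \<otimes>\<^bsub>?T\<^esub> \<one>\<^bsub>?T\<^esub> = r"
  proof (rule tensors_eqI[OF tensor_mult_closed[OF r one] r])
    fix \<beta> assume \<beta>: "\<beta> \<in> bilinear_forms A B"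
    have "(\<lambda>a b. \<one>\<^bsub>?T\<^esub> (\<lambda>c d. \<beta> (a \<otimes>\<^bsub>A\<^esub> c) (b \<otimes>\<^bsub>B\<^esub> d))) \<in> bilinear_forms A B"
      by (rule tensor_mult_inner[OF one \<beta>])
    then have "r (\<lambda>a b. \<one>\<^bsub>?T\<^esub> (\<lambda>c d. \<beta> (a \<otimes>\<^bsub>A\<^esub> c) (b \<otimes>\<^bsub>B\<^esub> d))) = r \<beta>"
      by (rule tensors_cong[OF r _ \<beta>]) (simp add: pure_tensor_def bil_shift \<beta>)
    then show "(r \<otimes>\<^bsub>?T\<^esub> \<one>\<^bsub>?T\<^esub>) \<beta> = r \<beta>" using \<beta> by simp
  qed
  fix s assume "s \<in> carrier ?T"
  then have s: "s \<in> tensors A B (carrier A) (carrier B)" by simp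
  show "r \<otimes>\<^bsub>?T\<^esub> s \<in> carrier ?T" using tensor_mult_closed[OF r s] by simp
  show "c \<odot>\<^bsub>?T\<^esub> r \<otimes>\<^bsub>?T\<^esub> s = c \<odot>\<^bsub>?T\<^esub> (r \<otimes>\<^bsub>?T\<^esub> s)" for c by auto
  show "r \<otimes>\<^bsub>?T\<^esub> (c \<odot>\<^bsub>?T\<^esub> s) = c \<odot>\<^bsub>?T\<^esub> (r \<otimes>\<^bsub>?T\<^esub> s)" for c
    by (auto simp: tensors_scale_form[OF r tensor_mult_inner[OF s]])
  fix t assume "t \<in> carrier ?T"
  then have t: "t \<in> tensors A B (carrier A) (carrier B)" by simp
  show "(r \<oplus>\<^bsub>?T\<^esub> s) \<otimes>\<^bsub>?T\<^esub> t = r \<otimes>\<^bsub>?T\<^esub> t \<oplus>\<^bsub>?T\<^esub> s \<otimes>\<^bsub>?T\<^esub> t" by auto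
  show "t \<otimes>\<^bsub>?T\<^esub> (r \<oplus>\<^bsub>?T\<^esub> s) = t \<otimes>\<^bsub>?T\<^esub> r \<oplus>\<^bsub>?T\<^esub> t \<otimes>\<^bsub>?T\<^esub> s"
    by (auto simp: tensors_add_form[OF t tensor_mult_inner[OF r] tensor_mult_inner[OF s]])
  show "r \<otimes>\<^bsub>?T\<^esub> s \<otimes>\<^bsub>?T\<^esub> t = r \<otimes>\<^bsub>?T\<^esub> (s \<otimes>\<^bsub>?T\<^esub> t)"
  proof
    fix \<beta> show "(r \<otimes>\<^bsub>?T\<^esub> s \<otimes>\<^bsub>?T\<^esub> t) \<beta> = (r \<otimes>\<^bsub>?T\<^esub> (s \<otimes>\<^bsub>?T\<^esub> t)) \<beta>"
    proof (cases "\<beta> \<in> bilinear_forms A B")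
      case True
      \<comment> \<open>Associativity in \<open>A\<close> and \<open>B\<close> is used underneath
        two tensors, and at each level the rewriting presupposes that the forms on both sides are
        bilinear.\<close>
      have 1: "s (\<lambda>c d. t (\<lambda>e f. \<beta> ((a \<otimes>\<^bsub>A\<^esub> c) \<otimes>\<^bsub>A\<^esub> e) ((b \<otimes>\<^bsub>B\<^esub> d) \<otimes>\<^bsub>B\<^esub> f))) =
          s (\<lambda>c d. t (\<lambda>e f. \<beta> (a \<otimes>\<^bsub>A\<^esub> (c \<otimes>\<^bsub>A\<^esub> e)) (b \<otimes>\<^bsub>B\<^esub> (d \<otimes>\<^bsub>B\<^esub> f))))"
        if ab: "a \<in> carrier A" "b \<in> carrier B" for a b
      proof (rule tensors_cong[OF s])
        show "(\<lambda>c d. t (\<lambda>e f. \<beta> (a \<otimes>\<^bsub>A\<^esub> (c \<otimes>\<^bsub>A\<^esub> e)) (b \<otimes>\<^bsub>B\<^esub> (d \<otimes>\<^bsub>B\<^esub> f)))) \<in> bilinear_forms A B"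
          by (rule tensor_mult_inner[OF t bil_shift[OF True ab]])
        show "(\<lambda>c d. t (\<lambda>e f. \<beta> ((a \<otimes>\<^bsub>A\<^esub> c) \<otimes>\<^bsub>A\<^esub> e) ((b \<otimes>\<^bsub>B\<^esub> d) \<otimes>\<^bsub>B\<^esub> f))) \<in> bilinear_forms A B"
          by (rule bil_shift[OF tensor_mult_inner[OF t True] ab])
        fix c d assume "c \<in> carrier A" "d \<in> carrier B"
        then show "t (\<lambda>e f. \<beta> ((a \<otimes>\<^bsub>A\<^esub> c) \<otimes>\<^bsub>A\<^esub> e) ((b \<otimes>\<^bsub>B\<^esub> d) \<otimes>\<^bsub>B\<^esub> f)) =
            t (\<lambda>e f. \<beta> (a \<otimes>\<^bsub>A\<^esub> (c \<otimes>\<^bsub>A\<^esub> e)) (b \<otimes>\<^bsub>B\<^esub> (d \<otimes>\<^bsub>B\<^esub> f)))"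
          using ab by (intro tensors_cong[OF t] bil_shift True bil_shift[OF bil_shift[OF True]])
            (auto simp: A.m_assoc B.m_assoc)
      qed
      have "(r \<otimes>\<^bsub>?T\<^esub> s \<otimes>\<^bsub>?T\<^esub> t) \<beta> =
          r (\<lambda>a b. s (\<lambda>c d. t (\<lambda>e f. \<beta> ((a \<otimes>\<^bsub>A\<^esub> c) \<otimes>\<^bsub>A\<^esub> e) ((b \<otimes>\<^bsub>B\<^esub> d) \<otimes>\<^bsub>B\<^esub> f))))"
        using True tensor_mult_inner[OF t True] by simp
      also have "\<dots> = r (\<lambda>a b. (s \<otimes>\<^bsub>?T\<^esub> t) (\<lambda>e f. \<beta> (a \<otimes>\<^bsub>A\<^esub> e) (b \<otimes>\<^bsub>B\<^esub> f)))"
      proof (rule tensors_cong[OF r])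
        show "(\<lambda>a b. s (\<lambda>c d. t (\<lambda>e f. \<beta> ((a \<otimes>\<^bsub>A\<^esub> c) \<otimes>\<^bsub>A\<^esub> e) ((b \<otimes>\<^bsub>B\<^esub> d) \<otimes>\<^bsub>B\<^esub> f)))) \<in> bilinear_forms A B"
          using tensor_mult_inner[OF s tensor_mult_inner[OF t True]] by simp
        show "(\<lambda>a b. (s \<otimes>\<^bsub>?T\<^esub> t) (\<lambda>e f. \<beta> (a \<otimes>\<^bsub>A\<^esub> e) (b \<otimes>\<^bsub>B\<^esub> f))) \<in> bilinear_forms A B"
          by (rule tensor_mult_inner[OF tensor_mult_closed[OF s t] True])
      qed (simp add: 1 bil_shift True)
      also have "\<dots> = (r \<otimes>\<^bsub>?T\<^esub> (s \<otimes>\<^bsub>?T\<^esub> t)) \<beta>" using True by simp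
      finally show ?thesis .
    qed simp
  qed
qed

end

section \<open>Functoriality of the tensor product\<close>

lemma tensor_map_tsum:
  assumes "h \<in> alg_hom A C" "k \<in> alg_hom B D" "set ps \<subseteq> carrier A \<times> carrier B"
  shows "tensor_map C D h k (tsum A B ps) = tsum C D (map (\<lambda>(a, b). (h a, k b)) ps)"
proof
  fix \<beta>
  have "(\<lambda>a b. \<beta> (h a) (k b)) \<in> bilinear_forms A B" if "\<beta> \<in> bilinear_forms C D"
    using assms(1,2) that by (auto simp: bilinear_forms_def linear_form_def alg_homD)
  then show "tensor_map C D h k (tsum A B ps) \<beta> = tsum C D (map (\<lambda>(a, b). (h a, k b)) ps) \<beta>"
    by (auto simp: tensor_map_def tsum_def o_def case_prod_unfold)
qed

lemma bil_comp:
  "\<beta> \<in> bilinear_forms C D \<Longrightarrow> h \<in> alg_hom A C \<Longrightarrow> k \<in> alg_hom B D \<Longrightarrow>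
    (\<lambda>a b. \<beta> (h a) (k b)) \<in> bilinear_forms A B"
  by (auto simp: bilinear_forms_def linear_form_def alg_homD)

lemma tensor_map_in:
  assumes "h \<in> alg_hom A C" "k \<in> alg_hom B D" "t \<in> tensors A B (carrier A) (carrier B)"
  shows "tensor_map C D h k t \<in> tensors C D (h ` carrier A) (k ` carrier B)"
proof -
  obtain ps where ps: "set ps \<subseteq> carrier A \<times> carrier B" "t = tsum A B ps" using assms(3) by (rule tensorsE)
  then show ?thesis
    unfolding ps(2) tensor_map_tsum[OF assms(1,2) ps(1)] by (intro tensors_tsumI) auto
qed

lemma tensor_map_alg_hom:
  assumes "kalg A" "kalg B" "kalg C" "kalg D" "h \<in> alg_hom A C" "k \<in> alg_hom B D"
  shows "tensor_map C D h k \<in> alg_hom (tensor_prod A B) (tensor_prod C D)"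
proof -
  interpret AB: two_algs A B using assms by (simp add: two_algs_def)
  interpret CD: two_algs C D using assms by (simp add: two_algs_def)
  have sub: "h ` carrier A \<subseteq> carrier C" "k ` carrier B \<subseteq> carrier D"
    using assms by (auto dest: alg_homD)
  have *: "(\<lambda>a b. \<beta> (h a) (k b)) \<in> bilinear_forms A B" if "\<beta> \<in> bilinear_forms C D" for \<beta>
    by (rule bil_comp[OF that assms(5,6)])
  show ?thesis
  proof (rule alg_homI)
    fix s t assume "s \<in> carrier (tensor_prod A B)" "t \<in> carrier (tensor_prod A B)"
    then have s: "s \<in> tensors A B (carrier A) (carrier B)" and t: "t \<in> tensors A B (carrier A) (carrier B)"
      by simp_all
    show "tensor_map C D h k s \<in> carrier (tensor_prod C D)"
      using tensor_map_in[OF assms(5,6) s] tensors_mono[OF sub] by auto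
    show "tensor_map C D h k (s \<oplus>\<^bsub>tensor_prod A B\<^esub> t) =
        tensor_map C D h k s \<oplus>\<^bsub>tensor_prod C D\<^esub> tensor_map C D h k t"
      by (auto simp: tensor_map_def)
    show "tensor_map C D h k (c \<odot>\<^bsub>tensor_prod A B\<^esub> s) = c \<odot>\<^bsub>tensor_prod C D\<^esub> tensor_map C D h k s" for c
      by (auto simp: tensor_map_def)
    show "tensor_map C D h k (s \<otimes>\<^bsub>tensor_prod A B\<^esub> t) =
        tensor_map C D h k s \<otimes>\<^bsub>tensor_prod C D\<^esub> tensor_map C D h k t"
    proof
      fix \<beta>
      show "tensor_map C D h k (s \<otimes>\<^bsub>tensor_prod A B\<^esub> t) \<beta> =
        (tensor_map C D h k s \<otimes>\<^bsub>tensor_prod C D\<^esub> tensor_map C D h k t) \<beta>"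
      proof (cases "\<beta> \<in> bilinear_forms C D")
        case True
        have "(tensor_map C D h k s \<otimes>\<^bsub>tensor_prod C D\<^esub> tensor_map C D h k t) \<beta> =
            s (\<lambda>a b. tensor_map C D h k t (\<lambda>c d. \<beta> (h a \<otimes>\<^bsub>C\<^esub> c) (k b \<otimes>\<^bsub>D\<^esub> d)))"
          using True CD.tensor_mult_inner[OF _ True, of "tensor_map C D h k t"]
            tensor_map_in[OF assms(5,6) t] tensors_mono[OF sub] by (auto simp: tensor_map_def)
        also have "\<dots> = s (\<lambda>a b. t (\<lambda>c d. \<beta> (h (a \<otimes>\<^bsub>A\<^esub> c)) (k (b \<otimes>\<^bsub>B\<^esub> d))))"
        proof (rule tensors_cong[OF s])
          show "(\<lambda>a b. tensor_map C D h k t (\<lambda>c d. \<beta> (h a \<otimes>\<^bsub>C\<^esub> c) (k b \<otimes>\<^bsub>D\<^esub> d))) \<in> bilinear_forms A B"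
            using *[OF CD.tensor_mult_inner[OF _ True, of "tensor_map C D h k t"]]
              tensor_map_in[OF assms(5,6) t] tensors_mono[OF sub] by auto
          show 1: "(\<lambda>a b. t (\<lambda>c d. \<beta> (h (a \<otimes>\<^bsub>A\<^esub> c)) (k (b \<otimes>\<^bsub>B\<^esub> d)))) \<in> bilinear_forms A B"
            by (rule AB.tensor_mult_inner[OF t *[OF True]])
          fix a b assume ab: "a \<in> carrier A" "b \<in> carrier B"
          then have hk: "h a \<in> carrier C" "k b \<in> carrier D" using assms by (auto dest: alg_homD)
          show "tensor_map C D h k t (\<lambda>c d. \<beta> (h a \<otimes>\<^bsub>C\<^esub> c) (k b \<otimes>\<^bsub>D\<^esub> d)) =
            t (\<lambda>c d. \<beta> (h (a \<otimes>\<^bsub>A\<^esub> c)) (k (b \<otimes>\<^bsub>B\<^esub> d)))"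
            unfolding tensor_map_def if_P[OF CD.bil_shift[OF True hk]]
            using ab *[OF CD.bil_shift[OF True hk]] AB.bil_shift[OF *[OF True] ab]
            by (intro tensors_cong[OF t]) (simp_all add: alg_homD(3)[OF assms(5)] alg_homD(3)[OF assms(6)])
        qed
        also have "\<dots> = tensor_map C D h k (s \<otimes>\<^bsub>tensor_prod A B\<^esub> t) \<beta>"
          using True * by (simp add: tensor_map_def)
        finally show ?thesis by simp
      qed (simp add: tensor_map_def)
    qed
  next
    show "tensor_map C D h k \<one>\<^bsub>tensor_prod A B\<^esub> = \<one>\<^bsub>tensor_prod C D\<^esub>"
      using * by (auto simp: tensor_map_def pure_tensor_def alg_homD(4)[OF assms(5)] alg_homD(4)[OF assms(6)])
  qed
qed

text \<open>
  Families of linear forms that separate points of \<open>A\<close> and \<open>B\<close> separate, through their products,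
  the points of \<open>A \<otimes> B\<close>. A form \<open>\<phi>\<close> with \<open>\<phi>(a) = 1\<close> allows to eliminate one
  of the terms of \<open>\<Sum> a\<^sub>i \<otimes> b\<^sub>i\<close>, since \<open>\<Sum> \<phi>(a\<^sub>i) b\<^sub>i = 0\<close>.
\<close>

definition separating :: "('k::field, 'a, 'm) module_scheme \<Rightarrow> ('a \<Rightarrow> 'k) set \<Rightarrow> bool"
  where "separating A \<Lambda> \<longleftrightarrow> (\<forall>\<phi>\<in>\<Lambda>. linear_form A \<phi>) \<and>
    (\<forall>a\<in>carrier A. (\<forall>\<phi>\<in>\<Lambda>. \<phi> a = 0) \<longrightarrow> a = \<zero>\<^bsub>A\<^esub>)"

lemma separating_tensor:
  assumes "kspace A" "kspace B" and sA: "separating A \<Lambda>" and sB: "separating B \<Lambda>'"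
    and t: "t \<in> tensors A B (carrier A) (carrier B)"
    and zero: "\<And>\<phi> \<psi>. \<phi> \<in> \<Lambda> \<Longrightarrow> \<psi> \<in> \<Lambda>' \<Longrightarrow> t (\<lambda>a b. \<phi> a * \<psi> b) = 0"
  shows "t = (\<lambda>\<beta>. 0)"
proof -
  interpret A: kspace A by fact
  interpret B: kspace B by fact
  have "tsum A B ps = (\<lambda>\<beta>. 0)"
    if "set ps \<subseteq> carrier A \<times> carrier B"
      "\<And>\<phi>. \<phi> \<in> \<Lambda> \<Longrightarrow> B.list_sum (\<lambda>(a, b). \<phi> a \<odot>\<^bsub>B\<^esub> b) ps = \<zero>\<^bsub>B\<^esub>" for ps
    using that
  \<comment> \<open>The induction is on the length, because the list \<open>rs\<close> to which the
    hypothesis is applied has altered first factors and is not a part of \<open>ps\<close>.\<close>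
  proof (induction "length ps" arbitrary: ps)
    case 0
    then show ?case by (auto simp: tsum_def)
  next
    case (Suc n)
    then obtain a b qs where ps: "ps = (a, b) # qs" and n: "n = length qs"
      by (metis length_Suc_conv surj_pair)
    have ab: "a \<in> carrier A" "b \<in> carrier B" and qs: "set qs \<subseteq> carrier A \<times> carrier B"
      using Suc.prems(1) by (auto simp: ps)
    show ?case
    proof (cases "a = \<zero>\<^bsub>A\<^esub>")
      case True
      have "B.list_sum (\<lambda>(a, b). \<phi> a \<odot>\<^bsub>B\<^esub> b) qs = \<zero>\<^bsub>B\<^esub>" if \<phi>: "\<phi> \<in> \<Lambda>" for \<phi>
      proof -
        have "linear_form A \<phi>" using \<phi> sA by (auto simp: separating_def)
        moreover have "B.list_sum (\<lambda>(a, b). \<phi> a \<odot>\<^bsub>B\<^esub> b) qs \<in> carrier B"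
          by (rule B.list_sum_closed) (use qs in auto)
        ultimately show ?thesis
          using Suc.prems(2)[OF \<phi>] ab by (simp add: ps True)
      qed
      then have IH: "tsum A B qs = (\<lambda>\<beta>. 0)" using Suc.hyps(1)[OF n qs] by blast
      show ?thesis
      proof
        fix \<beta> show "tsum A B ps \<beta> = 0"
          using fun_cong[OF IH, of \<beta>] A.linear_form_at_zero[OF bilD(2), of \<beta> B b] ab
          by (auto simp: tsum_def ps True)
      qed
    next
      case False
      then obtain \<phi> where \<phi>: "\<phi> \<in> \<Lambda>" "\<phi> a \<noteq> 0" using sA ab by (auto simp: separating_def)
      have lin\<phi>: "linear_form A \<phi>" using \<phi> sA by (auto simp: separating_def)
      \<comment> \<open>\<open>u\<close> is the projection along \<open>a\<close> onto the kernel of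
        \<open>\<phi>\<close>. What is subtracted from the first factors is compensated by the term
        with \<open>a\<close> itself, through the relation that \<open>\<phi>\<close> imposes on the
        second factors.\<close>
      define u where "u x = x \<oplus>\<^bsub>A\<^esub> (- (\<phi> x / \<phi> a)) \<odot>\<^bsub>A\<^esub> a" for x
      define rs where "rs = map (\<lambda>(x, y). (u x, y)) qs"
      have u: "u x \<in> carrier A" if "x \<in> carrier A" for x using that ab by (simp add: u_def)
      have rs: "set rs \<subseteq> carrier A \<times> carrier B" using qs u by (auto simp: rs_def)
      have eq: "(\<Sum>(x, y)\<leftarrow>rs. \<beta> x y) = (\<Sum>(x, y)\<leftarrow>ps. \<beta> x y)" if \<beta>: "\<beta> \<in> bilinear_forms A B" for \<beta>
      proof -
        have "(\<Sum>(x, y)\<leftarrow>rs. \<beta> x y) = (\<Sum>(x, y)\<leftarrow>qs. \<beta> x y - \<phi> x / \<phi> a * \<beta> a y)"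
          unfolding rs_def using qs ab
          by (induction qs) (auto simp: u_def linear_formD[OF bilD(2)[OF \<beta>]])
        also have "\<dots> = (\<Sum>(x, y)\<leftarrow>qs. \<beta> x y) - (\<Sum>(x, y)\<leftarrow>qs. \<phi> x / \<phi> a * \<beta> a y)"
          by (simp add: case_prod_unfold sum_list_subtractf)
        also have "(\<Sum>(x, y)\<leftarrow>qs. \<phi> x / \<phi> a * \<beta> a y) = inverse (\<phi> a) * (\<Sum>(x, y)\<leftarrow>qs. \<beta> a (\<phi> x \<odot>\<^bsub>B\<^esub> y))"
          unfolding sum_list_const_mult[symmetric]
          by (rule arg_cong[where f = sum_list], rule map_cong)
            (use qs ab in \<open>auto simp: linear_formD[OF bilD(1)[OF \<beta>]] field_simps\<close>)
        also have "\<dots> = inverse (\<phi> a) * (\<beta> a (B.list_sum (\<lambda>(x, y). \<phi> x \<odot>\<^bsub>B\<^esub> y) ps) - \<beta> a (\<phi> a \<odot>\<^bsub>B\<^esub> b))"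
          using Suc.prems(1) by (subst B.linear_form_list_sum[OF bilD(1)[OF \<beta> ab(1)]]) (auto simp: ps case_prod_unfold)
        also have "\<dots> = - \<beta> a b"
          unfolding Suc.prems(2)[OF \<phi>(1)] using ab \<phi>(2)
          by (simp add: B.linear_form_at_zero[OF bilD(1)[OF \<beta>]] linear_formD[OF bilD(1)[OF \<beta>]])
        finally show ?thesis by (simp add: ps)
      qed
      have "B.list_sum (\<lambda>(x, y). \<psi> x \<odot>\<^bsub>B\<^esub> y) rs = \<zero>\<^bsub>B\<^esub>" if \<psi>: "\<psi> \<in> \<Lambda>" for \<psi>
      proof -
        have lin\<psi>: "linear_form A \<psi>" using \<psi> sA by (auto simp: separating_def)
        have cl: "B.list_sum (\<lambda>(x, y). \<psi> x \<odot>\<^bsub>B\<^esub> y) rs \<in> carrier B"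
          by (rule B.list_sum_closed) (use rs in auto)
        have "\<chi> (B.list_sum (\<lambda>(x, y). \<psi> x \<odot>\<^bsub>B\<^esub> y) rs) = 0" if \<chi>: "\<chi> \<in> \<Lambda>'" for \<chi>
        proof -
          have lin\<chi>: "linear_form B \<chi>" using \<chi> sB by (auto simp: separating_def)
          have *: "\<chi> (B.list_sum (\<lambda>(x, y). \<psi> x \<odot>\<^bsub>B\<^esub> y) xs) = (\<Sum>(x, y)\<leftarrow>xs. \<psi> x * \<chi> y)"
            if "set xs \<subseteq> carrier A \<times> carrier B" for xs
            using that by (subst B.linear_form_list_sum[OF lin\<chi>])
              (auto simp: case_prod_unfold linear_formD(2)[OF lin\<chi>] subset_iff intro!: arg_cong[where f = sum_list])
          have "(\<Sum>(x, y)\<leftarrow>rs. \<psi> x * \<chi> y) = (\<Sum>(x, y)\<leftarrow>ps. \<psi> x * \<chi> y)"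
            using eq[OF bil_prod[OF lin\<psi> lin\<chi>]] .
          with *[OF rs] *[OF Suc.prems(1)] Suc.prems(2)[OF \<psi>] B.linear_form_at_zero[OF lin\<chi>]
          show ?thesis by simp
        qed
        with sB cl show ?thesis by (auto simp: separating_def)
      qed
      then have "tsum A B rs = (\<lambda>\<beta>. 0)"
        using Suc.hyps(1)[of rs] rs n by (auto simp: rs_def)
      moreover have "tsum A B ps = tsum A B rs" using eq by (auto simp: tsum_def)
      ultimately show ?thesis by simp
    qed
  qed note main = this
  obtain ps where ps: "set ps \<subseteq> carrier A \<times> carrier B" "t = tsum A B ps" using t by (rule tensorsE)
  have "B.list_sum (\<lambda>(a, b). \<phi> a \<odot>\<^bsub>B\<^esub> b) ps = \<zero>\<^bsub>B\<^esub>" if \<phi>: "\<phi> \<in> \<Lambda>" for \<phi>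
  proof -
    have cl: "B.list_sum (\<lambda>(x, y). \<phi> x \<odot>\<^bsub>B\<^esub> y) ps \<in> carrier B"
      by (rule B.list_sum_closed) (use ps in auto)
    have "\<chi> (B.list_sum (\<lambda>(x, y). \<phi> x \<odot>\<^bsub>B\<^esub> y) ps) = 0" if \<chi>: "\<chi> \<in> \<Lambda>'" for \<chi>
    proof -
      have lin: "linear_form A \<phi>" "linear_form B \<chi>" using \<phi> sA \<chi> sB by (auto simp: separating_def)
      have "\<chi> (B.list_sum (\<lambda>(x, y). \<phi> x \<odot>\<^bsub>B\<^esub> y) ps) = (\<Sum>(x, y)\<leftarrow>ps. \<phi> x * \<chi> y)"
        using ps(1) by (subst B.linear_form_list_sum[OF lin(2)])
          (auto simp: case_prod_unfold linear_formD(2)[OF lin(2)] subset_iff intro!: arg_cong[where f = sum_list])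
      also have "\<dots> = 0" using zero[OF \<phi> \<chi>] bil_prod[OF lin] by (simp add: ps(2) tsum_def)
      finally show ?thesis .
    qed
    with sB cl show ?thesis by (auto simp: separating_def)
  qed
  then show ?thesis using main[OF ps(1)] ps(2) by simp
qed


section \<open>Tensor algebras\<close>

definition wsum :: "('k::field, 'v, 'm) module_scheme \<Rightarrow> ('k \<times> 'v list) list \<Rightarrow> ('k, 'v) tens"
  where "wsum V ts = (\<lambda>\<phi>. if \<phi> \<in> multilinear_forms V then \<Sum>(c, vs)\<leftarrow>ts. c * \<phi> vs else 0)"

lemma wsum_word: "(\<lambda>\<phi>. \<Sum>(c, vs)\<leftarrow>ts. c * word V vs \<phi>) = wsum V ts"
  by (rule ext) (induction ts; auto simp: wsum_def word_def)

lemma ta_simps [simp]: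
  "carrier (tensor_algebra V) = {wsum V ts |ts. snd ` set ts \<subseteq> lists (carrier V)}"
  "mult (tensor_algebra V) = (\<lambda>s t \<phi>. if \<phi> \<in> multilinear_forms V then s (\<lambda>u. t (\<lambda>v. \<phi> (u @ v))) else 0)"
  "one (tensor_algebra V) = word V []"
  "zero (tensor_algebra V) = (\<lambda>_. 0)"
  "add (tensor_algebra V) = (\<lambda>s t \<phi>. s \<phi> + t \<phi>)"
  "module.smult (tensor_algebra V) = (\<lambda>c s \<phi>. c * s \<phi>)"
  by (simp_all add: tensor_algebra_def wsum_word)

lemma mfD: "\<phi> \<in> multilinear_forms V \<Longrightarrow> u \<in> lists (carrier V) \<Longrightarrow> w \<in> lists (carrier V) \<Longrightarrow>
    linear_form V (\<lambda>v. \<phi> (u @ v # w))"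
  by (simp add: multilinear_forms_def)

lemma mf_add: "\<phi> \<in> multilinear_forms V \<Longrightarrow> \<psi> \<in> multilinear_forms V \<Longrightarrow>
    (\<lambda>w. \<phi> w + \<psi> w) \<in> multilinear_forms V"
  and mf_scale: "\<phi> \<in> multilinear_forms V \<Longrightarrow> (\<lambda>w. c * \<phi> w) \<in> multilinear_forms V"
  by (simp_all add: multilinear_forms_def linear_form_add linear_form_scale linear_form_zero)

lemma mf_sum: "(\<And>i. i \<in> I \<Longrightarrow> \<phi> i \<in> multilinear_forms V) \<Longrightarrow>
    (\<lambda>w. \<Sum>i\<in>I. \<phi> i w) \<in> multilinear_forms V"
  by (simp add: multilinear_forms_def linear_form_sum)

lemma mf_prefix: "\<phi> \<in> multilinear_forms V \<Longrightarrow> u \<in> lists (carrier V) \<Longrightarrow>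
    (\<lambda>v. \<phi> (u @ v)) \<in> multilinear_forms V"
  using mfD[of \<phi> V "u @ u'" for u'] by (simp add: multilinear_forms_def)

lemma wsum_eval: "\<phi> \<in> multilinear_forms V \<Longrightarrow> wsum V ts \<phi> = (\<Sum>(c, vs)\<leftarrow>ts. c * \<phi> vs)"
  by (simp add: wsum_def)

lemma taE:
  assumes "a \<in> carrier (tensor_algebra V)"
  obtains ts where "snd ` set ts \<subseteq> lists (carrier V)" "a = wsum V ts"
  using assms by auto

lemma ta_off: "a \<in> carrier (tensor_algebra V) \<Longrightarrow> \<phi> \<notin> multilinear_forms V \<Longrightarrow> a \<phi> = 0"
  by (auto simp: wsum_def)

lemma ta_eqI:
  assumes "a \<in> carrier (tensor_algebra V)" "b \<in> carrier (tensor_algebra V)"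
    and "\<And>\<phi>. \<phi> \<in> multilinear_forms V \<Longrightarrow> a \<phi> = b \<phi>"
  shows "a = b"
proof
  fix \<phi> show "a \<phi> = b \<phi>"
    using assms ta_off[OF assms(1)] ta_off[OF assms(2)] by (cases "\<phi> \<in> multilinear_forms V") auto
qed

lemma ta_cong:
  assumes "a \<in> carrier (tensor_algebra V)" "\<phi> \<in> multilinear_forms V" "\<psi> \<in> multilinear_forms V"
    and "\<And>w. w \<in> lists (carrier V) \<Longrightarrow> \<phi> w = \<psi> w"
  shows "a \<phi> = a \<psi>"
  using assms(1)
proof (rule taE)
  fix ts assume ts: "snd ` set ts \<subseteq> lists (carrier V)" and a: "a = wsum V ts"
  have "(\<Sum>(c, vs)\<leftarrow>ts. c * \<phi> vs) = (\<Sum>(c, vs)\<leftarrow>ts. c * \<psi> vs)"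
    using ts by (induction ts) (simp_all add: assms(4) case_prod_unfold)
  then show ?thesis by (simp add: a wsum_eval assms(2,3))
qed

lemma ta_add_form:
  "a \<in> carrier (tensor_algebra V) \<Longrightarrow> \<phi> \<in> multilinear_forms V \<Longrightarrow> \<psi> \<in> multilinear_forms V \<Longrightarrow>
    a (\<lambda>w. \<phi> w + \<psi> w) = a \<phi> + a \<psi>"
  by (erule taE) (simp add: wsum_eval mf_add case_prod_unfold distrib_left sum_list_addf)

lemma ta_scale_form:
  "a \<in> carrier (tensor_algebra V) \<Longrightarrow> \<phi> \<in> multilinear_forms V \<Longrightarrow> a (\<lambda>w. c * \<phi> w) = c * a \<phi>"
  by (erule taE)
    (simp add: wsum_eval mf_scale case_prod_unfold mult.left_commute[of _ c] sum_list_const_mult)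

lemma ta_sum_form:
  "a \<in> carrier (tensor_algebra V) \<Longrightarrow> (\<And>i. i \<in> I \<Longrightarrow> \<phi> i \<in> multilinear_forms V) \<Longrightarrow>
    a (\<lambda>w. \<Sum>i\<in>I. \<phi> i w) = (\<Sum>i\<in>I. a (\<phi> i))"
proof (induction I rule: infinite_finite_induct)
  case (insert i I)
  then have "a (\<lambda>w. \<phi> i w + (\<Sum>i\<in>I. \<phi> i w)) = a (\<phi> i) + a (\<lambda>w. \<Sum>i\<in>I. \<phi> i w)"
    by (intro ta_add_form[OF insert.prems(1)] mf_sum) auto
  with insert show ?case by simp
qed (elim taE, simp add: wsum_def case_prod_unfold)+

context kspace
begin

abbreviation (input) TV :: "('k, ('k, 'v) tens) module" where "TV \<equiv> tensor_algebra V"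

text \<open>Multilinearity of the inner evaluation: it plays for the concatenation product the role
  that \<open>tensor_mult_inner\<close> plays for tensor products.\<close>

lemma ta_inner:
  assumes a: "a \<in> carrier TV" and \<phi>: "\<phi> \<in> multilinear_forms V"
  shows "(\<lambda>u. a (\<lambda>v. \<phi> (u @ v))) \<in> multilinear_forms V"
  unfolding multilinear_forms_def linear_form_def
proof (intro CollectI ballI conjI allI)
  fix u w assume uw: "u \<in> lists (carrier V)" "w \<in> lists (carrier V)"
  have lin: "linear_form V (\<lambda>x. \<phi> (u @ x # w @ v))" if "v \<in> lists (carrier V)" for v
    using mfD[OF \<phi> uw(1), of "w @ v"] uw that by simp
  have mf: "(\<lambda>v. \<phi> (u @ x # w @ v)) \<in> multilinear_forms V" if "x \<in> carrier V" for x
    using mf_prefix[OF \<phi>, of "u @ x # w"] uw that by simp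
  fix x assume x: "x \<in> carrier V"
  show "a (\<lambda>v. \<phi> ((u @ (x \<oplus> y) # w) @ v)) =
    a (\<lambda>v. \<phi> ((u @ x # w) @ v)) + a (\<lambda>v. \<phi> ((u @ y # w) @ v))" if y: "y \<in> carrier V" for y
  proof -
    have "a (\<lambda>v. \<phi> (u @ (x \<oplus> y) # w @ v)) = a (\<lambda>v. \<phi> (u @ x # w @ v) + \<phi> (u @ y # w @ v))"
      by (rule ta_cong[OF a mf[OF a_closed[OF x y]] mf_add[OF mf[OF x] mf[OF y]]])
        (simp add: linear_formD(1)[OF lin] x y)
    then show ?thesis using ta_add_form[OF a mf[OF x] mf[OF y]] by simp
  qed
  show "a (\<lambda>v. \<phi> ((u @ (c \<odot> x) # w) @ v)) = c * a (\<lambda>v. \<phi> ((u @ x # w) @ v))" for c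
  proof -
    have "a (\<lambda>v. \<phi> (u @ (c \<odot> x) # w @ v)) = a (\<lambda>v. c * \<phi> (u @ x # w @ v))"
      by (rule ta_cong[OF a mf[OF smult_closed[OF x]] mf_scale[OF mf[OF x]]])
        (simp add: linear_formD(2)[OF lin] x)
    then show ?thesis using ta_scale_form[OF a mf[OF x]] by simp
  qed
qed

lemma word_in [simp]: "vs \<in> lists (carrier V) \<Longrightarrow> word V vs \<in> carrier TV"
  by (auto simp: word_def wsum_def intro!: exI[of _ "[(1, vs)]"])

lemma word_eval: "\<phi> \<in> multilinear_forms V \<Longrightarrow> word V vs \<phi> = \<phi> vs"
  by (simp add: word_def)

lemma ta_add: "a \<in> carrier TV \<Longrightarrow> b \<in> carrier TV \<Longrightarrow> (\<lambda>\<phi>. a \<phi> + b \<phi>) \<in> carrier TV"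
proof (elim taE)
  fix ts us assume "snd ` set ts \<subseteq> lists (carrier V)" "snd ` set us \<subseteq> lists (carrier V)"
    "a = wsum V ts" "b = wsum V us"
  then show ?thesis
    unfolding ta_simps
    by (intro CollectI exI[of _ "ts @ us"]) (simp add: wsum_def image_Un fun_eq_iff)
qed

lemma ta_scale:
  assumes "a \<in> carrier TV" shows "(\<lambda>\<phi>. c * a \<phi>) \<in> carrier TV"
  using assms
proof (rule taE)
  fix ts assume ts: "snd ` set ts \<subseteq> lists (carrier V)" "a = wsum V ts"
  have "(\<lambda>\<phi>. c * a \<phi>) = wsum V (map (\<lambda>(d, vs). (c * d, vs)) ts)"
    by (auto simp: ts(2) wsum_def o_def case_prod_unfold mult.assoc sum_list_const_mult)
  moreover have "snd ` set (map (\<lambda>(d, vs). (c * d, vs)) ts) \<subseteq> lists (carrier V)"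
    using ts(1) by (auto simp: image_subset_iff)
  ultimately show ?thesis unfolding ta_simps by blast
qed

lemma ta_zero: "(\<lambda>\<phi>. 0) \<in> carrier TV"
  by (auto simp: wsum_def intro!: exI[of _ "[]"])

lemma ta_sum: "(\<And>i. i \<in> I \<Longrightarrow> a i \<in> carrier TV) \<Longrightarrow> (\<lambda>\<phi>. \<Sum>i\<in>I. a i \<phi>) \<in> carrier TV"
proof (induction I rule: infinite_finite_induct)
  case (insert i I)
  then show ?case using ta_add[of "a i" "\<lambda>\<phi>. \<Sum>i\<in>I. a i \<phi>"] by (simp del: ta_simps)
qed (simp_all add: ta_zero del: ta_simps)

lemma kspace_TV: "kspace TV"
proof (rule kspaceI)
  show "\<zero>\<^bsub>TV\<^esub> \<in> carrier TV" using ta_zero by simp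
  fix a b assume "a \<in> carrier TV" "b \<in> carrier TV"
  then show "a \<oplus>\<^bsub>TV\<^esub> b \<in> carrier TV" "c \<odot>\<^bsub>TV\<^esub> a \<in> carrier TV" for c
    using ta_add ta_scale by (simp_all only: ta_simps(5,6))
qed (auto simp: algebra_simps)

lemma ta_induct [consumes 1, case_names zero add]:
  assumes "a \<in> carrier TV" and "P \<zero>\<^bsub>TV\<^esub>"
    and "\<And>c vs a. vs \<in> lists (carrier V) \<Longrightarrow> a \<in> carrier TV \<Longrightarrow> P a \<Longrightarrow>
      P (c \<odot>\<^bsub>TV\<^esub> word V vs \<oplus>\<^bsub>TV\<^esub> a)"
  shows "P a"
proof -
  have "P (wsum V ts)" if "snd ` set ts \<subseteq> lists (carrier V)" for ts
    using that
  proof (induction ts)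
    case Nil
    have "wsum V [] = \<zero>\<^bsub>TV\<^esub>" by (auto simp: wsum_def)
    then show ?case using assms(2) by simp
  next
    case (Cons p ts)
    obtain c vs where p: "p = (c, vs)" by force
    have "wsum V (p # ts) = c \<odot>\<^bsub>TV\<^esub> word V vs \<oplus>\<^bsub>TV\<^esub> wsum V ts"
      by (auto simp: wsum_def word_def p)
    moreover have "wsum V ts \<in> carrier TV" using Cons.prems by auto
    ultimately show ?case using assms(3)[of vs "wsum V ts" c] Cons p by auto
  qed
  then show ?thesis using taE[OF assms(1)] by metis
qed

lemma ta_word_mult:
  assumes "u \<in> lists (carrier V)" "v \<in> lists (carrier V)"
  shows "word V u \<otimes>\<^bsub>TV\<^esub> word V v = word V (u @ v)"
proof
  fix \<phi> show "(word V u \<otimes>\<^bsub>TV\<^esub> word V v) \<phi> = word V (u @ v) \<phi>"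
    using ta_inner[OF word_in[OF assms(2)], of \<phi>] mf_prefix[OF _ assms(1), of \<phi>]
    by (simp add: word_def)
qed

lemma ta_mult_add_left: "a \<in> carrier TV \<Longrightarrow> b \<in> carrier TV \<Longrightarrow> c \<in> carrier TV \<Longrightarrow>
    (a \<oplus>\<^bsub>TV\<^esub> b) \<otimes>\<^bsub>TV\<^esub> c = a \<otimes>\<^bsub>TV\<^esub> c \<oplus>\<^bsub>TV\<^esub> b \<otimes>\<^bsub>TV\<^esub> c"
  and ta_mult_add_right: "a \<in> carrier TV \<Longrightarrow> b \<in> carrier TV \<Longrightarrow> c \<in> carrier TV \<Longrightarrow>
    c \<otimes>\<^bsub>TV\<^esub> (a \<oplus>\<^bsub>TV\<^esub> b) = c \<otimes>\<^bsub>TV\<^esub> a \<oplus>\<^bsub>TV\<^esub> c \<otimes>\<^bsub>TV\<^esub> b"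
  and ta_mult_scale_left: "a \<in> carrier TV \<Longrightarrow> b \<in> carrier TV \<Longrightarrow>
    (k \<odot>\<^bsub>TV\<^esub> a) \<otimes>\<^bsub>TV\<^esub> b = k \<odot>\<^bsub>TV\<^esub> (a \<otimes>\<^bsub>TV\<^esub> b)"
  and ta_mult_scale_right: "a \<in> carrier TV \<Longrightarrow> b \<in> carrier TV \<Longrightarrow>
    a \<otimes>\<^bsub>TV\<^esub> (k \<odot>\<^bsub>TV\<^esub> b) = k \<odot>\<^bsub>TV\<^esub> (a \<otimes>\<^bsub>TV\<^esub> b)"
proof -
  assume a: "a \<in> carrier TV" and b: "b \<in> carrier TV"
  show "(k \<odot>\<^bsub>TV\<^esub> a) \<otimes>\<^bsub>TV\<^esub> b = k \<odot>\<^bsub>TV\<^esub> (a \<otimes>\<^bsub>TV\<^esub> b)" by auto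
  show "a \<otimes>\<^bsub>TV\<^esub> (k \<odot>\<^bsub>TV\<^esub> b) = k \<odot>\<^bsub>TV\<^esub> (a \<otimes>\<^bsub>TV\<^esub> b)"
    by (auto simp: ta_scale_form[OF a ta_inner[OF b]] simp del: ta_simps(1))
  assume c: "c \<in> carrier TV"
  show "(a \<oplus>\<^bsub>TV\<^esub> b) \<otimes>\<^bsub>TV\<^esub> c = a \<otimes>\<^bsub>TV\<^esub> c \<oplus>\<^bsub>TV\<^esub> b \<otimes>\<^bsub>TV\<^esub> c" by auto
  show "c \<otimes>\<^bsub>TV\<^esub> (a \<oplus>\<^bsub>TV\<^esub> b) = c \<otimes>\<^bsub>TV\<^esub> a \<oplus>\<^bsub>TV\<^esub> c \<otimes>\<^bsub>TV\<^esub> b"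
    by (auto simp: ta_add_form[OF c ta_inner[OF a] ta_inner[OF b]] simp del: ta_simps(1))
qed

lemma ta_mult_closed:
  assumes a: "a \<in> carrier TV" and b: "b \<in> carrier TV"
  shows "a \<otimes>\<^bsub>TV\<^esub> b \<in> carrier TV"
proof -
  interpret T: kspace TV by (rule kspace_TV)
  note [simp del] = ta_simps
  have z: "\<zero>\<^bsub>TV\<^esub> \<otimes>\<^bsub>TV\<^esub> b = \<zero>\<^bsub>TV\<^esub>" for b by (auto simp: ta_simps)
  have z': "a \<otimes>\<^bsub>TV\<^esub> \<zero>\<^bsub>TV\<^esub> = \<zero>\<^bsub>TV\<^esub>" if "a \<in> carrier TV" for a
    using ta_mult_scale_right[OF that T.zero_closed, of 0] by (simp add: ta_simps(4,6))
  have "word V u \<otimes>\<^bsub>TV\<^esub> b \<in> carrier TV" if u: "u \<in> lists (carrier V)" for u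
    using b
  proof (induction rule: ta_induct)
    case (add c vs b)
    have "word V u \<otimes>\<^bsub>TV\<^esub> (c \<odot>\<^bsub>TV\<^esub> word V vs \<oplus>\<^bsub>TV\<^esub> b) =
        c \<odot>\<^bsub>TV\<^esub> word V (u @ vs) \<oplus>\<^bsub>TV\<^esub> word V u \<otimes>\<^bsub>TV\<^esub> b"
      using u add by (subst ta_mult_add_right) (simp_all add: ta_mult_scale_right ta_word_mult)
    moreover have "word V (u @ vs) \<in> carrier TV" using u add by simp
    ultimately show ?case using add by simp
  qed (simp add: z' u)
  with a show ?thesis
  proof (induction rule: ta_induct)
    case (add c vs a)
    have "(c \<odot>\<^bsub>TV\<^esub> word V vs \<oplus>\<^bsub>TV\<^esub> a) \<otimes>\<^bsub>TV\<^esub> b = c \<odot>\<^bsub>TV\<^esub> (word V vs \<otimes>\<^bsub>TV\<^esub> b) \<oplus>\<^bsub>TV\<^esub> a \<otimes>\<^bsub>TV\<^esub> b"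
      using add b by (subst ta_mult_add_left) (simp_all add: ta_mult_scale_left)
    then show ?case using add by simp
  qed (simp add: z)
qed

lemma kalg_TV: "kalg TV"
proof (rule kalgI[OF kspace_TV])
  show one: "\<one>\<^bsub>TV\<^esub> \<in> carrier TV" using word_in[of "[]"] by simp
  fix a assume a: "a \<in> carrier TV"
  show "\<one>\<^bsub>TV\<^esub> \<otimes>\<^bsub>TV\<^esub> a = a"
  proof (rule ta_eqI[OF ta_mult_closed[OF one a] a])
    fix \<phi> assume "\<phi> \<in> multilinear_forms V"
    with ta_inner[OF a this] show "(\<one>\<^bsub>TV\<^esub> \<otimes>\<^bsub>TV\<^esub> a) \<phi> = a \<phi>" by (simp add: word_def)
  qed
  show "a \<otimes>\<^bsub>TV\<^esub> \<one>\<^bsub>TV\<^esub> = a"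
  proof (rule ta_eqI[OF ta_mult_closed[OF a one] a])
    fix \<phi> assume \<phi>: "\<phi> \<in> multilinear_forms V"
    then have "a (\<lambda>u. word V [] (\<lambda>v. \<phi> (u @ v))) = a \<phi>"
      using ta_inner[OF one \<phi>] by (intro ta_cong[OF a]) (simp_all add: word_def mf_prefix)
    with \<phi> show "(a \<otimes>\<^bsub>TV\<^esub> \<one>\<^bsub>TV\<^esub>) \<phi> = a \<phi>" by simp
  qed
  fix b assume b: "b \<in> carrier TV"
  show "a \<otimes>\<^bsub>TV\<^esub> b \<in> carrier TV" by (rule ta_mult_closed[OF a b])
  show "(k \<odot>\<^bsub>TV\<^esub> a) \<otimes>\<^bsub>TV\<^esub> b = k \<odot>\<^bsub>TV\<^esub> (a \<otimes>\<^bsub>TV\<^esub> b)"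
    "a \<otimes>\<^bsub>TV\<^esub> (k \<odot>\<^bsub>TV\<^esub> b) = k \<odot>\<^bsub>TV\<^esub> (a \<otimes>\<^bsub>TV\<^esub> b)" for k
    by (rule ta_mult_scale_left[OF a b] ta_mult_scale_right[OF a b])+
  fix c assume c: "c \<in> carrier TV"
  show "(a \<oplus>\<^bsub>TV\<^esub> b) \<otimes>\<^bsub>TV\<^esub> c = a \<otimes>\<^bsub>TV\<^esub> c \<oplus>\<^bsub>TV\<^esub> b \<otimes>\<^bsub>TV\<^esub> c"
    "c \<otimes>\<^bsub>TV\<^esub> (a \<oplus>\<^bsub>TV\<^esub> b) = c \<otimes>\<^bsub>TV\<^esub> a \<oplus>\<^bsub>TV\<^esub> c \<otimes>\<^bsub>TV\<^esub> b"
    by (rule ta_mult_add_left[OF a b c] ta_mult_add_right[OF a b c])+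
  show "a \<otimes>\<^bsub>TV\<^esub> b \<otimes>\<^bsub>TV\<^esub> c = a \<otimes>\<^bsub>TV\<^esub> (b \<otimes>\<^bsub>TV\<^esub> c)"
  proof
    fix \<phi> show "(a \<otimes>\<^bsub>TV\<^esub> b \<otimes>\<^bsub>TV\<^esub> c) \<phi> = (a \<otimes>\<^bsub>TV\<^esub> (b \<otimes>\<^bsub>TV\<^esub> c)) \<phi>"
    proof (cases "\<phi> \<in> multilinear_forms V")
      case \<phi>: True
      have "a (\<lambda>u. (b \<otimes>\<^bsub>TV\<^esub> c) (\<lambda>w. \<phi> (u @ w))) = a (\<lambda>u. b (\<lambda>v. c (\<lambda>w. \<phi> ((u @ v) @ w))))"
        by (rule ta_cong[OF a ta_inner[OF ta_mult_closed[OF b c] \<phi>] ta_inner[OF b ta_inner[OF c \<phi>]]])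
          (simp add: mf_prefix[OF \<phi>])
      then show ?thesis using \<phi> ta_inner[OF c \<phi>] by (simp del: ta_simps(1))
    qed simp
  qed
qed

text \<open>Both factors of a product expand into words by linearity, so multiplicativity is a
  condition on concatenations only.\<close>

lemma alg_hom_TI:
  assumes B: "kalg B" and cl: "\<And>a. a \<in> carrier TV \<Longrightarrow> h a \<in> carrier B"
    and add: "\<And>a b. a \<in> carrier TV \<Longrightarrow> b \<in> carrier TV \<Longrightarrow> h (a \<oplus>\<^bsub>TV\<^esub> b) = h a \<oplus>\<^bsub>B\<^esub> h b"
    and scale: "\<And>c a. a \<in> carrier TV \<Longrightarrow> h (c \<odot>\<^bsub>TV\<^esub> a) = c \<odot>\<^bsub>B\<^esub> h a"
    and word: "\<And>u v. u \<in> lists (carrier V) \<Longrightarrow> v \<in> lists (carrier V) \<Longrightarrow>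
      h (word V (u @ v)) = h (word V u) \<otimes>\<^bsub>B\<^esub> h (word V v)"
    and one: "h (word V []) = \<one>\<^bsub>B\<^esub>"
  shows "h \<in> alg_hom TV B"
proof (rule alg_homI)
  interpret B: kalg B by fact
  interpret T: kalg TV by (rule kalg_TV)
  note [simp del] = ta_simps
  have z: "h \<zero>\<^bsub>TV\<^esub> = \<zero>\<^bsub>B\<^esub>" using scale[OF T.zero_closed, of 0] by (simp add: cl)
  fix a b assume a: "a \<in> carrier TV" and b: "b \<in> carrier TV"
  have "h (word V u \<otimes>\<^bsub>TV\<^esub> b) = h (word V u) \<otimes>\<^bsub>B\<^esub> h b" if u: "u \<in> lists (carrier V)" for u
    using b
  proof (induction rule: ta_induct)
    case (add c vs b)
    then show ?case using u
      by (simp add: T.r_distr B.r_distr T.smult_mult_right B.smult_mult_right assms(3) cl scale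
          ta_word_mult word)
  qed (simp add: z cl u)
  then show "h (a \<otimes>\<^bsub>TV\<^esub> b) = h a \<otimes>\<^bsub>B\<^esub> h b"
    using a
  proof (induction rule: ta_induct[OF a])
    case (2 c vs a)
    then show ?case using b
      by (simp add: T.l_distr B.l_distr T.smult_mult_left B.smult_mult_left add cl scale)
  qed (simp add: z cl b)
qed (use assms in \<open>simp_all add: ta_simps(3) del: ta_simps(1)\<close>)

lemma word_Cons: "v \<in> carrier V \<Longrightarrow> vs \<in> lists (carrier V) \<Longrightarrow>
    word V (v # vs) = word V [v] \<otimes>\<^bsub>TV\<^esub> word V vs"
  using ta_word_mult[of "[v]" vs] by simp

text \<open>One letter is split off on the left, which fits properties that hold for generators and
  pass to products, such as the counit equations.\<close>

lemma ta_gen_induct [consumes 1, case_names one gen add scale]: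
  assumes a: "a \<in> carrier TV" and one: "P \<one>\<^bsub>TV\<^esub>"
    and gen: "\<And>v b. v \<in> carrier V \<Longrightarrow> b \<in> carrier TV \<Longrightarrow> P b \<Longrightarrow> P (word V [v] \<otimes>\<^bsub>TV\<^esub> b)"
    and add: "\<And>b c. b \<in> carrier TV \<Longrightarrow> c \<in> carrier TV \<Longrightarrow> P b \<Longrightarrow> P c \<Longrightarrow> P (b \<oplus>\<^bsub>TV\<^esub> c)"
    and scale: "\<And>k b. b \<in> carrier TV \<Longrightarrow> P b \<Longrightarrow> P (k \<odot>\<^bsub>TV\<^esub> b)"
  shows "P a"
proof -
  interpret T: kalg TV by (rule kalg_TV)
  note [simp del] = ta_simps
  have w: "P (word V vs)" if "vs \<in> lists (carrier V)" for vs
    using that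
  proof (induction vs)
    case Nil then show ?case using one by (simp add: ta_simps(3))
  next
    case (Cons v vs) then show ?case using gen[of v "word V vs"] by (simp add: word_Cons[of v vs])
  qed
  show ?thesis
    using a
  proof (induction rule: ta_induct)
    case zero
    then show ?case using scale[OF T.one_closed one, of 0] by simp
  next
    case (add c vs a)
    then show ?case by (intro assms(4) scale w) simp_all
  qed
qed

lemma alg_hom_T_eq:
  assumes "h \<in> alg_hom TV B" "h' \<in> alg_hom TV B"
    and "\<And>v. v \<in> carrier V \<Longrightarrow> h (word V [v]) = h' (word V [v])" and "a \<in> carrier TV"
  shows "h a = h' a"
  using assms(4)
  by (induction rule: ta_gen_induct)
    (simp_all add: alg_homD[OF assms(1)] alg_homD[OF assms(2)] assms(3) del: ta_simps)

end

section \<open>The universal property of the tensor algebra, with values in a tensor product\<close>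

locale tensor_lift = V: kspace V + two_algs A B
  for V :: "('k::field, 'v, 'm) module_scheme" and A :: "('k, 'a, 'n) module_scheme"
    and B :: "('k, 'b, 'o) module_scheme" +
  fixes g :: "'v \<Rightarrow> ('k, 'a, 'b) tensor"
  assumes g_closed: "v \<in> carrier V \<Longrightarrow> g v \<in> carrier (tensor_prod A B)"
    and g_add: "v \<in> carrier V \<Longrightarrow> w \<in> carrier V \<Longrightarrow> g (v \<oplus>\<^bsub>V\<^esub> w) = g v \<oplus>\<^bsub>tensor_prod A B\<^esub> g w"
    and g_scale: "v \<in> carrier V \<Longrightarrow> g (c \<odot>\<^bsub>V\<^esub> v) = c \<odot>\<^bsub>tensor_prod A B\<^esub> g v"
begin

sublocale C: kalg "tensor_prod A B" by (rule kalg_tensor_prod)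

definition P :: "'v list \<Rightarrow> ('k, 'a, 'b) tensor"
  where "P vs = foldr (mult (tensor_prod A B)) (map g vs) \<one>\<^bsub>tensor_prod A B\<^esub>"

text \<open>Source and target both consist of functionals, so the extension can be written down form
  by form; it refers to no presentation as a sum of words and is well defined at once.\<close>

definition lift :: "('k, 'v) tens \<Rightarrow> ('k, 'a, 'b) tensor"
  where "lift a = (\<lambda>\<beta>. if \<beta> \<in> bilinear_forms A B then a (\<lambda>vs. P vs \<beta>) else 0)"

lemma P_closed: "vs \<in> lists (carrier V) \<Longrightarrow> P vs \<in> carrier (tensor_prod A B)"
  by (induction vs) (simp_all add: P_def g_closed del: tp_simps)

lemma P_append: "u \<in> lists (carrier V) \<Longrightarrow> v \<in> lists (carrier V) \<Longrightarrow>
    P (u @ v) = P u \<otimes>\<^bsub>tensor_prod A B\<^esub> P v"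
proof (induction u)
  case Nil
  then show ?case using C.l_one[OF P_closed] by (simp add: P_def del: tp_simps)
next
  case (Cons x u)
  then have "P (u @ v) = P u \<otimes>\<^bsub>tensor_prod A B\<^esub> P v" by simp
  moreover have "P ((x # u) @ v) = g x \<otimes>\<^bsub>tensor_prod A B\<^esub> P (u @ v)"
    "P (x # u) = g x \<otimes>\<^bsub>tensor_prod A B\<^esub> P u" by (simp_all add: P_def del: tp_simps)
  ultimately show ?case
    using C.m_assoc[OF g_closed P_closed P_closed] Cons.prems by (simp del: tp_simps)
qed

text \<open>Sums and multiples of tensors are pointwise, so multilinearity of the product
  \<open>P\<close> persists after evaluation at any \<open>\<beta>\<close>, bilinear or not.\<close>

lemma P_mf: "(\<lambda>vs. P vs \<beta>) \<in> multilinear_forms V"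
  unfolding multilinear_forms_def linear_form_def
proof (intro CollectI ballI conjI allI)
  note [simp del] = tp_simps
  fix u w x assume uw: "u \<in> lists (carrier V)" "w \<in> lists (carrier V)" and x: "x \<in> carrier V"
  have *: "P (u @ y # w) = P u \<otimes>\<^bsub>tensor_prod A B\<^esub> (g y \<otimes>\<^bsub>tensor_prod A B\<^esub> P w)"
    if "y \<in> carrier V" for y
    using P_append[of u "y # w"] uw that by (simp add: P_def)
  show "P (u @ (x \<oplus>\<^bsub>V\<^esub> y) # w) \<beta> = P (u @ x # w) \<beta> + P (u @ y # w) \<beta>" if "y \<in> carrier V" for y
  proof -
    have "P (u @ (x \<oplus>\<^bsub>V\<^esub> y) # w) = P (u @ x # w) \<oplus>\<^bsub>tensor_prod A B\<^esub> P (u @ y # w)"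
      using that x uw by (simp add: * g_add C.l_distr C.r_distr P_closed g_closed)
    then show ?thesis by (simp add: tp_simps(5))
  qed
  show "P (u @ (c \<odot>\<^bsub>V\<^esub> x) # w) \<beta> = c * P (u @ x # w) \<beta>" for c
  proof -
    have "P (u @ (c \<odot>\<^bsub>V\<^esub> x) # w) = c \<odot>\<^bsub>tensor_prod A B\<^esub> P (u @ x # w)"
      using x uw by (simp add: * g_scale C.smult_mult_left C.smult_mult_right P_closed g_closed)
    then show ?thesis by (simp add: tp_simps(6))
  qed
qed

lemma lift_word: "vs \<in> lists (carrier V) \<Longrightarrow> lift (word V vs) = P vs"
  using P_closed[of vs] tensors_off[of "P vs" A B] by (auto simp: lift_def word_def P_mf)

lemma lift_gen: "v \<in> carrier V \<Longrightarrow> lift (word V [v]) = g v"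
  using lift_word[of "[v]"] C.r_one[OF g_closed] by (simp add: P_def del: tp_simps)

lemma lift_alg_hom: "lift \<in> alg_hom (tensor_algebra V) (tensor_prod A B)"
proof (rule V.alg_hom_TI[OF kalg_tensor_prod])
  note [simp del] = ta_simps(1) tp_simps
  show *: "lift (a \<oplus>\<^bsub>tensor_algebra V\<^esub> b) = lift a \<oplus>\<^bsub>tensor_prod A B\<^esub> lift b"
    "lift (c \<odot>\<^bsub>tensor_algebra V\<^esub> a) = c \<odot>\<^bsub>tensor_prod A B\<^esub> lift a" for a b c
    by (auto simp: lift_def tp_simps)
  show "lift a \<in> carrier (tensor_prod A B)" if "a \<in> carrier (tensor_algebra V)" for a
    using that
  proof (induction rule: V.ta_induct)
    case zero
    have "lift \<zero>\<^bsub>tensor_algebra V\<^esub> = \<zero>\<^bsub>tensor_prod A B\<^esub>" by (auto simp: lift_def tp_simps)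
    then show ?case by simp
  next
    case (add c vs a)
    then show ?case by (simp add: * lift_word P_closed del: ta_simps)
  qed
  show "lift (word V []) = \<one>\<^bsub>tensor_prod A B\<^esub>" by (simp add: lift_word P_def)
qed (simp_all add: lift_word P_append)

end


section \<open>Quotients and subalgebras\<close>

lemma (in kspace) minus_zero_iff: "v \<in> carrier V \<Longrightarrow> w \<in> carrier V \<Longrightarrow> v \<ominus> w = \<zero> \<longleftrightarrow> v = w"
  using r_neg[of w] add.inv_equality[of v "\<ominus> w"] by (auto simp: a_minus_def)

lemma quot_alg_simps:
  "carrier (quot_alg A J) = a_rcosets\<^bsub>A\<^esub> J" "mult (quot_alg A J) = rcoset_mult A J"
  "one (quot_alg A J) = J +>\<^bsub>A\<^esub> \<one>\<^bsub>A\<^esub>" "zero (quot_alg A J) = J" "add (quot_alg A J) = set_add A"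
  "module.smult (quot_alg A J) = (\<lambda>c X. \<Union>x\<in>X. J +>\<^bsub>A\<^esub> (c \<odot>\<^bsub>A\<^esub> x))"
  by (simp_all add: quot_alg_def Let_def FactRing_def)

locale kalg_ideal = kalg A + ideal J A for A :: "('k::field, 'a, 'm) module_scheme" (structure) and J
begin

definition Q :: "('k, 'a set) module" where "Q = quot_alg A J"
abbreviation \<pi> :: "'a \<Rightarrow> 'a set" where "\<pi> a \<equiv> J +> a"

lemma carrier_Q: "carrier Q = \<pi> ` carrier A"
  unfolding Q_def quot_alg_simps A_RCOSETS_def RCOSETS_def a_r_coset_def by auto

lemma pi_in [simp]: "a \<in> carrier A \<Longrightarrow> \<pi> a \<in> carrier Q"
  by (simp add: carrier_Q)

lemma pi_eq_iff: "a \<in> carrier A \<Longrightarrow> b \<in> carrier A \<Longrightarrow> \<pi> a = \<pi> b \<longleftrightarrow> a \<ominus> b \<in> J"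
  using quotient_eq_iff_same_a_r_cos[OF is_ideal] by metis

lemma pi_zero_iff: "a \<in> carrier A \<Longrightarrow> \<pi> a = J \<longleftrightarrow> a \<in> J"
  by (metis a_coset_join1 a_coset_join2 a_subgroup additive_subgroup_def is_additive_subgroup a_rcos_self a_rcos_const)

text \<open>In a unital algebra a ring ideal is a subspace: scaling is multiplication by
  \<open>c \<odot> \<one>\<close>.\<close>

lemma smult_in_ideal: "a \<in> J \<Longrightarrow> c \<odot> a \<in> J"
  using I_l_closed[of a "c \<odot> \<one>"] smult_mult_left[of \<one> a c] a_Hcarr[of a] by simp

text \<open>The quotient scales all representatives and takes the union of their cosets; these
  cosets coincide because \<open>J\<close> is a subspace.\<close>

lemma pi_smult: "a \<in> carrier A \<Longrightarrow> c \<odot>\<^bsub>Q\<^esub> \<pi> a = \<pi> (c \<odot> a)"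
proof -
  assume a: "a \<in> carrier A"
  have "\<pi> (c \<odot> x) = \<pi> (c \<odot> a)" if x: "x \<in> \<pi> a" for x
  proof -
    obtain j where j: "j \<in> J" "x = j \<oplus> a" using x by (auto simp: a_r_coset_def')
    then have jc: "j \<in> carrier A" using a_Hcarr by simp
    have "c \<odot> x \<ominus> c \<odot> a = c \<odot> j"
      using a jc by (simp add: j(2) smult_r_distr a_minus_def a_assoc r_neg)
    then show ?thesis
      using smult_in_ideal[OF j(1)] a jc by (subst pi_eq_iff) (simp_all add: j(2))
  qed
  moreover have "a \<in> \<pi> a" using a by (rule a_rcos_self)
  ultimately show ?thesis unfolding Q_def quot_alg_simps by blast
qed

lemma pi_ops:
  assumes "a \<in> carrier A" "b \<in> carrier A"
  shows "\<pi> a \<oplus>\<^bsub>Q\<^esub> \<pi> b = \<pi> (a \<oplus> b)" "\<pi> a \<otimes>\<^bsub>Q\<^esub> \<pi> b = \<pi> (a \<otimes> b)"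
  using assms by (simp_all add: Q_def quot_alg_simps a_rcos_sum rcoset_mult_add)

lemma pi_one: "\<one>\<^bsub>Q\<^esub> = \<pi> \<one>" and pi_zero: "\<zero>\<^bsub>Q\<^esub> = \<pi> \<zero>"
  by (simp_all add: Q_def quot_alg_simps a_rcos_const)

lemma kalg_Q: "kalg Q"
proof -
  interpret R: ring "A Quot J" by (rule quotient_is_ring)
  have eq: "carrier Q = carrier (A Quot J)" "mult Q = mult (A Quot J)" "one Q = one (A Quot J)"
    "zero Q = zero (A Quot J)" "add Q = add (A Quot J)"
    by (simp_all add: Q_def quot_alg_def Let_def)
  have sm: "c \<odot>\<^bsub>Q\<^esub> X \<in> carrier Q" "0 \<odot>\<^bsub>Q\<^esub> X = \<zero>\<^bsub>Q\<^esub>" "1 \<odot>\<^bsub>Q\<^esub> X = X"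
    "(c + d) \<odot>\<^bsub>Q\<^esub> X = c \<odot>\<^bsub>Q\<^esub> X \<oplus>\<^bsub>Q\<^esub> d \<odot>\<^bsub>Q\<^esub> X"
    "(c * d) \<odot>\<^bsub>Q\<^esub> X = c \<odot>\<^bsub>Q\<^esub> (d \<odot>\<^bsub>Q\<^esub> X)" if "X \<in> carrier Q" for X c d
    using that by (auto simp: carrier_Q pi_smult pi_ops pi_zero smult_one smult_l_distr smult_assoc)
  have sm2: "c \<odot>\<^bsub>Q\<^esub> (X \<oplus>\<^bsub>Q\<^esub> Y) = c \<odot>\<^bsub>Q\<^esub> X \<oplus>\<^bsub>Q\<^esub> c \<odot>\<^bsub>Q\<^esub> Y"
    "(c \<odot>\<^bsub>Q\<^esub> X) \<otimes>\<^bsub>Q\<^esub> Y = c \<odot>\<^bsub>Q\<^esub> (X \<otimes>\<^bsub>Q\<^esub> Y)" "X \<otimes>\<^bsub>Q\<^esub> (c \<odot>\<^bsub>Q\<^esub> Y) = c \<odot>\<^bsub>Q\<^esub> (X \<otimes>\<^bsub>Q\<^esub> Y)"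
    if "X \<in> carrier Q" "Y \<in> carrier Q" for X Y c
    using that by (auto simp: carrier_Q pi_smult pi_ops smult_r_distr smult_mult_left smult_mult_right)
  show ?thesis
    by (intro kalgI kspaceI sm sm2)
      (simp_all add: eq R.a_ac R.m_assoc R.l_distr R.r_distr)
qed

lemma pi_alg_hom: "\<pi> \<in> alg_hom A Q"
  by (rule alg_homI) (simp_all add: pi_ops pi_one pi_smult)

end

lemma alg_hom_Idl_zero:
  assumes "kalg A" "kalg B" "h \<in> alg_hom A B" "S \<subseteq> carrier A"
    and "\<And>s. s \<in> S \<Longrightarrow> h s = \<zero>\<^bsub>B\<^esub>" and "a \<in> Idl\<^bsub>A\<^esub> S"
  shows "h a = \<zero>\<^bsub>B\<^esub>"
proof -
  interpret A: kalg A by fact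
  interpret B: kalg B by fact
  have "h \<in> ring_hom A B" using assms(3) by (simp add: alg_hom_def)
  then interpret ring_hom_ring A B h
    by (intro ring_hom_ringI2) unfold_locales
  have "ideal (a_kernel A B h) A" by (rule kernel_is_ideal)
  moreover have "S \<subseteq> a_kernel A B h"
  proof
    fix s assume "s \<in> S"
    then show "s \<in> a_kernel A B h" using assms(4,5) unfolding a_kernel_def' by blast
  qed
  ultimately have "Idl\<^bsub>A\<^esub> S \<subseteq> a_kernel A B h" by (rule A.genideal_minimal)
  with assms(6) show ?thesis unfolding a_kernel_def' by blast
qed

lemma commutator_ideal_ideal: "kalg A \<Longrightarrow> ideal (commutator_ideal A) A"
proof -
  assume "kalg A" then interpret A: kalg A .
  show ?thesis unfolding commutator_ideal_def by (rule A.genideal_ideal) auto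
qed

lemma commutator_in:
  assumes "kalg A" "a \<in> carrier A" "b \<in> carrier A"
  shows "a \<otimes>\<^bsub>A\<^esub> b \<ominus>\<^bsub>A\<^esub> b \<otimes>\<^bsub>A\<^esub> a \<in> commutator_ideal A"
proof -
  interpret A: kalg A by fact
  show ?thesis unfolding commutator_ideal_def
    by (rule subsetD[OF A.genideal_self]) (use assms in auto)
qed

lemma commutator_ideal_zero:
  assumes "kalg A" "kalg B" "h \<in> alg_hom A B" "a \<in> commutator_ideal A"
    and comm: "\<And>x y. x \<in> carrier A \<Longrightarrow> y \<in> carrier A \<Longrightarrow> h x \<otimes>\<^bsub>B\<^esub> h y = h y \<otimes>\<^bsub>B\<^esub> h x"
  shows "h a = \<zero>\<^bsub>B\<^esub>"
proof -
  interpret A: kalg A by fact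
  interpret B: kalg B by fact
  show ?thesis
  proof (rule alg_hom_Idl_zero[OF assms(1-3) _ _ assms(4)[unfolded commutator_ideal_def]])
    fix s assume "s \<in> {a \<otimes>\<^bsub>A\<^esub> b \<ominus>\<^bsub>A\<^esub> b \<otimes>\<^bsub>A\<^esub> a |a b. a \<in> carrier A \<and> b \<in> carrier A}"
    then obtain a b where ab: "a \<in> carrier A" "b \<in> carrier A" and s: "s = a \<otimes>\<^bsub>A\<^esub> b \<ominus>\<^bsub>A\<^esub> b \<otimes>\<^bsub>A\<^esub> a"
      by blast
    have "h s = h a \<otimes>\<^bsub>B\<^esub> h b \<ominus>\<^bsub>B\<^esub> h b \<otimes>\<^bsub>B\<^esub> h a"
      unfolding s using ab A.alg_hom_minus[OF assms(3) B.kspace_axioms]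
      by (simp add: alg_homD(3)[OF assms(3)])
    then show "h s = \<zero>\<^bsub>B\<^esub>" using comm[OF ab] alg_homD(1)[OF assms(3)] ab
      by (simp add: B.minus_zero_iff)
  qed auto
qed

lemma quot_commutator_comm:
  assumes "kalg A" "X \<in> carrier (quot_alg A (commutator_ideal A))" "Y \<in> carrier (quot_alg A (commutator_ideal A))"
  shows "X \<otimes>\<^bsub>quot_alg A (commutator_ideal A)\<^esub> Y = Y \<otimes>\<^bsub>quot_alg A (commutator_ideal A)\<^esub> X"
proof -
  interpret kalg A by fact
  interpret I: kalg_ideal A "commutator_ideal A"
    by (intro kalg_ideal.intro assms commutator_ideal_ideal)
  obtain a b where "a \<in> carrier A" "b \<in> carrier A" "X = I.\<pi> a" "Y = I.\<pi> b"
    using assms(2,3) I.carrier_Q unfolding I.Q_def by auto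
  then show ?thesis
    using commutator_in[OF assms(1), of a b] by (fold I.Q_def) (simp add: I.pi_ops I.pi_eq_iff)
qed

lemma sum_list_swap:
  "(\<Sum>x\<leftarrow>xs. \<Sum>y\<leftarrow>ys. f x y) = (\<Sum>y\<leftarrow>ys. \<Sum>x\<leftarrow>xs. f x y :: 'a::comm_monoid_add)"
  by (induction xs) (simp_all add: sum_list_addf)

text \<open>Meant for abelianizations: a commutative target of the projected coproduct makes it
  vanish on commutators.\<close>

lemma (in two_algs) tensor_mult_comm:
  assumes "\<And>a c. a \<in> carrier A \<Longrightarrow> c \<in> carrier A \<Longrightarrow> a \<otimes>\<^bsub>A\<^esub> c = c \<otimes>\<^bsub>A\<^esub> a"
    and "\<And>a c. a \<in> carrier B \<Longrightarrow> c \<in> carrier B \<Longrightarrow> a \<otimes>\<^bsub>B\<^esub> c = c \<otimes>\<^bsub>B\<^esub> a"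
    and s: "s \<in> carrier (tensor_prod A B)" and t: "t \<in> carrier (tensor_prod A B)"
  shows "s \<otimes>\<^bsub>tensor_prod A B\<^esub> t = t \<otimes>\<^bsub>tensor_prod A B\<^esub> s"
proof -
  have *: "(tsum A B ps \<otimes>\<^bsub>tensor_prod A B\<^esub> tsum A B qs) \<beta> =
      (\<Sum>(a, b)\<leftarrow>ps. \<Sum>(c, d)\<leftarrow>qs. \<beta> (a \<otimes>\<^bsub>A\<^esub> c) (b \<otimes>\<^bsub>B\<^esub> d))"
    if \<beta>: "\<beta> \<in> bilinear_forms A B" and ps: "set ps \<subseteq> carrier A \<times> carrier B"
      and qs: "set qs \<subseteq> carrier A \<times> carrier B" for ps qs \<beta>
  proof -
    have "(tsum A B ps \<otimes>\<^bsub>tensor_prod A B\<^esub> tsum A B qs) \<beta> =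
        (\<Sum>(a, b)\<leftarrow>ps. tsum A B qs (\<lambda>c d. \<beta> (a \<otimes>\<^bsub>A\<^esub> c) (b \<otimes>\<^bsub>B\<^esub> d)))"
      using tensor_mult_inner[OF tensors_tsumI[OF qs] \<beta>] \<beta> by (simp add: tsum_def[of A B ps])
    also have "\<dots> = (\<Sum>(a, b)\<leftarrow>ps. \<Sum>(c, d)\<leftarrow>qs. \<beta> (a \<otimes>\<^bsub>A\<^esub> c) (b \<otimes>\<^bsub>B\<^esub> d))"
      by (rule tsum_cong[OF ps]) (simp add: tsum_def bil_shift[OF \<beta>])
    finally show ?thesis .
  qed
  obtain ps where ps: "set ps \<subseteq> carrier A \<times> carrier B" "s = tsum A B ps" using s by (auto elim: tensorsE)
  obtain qs where qs: "set qs \<subseteq> carrier A \<times> carrier B" "t = tsum A B qs" using t by (auto elim: tensorsE)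
  show ?thesis
  proof
    fix \<beta> show "(s \<otimes>\<^bsub>tensor_prod A B\<^esub> t) \<beta> = (t \<otimes>\<^bsub>tensor_prod A B\<^esub> s) \<beta>"
    proof (cases "\<beta> \<in> bilinear_forms A B")
      case True
      have "(\<Sum>(a, b)\<leftarrow>ps. \<Sum>(c, d)\<leftarrow>qs. \<beta> (a \<otimes>\<^bsub>A\<^esub> c) (b \<otimes>\<^bsub>B\<^esub> d)) =
          (\<Sum>(a, b)\<leftarrow>ps. \<Sum>(c, d)\<leftarrow>qs. \<beta> (c \<otimes>\<^bsub>A\<^esub> a) (d \<otimes>\<^bsub>B\<^esub> b))"
        by (rule tsum_cong[OF ps(1)], rule tsum_cong[OF qs(1)]) (simp add: assms(1)[of _ _] assms(2)[of _ _])
      also have "\<dots> = (\<Sum>(c, d)\<leftarrow>qs. \<Sum>(a, b)\<leftarrow>ps. \<beta> (c \<otimes>\<^bsub>A\<^esub> a) (d \<otimes>\<^bsub>B\<^esub> b))"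
        unfolding case_prod_unfold by (rule sum_list_swap)
      finally show ?thesis
        unfolding ps(2) qs(2) *[OF True ps(1) qs(1)] *[OF True qs(1) ps(1)] .
    qed simp
  qed
qed


section \<open>Characters and counits\<close>

definition bialg :: "('k::field, 'a) bialgebra \<Rightarrow> bool"
  where "bialg H \<longleftrightarrow> kalg H \<and> coprod H \<in> alg_hom H (tensor_prod H H)"

text \<open>The counit equations at a single element, so that the elements satisfying them can be
  shown to form a subalgebra.\<close>

definition counital :: "('k::field, 'a) bialgebra \<Rightarrow> ('a \<Rightarrow> 'k) \<Rightarrow> 'a \<Rightarrow> bool"
  where "counital H \<epsilon> a \<longleftrightarrow> (\<forall>\<psi>. linear_form H \<psi> \<longrightarrow>
    coprod H a (\<lambda>x y. \<epsilon> x * \<psi> y) = \<psi> a \<and> coprod H a (\<lambda>x y. \<psi> x * \<epsilon> y) = \<psi> a)"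

text \<open>Collects what survives the passage to quotients and abelianizations. Multiplication is
  tested on pairs of points, but the counit against all linear forms, as the description of
  \<open>counit\<close> demands. The monoid laws for characters come from \<open>G\<close>.\<close>

definition points :: "('k::field, 'a) bialgebra \<Rightarrow> ('x, 'r) monoid_scheme \<Rightarrow> ('x \<Rightarrow> 'a \<Rightarrow> 'k) \<Rightarrow> bool"
  where "points H G \<chi> \<longleftrightarrow> bialg H \<and> monoid G \<and> bij_betw \<chi> (carrier G) (characters H) \<and>
    (\<forall>x\<in>carrier G. \<forall>y\<in>carrier G. \<forall>a\<in>carrier H.
      coprod H a (\<lambda>u v. \<chi> x u * \<chi> y v) = \<chi> (x \<otimes>\<^bsub>G\<^esub> y) a) \<and>
    (\<forall>a\<in>carrier H. counital H (\<chi> \<one>\<^bsub>G\<^esub>) a)"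

lemma characters_linear: "\<chi> \<in> characters H \<Longrightarrow> linear_form H \<chi>"
  by (auto simp: characters_def intro: alg_hom_scalars_linear)

text \<open>Uniqueness is the argument for units of a monoid: on a coproduct, the product of
  \<open>\<epsilon>\<close> and \<open>\<epsilon>'\<close> is computed once with each of the two as
  counit.\<close>

lemma counit_eq:
  assumes "\<epsilon> \<in> characters H" "\<And>a. a \<in> carrier H \<Longrightarrow> counital H \<epsilon> a"
  shows "counit H = \<epsilon>"
  unfolding counit_def
proof (rule the_equality)
  show "\<epsilon> \<in> characters H \<and> (\<forall>\<psi> a. linear_form H \<psi> \<longrightarrow> a \<in> carrier H \<longrightarrow>
      coprod H a (\<lambda>x y. \<epsilon> x * \<psi> y) = \<psi> a \<and> coprod H a (\<lambda>x y. \<psi> x * \<epsilon> y) = \<psi> a)"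
    using assms by (auto simp: counital_def)
  fix \<epsilon>' assume \<epsilon>': "\<epsilon>' \<in> characters H \<and> (\<forall>\<psi> a. linear_form H \<psi> \<longrightarrow> a \<in> carrier H \<longrightarrow>
      coprod H a (\<lambda>x y. \<epsilon>' x * \<psi> y) = \<psi> a \<and> coprod H a (\<lambda>x y. \<psi> x * \<epsilon>' y) = \<psi> a)"
  show "\<epsilon>' = \<epsilon>"
  proof (rule extensionalityI)
    show "\<epsilon>' \<in> extensional (carrier H)" "\<epsilon> \<in> extensional (carrier H)"
      using assms \<epsilon>' by (auto simp: characters_def)
    fix a assume a: "a \<in> carrier H"
    have "coprod H a (\<lambda>x y. \<epsilon> x * \<epsilon>' y) = \<epsilon> a" using \<epsilon>' a characters_linear[OF assms(1)] by auto
    moreover have "coprod H a (\<lambda>x y. \<epsilon> x * \<epsilon>' y) = \<epsilon>' a"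
      using assms(2)[OF a] \<epsilon>' characters_linear[of \<epsilon>'] by (auto simp: counital_def)
    ultimately show "\<epsilon>' a = \<epsilon> a" by simp
  qed
qed

text \<open>The structure of \<open>char_monoid H\<close> is transported from \<open>G\<close>.
  Characters are extensional, so it is enough to compare products on the carrier.\<close>

lemma points_iso:
  assumes "points H G \<chi>"
  shows "monoid (char_monoid H)" "\<chi> \<in> iso G (char_monoid H)"
proof -
  interpret G: monoid G using assms by (simp add: points_def)
  have bij: "bij_betw \<chi> (carrier G) (characters H)" using assms by (simp add: points_def)
  have ch: "\<chi> x \<in> characters H" if "x \<in> carrier G" for x using bij_betwE[OF bij] that by blast
  have mult: "\<chi> x \<otimes>\<^bsub>char_monoid H\<^esub> \<chi> y = \<chi> (x \<otimes>\<^bsub>G\<^esub> y)"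
    if xy: "x \<in> carrier G" "y \<in> carrier G" for x y
  proof (rule extensionalityI)
    show "\<chi> x \<otimes>\<^bsub>char_monoid H\<^esub> \<chi> y \<in> extensional (carrier H)" by (simp add: char_monoid_def)
    show "\<chi> (x \<otimes>\<^bsub>G\<^esub> y) \<in> extensional (carrier H)" using ch[of "x \<otimes>\<^bsub>G\<^esub> y"] xy by (simp add: characters_def)
    fix a assume "a \<in> carrier H"
    then show "(\<chi> x \<otimes>\<^bsub>char_monoid H\<^esub> \<chi> y) a = \<chi> (x \<otimes>\<^bsub>G\<^esub> y) a"
      using assms xy by (simp add: char_monoid_def points_def)
  qed
  have one: "\<one>\<^bsub>char_monoid H\<^esub> = \<chi> \<one>\<^bsub>G\<^esub>"
    using assms ch[OF G.one_closed] by (simp add: char_monoid_def points_def counit_eq)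
  have carr: "carrier (char_monoid H) = \<chi> ` carrier G"
    using bij by (simp add: char_monoid_def bij_betw_def)
  show "monoid (char_monoid H)"
    by (rule monoidI) (auto simp: carr one mult G.m_assoc)
  show "\<chi> \<in> iso G (char_monoid H)"
  proof (intro isoI homI)
    show "bij_betw \<chi> (carrier G) (carrier (char_monoid H))" using bij by (simp add: char_monoid_def)
  qed (auto simp: mult carr)
qed

lemma points_group:
  assumes "points H G \<chi>" "group G" shows "group (char_monoid H)"
  using group.iso_imp_group[OF assms(2) is_isoI[OF points_iso(2)[OF assms(1)]] points_iso(1)[OF assms(1)]] .

text \<open>\<open>e\<close> and \<open>e'\<close> are the results of applying
  \<open>\<epsilon>\<close> to one of the tensor factors. Through them the counit equations become
  equations in the algebra, which a separating family can test.\<close>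

lemma contract:
  assumes "kspace A" "t \<in> carrier (tensor_prod A A)" "linear_form A \<epsilon>"
  obtains e e' where "e \<in> carrier A" "\<And>\<psi>. linear_form A \<psi> \<Longrightarrow> t (\<lambda>x y. \<epsilon> x * \<psi> y) = \<psi> e"
    "e' \<in> carrier A" "\<And>\<psi>. linear_form A \<psi> \<Longrightarrow> t (\<lambda>x y. \<psi> x * \<epsilon> y) = \<psi> e'"
proof -
  interpret A: kspace A by fact
  obtain ps where ps: "set ps \<subseteq> carrier A \<times> carrier A" "t = tsum A A ps" using assms(2) by (auto elim: tensorsE)
  define e where "e = A.list_sum (\<lambda>(x, y). \<epsilon> x \<odot>\<^bsub>A\<^esub> y) ps"
  define e' where "e' = A.list_sum (\<lambda>(x, y). \<epsilon> y \<odot>\<^bsub>A\<^esub> x) ps"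
  show thesis
  proof
    show "e \<in> carrier A" "e' \<in> carrier A"
      unfolding e_def e'_def by (rule A.list_sum_closed; use ps in auto)+
    fix \<psi> assume \<psi>: "linear_form A \<psi>"
    have "\<psi> e = (\<Sum>p\<leftarrow>ps. \<psi> (\<epsilon> (fst p) \<odot>\<^bsub>A\<^esub> snd p))" "\<psi> e' = (\<Sum>p\<leftarrow>ps. \<psi> (\<epsilon> (snd p) \<odot>\<^bsub>A\<^esub> fst p))"
      unfolding e_def e'_def using ps(1)
      by (subst A.linear_form_list_sum[OF \<psi>]; auto simp: case_prod_unfold)+
    moreover have "\<psi> (\<epsilon> (fst p) \<odot>\<^bsub>A\<^esub> snd p) = \<epsilon> (fst p) * \<psi> (snd p)"
      "\<psi> (\<epsilon> (snd p) \<odot>\<^bsub>A\<^esub> fst p) = \<psi> (fst p) * \<epsilon> (snd p)" if "p \<in> set ps" for p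
      using ps(1) that linear_formD(2)[OF \<psi>] by (cases p; auto simp: subset_iff)+
    ultimately have "\<psi> e = (\<Sum>p\<leftarrow>ps. \<epsilon> (fst p) * \<psi> (snd p))" "\<psi> e' = (\<Sum>p\<leftarrow>ps. \<psi> (fst p) * \<epsilon> (snd p))"
      by (metis (mono_tags, lifting) map_cong)+
    then show "t (\<lambda>x y. \<epsilon> x * \<psi> y) = \<psi> e" "t (\<lambda>x y. \<psi> x * \<epsilon> y) = \<psi> e'"
      using bil_prod[OF \<psi> assms(3)] bil_prod[OF assms(3) \<psi>]
      by (simp_all add: ps(2) tsum_def case_prod_unfold)
  qed
qed

text \<open>The separating family is applied to the differences between \<open>a\<close> and its two
  contractions.\<close>

lemma counital_separating:
  assumes "kspace H" "coprod H a \<in> carrier (tensor_prod H H)" "linear_form H \<epsilon>" "separating H \<Lambda>"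
    and "a \<in> carrier H"
    and "\<And>\<phi>. \<phi> \<in> \<Lambda> \<Longrightarrow> coprod H a (\<lambda>x y. \<epsilon> x * \<phi> y) = \<phi> a"
    and "\<And>\<phi>. \<phi> \<in> \<Lambda> \<Longrightarrow> coprod H a (\<lambda>x y. \<phi> x * \<epsilon> y) = \<phi> a"
  shows "counital H \<epsilon> a"
proof -
  interpret A: kspace H by fact
  obtain e e' where e: "e \<in> carrier H" "\<And>\<psi>. linear_form H \<psi> \<Longrightarrow> coprod H a (\<lambda>x y. \<epsilon> x * \<psi> y) = \<psi> e"
    "e' \<in> carrier H" "\<And>\<psi>. linear_form H \<psi> \<Longrightarrow> coprod H a (\<lambda>x y. \<psi> x * \<epsilon> y) = \<psi> e'"
    using contract[OF assms(1-3)] by blast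
  have "b = a" if "b \<in> carrier H" "\<And>\<phi>. \<phi> \<in> \<Lambda> \<Longrightarrow> \<phi> b = \<phi> a" for b
  proof -
    have "\<phi> (b \<ominus>\<^bsub>H\<^esub> a) = 0" if "\<phi> \<in> \<Lambda>" for \<phi>
      using assms(4,5) that \<open>b \<in> carrier H\<close> \<open>\<And>\<phi>. \<phi> \<in> \<Lambda> \<Longrightarrow> \<phi> b = \<phi> a\<close>
      by (simp add: separating_def A.linear_form_minus)
    then have "b \<ominus>\<^bsub>H\<^esub> a = \<zero>\<^bsub>H\<^esub>" using assms(4,5) that(1) by (auto simp: separating_def)
    then show ?thesis using A.minus_zero_iff[OF that(1) assms(5)] by simp
  qed
  then have "e = a" "e' = a" using e assms by (auto simp: separating_def)
  then show ?thesis using e by (auto simp: counital_def)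
qed

text \<open>As \<open>\<epsilon>\<close> is multiplicative, the equation for \<open>b\<close> is
  used first, for the forms sending y' to \<open>\<psi>\<close> of the product of y and y', and the
  equation for \<open>a\<close> afterwards, for the form sending y to \<open>\<psi>\<close> of the
  product of y and \<open>b\<close>. These shifted forms are arbitrary linear forms, so the
  hypotheses are used in their full strength.\<close>

lemma counital_mult:
  assumes "bialg H" "\<epsilon> \<in> alg_hom H scalars" "a \<in> carrier H" "b \<in> carrier H"
    and a: "counital H \<epsilon> a" and b: "counital H \<epsilon> b"
  shows "counital H \<epsilon> (a \<otimes>\<^bsub>H\<^esub> b)"
  unfolding counital_def
proof (intro allI impI conjI)
  have "kalg H" and hom: "coprod H \<in> alg_hom H (tensor_prod H H)" using assms(1) by (auto simp: bialg_def)
  then interpret H: kalg H by simp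
  interpret two_algs H H by unfold_locales
  have lin\<epsilon>: "linear_form H \<epsilon>" by (rule alg_hom_scalars_linear[OF assms(2)])
  have ta: "coprod H a \<in> tensors H H (carrier H) (carrier H)"
    and tb: "coprod H b \<in> tensors H H (carrier H) (carrier H)"
    using alg_homD(1)[OF hom] assms(3,4) by auto
  fix \<psi> assume \<psi>: "linear_form H \<psi>"
  have l: "linear_form H (\<lambda>y. \<psi> (x \<otimes>\<^bsub>H\<^esub> y))" and r: "linear_form H (\<lambda>y. \<psi> (y \<otimes>\<^bsub>H\<^esub> x))"
    if "x \<in> carrier H" for x
    using that by (auto simp: linear_form_def linear_formD[OF \<psi>] H.r_distr H.l_distr H.smult_mult_left H.smult_mult_right)
  have bil: "(\<lambda>x y. \<epsilon> x * \<psi> y) \<in> bilinear_forms H H" "(\<lambda>x y. \<psi> x * \<epsilon> y) \<in> bilinear_forms H H"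
    using bil_prod \<psi> lin\<epsilon> by blast+
  have "coprod H (a \<otimes>\<^bsub>H\<^esub> b) (\<lambda>x y. \<epsilon> x * \<psi> y) =
      coprod H a (\<lambda>x y. coprod H b (\<lambda>x' y'. \<epsilon> (x \<otimes>\<^bsub>H\<^esub> x') * \<psi> (y \<otimes>\<^bsub>H\<^esub> y')))"
    using bil by (simp add: alg_homD(3)[OF hom assms(3,4)])
  also have "\<dots> = coprod H a (\<lambda>x y. \<epsilon> x * \<psi> (y \<otimes>\<^bsub>H\<^esub> b))"
  proof (rule tensors_cong[OF ta tensor_mult_inner[OF tb bil(1)] bil_prod[OF lin\<epsilon> r[OF assms(4)]]])
    fix x y assume xy: "x \<in> carrier H" "y \<in> carrier H"
    have "coprod H b (\<lambda>x' y'. \<epsilon> (x \<otimes>\<^bsub>H\<^esub> x') * \<psi> (y \<otimes>\<^bsub>H\<^esub> y')) =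
        coprod H b (\<lambda>x' y'. \<epsilon> x * (\<epsilon> x' * \<psi> (y \<otimes>\<^bsub>H\<^esub> y')))"
      using xy by (intro tensors_cong[OF tb bil_shift[OF bil(1)] bil_scale[OF bil_prod[OF lin\<epsilon> l]]])
        (simp_all add: alg_homD(3)[OF assms(2)])
    also have "\<dots> = \<epsilon> x * \<psi> (y \<otimes>\<^bsub>H\<^esub> b)"
      using b l[OF xy(2)] unfolding counital_def
      by (subst tensors_scale_form[OF tb bil_prod[OF lin\<epsilon> l[OF xy(2)]]]) simp
    finally show "coprod H b (\<lambda>x' y'. \<epsilon> (x \<otimes>\<^bsub>H\<^esub> x') * \<psi> (y \<otimes>\<^bsub>H\<^esub> y')) = \<epsilon> x * \<psi> (y \<otimes>\<^bsub>H\<^esub> b)" .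
  qed
  also have "\<dots> = \<psi> (a \<otimes>\<^bsub>H\<^esub> b)" using a r[OF assms(4)] by (simp add: counital_def)
  finally show "coprod H (a \<otimes>\<^bsub>H\<^esub> b) (\<lambda>x y. \<epsilon> x * \<psi> y) = \<psi> (a \<otimes>\<^bsub>H\<^esub> b)" .
  have "coprod H (a \<otimes>\<^bsub>H\<^esub> b) (\<lambda>x y. \<psi> x * \<epsilon> y) =
      coprod H a (\<lambda>x y. coprod H b (\<lambda>x' y'. \<psi> (x \<otimes>\<^bsub>H\<^esub> x') * \<epsilon> (y \<otimes>\<^bsub>H\<^esub> y')))"
    using bil by (simp add: alg_homD(3)[OF hom assms(3,4)])
  also have "\<dots> = coprod H a (\<lambda>x y. \<psi> (x \<otimes>\<^bsub>H\<^esub> b) * \<epsilon> y)"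
  proof (rule tensors_cong[OF ta tensor_mult_inner[OF tb bil(2)] bil_prod[OF r[OF assms(4)] lin\<epsilon>]])
    fix x y assume xy: "x \<in> carrier H" "y \<in> carrier H"
    have "coprod H b (\<lambda>x' y'. \<psi> (x \<otimes>\<^bsub>H\<^esub> x') * \<epsilon> (y \<otimes>\<^bsub>H\<^esub> y')) =
        coprod H b (\<lambda>x' y'. \<epsilon> y * (\<psi> (x \<otimes>\<^bsub>H\<^esub> x') * \<epsilon> y'))"
      using xy by (intro tensors_cong[OF tb bil_shift[OF bil(2)] bil_scale[OF bil_prod[OF l lin\<epsilon>]]])
        (simp_all add: alg_homD(3)[OF assms(2)])
    also have "\<dots> = \<epsilon> y * \<psi> (x \<otimes>\<^bsub>H\<^esub> b)"
      using b l[OF xy(1)] unfolding counital_def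
      by (subst tensors_scale_form[OF tb bil_prod[OF l[OF xy(1)] lin\<epsilon>]]) simp
    finally show "coprod H b (\<lambda>x' y'. \<psi> (x \<otimes>\<^bsub>H\<^esub> x') * \<epsilon> (y \<otimes>\<^bsub>H\<^esub> y')) = \<psi> (x \<otimes>\<^bsub>H\<^esub> b) * \<epsilon> y"
      by simp
  qed
  also have "\<dots> = \<psi> (a \<otimes>\<^bsub>H\<^esub> b)" using a r[OF assms(4)] by (simp add: counital_def)
  finally show "coprod H (a \<otimes>\<^bsub>H\<^esub> b) (\<lambda>x y. \<psi> x * \<epsilon> y) = \<psi> (a \<otimes>\<^bsub>H\<^esub> b)" .
qed

lemma counital_linear:
  assumes "bialg H" "a \<in> carrier H" "counital H \<epsilon> a"
  shows "counital H \<epsilon> (c \<odot>\<^bsub>H\<^esub> a)"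
    and "b \<in> carrier H \<Longrightarrow> counital H \<epsilon> b \<Longrightarrow> counital H \<epsilon> (a \<oplus>\<^bsub>H\<^esub> b)"
  using assms by (auto simp: counital_def bialg_def alg_homD linear_formD)

lemma counital_one:
  assumes "bialg H" "\<epsilon> \<in> alg_hom H scalars" shows "counital H \<epsilon> \<one>\<^bsub>H\<^esub>"
proof -
  interpret H: kalg H using assms(1) by (simp add: bialg_def)
  have "coprod H \<one>\<^bsub>H\<^esub> = pure_tensor H H \<one>\<^bsub>H\<^esub> \<one>\<^bsub>H\<^esub>" using assms(1) alg_homD(4)[of "coprod H" H "tensor_prod H H"] by (auto simp: bialg_def)
  then show ?thesis
    using bil_prod[OF alg_hom_scalars_linear[OF assms(2)]] bil_prod[OF _ alg_hom_scalars_linear[OF assms(2)]]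
      alg_homD(4)[OF assms(2)]
    by (auto simp: counital_def pure_tensor_def)
qed


section \<open>Quotient bialgebras\<close>

lemma with_coprod_simps [simp]:
  "carrier (with_coprod A \<delta>) = carrier A" "mult (with_coprod A \<delta>) = mult A"
  "one (with_coprod A \<delta>) = one A" "zero (with_coprod A \<delta>) = zero A"
  "add (with_coprod A \<delta>) = add A" "module.smult (with_coprod A \<delta>) = module.smult A"
  "coprod (with_coprod A \<delta>) = \<delta>"
  by (simp_all add: with_coprod_def)

lemma linear_form_with_coprod [simp]: "linear_form (with_coprod A \<delta>) = linear_form A"
  by (simp add: linear_form_def fun_eq_iff)

lemma tensor_prod_with_coprod [simp]:
  "bilinear_forms (with_coprod A \<delta>) (with_coprod B \<delta>') = bilinear_forms A B"
  "tensors (with_coprod A \<delta>) (with_coprod B \<delta>') = tensors A B"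
  "tensor_prod (with_coprod A \<delta>) (with_coprod B \<delta>') = tensor_prod A B"
  by (simp_all add: bilinear_forms_def tensor_prod_def tensors_def pure_tensor_def fun_eq_iff)

lemma alg_hom_with_coprod [simp]:
  "alg_hom (with_coprod A \<delta>) B = alg_hom A B" "alg_hom B (with_coprod A \<delta>) = alg_hom B A"
  by (simp_all add: alg_hom_def ring_hom_def)

lemma kalg_with_coprod [simp]: "kalg (with_coprod A \<delta>) = kalg A"
  by (auto intro: kalg_cong)

text \<open>The coideal condition is expressed by vanishing of the projected coproduct rather than
  by a decomposition of the coproduct of \<open>J\<close>; in this form it can be tested by linear
  forms on the quotient.\<close>

locale bialg_quot = kalg_ideal H J for H :: "('k::field, 'a) bialgebra" (structure) and J +
  assumes bialg: "bialg H"
    and coideal: "\<And>a. a \<in> J \<Longrightarrow> tensor_map Q Q \<pi> \<pi> (coprod H a) = (\<lambda>_. 0)"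
begin

abbreviation \<theta> where "\<theta> a \<equiv> tensor_map Q Q \<pi> \<pi> (coprod H a)"

lemma theta_alg_hom: "\<theta> \<in> alg_hom H (tensor_prod Q Q)"
  using bialg by (intro alg_hom_comp[OF _ tensor_map_alg_hom[OF _ _ kalg_Q kalg_Q pi_alg_hom pi_alg_hom]])
    (auto simp: bialg_def)

lemma theta_cong:
  assumes "a \<in> carrier H" "b \<in> carrier H" "\<pi> a = \<pi> b" shows "\<theta> a = \<theta> b"
proof -
  interpret QQ: kalg "tensor_prod Q Q"
    by (intro two_algs.kalg_tensor_prod two_algs.intro kalg_Q)
  have "\<theta> (a \<ominus> b) = \<zero>\<^bsub>tensor_prod Q Q\<^esub>" using coideal[of "a \<ominus> b"] assms by (simp add: pi_eq_iff)
  then have "\<theta> a \<ominus>\<^bsub>tensor_prod Q Q\<^esub> \<theta> b = \<zero>\<^bsub>tensor_prod Q Q\<^esub>"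
    using alg_hom_minus[OF theta_alg_hom QQ.kspace_axioms] assms by simp
  then show ?thesis
    using assms alg_homD(1)[OF theta_alg_hom] QQ.minus_zero_iff by blast
qed

definition delta :: "'a set \<Rightarrow> ('k, 'a set, 'a set) tensor"
  where "delta = (\<lambda>X\<in>carrier Q. \<theta> (SOME a. a \<in> carrier H \<and> \<pi> a = X))"

lemma delta_pi: "a \<in> carrier H \<Longrightarrow> delta (\<pi> a) = \<theta> a"
proof -
  assume a: "a \<in> carrier H"
  then have "\<exists>b. b \<in> carrier H \<and> \<pi> b = \<pi> a" by blast
  from someI_ex[OF this] show ?thesis using a by (auto simp: delta_def intro: theta_cong)
qed

text \<open>Every coset has a representative, so the defining equation fixes the coproduct on the
  carrier, and extensionality fixes it elsewhere.\<close>

lemma quot_bialgebra_eq: "quot_bialgebra H J = with_coprod Q delta"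
proof -
  have "(THE \<delta>. \<delta> \<in> extensional (carrier Q) \<and> (\<forall>a\<in>carrier H. \<delta> (\<pi> a) = \<theta> a)) = delta"
  proof (rule the_equality)
    show "delta \<in> extensional (carrier Q) \<and> (\<forall>a\<in>carrier H. delta (\<pi> a) = \<theta> a)"
      by (simp add: delta_pi) (simp add: delta_def)
    fix \<delta> assume \<delta>: "\<delta> \<in> extensional (carrier Q) \<and> (\<forall>a\<in>carrier H. \<delta> (\<pi> a) = \<theta> a)"
    show "\<delta> = delta"
      by (rule extensionalityI[of _ "carrier Q"])
        (use \<delta> in \<open>auto simp: delta_pi carrier_Q\<close>, simp add: delta_def carrier_Q)
  qed
  then show ?thesis by (simp add: quot_bialgebra_def Q_def[symmetric] Let_def)
qed

abbreviation QB where "QB \<equiv> quot_bialgebra H J"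

lemma QB_simps [simp]:
  "carrier QB = carrier Q" "mult QB = mult Q" "one QB = one Q" "zero QB = zero Q" "add QB = add Q"
  "module.smult QB = module.smult Q" "alg_hom QB B = alg_hom Q B" "linear_form QB = linear_form Q"
  by (simp_all add: quot_bialgebra_eq)

lemma pi_QB: "\<pi> \<in> alg_hom H QB"
  using pi_alg_hom by (simp add: quot_bialgebra_eq)

lemma coprod_QB:
  assumes "a \<in> carrier H" "linear_form Q \<phi>" "linear_form Q \<psi>"
  shows "coprod QB (\<pi> a) (\<lambda>x y. \<phi> x * \<psi> y) = coprod H a (\<lambda>x y. \<phi> (\<pi> x) * \<psi> (\<pi> y))"
  using bil_prod[OF assms(2,3)] by (simp add: quot_bialgebra_eq delta_pi assms(1) tensor_map_def)

lemma bialg_QB: "bialg QB"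
proof -
  have "delta \<in> alg_hom Q (tensor_prod Q Q)"
  proof (rule alg_homI)
    show "delta \<one>\<^bsub>Q\<^esub> = \<one>\<^bsub>tensor_prod Q Q\<^esub>"
      using alg_homD(4)[OF theta_alg_hom] by (simp add: pi_one delta_pi)
    fix X Y assume "X \<in> carrier Q" "Y \<in> carrier Q"
    then obtain a b where "a \<in> carrier H" "b \<in> carrier H" "X = \<pi> a" "Y = \<pi> b" by (auto simp: carrier_Q)
    then show "delta X \<in> carrier (tensor_prod Q Q)"
      "delta (X \<oplus>\<^bsub>Q\<^esub> Y) = delta X \<oplus>\<^bsub>tensor_prod Q Q\<^esub> delta Y"
      "delta (X \<otimes>\<^bsub>Q\<^esub> Y) = delta X \<otimes>\<^bsub>tensor_prod Q Q\<^esub> delta Y"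
      "delta (c \<odot>\<^bsub>Q\<^esub> X) = c \<odot>\<^bsub>tensor_prod Q Q\<^esub> delta X" for c
      using alg_homD[OF theta_alg_hom] by (simp_all add: pi_ops pi_smult delta_pi del: tp_simps)
  qed
  then show ?thesis by (simp add: bialg_def quot_bialgebra_eq kalg_Q)
qed

text \<open>A character of the quotient is a character of \<open>H\<close> that kills
  \<open>J\<close>. The map \<open>h\<close> names these characters by another monoid
  \<open>G'\<close>, since for the unit ideal they are the points I + y, and y is the name.\<close>

lemma points_quot:
  assumes pts: "points H G \<chi>" and G': "monoid G'" and h: "h \<in> hom G' G" "inj_on h (carrier G')"
    and one: "h \<one>\<^bsub>G'\<^esub> = \<one>\<^bsub>G\<^esub>"
    and im: "\<And>x. x \<in> carrier G \<Longrightarrow> (\<forall>a\<in>J. \<chi> x a = 0) \<longleftrightarrow> x \<in> h ` carrier G'"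
  shows "\<exists>\<chi>'. points QB G' \<chi>' \<and> (\<forall>x\<in>carrier G'. \<forall>a\<in>carrier H. \<chi>' x (\<pi> a) = \<chi> (h x) a)"
proof -
  interpret G: monoid G using pts by (simp add: points_def)
  interpret G': monoid G' by fact
  have bij: "bij_betw \<chi> (carrier G) (characters H)" using pts by (simp add: points_def)
  have hG: "h x \<in> carrier G" if "x \<in> carrier G'" for x using h(1) that by (auto simp: hom_def)
  have ch: "\<chi> x \<in> characters H" if "x \<in> carrier G" for x using bij_betwE[OF bij] that by blast
  have alg: "\<chi> x \<in> alg_hom H scalars" if "x \<in> carrier G" for x using ch[OF that] by (simp add: characters_def)
  \<comment> \<open>The choice of representative is harmless because the point \<open>h x\<close>
    kills \<open>J\<close>.\<close>
  define \<chi>' where "\<chi>' x = (\<lambda>X\<in>carrier Q. \<chi> (h x) (SOME a. a \<in> carrier H \<and> \<pi> a = X))" for x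
  have pi: "\<chi>' x (\<pi> a) = \<chi> (h x) a" if x: "x \<in> carrier G'" and a: "a \<in> carrier H" for x a
  proof -
    define b where "b = (SOME b. b \<in> carrier H \<and> \<pi> b = \<pi> a)"
    have "\<exists>b. b \<in> carrier H \<and> \<pi> b = \<pi> a" using a by blast
    from someI_ex[OF this] have b: "b \<in> carrier H" "\<pi> b = \<pi> a" unfolding b_def by auto
    have "\<chi> (h x) (b \<ominus> a) = 0" using im[OF hG[OF x]] x b a by (auto simp: pi_eq_iff)
    then have "\<chi> (h x) b = \<chi> (h x) a"
      using linear_form_minus[OF characters_linear[OF ch[OF hG[OF x]]] b(1) a] by simp
    then show ?thesis using a by (simp add: \<chi>'_def b_def)
  qed
  have ch': "\<chi>' x \<in> characters QB" if x: "x \<in> carrier G'" for x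
  proof -
    have "\<chi>' x \<in> alg_hom Q scalars"
    proof (rule alg_homI)
      show "\<chi>' x \<one>\<^bsub>Q\<^esub> = \<one>\<^bsub>scalars\<^esub>"
        using alg_homD(4)[OF alg[OF hG[OF x]]] by (simp add: pi_one pi x)
      fix X Y assume "X \<in> carrier Q" "Y \<in> carrier Q"
      then obtain a b where "a \<in> carrier H" "b \<in> carrier H" "X = \<pi> a" "Y = \<pi> b" by (auto simp: carrier_Q)
      then show "\<chi>' x (X \<oplus>\<^bsub>Q\<^esub> Y) = \<chi>' x X \<oplus>\<^bsub>scalars\<^esub> \<chi>' x Y"
        "\<chi>' x (X \<otimes>\<^bsub>Q\<^esub> Y) = \<chi>' x X \<otimes>\<^bsub>scalars\<^esub> \<chi>' x Y"
        "\<chi>' x (c \<odot>\<^bsub>Q\<^esub> X) = c \<odot>\<^bsub>scalars\<^esub> \<chi>' x X" for c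
        using alg_homD[OF alg[OF hG[OF x]]] by (simp_all add: pi_ops pi_smult pi x)
    qed simp
    then show ?thesis by (simp add: characters_def \<chi>'_def)
  qed
  have lin': "linear_form Q (\<chi>' x)" if "x \<in> carrier G'" for x
    using characters_linear[OF ch'[OF that]] by simp
  have tens: "coprod H a \<in> tensors H H (carrier H) (carrier H)" if "a \<in> carrier H" for a
    using bialg that alg_homD(1)[of "coprod H" H "tensor_prod H H"] by (auto simp: bialg_def)
  have linpi: "linear_form H (\<lambda>a. \<psi> (\<pi> a))" if "linear_form Q \<psi>" for \<psi>
    by (rule linear_form_comp[OF that pi_alg_hom])
  have linh: "linear_form H (\<chi> (h x))" if "x \<in> carrier G'" for x
    using characters_linear[OF ch[OF hG[OF that]]] .
  show ?thesis
  proof (intro exI[of _ \<chi>'] conjI ballI)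
    show "points QB G' \<chi>'"
      unfolding points_def
    proof (intro conjI ballI bialg_QB G')
      show "bij_betw \<chi>' (carrier G') (characters QB)"
      proof (rule bij_betw_imageI)
        show "inj_on \<chi>' (carrier G')"
        proof (rule inj_onI)
          fix x y assume xy: "x \<in> carrier G'" "y \<in> carrier G'" and eq: "\<chi>' x = \<chi>' y"
          have "\<chi> (h x) = \<chi> (h y)"
            by (rule extensionalityI[of _ "carrier H"])
              (use ch[OF hG[OF xy(1)]] ch[OF hG[OF xy(2)]] pi[OF xy(1)] pi[OF xy(2)] eq
                in \<open>auto simp: characters_def\<close>)
          then have "h x = h y" using bij hG xy by (auto simp: bij_betw_def inj_on_def)
          then show "x = y" using h(2) xy by (auto simp: inj_on_def)
        qed
        show "\<chi>' ` carrier G' = characters QB"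
        proof
          show "\<chi>' ` carrier G' \<subseteq> characters QB" using ch' by blast
          show "characters QB \<subseteq> \<chi>' ` carrier G'"
          proof
            fix \<xi> assume \<xi>: "\<xi> \<in> characters QB"
            then have \<xi>': "\<xi> \<in> alg_hom Q scalars" "\<xi> \<in> extensional (carrier Q)" by (auto simp: characters_def)
            have "(\<lambda>a\<in>carrier H. \<xi> (\<pi> a)) \<in> alg_hom H scalars"
              by (rule alg_homI) (simp_all add: alg_homD[OF alg_hom_comp[OF pi_alg_hom \<xi>'(1)]])
            then have "(\<lambda>a\<in>carrier H. \<xi> (\<pi> a)) \<in> characters H" by (simp add: characters_def)
            then obtain z where z: "z \<in> carrier G" "\<chi> z = (\<lambda>a\<in>carrier H. \<xi> (\<pi> a))"
              using bij by (metis (no_types, lifting) bij_betw_def image_iff)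
            have "\<chi> z a = 0" if "a \<in> J" for a
            proof -
              have "\<pi> a = \<zero>\<^bsub>Q\<^esub>" using that by (simp add: Q_def quot_alg_simps a_rcos_const)
              then show ?thesis
                using that a_Hcarr[OF that] kspace.linear_form_at_zero[of Q \<xi>] kalg_Q alg_hom_scalars_linear[OF \<xi>'(1)]
                by (simp add: z(2) kalg_def)
            qed
            then obtain x where x: "x \<in> carrier G'" "z = h x" using im[OF z(1)] by blast
            have "\<chi>' x = \<xi>"
              by (rule extensionalityI[of _ "carrier Q"])
                (use \<xi>' x z pi in \<open>auto simp: carrier_Q\<close>, simp add: \<chi>'_def carrier_Q)
            then show "\<xi> \<in> \<chi>' ` carrier G'" using x by blast
          qed
        qed
      qed
    next
      fix x y X assume xy: "x \<in> carrier G'" "y \<in> carrier G'" and "X \<in> carrier QB"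
      then obtain a where a: "a \<in> carrier H" "X = \<pi> a" by (auto simp: carrier_Q)
      have "coprod QB X (\<lambda>u v. \<chi>' x u * \<chi>' y v) = coprod H a (\<lambda>u v. \<chi>' x (\<pi> u) * \<chi>' y (\<pi> v))"
        unfolding a(2) by (rule coprod_QB[OF a(1) lin' lin']) (use xy in auto)
      also have "\<dots> = coprod H a (\<lambda>u v. \<chi> (h x) u * \<chi> (h y) v)"
        by (rule tensors_cong[OF tens[OF a(1)] bil_prod[OF linpi linpi] bil_prod[OF linh linh]])
          (use xy lin' in \<open>auto simp: pi\<close>)
      also have "\<dots> = \<chi> (h (x \<otimes>\<^bsub>G'\<^esub> y)) a"
        using pts xy a hG h(1) by (simp add: points_def hom_mult)
      also have "\<dots> = \<chi>' (x \<otimes>\<^bsub>G'\<^esub> y) X" using xy a by (simp add: pi)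
      finally show "coprod QB X (\<lambda>u v. \<chi>' x u * \<chi>' y v) = \<chi>' (x \<otimes>\<^bsub>G'\<^esub> y) X" .
    next
      fix X assume "X \<in> carrier QB"
      then obtain a where a: "a \<in> carrier H" "X = \<pi> a" by (auto simp: carrier_Q)
      show "counital QB (\<chi>' \<one>\<^bsub>G'\<^esub>) X"
        unfolding counital_def
      proof (intro allI impI)
        fix \<psi> assume "linear_form QB \<psi>"
        then have \<psi>: "linear_form Q \<psi>" by simp
        have *: "linear_form Q (\<chi>' \<one>\<^bsub>G'\<^esub>)" by (rule lin') simp
        have "coprod QB X (\<lambda>x y. \<chi>' \<one>\<^bsub>G'\<^esub> x * \<psi> y) = coprod H a (\<lambda>x y. \<chi> \<one>\<^bsub>G\<^esub> x * \<psi> (\<pi> y))"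
          unfolding a(2) coprod_QB[OF a(1) * \<psi>]
          by (rule tensors_cong[OF tens[OF a(1)] bil_prod[OF linpi[OF *] linpi[OF \<psi>]]
              bil_prod[OF linh[OF G'.one_closed, unfolded one] linpi[OF \<psi>]]]) (simp add: pi one)
        moreover have "coprod QB X (\<lambda>x y. \<psi> x * \<chi>' \<one>\<^bsub>G'\<^esub> y) = coprod H a (\<lambda>x y. \<psi> (\<pi> x) * \<chi> \<one>\<^bsub>G\<^esub> y)"
          unfolding a(2) coprod_QB[OF a(1) \<psi> *]
          by (rule tensors_cong[OF tens[OF a(1)] bil_prod[OF linpi[OF \<psi>] linpi[OF *]]
              bil_prod[OF linpi[OF \<psi>] linh[OF G'.one_closed, unfolded one]]]) (simp add: pi one)
        ultimately show "coprod QB X (\<lambda>x y. \<chi>' \<one>\<^bsub>G'\<^esub> x * \<psi> y) = \<psi> X \<and>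
            coprod QB X (\<lambda>x y. \<psi> x * \<chi>' \<one>\<^bsub>G'\<^esub> y) = \<psi> X"
          using pts a linpi[OF \<psi>] by (simp add: points_def counital_def)
      qed
    qed
  qed (rule pi)
qed

end

text \<open>The quotient is commutative, hence so is its tensor square, and an algebra morphism into
  a commutative algebra kills commutators.\<close>

lemma bialg_quot_abelianization:
  assumes "bialg H" shows "bialg_quot H (commutator_ideal H)"
proof -
  interpret kalg H using assms by (simp add: bialg_def)
  interpret kalg_ideal H "commutator_ideal H"
    by (intro kalg_ideal.intro commutator_ideal_ideal kalg_axioms)
  interpret QQ: two_algs Q Q by (intro two_algs.intro kalg_Q)
  have hom: "(\<lambda>a. tensor_map Q Q \<pi> \<pi> (coprod H a)) \<in> alg_hom H (tensor_prod Q Q)"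
    using assms by (intro alg_hom_comp[OF _ tensor_map_alg_hom[OF _ _ kalg_Q kalg_Q pi_alg_hom pi_alg_hom]])
      (auto simp: bialg_def)
  have "tensor_map Q Q \<pi> \<pi> (coprod H a) = \<zero>\<^bsub>tensor_prod Q Q\<^esub>" if "a \<in> commutator_ideal H" for a
    by (rule commutator_ideal_zero[OF kalg_axioms QQ.kalg_tensor_prod hom that])
      (intro QQ.tensor_mult_comm alg_homD(1)[OF hom]; simp add: Q_def quot_commutator_comm[OF kalg_axioms])
  then show ?thesis by unfold_locales (auto simp: assms)
qed

text \<open>All characters kill commutators, as the field is commutative; so no point is lost and
  \<open>h\<close> is the identity.\<close>

lemma points_abelianization:
  assumes pts: "points H G \<chi>"
  shows "\<exists>\<chi>'. points (abelianization H) G \<chi>' \<and>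
    (\<forall>x\<in>carrier G. \<forall>a\<in>carrier H. \<chi>' x (ab_class H a) = \<chi> x a)"
proof -
  have b: "bialg H" using pts by (simp add: points_def)
  interpret bialg_quot H "commutator_ideal H" by (rule bialg_quot_abelianization[OF b])
  interpret G: monoid G using pts by (simp add: points_def)
  have "\<chi> x a = \<zero>\<^bsub>scalars\<^esub>" if "x \<in> carrier G" "a \<in> commutator_ideal H" for x a
  proof (rule commutator_ideal_zero[OF kalg_axioms kalg_scalars _ that(2)])
    show "\<chi> x \<in> alg_hom H scalars" using pts that(1) by (auto simp: points_def bij_betw_def characters_def)
  qed simp
  then have "\<exists>\<chi>'. points QB G \<chi>' \<and> (\<forall>x\<in>carrier G. \<forall>a\<in>carrier H. \<chi>' x (\<pi> a) = \<chi> x a)"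
    by (intro points_quot[OF pts G.monoid_axioms, where h = "\<lambda>x. x"]) (auto simp: hom_def)
  then show ?thesis by (simp add: abelianization_def ab_class_def)
qed


section \<open>Compositions in an operad\<close>

lemma finite_lists_sum: "finite {ms. length ms = n \<and> sum_list ms = (N::nat)}"
  by (rule finite_subset[OF _ finite_lists_length_eq[of "{..N}" n]])
    (auto dest: member_le_sum_list)

text \<open>Compositions of \<open>N\<close> in the combinatorial sense, of any length. Parts equal
  to 0 are excluded: they contribute nothing, since families vanish in arity 0, and with them the
  set would be infinite.\<close>

definition comps :: "nat \<Rightarrow> nat list set"
  where "comps N = {ms. 0 \<notin> set ms \<and> sum_list ms = N}"

lemma length_le_sum_list: "0 \<notin> set ms \<Longrightarrow> length ms \<le> sum_list (ms :: nat list)"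
  by (induction ms) auto

lemma comps_length: "ms \<in> comps N \<Longrightarrow> length ms \<le> N"
  using length_le_sum_list by (auto simp: comps_def)

lemma finite_comps [simp]: "finite (comps N)"
proof (rule finite_subset)
  show "comps N \<subseteq> (\<Union>n\<le>N. {ms. length ms = n \<and> sum_list ms = N})"
    using comps_length by (auto simp: comps_def)
  show "finite (\<Union>n\<le>N. {ms. length ms = n \<and> sum_list ms = N})"
    by (intro finite_UN_I finite_lists_sum) auto
qed

lemma comps_0: "comps 0 = {[]}"
  by (auto simp: comps_def) (metis list.set_intros(1) neq_Nil_conv)

lemma sum_set_Cons:
  "(\<Sum>z\<in>set_Cons A X. g z) = (\<Sum>a\<in>A. \<Sum>xs\<in>X. g (a # xs) :: 'b::comm_monoid_add)"
proof -
  have "set_Cons A X = (\<lambda>(a, xs). a # xs) ` (A \<times> X)" by (auto simp: set_Cons_def)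
  moreover have "inj_on (\<lambda>(a, xs). a # xs) (A \<times> X)" by (auto simp: inj_on_def)
  ultimately show ?thesis
    by (simp add: sum.reindex sum.cartesian_product o_def case_prod_unfold)
qed

lemma completionD: "x \<in> completion V \<Longrightarrow> x n \<in> V n"
  by (simp add: completion_def)

locale reduced_operad = operad \<P> for \<P> :: "('k::field, 'a::ab_group_add) operad_data" +
  assumes ops_0: "ops \<P> 0 = {0}"
begin

sublocale V: vector_space "scal \<P>" by (rule vs)

abbreviation "fams \<equiv> completion (ops \<P>)"

lemma ops_closed [simp]:
  "0 \<in> ops \<P> n" "p \<in> ops \<P> n \<Longrightarrow> q \<in> ops \<P> n \<Longrightarrow> p + q \<in> ops \<P> n"
  "p \<in> ops \<P> n \<Longrightarrow> scal \<P> c p \<in> ops \<P> n" "p \<in> ops \<P> n \<Longrightarrow> - p \<in> ops \<P> n"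
  "p \<in> ops \<P> n \<Longrightarrow> q \<in> ops \<P> n \<Longrightarrow> p - q \<in> ops \<P> n"
  using ops_subspace[of n] V.subspace_0 V.subspace_add V.subspace_scale V.subspace_neg V.subspace_diff
  by blast+

lemma ops_sum: "(\<And>i. i \<in> I \<Longrightarrow> f i \<in> ops \<P> n) \<Longrightarrow> sum f I \<in> ops \<P> n"
  by (rule V.subspace_sum[OF ops_subspace])

lemma in_tagged [simp]: "(m, q) \<in> tagged \<P> \<longleftrightarrow> q \<in> ops \<P> m"
  by (simp add: tagged_def)

lemma fams_0: "x \<in> fams \<Longrightarrow> x 0 = 0"
  using ops_0 completionD by fastforce

lemma fams_add: "x \<in> fams \<Longrightarrow> y \<in> fams \<Longrightarrow> x + y \<in> fams"
  and fams_diff: "x \<in> fams \<Longrightarrow> y \<in> fams \<Longrightarrow> x - y \<in> fams"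
  and fams_scale: "x \<in> fams \<Longrightarrow> (\<lambda>n. scal \<P> c (x n)) \<in> fams"
  and fams_zero: "0 \<in> fams"
  by (auto simp: completion_def)

lemma fams_sum: "(\<And>i. i \<in> I \<Longrightarrow> f i \<in> fams) \<Longrightarrow> (\<lambda>n. \<Sum>i\<in>I. f i n) \<in> fams"
  by (auto simp: completion_def intro: ops_sum)

lemma unit_fam_in: "unit_fam \<P> \<in> fams"
  using unt_closed by (auto simp: completion_def unit_fam_def)

lemma comp_zero_left: "set xs \<subseteq> tagged \<P> \<Longrightarrow> comp \<P> 0 xs = 0"
  using comp_add_left[of 0 xs 0] by simp

lemma comp_zero_right:
  assumes "p \<in> ops \<P> (length xs)" "set xs \<subseteq> tagged \<P>" "(m, 0) \<in> set xs"
  shows "comp \<P> p xs = 0"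
proof -
  obtain us ws where xs: "xs = us @ (m, 0) # ws" using split_list[OF assms(3)] by blast
  show ?thesis using comp_add_right[of p us m 0 ws 0] assms(1,2) by (simp add: xs)
qed

lemma comp_sum_left:
  "(\<And>i. i \<in> I \<Longrightarrow> f i \<in> ops \<P> (length xs)) \<Longrightarrow> set xs \<subseteq> tagged \<P> \<Longrightarrow>
    comp \<P> (sum f I) xs = (\<Sum>i\<in>I. comp \<P> (f i) xs)"
  by (induction I rule: infinite_finite_induct)
    (simp_all add: comp_zero_left comp_add_left ops_sum)

lemma comp_sum_right:
  assumes "p \<in> ops \<P> (length us + Suc (length ws))" "set us \<subseteq> tagged \<P>" "set ws \<subseteq> tagged \<P>"
  shows "(\<And>i. i \<in> I \<Longrightarrow> f i \<in> ops \<P> m) \<Longrightarrow>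
    comp \<P> p (us @ (m, sum f I) # ws) = (\<Sum>i\<in>I. comp \<P> p (us @ (m, f i) # ws))"
proof (induction I rule: infinite_finite_induct)
  case (insert i I)
  then show ?case using assms by (simp add: comp_add_right ops_sum)
qed (use assms comp_zero_right[of p "us @ (m, 0) # ws" m] in simp_all)

text \<open>Full multilinear expansion, one input at a time; \<open>us\<close> holds the inputs that
  have already been reduced to single summands.\<close>

lemma comp_sum_all:
  assumes "\<And>M. M \<in> set Ms \<Longrightarrow> finite (A M)"
    and "\<And>M l. M \<in> set Ms \<Longrightarrow> l \<in> A M \<Longrightarrow> f l \<in> ops \<P> M"
    and "p \<in> ops \<P> (length us + length Ms)" and "set us \<subseteq> tagged \<P>"
  shows "comp \<P> p (us @ map (\<lambda>M. (M, \<Sum>l\<in>A M. f l)) Ms) =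
    (\<Sum>ls\<in>listset (map A Ms). comp \<P> p (us @ map (\<lambda>(M, l). (M, f l)) (zip Ms ls)))"
  using assms
proof (induction Ms arbitrary: us)
  case (Cons M Ms)
  have "comp \<P> p (us @ (M, \<Sum>l\<in>A M. f l) # map (\<lambda>M. (M, \<Sum>l\<in>A M. f l)) Ms) =
      (\<Sum>l\<in>A M. comp \<P> p (us @ (M, f l) # map (\<lambda>M. (M, \<Sum>l\<in>A M. f l)) Ms))"
    using Cons.prems by (intro comp_sum_right) (auto intro!: ops_sum)
  also have "\<dots> = (\<Sum>l\<in>A M. \<Sum>ls\<in>listset (map A Ms).
      comp \<P> p ((us @ [(M, f l)]) @ map (\<lambda>(M, l). (M, f l)) (zip Ms ls)))"
    using Cons.IH[of "us @ [(M, f l)]" for l] Cons.prems by (intro sum.cong) auto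
  finally show ?case by (simp add: sum_set_Cons)
qed simp


subsection \<open>Multilinearity of the composition of families\<close>

definition comp_term :: "'a fam \<Rightarrow> nat list \<Rightarrow> 'a fam list \<Rightarrow> 'a"
  where "comp_term x ms ys = comp \<P> (x (length ys)) (map (\<lambda>(m, y). (m, y m)) (zip ms ys))"

lemma fam_comp_eq: "fam_comp \<P> x ys N = (\<Sum>ms | length ms = length ys \<and> sum_list ms = N. comp_term x ms ys)"
  by (simp add: fam_comp_def comp_term_def)

lemma tagged_zip: "set ys \<subseteq> fams \<Longrightarrow> set (map (\<lambda>(m, y). (m, y m)) (zip ms ys)) \<subseteq> tagged \<P>"
  by (auto dest!: set_zip_rightD completionD[OF subsetD])

lemma comp_term_closed:
  "x \<in> fams \<Longrightarrow> set ys \<subseteq> fams \<Longrightarrow> length ms = length ys \<Longrightarrow> comp_term x ms ys \<in> ops \<P> (sum_list ms)"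
  using comp_closed[of "x (length ys)" "map (\<lambda>(m, y). (m, y m)) (zip ms ys)"]
    tagged_zip[of ys ms] completionD[of x]
  by (simp add: comp_term_def o_def case_prod_unfold)

lemma comp_term_zero:
  assumes "x \<in> fams" "set ys \<subseteq> fams" "length ms = length ys" "0 \<in> set ms"
  shows "comp_term x ms ys = 0"
proof -
  obtain i where i: "i < length ms" "ms ! i = 0" using assms(4) by (auto simp: in_set_conv_nth)
  have "(0, (ys ! i) 0) \<in> set (map (\<lambda>(m, y). (m, y m)) (zip ms ys))"
    using i assms(3) by (auto simp: in_set_conv_nth intro!: image_eqI[of _ _ "(0, ys ! i)"] exI[of _ i])
  moreover have "(ys ! i) 0 = 0" using assms i by (intro fams_0) auto
  ultimately show ?thesis
    using assms tagged_zip[of ys ms] completionD[of x] unfolding comp_term_def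
    by (intro comp_zero_right) auto
qed

lemma fam_comp_closed: "x \<in> fams \<Longrightarrow> set ys \<subseteq> fams \<Longrightarrow> fam_comp \<P> x ys \<in> fams"
  using comp_term_closed by (fastforce simp: completion_def[of "ops \<P>"] fam_comp_eq intro!: ops_sum)

lemma fam_comp_add_left: "x \<in> fams \<Longrightarrow> x' \<in> fams \<Longrightarrow> set ys \<subseteq> fams \<Longrightarrow>
    fam_comp \<P> (x + x') ys = fam_comp \<P> x ys + fam_comp \<P> x' ys"
  and fam_comp_scale_left: "x \<in> fams \<Longrightarrow> set ys \<subseteq> fams \<Longrightarrow>
    fam_comp \<P> (\<lambda>n. scal \<P> c (x n)) ys = (\<lambda>n. scal \<P> c (fam_comp \<P> x ys n))"
proof -
  assume x: "x \<in> fams" and ys: "set ys \<subseteq> fams"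
  show "fam_comp \<P> (\<lambda>n. scal \<P> c (x n)) ys = (\<lambda>n. scal \<P> c (fam_comp \<P> x ys n))"
    unfolding fam_comp_eq comp_term_def V.scale_sum_right
    by (intro ext sum.cong refl comp_scale_left tagged_zip ys) (simp add: completionD[OF x])
  assume x': "x' \<in> fams"
  show "fam_comp \<P> (x + x') ys = fam_comp \<P> x ys + fam_comp \<P> x' ys"
    unfolding fam_comp_eq comp_term_def plus_fun_def sum.distrib[symmetric]
    by (intro ext sum.cong refl comp_add_left tagged_zip ys) (simp_all add: completionD[OF x] completionD[OF x'])
qed

text \<open>The splitting of \<open>ms\<close> does not depend on the family in the distinguished
  slot, so linearity of the operadic composition in one input becomes applicable.\<close>

lemma comp_term_split:
  assumes "length ms = length (u @ v # w)"
  obtains a m b where "\<And>v. comp_term x ms (u @ v # w) = comp \<P> (x (Suc (length u + length w)))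
      (map (\<lambda>(m, y). (m, y m)) (zip a u) @ (m, v m) # map (\<lambda>(m, y). (m, y m)) (zip b w))"
    "length a = length u" "length b = length w"
proof -
  define a m b where "a = take (length u) ms" and "m = ms ! length u" and "b = drop (Suc (length u)) ms"
  have "ms = a @ m # b" using assms by (simp add: a_def m_def b_def id_take_nth_drop)
  moreover have "length a = length u" "length b = length w" using assms by (simp_all add: a_def b_def)
  ultimately show thesis by (intro that[of a m b]) (simp_all add: comp_term_def)
qed

lemma comp_term_linear:
  assumes "x \<in> fams" "set u \<subseteq> fams" "set w \<subseteq> fams" "v \<in> fams" "length ms = length (u @ v # w)"
  shows "v' \<in> fams \<Longrightarrow> comp_term x ms (u @ (v + v') # w) = comp_term x ms (u @ v # w) + comp_term x ms (u @ v' # w)"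
    and "comp_term x ms (u @ (\<lambda>n. scal \<P> c (v n)) # w) = scal \<P> c (comp_term x ms (u @ v # w))"
proof -
  obtain a m b where eq: "\<And>v. comp_term x ms (u @ v # w) = comp \<P> (x (Suc (length u + length w)))
      (map (\<lambda>(m, y). (m, y m)) (zip a u) @ (m, v m) # map (\<lambda>(m, y). (m, y m)) (zip b w))"
    and len: "length a = length u" "length b = length w"
    \<comment> \<open>Any family may stand in the slot here, as only the length of the list
      matters.\<close>
    using comp_term_split[of ms u undefined w x] assms(5) by auto
  note cl = tagged_zip[OF assms(2)] tagged_zip[OF assms(3)] completionD[OF assms(1)] completionD[OF assms(4)]
  show "comp_term x ms (u @ (\<lambda>n. scal \<P> c (v n)) # w) = scal \<P> c (comp_term x ms (u @ v # w))"
    unfolding eq by (rule comp_scale_right) (use cl len in auto)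
  assume "v' \<in> fams"
  then show "comp_term x ms (u @ (v + v') # w) = comp_term x ms (u @ v # w) + comp_term x ms (u @ v' # w)"
    unfolding eq plus_fun_apply by (intro comp_add_right) (use cl len completionD[of v'] in auto)
qed

lemma fam_comp_add_right: "x \<in> fams \<Longrightarrow> set u \<subseteq> fams \<Longrightarrow> set w \<subseteq> fams \<Longrightarrow> v \<in> fams \<Longrightarrow> v' \<in> fams \<Longrightarrow>
    fam_comp \<P> x (u @ (v + v') # w) = fam_comp \<P> x (u @ v # w) + fam_comp \<P> x (u @ v' # w)"
  by (rule ext) (simp add: fam_comp_eq comp_term_linear(1) flip: sum.distrib)

lemma fam_comp_scale_right: "x \<in> fams \<Longrightarrow> set u \<subseteq> fams \<Longrightarrow> set w \<subseteq> fams \<Longrightarrow> v \<in> fams \<Longrightarrow>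
    fam_comp \<P> x (u @ (\<lambda>n. scal \<P> c (v n)) # w) = (\<lambda>n. scal \<P> c (fam_comp \<P> x (u @ v # w) n))"
  by (rule ext) (simp add: fam_comp_eq comp_term_linear(2) V.scale_sum_right)

text \<open>With fewer inputs than slots, some slot receives arity 0, where families vanish.\<close>

lemma fam_comp_vanish:
  assumes "x \<in> fams" "set ys \<subseteq> fams" "N < length ys" shows "fam_comp \<P> x ys N = 0"
  unfolding fam_comp_eq
proof (rule sum.neutral, intro ballI)
  fix ms assume ms: "ms \<in> {ms. length ms = length ys \<and> sum_list ms = N}"
  then have "0 \<in> set ms" using length_le_sum_list[of ms] assms(3) by auto
  with ms show "comp_term x ms ys = 0" using assms by (intro comp_term_zero) auto
qed

text \<open>The parts of a sequence with sum \<open>N\<close> are at most \<open>N\<close>, so a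
  component of a composite involves only finitely many components of the inputs. This locality makes
  the truncation of infinite families possible.\<close>

lemma fam_comp_cong:
  assumes "length ys = length ys'" "x (length ys) = x' (length ys)"
    and "\<And>i m. i < length ys \<Longrightarrow> m \<le> N \<Longrightarrow> (ys ! i) m = (ys' ! i) m"
  shows "fam_comp \<P> x ys N = fam_comp \<P> x' ys' N"
  unfolding fam_comp_eq assms(1)[symmetric]
proof (rule sum.cong[OF refl])
  fix ms assume "ms \<in> {ms. length ms = length ys \<and> sum_list ms = N}"
  then have ms: "length ms = length ys" "sum_list ms = N" by auto
  then have "ms ! i \<le> N" if "i < length ys" for i using that elem_le_sum_list[of i ms] by auto
  then have "map (\<lambda>(m, y). (m, y m)) (zip ms ys) = map (\<lambda>(m, y). (m, y m)) (zip ms ys')"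
    using ms assms by (intro nth_equalityI) auto
  then show "comp_term x ms ys = comp_term x' ms ys'" using assms by (simp add: comp_term_def)
qed


subsection \<open>The monoid of families\<close>

definition dterm :: "'a fam \<Rightarrow> 'a fam \<Rightarrow> nat list \<Rightarrow> 'a"
  where "dterm x y ms = comp \<P> (x (length ms)) (map (\<lambda>m. (m, y m)) ms)"

lemma tagged_map: "y \<in> fams \<Longrightarrow> set (map (\<lambda>m. (m, y m)) ms) \<subseteq> tagged \<P>"
  by (auto dest: completionD)

lemma comp_term_replicate: "length ms = n \<Longrightarrow> comp_term x ms (replicate n y) = dterm x y ms"
  by (simp add: comp_term_def dterm_def zip_replicate2 o_def)

lemma dterm_closed: "x \<in> fams \<Longrightarrow> y \<in> fams \<Longrightarrow> dterm x y ms \<in> ops \<P> (sum_list ms)"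
  using comp_term_closed[of x "replicate (length ms) y" ms] comp_term_replicate[of ms] by fastforce

lemma dterm_comps: "x \<in> fams \<Longrightarrow> y \<in> fams \<Longrightarrow> ms \<in> comps N \<Longrightarrow> dterm x y ms \<in> ops \<P> N"
  using dterm_closed[of x y ms] by (simp add: comps_def)

text \<open>The sums over the number of slots and over the distributions of \<open>N\<close> merge
  into one sum over compositions, an index set that can be nested and reindexed.\<close>

lemma diamond_dterm:
  assumes "x \<in> fams" "y \<in> fams"
  shows "diamond \<P> x y N = (\<Sum>ms\<in>comps N. dterm x y ms)"
proof (cases "N = 0")
  case True
  then show ?thesis using fams_0[OF assms(1)] by (simp add: diamond_def comps_0 dterm_def comp_zero_left)
next
  case False
  have "diamond \<P> x y N = (\<Sum>n=1..N. \<Sum>ms | length ms = n \<and> sum_list ms = N. dterm x y ms)"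
    unfolding diamond_def fam_comp_eq by (intro sum.cong) (auto simp: comp_term_replicate)
  also have "\<dots> = (\<Sum>n=1..N. \<Sum>ms | ms \<in> comps N \<and> length ms = n. dterm x y ms)"
  proof (rule sum.cong[OF refl], rule sum.mono_neutral_right[OF finite_lists_sum], goal_cases)
    case 1
    then show ?case by (auto simp: comps_def)
  next
    case (2 n)
    show ?case
    proof
    fix ms assume "ms \<in> {ms. length ms = n \<and> sum_list ms = N} - {ms. ms \<in> comps N \<and> length ms = n}"
    then have "0 \<in> set ms" "length ms = n" by (auto simp: comps_def)
    then show "dterm x y ms = 0"
      using comp_term_zero[of x "replicate n y" ms] assms
      by (auto simp: comp_term_replicate set_replicate_conv_if split: if_splits)
    qed
  qed
  also have "\<dots> = (\<Sum>ms\<in>comps N. dterm x y ms)"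
  proof (rule sum.group)
    have "ms \<noteq> []" if "ms \<in> comps N" for ms using that False by (auto simp: comps_def)
    then show "length ` comps N \<subseteq> {1..N}" using comps_length by (auto simp: Suc_le_eq)
  qed auto
  finally show ?thesis .
qed

lemma diamond_closed: "x \<in> fams \<Longrightarrow> y \<in> fams \<Longrightarrow> diamond \<P> x y \<in> fams"
  by (subst completion_def) (simp add: diamond_dterm dterm_comps ops_sum)

lemma diamond_add_left:
  assumes "x \<in> fams" "x' \<in> fams" "y \<in> fams"
  shows "diamond \<P> (x + x') y = diamond \<P> x y + diamond \<P> x' y"
  by (rule ext) (simp add: diamond_def fam_comp_add_left assms flip: sum.distrib)

lemma diamond_unit_left:
  assumes "y \<in> fams" shows "diamond \<P> (unit_fam \<P>) y = y"
proof
  fix N show "diamond \<P> (unit_fam \<P>) y N = y N"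
  proof (cases "N = 0")
    case False
    have "diamond \<P> (unit_fam \<P>) y N = (\<Sum>ms\<in>{[N]}. dterm (unit_fam \<P>) y ms)"
      unfolding diamond_dterm[OF unit_fam_in assms]
    proof (rule sum.mono_neutral_right)
      show "\<forall>ms\<in>comps N - {[N]}. dterm (unit_fam \<P>) y ms = 0"
      proof
        fix ms assume ms: "ms \<in> comps N - {[N]}"
        then have "length ms \<noteq> 1" by (auto simp: comps_def length_Suc_conv)
        then show "dterm (unit_fam \<P>) y ms = 0"
          using tagged_map[OF assms] by (simp add: dterm_def unit_fam_def comp_zero_left)
      qed
    qed (use False in \<open>auto simp: comps_def finite_comps[unfolded comps_def]\<close>)
    then show ?thesis using completionD[OF assms] by (simp add: dterm_def unit_fam_def comp_unt_left)
  qed (simp add: diamond_def fams_0[OF assms])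
qed

lemma diamond_unit_right:
  assumes "x \<in> fams" shows "diamond \<P> x (unit_fam \<P>) = x"
proof
  fix N
  have "diamond \<P> x (unit_fam \<P>) N = (\<Sum>ms\<in>{replicate N 1}. dterm x (unit_fam \<P>) ms)"
    unfolding diamond_dterm[OF assms unit_fam_in]
  proof (rule sum.mono_neutral_right)
    show "\<forall>ms\<in>comps N - {replicate N 1}. dterm x (unit_fam \<P>) ms = 0"
    proof
      fix ms assume ms: "ms \<in> comps N - {replicate N 1}"
      have "\<exists>m\<in>set ms. m \<noteq> 1"
      proof (rule ccontr)
        assume "\<not> (\<exists>m\<in>set ms. m \<noteq> 1)"
        then have "ms = replicate (length ms) 1" by (intro replicate_eqI) auto
        then obtain k where "ms = replicate k 1" ..
        then show False using ms by (simp add: comps_def sum_list_replicate)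
      qed
      then obtain m where "m \<in> set ms" "m \<noteq> 1" by blast
      then have "(m, 0) \<in> set (map (\<lambda>m. (m, unit_fam \<P> m)) ms)" by (force simp: unit_fam_def)
      then show "dterm x (unit_fam \<P>) ms = 0"
        unfolding dterm_def using completionD[OF assms]
        by (intro comp_zero_right tagged_map[OF unit_fam_in]) simp_all
    qed
  qed (auto simp: comps_def sum_list_replicate finite_comps[unfolded comps_def])
  then show "diamond \<P> x (unit_fam \<P>) N = x N"
    using comp_unt_right[OF completionD[OF assms]] by (simp add: dterm_def unit_fam_def)
qed

text \<open>Compositions of \<open>N\<close> whose parts are decomposed once more. Concatenation,
  recorded together with the lengths, and the list of sums are two ways of reading such an object;
  they correspond to the two bracketings of a triple product.\<close>

definition nested :: "nat \<Rightarrow> nat list list set"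
  where "nested N = {lss. (\<forall>ls\<in>set lss. ls \<noteq> [] \<and> 0 \<notin> set ls) \<and> sum_list (map sum_list lss) = N}"

lemma ex_concat: "sum_list ms = length ls \<Longrightarrow> \<exists>lss. concat lss = ls \<and> map length lss = ms"
proof (induction ms arbitrary: ls)
  case (Cons m ms)
  then obtain lss where "concat lss = drop m ls" "map length lss = ms"
    by (metis add_diff_cancel_left' length_drop sum_list.Cons)
  then show ?case using Cons.prems
    by (intro exI[of _ "take m ls # lss"]) simp
qed auto

lemma nested_bij_concat:
  "bij_betw (\<lambda>lss. (concat lss, map length lss)) (nested N) (SIGMA ls:comps N. comps (length ls))"
proof (rule bij_betw_imageI)
  show "inj_on (\<lambda>lss. (concat lss, map length lss)) (nested N)"
  proof (rule inj_onI, clarify)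
    fix xss yss :: "nat list list"
    assume "concat xss = concat yss" "map length xss = map length yss"
    then show "xss = yss"
    proof (induction xss arbitrary: yss)
      case (Cons xs xss)
      then show ?case by (cases yss) auto
    qed simp
  qed
  have sl: "sum_list (concat lss) = sum_list (map sum_list lss)" for lss :: "nat list list"
    by (induction lss) auto
  show "(\<lambda>lss. (concat lss, map length lss)) ` nested N = (SIGMA ls:comps N. comps (length ls))"
  proof (intro equalityI subsetI)
    fix z assume "z \<in> (\<lambda>lss. (concat lss, map length lss)) ` nested N"
    then show "z \<in> (SIGMA ls:comps N. comps (length ls))"
      by (auto simp: nested_def comps_def sl length_concat)
  next
    fix z assume "z \<in> (SIGMA ls:comps N. comps (length ls))"
    then obtain ls ms where z: "z = (ls, ms)" "0 \<notin> set ls" "sum_list ls = N" "0 \<notin> set ms" "sum_list ms = length ls"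
      by (auto simp: comps_def)
    obtain lss where lss: "concat lss = ls" "map length lss = ms" using ex_concat[OF z(5)] by blast
    have "lss \<in> nested N"
      using z lss sl[of lss] by (fastforce simp: nested_def)
    then show "z \<in> (\<lambda>lss. (concat lss, map length lss)) ` nested N"
      using z(1) lss by (auto intro!: image_eqI[of _ _ lss])
  qed
qed

lemma listset_comps: "lss \<in> listset (map comps Ms) \<longleftrightarrow> map sum_list lss = Ms \<and> (\<forall>ls\<in>set lss. 0 \<notin> set ls)"
proof (induction Ms arbitrary: lss)
  case (Cons M Ms)
  then show ?case by (cases lss) (auto simp: set_Cons_def comps_def)
qed auto

text \<open>For a sequence of positive integers, being empty and having sum 0 are the same; this
  turns a condition on the entries into one on the list of sums.\<close>

lemma nested_eq: "nested N = {lss. map sum_list lss \<in> comps N \<and> (\<forall>ls\<in>set lss. 0 \<notin> set ls)}"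
proof -
  have "ls \<noteq> [] \<and> 0 \<notin> set ls \<longleftrightarrow> sum_list ls \<noteq> 0 \<and> 0 \<notin> set ls" for ls :: "nat list"
    by (cases ls) auto
  then show ?thesis unfolding nested_def comps_def by (auto simp: image_iff)
qed

lemma nested_bij_sums:
  "bij_betw (\<lambda>lss. (map sum_list lss, lss)) (nested N) (SIGMA Ms:comps N. listset (map comps Ms))"
  by (rule bij_betw_imageI) (auto simp: inj_on_def nested_eq listset_comps simp del: map_map)

lemma finite_listset: "(\<And>M. M \<in> set Ms \<Longrightarrow> finite (A M)) \<Longrightarrow> finite (listset (map A Ms))"
proof (induction Ms)
  case (Cons M Ms)
  have "set_Cons (A M) (listset (map A Ms)) = (\<lambda>(a, xs). a # xs) ` (A M \<times> listset (map A Ms))"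
    by (auto simp: set_Cons_def)
  then show ?case using Cons by auto
qed auto

text \<open>Expanded by linearity, both sides become sums over \<open>nested N\<close>, and
  associativity of the operad identifies the terms.\<close>

lemma diamond_assoc:
  assumes x: "x \<in> fams" and y: "y \<in> fams" and z: "z \<in> fams"
  shows "diamond \<P> (diamond \<P> x y) z = diamond \<P> x (diamond \<P> y z)"
proof
  fix N
  define g where "g lss = comp \<P> (x (length lss)) (map (\<lambda>ls. (sum_list ls, dterm y z ls)) lss)" for lss
  have "diamond \<P> (diamond \<P> x y) z N = (\<Sum>ls\<in>comps N. \<Sum>ms\<in>comps (length ls).
      comp \<P> (dterm x y ms) (map (\<lambda>m. (m, z m)) ls))"
    unfolding diamond_dterm[OF diamond_closed[OF x y] z]
  proof (rule sum.cong[OF refl])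
    fix ls
    show "dterm (diamond \<P> x y) z ls = (\<Sum>ms\<in>comps (length ls). comp \<P> (dterm x y ms) (map (\<lambda>m. (m, z m)) ls))"
      unfolding dterm_def[of "diamond \<P> x y"] diamond_dterm[OF x y]
      by (intro comp_sum_left tagged_map z) (simp add: dterm_comps[OF x y])
  qed
  also have "\<dots> = (\<Sum>(ls, ms)\<in>(SIGMA ls:comps N. comps (length ls)).
      comp \<P> (dterm x y ms) (map (\<lambda>m. (m, z m)) ls))"
    by (subst sum.Sigma) auto
  also have "\<dots> = (\<Sum>lss\<in>nested N. comp \<P> (dterm x y (map length lss)) (map (\<lambda>m. (m, z m)) (concat lss)))"
    by (subst sum.reindex_bij_betw[OF nested_bij_concat, symmetric]) simp
  also have "\<dots> = (\<Sum>lss\<in>nested N. g lss)"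
  proof (rule sum.cong[OF refl])
    fix lss
    have "comp \<P> (dterm x y (map length lss)) (concat (map (map (\<lambda>m. (m, z m))) lss)) =
        comp \<P> (x (length lss)) (map (\<lambda>((m, q), ys). ((\<Sum>(l, r)\<leftarrow>ys. l), comp \<P> q ys))
          (zip (map (\<lambda>m. (m, y m)) (map length lss)) (map (map (\<lambda>m. (m, z m))) lss)))"
      unfolding dterm_def length_map
      using completionD[OF x] completionD[OF y] completionD[OF z]
      by (intro comp_assoc) (auto simp: o_def)
    also have "\<dots> = g lss"
      unfolding g_def dterm_def
      by (simp add: o_def case_prod_unfold zip_map1 zip_map2 zip_same_conv_map)
    finally show "comp \<P> (dterm x y (map length lss)) (map (\<lambda>m. (m, z m)) (concat lss)) = g lss"
      by (simp add: map_concat)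
  qed
  also have "\<dots> = (\<Sum>(Ms, lss)\<in>(SIGMA Ms:comps N. listset (map comps Ms)). g lss)"
    by (subst sum.reindex_bij_betw[OF nested_bij_sums, symmetric]) simp
  also have "\<dots> = (\<Sum>Ms\<in>comps N. \<Sum>lss\<in>listset (map comps Ms). g lss)"
    by (subst sum.Sigma) (auto intro!: finite_listset)
  also have "\<dots> = diamond \<P> x (diamond \<P> y z) N"
    unfolding diamond_dterm[OF x diamond_closed[OF y z]]
  proof (rule sum.cong[OF refl])
    fix Ms
    have "dterm x (diamond \<P> y z) Ms = comp \<P> (x (length Ms)) ([] @ map (\<lambda>M. (M, \<Sum>ls\<in>comps M. dterm y z ls)) Ms)"
      by (simp add: dterm_def[of x "diamond \<P> y z"] diamond_dterm[OF y z])
    also have "\<dots> = (\<Sum>lss\<in>listset (map comps Ms). comp \<P> (x (length Ms)) ([] @ map (\<lambda>(M, l). (M, dterm y z l)) (zip Ms lss)))"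
      using completionD[OF x] by (intro comp_sum_all) (auto simp: dterm_comps[OF y z])
    also have "\<dots> = (\<Sum>lss\<in>listset (map comps Ms). g lss)"
    proof (rule sum.cong[OF refl])
      fix lss assume "lss \<in> listset (map comps Ms)"
      then have Ms: "Ms = map sum_list lss" by (simp add: listset_comps)
      show "comp \<P> (x (length Ms)) ([] @ map (\<lambda>(M, l). (M, dterm y z l)) (zip Ms lss)) = g lss"
        unfolding Ms g_def by (simp add: zip_map1 zip_same_conv_map o_def)
    qed
    finally show "(\<Sum>lss\<in>listset (map comps Ms). g lss) = dterm x (diamond \<P> y z) Ms" by simp
  qed
  finally show "diamond \<P> (diamond \<P> x y) z N = diamond \<P> x (diamond \<P> y z) N" .
qed

lemma M_simps [simp]:
  "carrier (M \<P>) = fams" "mult (M \<P>) = diamond \<P>" "one (M \<P>) = unit_fam \<P>"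
  "carrier (M' \<P>) = fams" "mult (M' \<P>) = diamond' \<P>" "one (M' \<P>) = 0"
  "carrier (M_plus \<P>) = completion (plus_ops \<P>)" "mult (M_plus \<P>) = diamond_plus \<P>" "one (M_plus \<P>) = 0"
  by (simp_all add: M_def M'_def M_plus_def zero_fun_def)

lemma monoid_M: "monoid (M \<P>)"
  by (rule monoidI)
    (simp_all add: diamond_closed unit_fam_in diamond_assoc diamond_unit_left diamond_unit_right)

end


section \<open>Quotient monoids\<close>

lemma quotient_monoid_epi:
  assumes "monoid G" and C: "C = \<pi> ` carrier G"
    and cong: "\<And>x x' y y'. x \<in> carrier G \<Longrightarrow> x' \<in> carrier G \<Longrightarrow> y \<in> carrier G \<Longrightarrow> y' \<in> carrier G \<Longrightarrow>
      \<pi> x = \<pi> x' \<Longrightarrow> \<pi> y = \<pi> y' \<Longrightarrow> \<pi> (x \<otimes>\<^bsub>G\<^esub> y) = \<pi> (x' \<otimes>\<^bsub>G\<^esub> y')"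
  shows "monoid (quotient_monoid G \<pi> C)" "\<pi> \<in> epi G (quotient_monoid G \<pi> C)"
    and "\<pi> \<one>\<^bsub>G\<^esub> = \<one>\<^bsub>quotient_monoid G \<pi> C\<^esub>"
proof -
  interpret G: monoid G by fact
  let ?Q = "quotient_monoid G \<pi> C"
  have mult: "\<pi> x \<otimes>\<^bsub>?Q\<^esub> \<pi> y = \<pi> (x \<otimes>\<^bsub>G\<^esub> y)" if "x \<in> carrier G" "y \<in> carrier G" for x y
    using that by (simp add: quotient_monoid_def) (intro cong; simp add: inv_into_into f_inv_into_f)
  show one: "\<pi> \<one>\<^bsub>G\<^esub> = \<one>\<^bsub>?Q\<^esub>" by (simp add: quotient_monoid_def)
  have carr: "carrier ?Q = \<pi> ` carrier G" by (simp add: quotient_monoid_def C)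
  show "monoid ?Q"
    by (rule monoidI) (auto simp: carr mult G.m_assoc simp flip: one)
  show "\<pi> \<in> epi G ?Q"
    by (auto simp: epi_def hom_def carr mult)
qed

lemma quotient_monoid_group:
  assumes "group G" "monoid Q" "\<pi> \<in> epi G Q" "\<pi> \<one>\<^bsub>G\<^esub> = \<one>\<^bsub>Q\<^esub>"
  shows "group Q"
proof -
  interpret G: group G by fact
  interpret Q: monoid Q by fact
  have carr: "carrier Q = \<pi> ` carrier G" and hom: "\<pi> \<in> hom G Q" using assms(3) by (auto simp: epi_def)
  show ?thesis
  proof (rule Q.group_l_invI)
    fix X assume "X \<in> carrier Q"
    then obtain x where x: "x \<in> carrier G" "X = \<pi> x" by (auto simp: carr)
    then have "\<pi> (inv\<^bsub>G\<^esub> x) \<otimes>\<^bsub>Q\<^esub> X = \<one>\<^bsub>Q\<^esub>" using hom_mult[OF hom, of "inv\<^bsub>G\<^esub> x" x] assms(4) by simp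
    then show "\<exists>Y\<in>carrier Q. Y \<otimes>\<^bsub>Q\<^esub> X = \<one>\<^bsub>Q\<^esub>" using x carr by blast
  qed
qed

lemma monoid_right_inverse_group:
  assumes "monoid G" "\<And>x. x \<in> carrier G \<Longrightarrow> \<exists>y\<in>carrier G. x \<otimes>\<^bsub>G\<^esub> y = \<one>\<^bsub>G\<^esub>"
  shows "group G"
proof -
  interpret G: monoid G by fact
  show ?thesis
  proof (rule G.group_l_invI)
    fix x assume x: "x \<in> carrier G"
    then obtain y where y: "y \<in> carrier G" "x \<otimes>\<^bsub>G\<^esub> y = \<one>\<^bsub>G\<^esub>" using assms(2) by blast
    then obtain z where z: "z \<in> carrier G" "y \<otimes>\<^bsub>G\<^esub> z = \<one>\<^bsub>G\<^esub>" using assms(2) by blast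
    have "x = x \<otimes>\<^bsub>G\<^esub> (y \<otimes>\<^bsub>G\<^esub> z)" using x z by simp
    also have "\<dots> = z" using x y z G.m_assoc[of x y z] by simp
    finally have "y \<otimes>\<^bsub>G\<^esub> x = \<one>\<^bsub>G\<^esub>" using z by simp
    with y show "\<exists>y\<in>carrier G. y \<otimes>\<^bsub>G\<^esub> x = \<one>\<^bsub>G\<^esub>" by blast
  qed
qed

text \<open>The laws for the two translated operations are inherited along an injective map instead
  of being recomputed.\<close>

lemma monoid_pullback:
  assumes "monoid H" "\<And>x y. x \<in> carrier G \<Longrightarrow> y \<in> carrier G \<Longrightarrow> x \<otimes>\<^bsub>G\<^esub> y \<in> carrier G"
    and "\<one>\<^bsub>G\<^esub> \<in> carrier G" and h: "h \<in> hom G H" "inj_on h (carrier G)" "h \<one>\<^bsub>G\<^esub> = \<one>\<^bsub>H\<^esub>"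
  shows "monoid G"
proof -
  interpret H: monoid H by fact
  have hc: "h x \<in> carrier H" if "x \<in> carrier G" for x using h(1) that by (auto simp: hom_def)
  show ?thesis
    by (rule monoidI)
      (auto intro!: inj_onD[OF h(2)] simp: assms(2,3) hom_mult[OF h(1)] hc h(3) H.m_assoc)
qed


context reduced_operad
begin

subsection \<open>The translated monoid and the group of units\<close>

definition shift :: "'a fam \<Rightarrow> 'a fam" where "shift y = unit_fam \<P> + y"

lemma shift_in: "y \<in> fams \<Longrightarrow> shift y \<in> fams"
  unfolding shift_def by (intro fams_add unit_fam_in)

lemma shift_inj: "inj shift"
  by (simp add: inj_def shift_def)

lemma shift_surj: "x \<in> fams \<Longrightarrow> \<exists>y\<in>fams. x = shift y"
  by (intro bexI[of _ "x - unit_fam \<P>"] fams_diff unit_fam_in) (auto simp: shift_def)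

lemma sum_Pow_insert:
  assumes "finite A" "a \<notin> A"
  shows "(\<Sum>U\<in>Pow (insert a A). g U) = (\<Sum>U\<in>Pow A. g U) + (\<Sum>U\<in>Pow A. g (insert a U) :: 'b::comm_monoid_add)"
proof -
  have "inj_on (insert a) (Pow A)" using assms(2) by (auto simp: inj_on_def)
  moreover have "Pow A \<inter> insert a ` Pow A = {}" using assms(2) by blast
  ultimately show ?thesis using assms(1)
    by (simp add: Pow_insert sum.union_disjoint sum.reindex o_def)
qed

text \<open>A product of binomials: \<open>U\<close> is the set of slots from which the summand
  \<open>b i\<close> is taken. In the induction, \<open>us\<close> contains the slots already
  decided.\<close>

lemma fam_comp_expand:
  fixes a b :: "nat \<Rightarrow> 'a fam"
  assumes x: "x \<in> fams" and a: "\<And>i. a i \<in> fams" and b: "\<And>i. b i \<in> fams"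
  shows "distinct is \<Longrightarrow> set us \<subseteq> fams \<Longrightarrow> fam_comp \<P> x (us @ map (\<lambda>i. a i + b i) is) N =
    (\<Sum>U\<in>Pow (set is). fam_comp \<P> x (us @ map (\<lambda>i. if i \<in> U then b i else a i) is) N)"
proof (induction "is" arbitrary: us)
  case (Cons i "is")
  let ?m = "\<lambda>U. map (\<lambda>i. if i \<in> U then b i else a i) is"
  have i: "i \<notin> set is" using Cons.prems by simp
  have m: "set (map (\<lambda>i. a i + b i) is) \<subseteq> fams" using fams_add[OF a b] by auto
  have eq: "map (\<lambda>j. if j \<in> insert i U then b j else a j) is = ?m U" for U
    using i by auto
  have eq': "U \<in> Pow (set is) \<Longrightarrow> i \<notin> U" for U using i by auto
  have "fam_comp \<P> x (us @ (a i + b i) # map (\<lambda>i. a i + b i) is) N =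
      fam_comp \<P> x ((us @ [a i]) @ map (\<lambda>i. a i + b i) is) N + fam_comp \<P> x ((us @ [b i]) @ map (\<lambda>i. a i + b i) is) N"
    using fam_comp_add_right[OF x Cons.prems(2) m a b] by simp
  also have "\<dots> = (\<Sum>U\<in>Pow (set is). fam_comp \<P> x (us @ a i # ?m U) N) +
      (\<Sum>U\<in>Pow (set is). fam_comp \<P> x (us @ b i # ?m U) N)"
  proof -
    have IH: "fam_comp \<P> x ((us @ [c]) @ map (\<lambda>i. a i + b i) is) N =
        (\<Sum>U\<in>Pow (set is). fam_comp \<P> x ((us @ [c]) @ ?m U) N)" if "c \<in> fams" for c
      by (rule Cons.IH) (use Cons.prems that in auto)
    show ?thesis unfolding IH[OF a] IH[OF b] by (simp only: append_assoc append.simps)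
  qed
  also have "\<dots> = (\<Sum>U\<in>Pow (insert i (set is)). fam_comp \<P> x (us @ map (\<lambda>i. if i \<in> U then b i else a i) (i # is)) N)"
    unfolding sum_Pow_insert[OF finite_set i] list.map eq
    by (intro arg_cong2[where f = "(+)"] sum.cong refl) (use eq' in auto)
  finally show ?case by (simp add: plus_fun_def)
qed simp

text \<open>With equal entries, the rank that selects the entry for a position matters only through
  being in range.\<close>

lemma circ_at_replicate:
  assumes "S \<subseteq> {..<n}"
  shows "circ_at \<P> x n S (replicate (card S) y) = fam_comp \<P> x (map (\<lambda>i. if i \<in> S then y else unit_fam \<P>) [0..<n])"
proof -
  have "replicate (card S) y ! card {j \<in> S. j < i} = y" if "i \<in> S" for i
  proof -
    have "finite S" using assms finite_subset by blast
    then have "card {j \<in> S. j < i} < card S" using that by (intro psubset_card_mono) auto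
    then show ?thesis by simp
  qed
  then show ?thesis unfolding circ_at_def by (metis (no_types, lifting))
qed

text \<open>The sum over subsets of positions is the multilinear expansion of the composition of
  \<open>x\<close> with \<open>shift y\<close> in every slot.\<close>

lemma diamond'_eq:
  assumes "x \<in> fams" "y \<in> fams"
  shows "diamond' \<P> x y = y + diamond \<P> x (shift y)"
proof
  fix N
  have "(\<Sum>S\<in>Pow {..<n}. circ_at \<P> x n S (replicate (card S) y) N) = fam_comp \<P> x (replicate n (shift y)) N" for n
  proof -
    have "fam_comp \<P> x ([] @ map (\<lambda>i. unit_fam \<P> + y) [0..<n]) N =
        (\<Sum>S\<in>Pow (set [0..<n]). fam_comp \<P> x ([] @ map (\<lambda>i. if i \<in> S then y else unit_fam \<P>) [0..<n]) N)"
      using assms unit_fam_in by (intro fam_comp_expand) auto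
    moreover have "map (\<lambda>i. unit_fam \<P> + y) [0..<n] = replicate n (shift y)"
      by (simp add: map_replicate_const shift_def)
    ultimately show ?thesis by (simp add: circ_at_replicate atLeast0LessThan)
  qed
  then show "diamond' \<P> x y N = (y + diamond \<P> x (shift y)) N"
    by (simp add: diamond'_def diamond_def)
qed

lemma diamond_plus_eq: "diamond_plus \<P> x y = y + diamond \<P> x (shift y)"
  by (simp add: diamond_plus_def diamond_def shift_def plus_fun_def)

text \<open>By additivity on the left, composing I + x with I + y gives I + y plus the contribution
  of \<open>x\<close>; the extra summand \<open>y\<close> of \<open>diamond'\<close> is what the
  unit on the left produces.\<close>

lemma shift_diamond':
  assumes "x \<in> fams" "y \<in> fams"
  shows "shift (diamond' \<P> x y) = diamond \<P> (shift x) (shift y)"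
  unfolding diamond'_eq[OF assms] shift_def[of x]
  by (subst diamond_add_left) (simp_all add: assms unit_fam_in shift_in diamond_unit_left, simp add: shift_def add.assoc)

lemma shift_iso: "shift \<in> iso (M' \<P>) (M \<P>)"
  by (intro isoI homI bij_betw_imageI)
    (auto simp: shift_in shift_diamond' inj_on_subset[OF shift_inj] dest: shift_surj)

lemma diamond'_closed: "x \<in> fams \<Longrightarrow> y \<in> fams \<Longrightarrow> diamond' \<P> x y \<in> fams"
  by (simp add: diamond'_eq fams_add diamond_closed shift_in)

lemma monoid_M': "monoid (M' \<P>)"
  by (rule monoid_pullback[OF monoid_M, where h = shift])
    (use shift_iso inj_on_subset[OF shift_inj] in \<open>auto simp: diamond'_closed fams_zero shift_def iso_def\<close>)

abbreviation "pfams \<equiv> completion (plus_ops \<P>)"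

lemma pfams_iff: "y \<in> pfams \<longleftrightarrow> y \<in> fams \<and> y 1 = 0"
proof -
  have "plus_ops \<P> n = (if n = 1 then {0} else ops \<P> n)" for n
    by (cases "n = 0") (auto simp: plus_ops_def ops_0)
  then show ?thesis by (auto simp: completion_def ops_closed(1) split: if_splits)
qed

lemma diamond_plus_diamond': "x \<in> pfams \<Longrightarrow> y \<in> pfams \<Longrightarrow> diamond_plus \<P> x y = diamond' \<P> x y"
  by (simp add: diamond_plus_eq diamond'_eq pfams_iff)

lemma comps_1: "comps 1 = {[1]}"
proof (intro equalityI subsetI)
  fix ms assume ms: "ms \<in> comps 1"
  have "length ms \<le> 1" "ms \<noteq> []" using comps_length[OF ms] ms by (auto simp: comps_def)
  then obtain m where "ms = [m]" by (cases ms) auto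
  with ms show "ms \<in> {[1]}" by (simp add: comps_def)
qed (simp add: comps_def)

lemma diamond_1: "x \<in> fams \<Longrightarrow> y \<in> fams \<Longrightarrow> diamond \<P> x y 1 = comp \<P> (x 1) [(1, y 1)]"
  by (simp add: diamond_dterm comps_1[unfolded One_nat_def] dterm_def)

lemma diamond_plus_closed: "x \<in> pfams \<Longrightarrow> y \<in> pfams \<Longrightarrow> diamond_plus \<P> x y \<in> pfams"
  using diamond_1[of x "shift y"] completionD[OF shift_in, of y 1]
  by (auto simp: diamond_plus_eq pfams_iff diamond_closed fams_add shift_in comp_zero_left)

lemma monoid_M_plus: "monoid (M_plus \<P>)"
proof (rule monoid_pullback[OF monoid_M', where h = "\<lambda>x. x"])
  show "(\<lambda>x. x) \<in> hom (M_plus \<P>) (M' \<P>)"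
    by (rule homI) (simp_all add: diamond_plus_diamond', simp add: pfams_iff)
qed (simp_all add: diamond_plus_closed monoid_M', simp add: pfams_iff fams_zero)

text \<open>The equation \<open>y + x \<circ> (I + y) = 0\<close> for a right inverse \<open>y\<close> determines \<open>y\<^sub>N\<close> from the
  components of lower arity, as \<open>x\<^sub>1 = 0\<close>.\<close>

lemma diamond_plus_inverse:
  assumes x: "x \<in> pfams" shows "\<exists>y\<in>pfams. diamond_plus \<P> x y = 0"
proof -
  have xf: "x \<in> fams" and x1: "x 1 = 0" using x by (auto simp: pfams_iff)
  \<comment> \<open>A fixed point of \<open>F\<close> is a right inverse of
    \<open>x\<close>.\<close>
  define F where "F y = - diamond \<P> x (shift y)" for y
  have Fc: "F y \<in> fams" if "y \<in> fams" for y
    using fams_diff[OF fams_zero diamond_closed[OF xf shift_in[OF that]]] by (simp add: F_def)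
  have dep: "F y N = F y' N" if y: "y \<in> fams" "y' \<in> fams" and eq: "\<And>m. m < N \<Longrightarrow> y m = y' m" for y y' N
  proof -
    \<comment> \<open>A composition with several parts has all of them below \<open>N\<close>; one
      with a single part meets \<open>x 1 = 0\<close>.\<close>
    have "dterm x (shift y) ms = dterm x (shift y') ms" if ms: "ms \<in> comps N" for ms
    proof (cases "length ms = 1")
      case True
      then show ?thesis using x1 tagged_map shift_in y by (simp add: dterm_def comp_zero_left)
    next
      case False
      have "m < N" if m: "m \<in> set ms" for m
      proof -
        obtain us ws where us: "ms = us @ m # ws" using split_list[OF m] by blast
        with False have "us \<noteq> [] \<or> ws \<noteq> []" by auto
        moreover have "length us \<le> sum_list us" "length ws \<le> sum_list ws"
          using ms us by (auto simp: comps_def intro!: length_le_sum_list)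
        ultimately have "0 < sum_list us + sum_list ws" by (cases us; cases ws) auto
        then show ?thesis using ms us by (auto simp: comps_def)
      qed
      then have "map (\<lambda>m. (m, shift y m)) ms = map (\<lambda>m. (m, shift y' m)) ms"
        using eq by (simp add: shift_def)
      then show ?thesis by (simp only: dterm_def)
    qed
    then show ?thesis using y by (simp add: F_def diamond_dterm xf shift_in)
  qed
  define Y where "Y k = (F ^^ k) 0" for k
  have Yc: "Y k \<in> fams" for k
    by (induction k) (simp_all add: Y_def fams_zero fams_zero[unfolded zero_fun_def] Fc)
  \<comment> \<open>Each application of \<open>F\<close> settles one more arity, beginning with
    arity 0; component \<open>N\<close> is final from iterate \<open>Suc N\<close> on, and that is
    where \<open>y\<close> is read off.\<close>
  have stab: "Y k N = Y k' N" if "N < k" "N < k'" for N k k'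
    using that
  proof (induction N arbitrary: k k' rule: less_induct)
    case (less N)
    then obtain l l' where k: "k = Suc l" "k' = Suc l'" by (metis less_zeroE not0_implies_Suc)
    have "Y l m = Y l' m" if "m < N" for m
      by (rule less.IH[OF that]) (use less.prems k that in auto)
    then show ?case using dep[OF Yc Yc, of N l l'] by (simp add: k Y_def)
  qed
  define y where "y N = Y (Suc N) N" for N
  have yf: "y \<in> fams" using Yc by (simp add: completion_def y_def)
  have fixp: "F y = y"
  proof
    fix N
    have "F y N = F (Y (Suc N)) N"
      by (rule dep[OF yf Yc]) (unfold y_def, rule stab, auto)
    also have "\<dots> = Y (Suc (Suc N)) N" by (simp add: Y_def)
    also have "\<dots> = y N" unfolding y_def by (rule stab) auto
    finally show "F y N = y N" .
  qed
  have "F y 1 = 0"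
    using completionD[OF shift_in[OF yf], of 1] diamond_1[OF xf shift_in[OF yf]]
    by (simp add: F_def x1[unfolded One_nat_def] comp_zero_left)
  then have "y \<in> pfams" using yf fixp by (simp add: pfams_iff)
  moreover have "diamond_plus \<P> x y = 0" using fixp by (simp add: diamond_plus_eq F_def) (metis add.right_inverse add.commute minus_minus)
  ultimately show ?thesis by blast
qed

lemma group_M_plus: "group (M_plus \<P>)"
  by (rule monoid_right_inverse_group[OF monoid_M_plus]) (simp add: diamond_plus_inverse)


subsection \<open>Coinvariants\<close>

abbreviation "W \<equiv> coinv_kernel \<P> (ops \<P>)"

lemma W_subspace: "V.subspace (coinv_kernel \<P> U n)"
  unfolding coinv_kernel_def by (rule V.subspace_span)

lemma W_gen: "\<sigma> permutes {..<n} \<Longrightarrow> p \<in> ops \<P> n \<Longrightarrow> act \<P> n \<sigma> p - p \<in> W n"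
  unfolding coinv_kernel_def by (rule V.span_base) auto

lemma W_induct [consumes 1, case_names base step]:
  assumes "w \<in> W n" "P 0"
    and "\<And>c \<sigma> p v. \<sigma> permutes {..<n} \<Longrightarrow> p \<in> ops \<P> n \<Longrightarrow> v \<in> ops \<P> n \<Longrightarrow> P v \<Longrightarrow>
      P (scal \<P> c (act \<P> n \<sigma> p - p) + v)"
  shows "P w"
proof -
  have "w \<in> ops \<P> n \<and> P w"
    using assms(1) unfolding coinv_kernel_def
    by (induction rule: V.span_induct_alt) (auto simp: assms act_closed)
  then show ?thesis ..
qed

section \<open>Equivariance of the composition modulo the coinvariant kernels\<close>

lemma block_start_length: "block_start xs (length xs) = (\<Sum>(m, q)\<leftarrow>xs. m)"
  by (simp add: block_start_def case_prod_unfold sum_list_sum_nth atLeast0LessThan)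

lemma ex_block_perm:
  fixes s :: nat
  assumes "\<sigma> permutes {..<m}"
  shows "\<exists>\<beta>. \<beta> permutes {s..<s + m} \<and> (\<forall>r<m. \<beta> (s + r) = s + \<sigma> r)"
proof -
  define \<beta> where "\<beta> k = (if k \<in> {s..<s + m} then s + \<sigma> (k - s) else k)" for k
  have \<sigma>: "bij_betw \<sigma> {..<m} {..<m}" using assms by (rule permutes_imp_bij)
  have 1: "bij_betw (\<lambda>k. k - s) {s..<s + m} {..<m}"
    by (rule bij_betw_byWitness[where f' = "\<lambda>k. s + k"]) auto
  have 2: "bij_betw (\<lambda>k. s + k) {..<m} {s..<s + m}"
    by (rule bij_betw_byWitness[where f' = "\<lambda>k. k - s"]) auto
  have "bij_betw ((\<lambda>k. s + k) \<circ> (\<sigma> \<circ> (\<lambda>k. k - s))) {s..<s + m} {s..<s + m}"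
    using bij_betw_trans[OF bij_betw_trans[OF 1 \<sigma>] 2] .
  then have "bij_betw \<beta> {s..<s + m} {s..<s + m}"
    by (rule bij_betw_cong[THEN iffD1, rotated]) (simp add: \<beta>_def)
  then have "\<beta> permutes {s..<s + m}" by (rule bij_imp_permutes) (auto simp: \<beta>_def)
  then show ?thesis by (intro exI[of _ \<beta>]) (auto simp: \<beta>_def)
qed

text \<open>Acting on one inner operation amounts to permuting its block of inputs in the composite,
  so a generator of the kernel in that slot yields a generator of the kernel in the result.\<close>

lemma comp_W_right:
  assumes p: "p \<in> ops \<P> (length us + Suc (length ws))" and us: "set us \<subseteq> tagged \<P>" and ws: "set ws \<subseteq> tagged \<P>"
    and w: "w \<in> W m"
  shows "comp \<P> p (us @ (m, w) # ws) \<in> W ((\<Sum>(l, q)\<leftarrow>us. l) + m + (\<Sum>(l, q)\<leftarrow>ws. l))" (is "_ \<in> W ?N")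
  using w
proof (induction rule: W_induct)
  case base
  have "comp \<P> p (us @ (m, 0) # ws) = 0" using assms by (intro comp_zero_right) auto
  then show ?case using V.subspace_0[OF W_subspace] by simp
next
  case (step c \<sigma> q v)
  let ?xs = "us @ (m, q) # ws" and ?s = "\<Sum>(l, q)\<leftarrow>us. l"
  let ?n = "length ?xs"
  have xs: "set ?xs \<subseteq> tagged \<P>" using us ws step by simp
  have N: "block_start ?xs ?n = ?N" using block_start_length[of ?xs] by (simp add: add.assoc)
  have s: "block_start ?xs (length us) = ?s"
    by (simp add: block_start_def nth_append case_prod_unfold sum_list_sum_nth atLeast0LessThan)
  obtain \<beta> where \<beta>: "\<beta> permutes {?s..<?s + m}" "\<And>r. r < m \<Longrightarrow> \<beta> (?s + r) = ?s + \<sigma> r"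
    using ex_block_perm[OF step(1)] by blast
  have \<beta>N: "\<beta> permutes {..<?N}" using \<beta>(1) by (rule permutes_subset) auto
  \<comment> \<open>The equivariance axiom acts on all inputs at once; the other inputs are acted on
    by the identity.\<close>
  define \<tau>s where "\<tau>s j = (if j = length us then \<sigma> else id)" for j
  have blocks: "\<beta> (block_start ?xs j + r) = block_start ?xs j + \<tau>s j r" if j: "j < ?n" "r < fst (?xs ! j)" for j r
  proof (cases "j = length us")
    case True
    then show ?thesis using j \<beta>(2) by (simp add: \<tau>s_def s)
  next
    case False
    have mono: "block_start ?xs a \<le> block_start ?xs b" if "a \<le> b" for a b
      unfolding block_start_def using that by (intro sum_mono2) auto
    have Suc: "block_start ?xs (Suc a) = block_start ?xs a + fst (?xs ! a)" for a by (simp add: block_start_def)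
    have "block_start ?xs j + r < ?s \<or> ?s + m \<le> block_start ?xs j + r"
    proof (cases "j < length us")
      case True
      then have "block_start ?xs j + fst (?xs ! j) \<le> ?s" using mono[of "Suc j" "length us"] by (simp add: Suc s)
      then show ?thesis using j by simp
    next
      case False
      then have "?s + m \<le> block_start ?xs j"
        using mono[of "Suc (length us)" j] \<open>j \<noteq> length us\<close> by (simp add: Suc s)
      then show ?thesis by simp
    qed
    then have "\<beta> (block_start ?xs j + r) = block_start ?xs j + r" using \<beta>(1) by (auto intro: permutes_not_in)
    then show ?thesis using False by (simp add: \<tau>s_def)
  qed
  have "comp \<P> p (us @ (m, act \<P> m \<sigma> q) # ws) =
      comp \<P> p (map (\<lambda>j. (fst (?xs ! j), act \<P> (fst (?xs ! j)) (\<tau>s j) (snd (?xs ! j)))) [0..<?n])"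
  proof (rule arg_cong[where f = "comp \<P> p"], rule nth_equalityI)
    fix j assume "j < length (us @ (m, act \<P> m \<sigma> q) # ws)"
    then have j: "j < ?n" by simp
    have "?xs ! j \<in> tagged \<P>" using xs nth_mem[OF j] by blast
    then have t: "snd (?xs ! j) \<in> ops \<P> (fst (?xs ! j))" by (cases "?xs ! j") auto
    show "(us @ (m, act \<P> m \<sigma> q) # ws) ! j =
        map (\<lambda>j. (fst (?xs ! j), act \<P> (fst (?xs ! j)) (\<tau>s j) (snd (?xs ! j)))) [0..<?n] ! j"
    proof (cases "j \<le> length us")
      case True
      then show ?thesis using j t by (cases "j = length us") (auto simp: \<tau>s_def nth_append act_id)
    next
      case False
      then obtain k where k: "j = Suc (length us + k)" by (metis add_Suc less_imp_Suc_add not_le_imp_less)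
      then show ?thesis using j t by (simp add: \<tau>s_def nth_append act_id del: upt_Suc)
    qed
  qed simp
  also have "\<dots> = act \<P> (block_start ?xs ?n) \<beta> (comp \<P> p ?xs)"
  proof (rule comp_act_right)
    show "\<tau>s j permutes {..<fst (?xs ! j)}" for j
      using step(1) by (auto simp: \<tau>s_def nth_append permutes_id)
  qed (use p xs \<beta>N blocks N in auto)
  finally have eq: "comp \<P> p (us @ (m, act \<P> m \<sigma> q) # ws) = act \<P> ?N \<beta> (comp \<P> p ?xs)" by (simp only: N)
  have "comp \<P> p ?xs \<in> ops \<P> ?N" using comp_closed[of p ?xs] p xs by (simp add: add.assoc)
  then have "comp \<P> p (us @ (m, act \<P> m \<sigma> q) # ws) - comp \<P> p ?xs \<in> W ?N"
    unfolding eq by (rule W_gen[OF \<beta>N])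
  moreover have "comp \<P> p (us @ (m, scal \<P> c (act \<P> m \<sigma> q - q) + v) # ws) =
      scal \<P> c (comp \<P> p (us @ (m, act \<P> m \<sigma> q) # ws) - comp \<P> p ?xs) + comp \<P> p (us @ (m, v) # ws)"
  proof -
    have cl: "act \<P> m \<sigma> q \<in> ops \<P> m" "q \<in> ops \<P> m" "v \<in> ops \<P> m" using step act_closed by auto
    have p': "p \<in> ops \<P> (length (us @ (m, z) # ws))" for z using p by simp
    have "comp \<P> p (us @ (m, (act \<P> m \<sigma> q - q) + q) # ws) = comp \<P> p (us @ (m, act \<P> m \<sigma> q - q) # ws) + comp \<P> p ?xs"
      by (rule comp_add_right[OF p' us ws]) (use cl in auto)
    moreover have "comp \<P> p (us @ (m, scal \<P> c (act \<P> m \<sigma> q - q) + v) # ws) =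
        comp \<P> p (us @ (m, scal \<P> c (act \<P> m \<sigma> q - q)) # ws) + comp \<P> p (us @ (m, v) # ws)"
      by (rule comp_add_right[OF p' us ws]) (use cl in auto)
    moreover have "comp \<P> p (us @ (m, scal \<P> c (act \<P> m \<sigma> q - q)) # ws) = scal \<P> c (comp \<P> p (us @ (m, act \<P> m \<sigma> q - q) # ws))"
      by (rule comp_scale_right[OF p' us ws]) (use cl in auto)
    ultimately show ?thesis by simp
  qed
  ultimately show ?case
    using step V.subspace_add[OF W_subspace] V.subspace_scale[OF W_subspace] by simp
qed

text \<open>The inputs are exchanged one after the other, and the differences telescope.\<close>

lemma comp_W_right_map:
  assumes "y \<in> fams" "y' \<in> fams" "\<And>m. y m - y' m \<in> W m"
  shows "p \<in> ops \<P> (length us + length ms) \<Longrightarrow> set us \<subseteq> tagged \<P> \<Longrightarrow>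
    comp \<P> p (us @ map (\<lambda>m. (m, y m)) ms) - comp \<P> p (us @ map (\<lambda>m. (m, y' m)) ms)
      \<in> W ((\<Sum>(l, q)\<leftarrow>us. l) + sum_list ms)"
proof (induction ms arbitrary: us)
  case Nil
  then show ?case using V.subspace_0[OF W_subspace] by simp
next
  case (Cons m ms)
  note y = completionD[OF assms(1)] completionD[OF assms(2)]
  let ?a = "map (\<lambda>m. (m, y m)) ms" and ?b = "map (\<lambda>m. (m, y' m)) ms"
  have "comp \<P> p (us @ (m, (y m - y' m) + y' m) # ?a) = comp \<P> p (us @ (m, y m - y' m) # ?a) + comp \<P> p (us @ (m, y' m) # ?a)"
    using Cons.prems y by (intro comp_add_right) auto
  then have "comp \<P> p (us @ (m, y m) # ?a) - comp \<P> p (us @ (m, y' m) # ?a) = comp \<P> p (us @ (m, y m - y' m) # ?a)"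
    by simp
  also have "\<dots> \<in> W ((\<Sum>(l, q)\<leftarrow>us. l) + sum_list (m # ms))"
    using comp_W_right[of p us ?a "y m - y' m" m] Cons.prems y assms(3)
    by (simp add: o_def add.assoc image_subset_iff)
  finally have "comp \<P> p (us @ (m, y m) # ?a) - comp \<P> p (us @ (m, y' m) # ?a) \<in> W ((\<Sum>(l, q)\<leftarrow>us. l) + sum_list (m # ms))" .
  moreover have "comp \<P> p (us @ (m, y' m) # ?a) - comp \<P> p (us @ (m, y' m) # ?b) \<in> W ((\<Sum>(l, q)\<leftarrow>us. l) + sum_list (m # ms))"
    using Cons.IH[of "us @ [(m, y' m)]"] Cons.prems y by (simp add: add.assoc)
  ultimately show ?case using V.subspace_add[OF W_subspace] by fastforce
qed

lemma diamond_W_right: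
  assumes "x \<in> fams" "y \<in> fams" "y' \<in> fams" "\<And>m. y m - y' m \<in> W m"
  shows "diamond \<P> x y N - diamond \<P> x y' N \<in> W N"
  unfolding diamond_dterm[OF assms(1,2)] diamond_dterm[OF assms(1,3)] sum_subtractf[symmetric]
proof (rule V.subspace_sum[OF W_subspace])
  fix ms assume "ms \<in> comps N"
  then show "dterm x y ms - dterm x y' ms \<in> W N"
    using comp_W_right_map[OF assms(2-4), of "x (length ms)" "[]" ms] completionD[OF assms(1)]
    by (simp add: dterm_def comps_def)
qed

text \<open>Blocks of sizes \<open>m\<^sub>0, \<dots>, m\<^bsub>n-1\<^esub>\<close>, arranged in the order given by \<open>\<sigma>\<close>, tile an interval.\<close>

lemma block_bij:
  fixes mf :: "nat \<Rightarrow> nat"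
  assumes \<sigma>: "\<sigma> permutes {..<n}"
  shows "bij_betw (\<lambda>(j, r). (\<Sum>i | i < n \<and> \<sigma> i < \<sigma> j. mf i) + r)
    (SIGMA j:{..<n}. {..<mf j}) {..<\<Sum>i<n. mf i}"
proof -
  let ?S = "\<lambda>j. \<Sum>i | i < n \<and> \<sigma> i < \<sigma> j. mf i" and ?A = "SIGMA j:{..<n}. {..<mf j}"
  let ?e = "\<lambda>(j, r). ?S j + r"
  have step: "?S j + mf j \<le> ?S j'" if "j < n" "\<sigma> j < \<sigma> j'" for j j'
  proof -
    have "?S j + mf j = (\<Sum>i\<in>insert j {i. i < n \<and> \<sigma> i < \<sigma> j}. mf i)" by simp
    also have "\<dots> \<le> ?S j'" using that by (intro sum_mono2) auto
    finally show ?thesis .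
  qed
  have top: "?S j + mf j \<le> (\<Sum>i<n. mf i)" if "j < n" for j
  proof -
    have "?S j + mf j = (\<Sum>i\<in>insert j {i. i < n \<and> \<sigma> i < \<sigma> j}. mf i)" by simp
    also have "\<dots> \<le> (\<Sum>i<n. mf i)" using that by (intro sum_mono2) auto
    finally show ?thesis .
  qed
  have inj: "inj_on ?e ?A"
  proof (rule inj_onI)
    fix a a' assume a: "a \<in> ?A" "a' \<in> ?A" "?e a = ?e a'"
    obtain j r j' r' where aj: "a = (j, r)" "a' = (j', r')" by force
    have jr: "j < n" "j' < n" "r < mf j" "r' < mf j'" "?S j + r = ?S j' + r'" using a by (auto simp: aj)
    have "\<sigma> j = \<sigma> j'"
      using step[of j j'] step[of j' j] jr by (cases "\<sigma> j" "\<sigma> j'" rule: linorder_cases) auto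
    then have "j = j'" using permutes_inj[OF \<sigma>] by (simp add: inj_eq)
    then show "a = a'" using jr by (simp add: aj)
  qed
  moreover have "?e ` ?A = {..<\<Sum>i<n. mf i}"
  \<comment> \<open>Surjectivity follows by counting, as the map is injective and the block sizes
    add up to the length of the interval.\<close>
  proof (rule card_subset_eq)
    show "?e ` ?A \<subseteq> {..<\<Sum>i<n. mf i}" using top by fastforce
    show "card (?e ` ?A) = card {..<\<Sum>i<n. mf i}"
      using card_image[OF inj] by (simp add: card_SigmaI)
  qed simp
  ultimately show ?thesis by (rule bij_betw_imageI)
qed

lemma ex_blocks_perm:
  fixes mf :: "nat \<Rightarrow> nat"
  assumes \<sigma>: "\<sigma> permutes {..<n}"
  shows "\<exists>\<beta>. \<beta> permutes {..<\<Sum>i<n. mf i} \<and>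
    (\<forall>j<n. \<forall>r<mf j. \<beta> ((\<Sum>i<j. mf i) + r) = (\<Sum>i | i < n \<and> \<sigma> i < \<sigma> j. mf i) + (r :: nat))"
proof -
  let ?A = "SIGMA j:{..<n}. {..<mf j}" and ?N = "\<Sum>i<n. mf i"
  let ?e = "\<lambda>(j, r). (\<Sum>i | i < n \<and> \<sigma> i < \<sigma> j. mf i) + r"
  \<comment> \<open>The tiling for the natural order of the blocks; \<open>\<beta>\<close> is its
    inverse followed by the tiling in the order of \<open>\<sigma>\<close>.\<close>
  let ?d = "\<lambda>(j, r). (\<Sum>i | i < n \<and> id i < id j. mf i) + r"
  have e: "bij_betw ?e ?A {..<?N}" by (rule block_bij[OF \<sigma>])
  have d: "bij_betw ?d ?A {..<?N}" by (rule block_bij[OF permutes_id])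
  define \<beta> where "\<beta> k = (if k \<in> {..<?N} then ?e (inv_into ?A ?d k) else k)" for k
  have "bij_betw (?e \<circ> inv_into ?A ?d) {..<?N} {..<?N}"
    by (rule bij_betw_trans[OF bij_betw_inv_into[OF d] e])
  then have "bij_betw \<beta> {..<?N} {..<?N}"
    by (rule bij_betw_cong[THEN iffD1, rotated]) (simp add: \<beta>_def)
  then have "\<beta> permutes {..<?N}" by (rule bij_imp_permutes) (auto simp: \<beta>_def)
  moreover have "\<beta> ((\<Sum>i<j. mf i) + r) = (\<Sum>i | i < n \<and> \<sigma> i < \<sigma> j. mf i) + r" if jr: "j < n" "r < mf j" for j r
  proof -
    have "{i. i < n \<and> i < j} = {..<j}" using jr by auto
    then have k: "(\<Sum>i<j. mf i) + r = ?d (j, r)" by simp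
    have in_A: "(j, r) \<in> ?A" using jr by simp
    have "?d (j, r) \<in> {..<?N}" using bij_betwE[OF d] in_A by blast
    moreover have "inv_into ?A ?d (?d (j, r)) = (j, r)" using bij_betw_inv_into_left[OF d in_A] .
    ultimately show ?thesis unfolding k \<beta>_def by simp
  qed
  ultimately show ?thesis by blast
qed

text \<open>Acting on the outer operation also permutes the sizes of the blocks, so the term for
  \<open>ms\<close> is compared with the term for the permuted sizes. This does not control the
  terms one by one, but the permutation of sizes is a bijection of the index set, and the sum is
  controlled.\<close>

lemma dsum_W:
  assumes y: "y \<in> fams" and w: "w \<in> W n"
  shows "(\<Sum>ms | ms \<in> comps N \<and> length ms = n. comp \<P> w (map (\<lambda>m. (m, y m)) ms)) \<in> W N"
  using w
proof (induction rule: W_induct)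
  case base
  show ?case using tagged_map[OF y] V.subspace_0[OF W_subspace] by (simp add: comp_zero_left)
next
  case (step c \<sigma> p v)
  let ?C = "{ms. ms \<in> comps N \<and> length ms = n}" and ?y = "map (\<lambda>m. (m, y m))"
  have fin: "finite ?C" by simp
  have cl: "act \<P> n \<sigma> p \<in> ops \<P> n" using step act_closed by blast
  \<comment> \<open>The sizes are rearranged by the inverse permutation, in agreement with the order
    of the inputs in the equivariance axiom.\<close>
  define perm where "perm ms = map (\<lambda>i. ms ! inv_into UNIV \<sigma> i) [0..<n]" for ms :: "nat list"
  have inv: "inv_into UNIV \<sigma> permutes {..<n}" using step(1) by (rule permutes_inv)
  have permC: "perm ms \<in> ?C" and mset: "mset (perm ms) = mset ms" if "ms \<in> ?C" for ms
  proof -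
    have len: "length ms = n" using that by simp
    have "perm ms = permute_list (inv_into UNIV \<sigma>) ms" by (simp add: perm_def permute_list_def len)
    then show m: "mset (perm ms) = mset ms" using inv len by simp
    then have "set (perm ms) = set ms" "sum_list (perm ms) = sum_list ms"
      by (metis set_mset_mset) (metis m sum_mset_sum_list)
    then show "perm ms \<in> ?C" using that by (simp add: comps_def) (simp add: perm_def)
  qed
  have inj: "inj_on perm ?C"
  proof (rule inj_onI)
    fix ms ms' assume ms: "ms \<in> ?C" "ms' \<in> ?C" "perm ms = perm ms'"
    show "ms = ms'"
    proof (rule nth_equalityI)
      fix i assume "i < length ms"
      then have "\<sigma> i < n" using ms permutes_in_image[OF step(1), of i] by auto
      then have "perm ms ! \<sigma> i = perm ms' ! \<sigma> i" "\<sigma> i < n" using ms(3) by auto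
      then show "ms ! i = ms' ! i" using permutes_inverses(2)[OF step(1)] by (simp add: perm_def)
    qed (use ms in simp)
  qed
  then have "perm ` ?C = ?C" using permC fin by (intro endo_inj_surj) auto
  then have bij: "bij_betw perm ?C ?C" using inj by (simp add: bij_betw_def)
  have "comp \<P> (act \<P> n \<sigma> p) (?y ms) - comp \<P> p (?y (perm ms)) \<in> W N" if ms: "ms \<in> ?C" for ms
  proof -
    have len: "length ms = n" and N: "block_start (?y ms) n = N"
      using ms block_start_length[of "?y ms"] by (auto simp: comps_def o_def)
    have bs: "block_start (?y ms) j = (\<Sum>i<j. ms ! i)" if "j \<le> n" for j
      unfolding block_start_def using that len by (intro sum.cong) auto
    obtain \<beta> where \<beta>: "\<beta> permutes {..<\<Sum>i<n. ms ! i}"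
      "\<And>j r. j < n \<Longrightarrow> r < ms ! j \<Longrightarrow> \<beta> ((\<Sum>i<j. ms ! i) + r) = (\<Sum>i | i < n \<and> \<sigma> i < \<sigma> j. ms ! i) + r"
      using ex_blocks_perm[OF step(1), of "\<lambda>i. ms ! i"] by blast
    have \<beta>N: "\<beta> permutes {..<N}" using \<beta>(1) bs[of n] N by simp
    have "comp \<P> (act \<P> n \<sigma> p) (?y ms) =
        act \<P> (block_start (?y ms) n) \<beta> (comp \<P> p (map (\<lambda>i. ?y ms ! inv_into UNIV \<sigma> i) [0..<n]))"
    proof (rule comp_act_left[OF step(2) _ tagged_map[OF y] step(1)])
      fix j r assume jr: "j < n" "r < fst (?y ms ! j)"
      have "(\<Sum>i | i < n \<and> \<sigma> i < \<sigma> j. fst (?y ms ! i)) = (\<Sum>i | i < n \<and> \<sigma> i < \<sigma> j. ms ! i)"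
        using len by (intro sum.cong) auto
      then show "\<beta> (block_start (?y ms) j + r) = (\<Sum>i | i < n \<and> \<sigma> i < \<sigma> j. fst (?y ms ! i)) + r"
        using \<beta>(2)[of j r] jr len by (simp add: bs)
    qed (use len N \<beta>N in auto)
    also have "map (\<lambda>i. ?y ms ! inv_into UNIV \<sigma> i) [0..<n] = ?y (perm ms)"
      using len permutes_in_image[OF inv] by (auto simp: perm_def)
    finally have "comp \<P> (act \<P> n \<sigma> p) (?y ms) = act \<P> N \<beta> (comp \<P> p (?y (perm ms)))" by (simp only: N)
    moreover have "comp \<P> p (?y (perm ms)) \<in> ops \<P> N"
      using comp_closed[of p "?y (perm ms)"] permC[OF ms] step(2) tagged_map[OF y]
      by (simp add: comps_def o_def)
    ultimately show ?thesis using W_gen[OF \<beta>N] by simp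
  qed
  then have "(\<Sum>ms\<in>?C. comp \<P> (act \<P> n \<sigma> p) (?y ms) - comp \<P> p (?y (perm ms))) \<in> W N"
    by (rule V.subspace_sum[OF W_subspace])
  then have D: "(\<Sum>ms\<in>?C. comp \<P> (act \<P> n \<sigma> p) (?y ms)) - (\<Sum>ms\<in>?C. comp \<P> p (?y ms)) \<in> W N"
    using sum.reindex_bij_betw[OF bij, of "\<lambda>ms. comp \<P> p (?y ms)"] by (simp add: sum_subtractf)
  have "comp \<P> (scal \<P> c (act \<P> n \<sigma> p - p) + v) (?y ms) =
      scal \<P> c (comp \<P> (act \<P> n \<sigma> p) (?y ms) - comp \<P> p (?y ms)) + comp \<P> v (?y ms)" if "ms \<in> ?C" for ms
  proof -
    have len: "length (?y ms) = n" using that by simp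
    note t = tagged_map[OF y, of ms]
    have "comp \<P> ((act \<P> n \<sigma> p - p) + p) (?y ms) = comp \<P> (act \<P> n \<sigma> p - p) (?y ms) + comp \<P> p (?y ms)"
      using cl step len t by (intro comp_add_left) auto
    moreover have "comp \<P> (scal \<P> c (act \<P> n \<sigma> p - p) + v) (?y ms) =
        comp \<P> (scal \<P> c (act \<P> n \<sigma> p - p)) (?y ms) + comp \<P> v (?y ms)"
      using cl step len t by (intro comp_add_left) auto
    moreover have "comp \<P> (scal \<P> c (act \<P> n \<sigma> p - p)) (?y ms) = scal \<P> c (comp \<P> (act \<P> n \<sigma> p - p) (?y ms))"
      using cl step len t by (intro comp_scale_left) auto
    ultimately show ?thesis by simp
  qed
  then have "(\<Sum>ms\<in>?C. comp \<P> (scal \<P> c (act \<P> n \<sigma> p - p) + v) (?y ms)) =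
      scal \<P> c ((\<Sum>ms\<in>?C. comp \<P> (act \<P> n \<sigma> p) (?y ms)) - (\<Sum>ms\<in>?C. comp \<P> p (?y ms))) + (\<Sum>ms\<in>?C. comp \<P> v (?y ms))"
    by (simp add: sum.distrib sum_subtractf V.scale_sum_right[symmetric])
  then show ?case
    using D step V.subspace_add[OF W_subspace] V.subspace_scale[OF W_subspace] by simp
qed

text \<open>The sum over compositions is grouped by length, because \<open>dsum_W\<close> needs all
  sequences of one length together.\<close>

lemma diamond_W_left:
  assumes "x \<in> fams" "x' \<in> fams" "y \<in> fams" "\<And>m. x m - x' m \<in> W m"
  shows "diamond \<P> x y N - diamond \<P> x' y N \<in> W N"
proof -
  have d: "x - x' \<in> fams" using assms fams_diff by blast
  have "diamond \<P> ((x - x') + x') y = diamond \<P> (x - x') y + diamond \<P> x' y"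
    by (rule diamond_add_left[OF d assms(2,3)])
  then have "diamond \<P> x y N - diamond \<P> x' y N = diamond \<P> (x - x') y N" by simp
  also have "\<dots> = (\<Sum>n\<le>N. \<Sum>ms | ms \<in> comps N \<and> length ms = n. dterm (x - x') y ms)"
    unfolding diamond_dterm[OF d assms(3)]
    by (rule sum.group[symmetric]) (auto dest: comps_length)
  also have "\<dots> = (\<Sum>n\<le>N. \<Sum>ms | ms \<in> comps N \<and> length ms = n. comp \<P> ((x - x') n) (map (\<lambda>m. (m, y m)) ms))"
    by (intro sum.cong) (auto simp: dterm_def)
  also have "\<dots> \<in> W N"
    using assms(4) by (intro V.subspace_sum[OF W_subspace] dsum_W[OF assms(3)]) simp
  finally show ?thesis .
qed

section \<open>Classes of families modulo the coinvariant kernels\<close>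

lemma coinv_class_eq_iff:
  "coinv_class \<P> U x = coinv_class \<P> U x' \<longleftrightarrow> (\<forall>n. x n - x' n \<in> coinv_kernel \<P> U n)"
proof -
  have "{a + w |w. w \<in> K} = {b + w |w. w \<in> K} \<longleftrightarrow> a - b \<in> K" if K: "V.subspace K" for a b K
  proof
    assume eq: "{a + w |w. w \<in> K} = {b + w |w. w \<in> K}"
    have "a \<in> {a + w |w. w \<in> K}" using V.subspace_0[OF K] by force
    then obtain w where "w \<in> K" "a = b + w" unfolding eq by blast
    then show "a - b \<in> K" by simp
  next
    assume d: "a - b \<in> K"
    show "{a + w |w. w \<in> K} = {b + w |w. w \<in> K}"
    proof (intro equalityI subsetI)
      fix z assume "z \<in> {a + w |w. w \<in> K}"
      then obtain w where "w \<in> K" "z = b + ((a - b) + w)" by force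
      then show "z \<in> {b + w |w. w \<in> K}" using V.subspace_add[OF K d] by blast
    next
      fix z assume "z \<in> {b + w |w. w \<in> K}"
      then obtain w where "w \<in> K" "z = a + (w - (a - b))" by force
      then show "z \<in> {a + w |w. w \<in> K}" using V.subspace_diff[OF K _ d] by blast
    qed
  qed
  from this[OF W_subspace] show ?thesis by (simp add: coinv_class_def fun_eq_iff)
qed

lemma completion_coinv: "completion (coinv \<P> U) = coinv_class \<P> U ` completion U"
proof (intro equalityI subsetI)
  fix X assume "X \<in> completion (coinv \<P> U)"
  then have "\<forall>n. \<exists>p. p \<in> U n \<and> X n = {p + w |w. w \<in> coinv_kernel \<P> U n}"
    by (auto simp: completion_def coinv_def)
  from choice[OF this] obtain x where "\<forall>n. x n \<in> U n \<and> X n = {x n + w |w. w \<in> coinv_kernel \<P> U n}" ..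
  then have "x \<in> completion U" "X = coinv_class \<P> U x" by (auto simp: completion_def coinv_class_def)
  then show "X \<in> coinv_class \<P> U ` completion U" by blast
qed (auto simp: completion_def coinv_def coinv_class_def)

lemma diamond_W:
  assumes "x \<in> fams" "x' \<in> fams" "y \<in> fams" "y' \<in> fams"
    "\<And>m. x m - x' m \<in> W m" "\<And>m. y m - y' m \<in> W m"
  shows "diamond \<P> x y N - diamond \<P> x' y' N \<in> W N"
  using V.subspace_add[OF W_subspace diamond_W_right[OF assms(1,3,4,6)] diamond_W_left[OF assms(1,2,4,5)]]
  by simp

lemma diamond'_W:
  assumes "x \<in> fams" "x' \<in> fams" "y \<in> fams" "y' \<in> fams"
    "\<And>m. x m - x' m \<in> W m" "\<And>m. y m - y' m \<in> W m"
  shows "diamond' \<P> x y N - diamond' \<P> x' y' N \<in> W N"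
proof -
  have "diamond \<P> x (shift y) N - diamond \<P> x' (shift y') N \<in> W N"
    using assms by (intro diamond_W shift_in) (simp_all add: shift_def)
  from V.subspace_add[OF W_subspace assms(6) this] show ?thesis
    using assms by (simp add: diamond'_eq algebra_simps)
qed

lemma coinv_kernel_plus: "coinv_kernel \<P> (plus_ops \<P>) n = (if n \<ge> 2 then W n else {0})"
proof (cases "n \<ge> 2")
  case False
  have z: "act \<P> n \<sigma> 0 = 0" if "\<sigma> permutes {..<n}" for \<sigma>
    using act_add[OF that, of 0 0] by simp
  have "{act \<P> n \<sigma> p - p |\<sigma> p. \<sigma> permutes {..<n} \<and> p \<in> plus_ops \<P> n} \<subseteq> {0}"
    using False z by (auto simp: plus_ops_def)
  then have "coinv_kernel \<P> (plus_ops \<P>) n \<subseteq> {0}"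
    unfolding coinv_kernel_def by (intro V.span_minimal) (auto simp: V.subspace_single_0)
  then show ?thesis using False V.subspace_0[OF W_subspace] by auto
qed (simp add: coinv_kernel_def plus_ops_def)

text \<open>In arities below 2 the difference of the families is 0 and lies in both kernels.
  Congruence for \<open>diamond_plus\<close> can therefore be inherited from
  \<open>diamond'\<close>.\<close>

lemma coinv_class_plus_eq_iff:
  assumes "x \<in> pfams" "x' \<in> pfams"
  shows "coinv_class \<P> (plus_ops \<P>) x = coinv_class \<P> (plus_ops \<P>) x' \<longleftrightarrow>
    coinv_class \<P> (ops \<P>) x = coinv_class \<P> (ops \<P>) x'"
proof -
  have "x n - x' n \<in> coinv_kernel \<P> (plus_ops \<P>) n \<longleftrightarrow> x n - x' n \<in> W n" for n
  proof (cases "n \<ge> 2")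
    case False
    then have "n = 0 \<or> n = 1" by auto
    then have "x n - x' n = 0" using assms fams_0[of x] fams_0[of x'] by (auto simp: pfams_iff)
    then show ?thesis using V.subspace_0[OF W_subspace] by simp
  qed (simp add: coinv_kernel_plus)
  then show ?thesis by (simp add: coinv_class_eq_iff)
qed

end


section \<open>The graded dual\<close>

lemma gd_simps [simp]:
  "zero (graded_dual \<P> U) = (\<lambda>_ _. 0)" "add (graded_dual \<P> U) = (\<lambda>f g n p. f n p + g n p)"
  "module.smult (graded_dual \<P> U) = (\<lambda>c f n p. c * f n p)"
  by (simp_all add: graded_dual_def)

lemma gd_carrier_iff: "f \<in> carrier (graded_dual \<P> U) \<longleftrightarrow> finite {n. f n \<noteq> (\<lambda>_. 0)} \<and>
       (\<forall>n. (\<forall>p\<in>U n. \<forall>q\<in>U n. f n (p + q) = f n p + f n q) \<and>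
            (\<forall>c. \<forall>p\<in>U n. f n (scal \<P> c p) = c * f n p) \<and>
            (\<forall>p. p \<notin> U n \<longrightarrow> f n p = 0))"
  by (simp add: graded_dual_def)

lemma kspace_graded_dual:
  "kspace (graded_dual \<P> U)"
proof (rule kspaceI)
  let ?D = "graded_dual \<P> U"
  fix f assume f: "f \<in> carrier ?D"
  show "c \<odot>\<^bsub>?D\<^esub> f \<in> carrier ?D" for c
  proof -
    have "{n. (\<lambda>p. c * f n p) \<noteq> (\<lambda>_. 0)} \<subseteq> {n. f n \<noteq> (\<lambda>_. 0)}" by auto
    then show ?thesis using f finite_subset by (auto simp: gd_carrier_iff algebra_simps)
  qed
  fix g assume g: "g \<in> carrier ?D"
  have "{n. (\<lambda>p. f n p + g n p) \<noteq> (\<lambda>_. 0)} \<subseteq> {n. f n \<noteq> (\<lambda>_. 0)} \<union> {n. g n \<noteq> (\<lambda>_. 0)}" by auto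
  then have "finite {n. (\<lambda>p. f n p + g n p) \<noteq> (\<lambda>_. 0)}"
    using f g by (auto simp: gd_carrier_iff intro: finite_subset)
  then show "f \<oplus>\<^bsub>?D\<^esub> g \<in> carrier ?D"
    using f g by (auto simp: gd_carrier_iff algebra_simps)
qed (auto simp: gd_carrier_iff algebra_simps)

locale operad_fin = reduced_operad \<P> for \<P> :: "('k::field_char_0, 'a::ab_group_add) operad_data" +
  assumes findim: "finite_dim \<P> (ops \<P> n)"
begin

abbreviation "D \<equiv> graded_dual \<P> (ops \<P>)"

sublocale D: kspace D by (rule kspace_graded_dual)

lemma D_fin: "f \<in> carrier D \<Longrightarrow> finite {n. f n \<noteq> (\<lambda>_. 0)}"
  by (simp add: gd_carrier_iff)

lemma D_lin:
  assumes "f \<in> carrier D"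
  shows "p \<in> ops \<P> n \<Longrightarrow> q \<in> ops \<P> n \<Longrightarrow> f n (p + q) = f n p + f n q"
    and "p \<in> ops \<P> n \<Longrightarrow> f n (scal \<P> c p) = c * f n p"
    and "p \<notin> ops \<P> n \<Longrightarrow> f n p = 0"
  using assms by (auto simp: gd_carrier_iff)

lemma D_zero [simp]: "f \<in> carrier D \<Longrightarrow> f n 0 = 0"
  using D_lin(2)[of f 0 n 0] by simp

lemma D_sum: "f \<in> carrier D \<Longrightarrow> (\<And>i. i \<in> I \<Longrightarrow> p i \<in> ops \<P> n) \<Longrightarrow> f n (sum p I) = (\<Sum>i\<in>I. f n (p i))"
  by (induction I rule: infinite_finite_induct) (simp_all add: D_lin(1) ops_sum)

lemma D_uminus: "f \<in> carrier D \<Longrightarrow> p \<in> ops \<P> n \<Longrightarrow> f n (- p) = - f n p"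
  using D_lin(1)[of f p n "- p"] by (simp add: eq_neg_iff_add_eq_0 add.commute)

lemma D_diff: "f \<in> carrier D \<Longrightarrow> p \<in> ops \<P> n \<Longrightarrow> q \<in> ops \<P> n \<Longrightarrow> f n (p - q) = f n p - f n q"
  using D_lin(1)[of f p n "- q"] by (simp add: D_uminus)

lemma D_bound: "f \<in> carrier D \<Longrightarrow> \<exists>N. \<forall>n>N. f n = (\<lambda>_. 0)"
proof -
  assume "f \<in> carrier D"
  then obtain N where N: "\<forall>n\<in>{n. f n \<noteq> (\<lambda>_. 0)}. n \<le> N"
    using D_fin unfolding finite_nat_set_iff_bounded_le by blast
  have "f n = (\<lambda>_. 0)" if "n > N" for n
  proof (rule ccontr)
    assume "f n \<noteq> (\<lambda>_. 0)"
    then have "n \<le> N" using N by blast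
    with that show False by simp
  qed
  then show ?thesis by blast
qed

text \<open>The support varies with the form; several forms can be compared only over a common
  finite index set.\<close>

lemma eval_superset:
  assumes "finite A" "\<And>n. n \<notin> A \<Longrightarrow> f n = (\<lambda>_. 0)"
  shows "eval f x = (\<Sum>n\<in>A. f n (x n))"
  unfolding eval_def by (rule sum.mono_neutral_left) (use assms in auto)

lemma eval_bound: "\<forall>n>N. f n = (\<lambda>_. 0) \<Longrightarrow> eval f x = (\<Sum>n\<le>N. f n (x n))"
  by (rule eval_superset) auto

lemma eval_linear_form: "linear_form D (\<lambda>f. eval f x)"
  unfolding linear_form_def
proof (intro conjI ballI allI)
  fix f g assume f: "f \<in> carrier D" and g: "g \<in> carrier D"
  let ?A = "{n. f n \<noteq> (\<lambda>_. 0)} \<union> {n. g n \<noteq> (\<lambda>_. 0)}"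
  have "finite ?A" using D_fin f g by blast
  then have "eval h x = (\<Sum>n\<in>?A. h n (x n))" if "\<And>n. n \<notin> ?A \<Longrightarrow> h n = (\<lambda>_. 0)" for h
    using that by (rule eval_superset)
  from this[of f] this[of g] this[of "\<lambda>n p. f n p + g n p"]
  show "eval (f \<oplus>\<^bsub>D\<^esub> g) x = eval f x + eval g x" by (simp add: sum.distrib)
next
  fix c f assume "f \<in> carrier D"
  then have "eval (\<lambda>n p. c * f n p) x = (\<Sum>n | f n \<noteq> (\<lambda>_. 0). c * f n (x n))"
    by (intro eval_superset D_fin) auto
  then show "eval (c \<odot>\<^bsub>D\<^esub> f) x = c * eval f x" by (simp add: eval_def sum_distrib_left)
qed

lemma eval_add: "f \<in> carrier D \<Longrightarrow> x \<in> fams \<Longrightarrow> y \<in> fams \<Longrightarrow> eval f (x + y) = eval f x + eval f y"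
  unfolding eval_def by (simp add: D_lin(1) completionD sum.distrib)

lemma eval_scale: "f \<in> carrier D \<Longrightarrow> x \<in> fams \<Longrightarrow> eval f (\<lambda>n. scal \<P> c (x n)) = c * eval f x"
  unfolding eval_def by (simp add: D_lin(2) completionD sum_distrib_left)

lemma eval_zero [simp]: "f \<in> carrier D \<Longrightarrow> eval f 0 = 0" "f \<in> carrier D \<Longrightarrow> eval f (\<lambda>_. 0) = 0"
  by (simp_all add: eval_def)

lemma eval_cong: "\<forall>n>N. f n = (\<lambda>_. 0) \<Longrightarrow> (\<And>n. n \<le> N \<Longrightarrow> x n = y n) \<Longrightarrow> eval f x = eval f y"
  by (simp add: eval_bound)

lemma eval_sum: "f \<in> carrier D \<Longrightarrow> (\<And>i. i \<in> I \<Longrightarrow> x i \<in> fams) \<Longrightarrow>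
    eval f (\<lambda>n. \<Sum>i\<in>I. x i n) = (\<Sum>i\<in>I. eval f (x i))"
proof (induction I rule: infinite_finite_induct)
  case (insert i I)
  have "eval f (x i + (\<lambda>n. \<Sum>i\<in>I. x i n)) = eval f (x i) + eval f (\<lambda>n. \<Sum>i\<in>I. x i n)"
    by (rule eval_add) (use insert in \<open>auto intro: fams_sum\<close>)
  with insert show ?case by (simp add: plus_fun_def)
qed simp_all

lemma finite_fams_sub: "finite_fams \<P> \<subseteq> fams"
  by (auto simp: finite_fams_def)


subsection \<open>Dual bases\<close>

definition basis :: "nat \<Rightarrow> 'a set"
  where "basis n = (SOME B. finite B \<and> B \<subseteq> ops \<P> n \<and> V.independent B \<and> V.span B = ops \<P> n)"

lemma basis: "finite (basis n)" "basis n \<subseteq> ops \<P> n" "V.independent (basis n)" "V.span (basis n) = ops \<P> n"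
proof -
  obtain B0 where B0: "finite B0" "V.span B0 = ops \<P> n" using findim[of n] by (auto simp: finite_dim_def)
  obtain B where B: "B \<subseteq> ops \<P> n" "V.independent B" "ops \<P> n \<subseteq> V.span B"
    using V.maximal_independent_subset by blast
  have "finite B" using V.independent_span_bound[OF B0(1) B(2)] B(1) B0(2) by blast
  moreover have "V.span B = ops \<P> n" using B V.span_minimal[OF B(1) ops_subspace] by blast
  ultimately have "\<exists>B. finite B \<and> B \<subseteq> ops \<P> n \<and> V.independent B \<and> V.span B = ops \<P> n" using B by blast
  from someI_ex[OF this] show "finite (basis n)" "basis n \<subseteq> ops \<P> n" "V.independent (basis n)" "V.span (basis n) = ops \<P> n"
    unfolding basis_def by auto
qed

lemma basis_in: "b \<in> basis n \<Longrightarrow> b \<in> ops \<P> n"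
  using basis(2) by blast

definition coord :: "nat \<Rightarrow> 'a \<Rightarrow> 'a \<Rightarrow> 'k"
  where "coord n b p = (if p \<in> ops \<P> n then V.representation (basis n) p b else 0)"

lemma coord_expand: "p \<in> ops \<P> n \<Longrightarrow> p = (\<Sum>b\<in>basis n. scal \<P> (coord n b p) b)"
  using V.sum_representation_eq[OF basis(3) _ basis(1) order.refl, of p n]
  by (simp add: coord_def basis(4))

text \<open>Basis vectors are indexed together with their arity, since the spaces \<open>ops\<close>
  may overlap; \<open>be\<close> gives the corresponding families and \<open>bd\<close> the dual
  forms.\<close>

definition idx :: "nat \<Rightarrow> (nat \<times> 'a) set" where "idx N = (SIGMA n:{..N}. basis n)"
definition be :: "nat \<times> 'a \<Rightarrow> 'a fam" where "be i = (\<lambda>m. if m = fst i then snd i else 0)"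
definition bd :: "nat \<times> 'a \<Rightarrow> ('k, 'a) dual" where "bd i = (\<lambda>m. if m = fst i then coord m (snd i) else (\<lambda>_. 0))"

lemma finite_idx [simp]: "finite (idx N)"
  by (auto simp: idx_def intro!: finite_SigmaI basis)

lemma be_in: "i \<in> idx N \<Longrightarrow> be i \<in> finite_fams \<P>"
proof -
  assume "i \<in> idx N"
  then have "snd i \<in> ops \<P> (fst i)" by (auto simp: idx_def basis_in)
  moreover have "{n. be i n \<noteq> 0} \<subseteq> {fst i}" by (auto simp: be_def)
  ultimately show ?thesis by (auto simp: finite_fams_def completion_def be_def intro: finite_subset)
qed

lemma bd_in: "bd i \<in> carrier D"
proof -
  have "{n. bd i n \<noteq> (\<lambda>_. 0)} \<subseteq> {fst i}" by (auto simp: bd_def)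
  moreover have "coord n b (p + q) = coord n b p + coord n b q" "coord n b (scal \<P> c p) = c * coord n b p"
    if "p \<in> ops \<P> n" "q \<in> ops \<P> n" for n b p q c
    using that V.representation_add[OF basis(3)] V.representation_scale[OF basis(3)]
    by (simp_all add: coord_def basis(4))
  ultimately show ?thesis
    by (auto simp: gd_carrier_iff bd_def coord_def intro: finite_subset)
qed

lemma eval_be: "eval f (be (n, b)) = f n b" if f: "f \<in> carrier D"
proof -
  obtain N where N: "\<forall>m>N. f m = (\<lambda>_. 0)" using D_bound[OF f] by blast
  have "eval f (be (n, b)) = (\<Sum>m\<le>N. if m = n then f n b else 0)"
    unfolding eval_bound[OF N] by (intro sum.cong refl) (simp add: be_def f)
  also have "\<dots> = f n b" using N by (cases "n \<le> N") (auto simp: sum.delta)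
  finally show ?thesis .
qed

lemma eval_bd: "eval (bd (n, b)) x = coord n b (x n)"
  by (subst eval_superset[of "{n}"]) (auto simp: bd_def)

lemma sum_idx: "(\<Sum>i\<in>idx N. g i) = (\<Sum>n\<le>N. \<Sum>b\<in>basis n. g (n, b))"
  unfolding idx_def by (subst sum.Sigma) (auto intro: basis)

lemma D_at: "f \<in> carrier D \<Longrightarrow> p \<in> ops \<P> n \<Longrightarrow> f n p = (\<Sum>b\<in>basis n. coord n b p * f n b)"
proof -
  assume f: "f \<in> carrier D" and p: "p \<in> ops \<P> n"
  have "f n p = f n (\<Sum>b\<in>basis n. scal \<P> (coord n b p) b)" using coord_expand[OF p] by simp
  also have "\<dots> = (\<Sum>b\<in>basis n. f n (scal \<P> (coord n b p) b))"
    by (intro D_sum f) (simp add: basis_in)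
  also have "\<dots> = (\<Sum>b\<in>basis n. coord n b p * f n b)"
    by (intro sum.cong) (auto simp: D_lin(2)[OF f] basis_in)
  finally show ?thesis .
qed

lemma dual_expand:
  assumes f: "f \<in> carrier D" and N: "\<forall>n>N. f n = (\<lambda>_. 0)"
  shows "f = (\<lambda>n p. \<Sum>i\<in>idx N. eval f (be i) * bd i n p)"
proof (intro ext)
  fix n p
  have "(\<Sum>i\<in>idx N. eval f (be i) * bd i n p) = (\<Sum>m\<le>N. if m = n then (\<Sum>b\<in>basis n. f n b * coord n b p) else 0)"
    unfolding sum_idx by (intro sum.cong refl) (auto simp: eval_be f bd_def)
  also have "\<dots> = (if n \<le> N then (\<Sum>b\<in>basis n. f n b * coord n b p) else 0)" by (simp add: sum.delta)
  also have "\<dots> = f n p"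
    using N D_at[OF f, of p n] D_lin(3)[OF f, of p n]
    by (cases "p \<in> ops \<P> n") (auto simp: mult.commute coord_def)
  finally show "f n p = (\<Sum>i\<in>idx N. eval f (be i) * bd i n p)" by simp
qed

lemma fam_expand:
  assumes "x \<in> fams"
  shows "(\<lambda>n. if n \<le> N then x n else 0) = (\<lambda>n. \<Sum>i\<in>idx N. scal \<P> (eval (bd i) x) (be i n))"
proof
  fix n
  have "(\<Sum>i\<in>idx N. scal \<P> (eval (bd i) x) (be i n)) =
      (\<Sum>m\<le>N. if m = n then (\<Sum>b\<in>basis n. scal \<P> (coord n b (x n)) b) else 0)"
    unfolding sum_idx by (intro sum.cong refl) (auto simp: eval_bd be_def)
  also have "\<dots> = (if n \<le> N then x n else 0)"
    using coord_expand[OF completionD[OF assms, of n]] by (simp add: sum.delta)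
  finally show "(if n \<le> N then x n else 0) = (\<Sum>i\<in>idx N. scal \<P> (eval (bd i) x) (be i n))" by simp
qed

lemma D_sum_in: "(\<And>i. i \<in> I \<Longrightarrow> g i \<in> carrier D) \<Longrightarrow> (\<lambda>n p. \<Sum>i\<in>I. c i * g i n p) \<in> carrier D"
proof (induction I rule: infinite_finite_induct)
  case (insert i I)
  then have "c i \<odot>\<^bsub>D\<^esub> g i \<oplus>\<^bsub>D\<^esub> (\<lambda>n p. \<Sum>i\<in>I. c i * g i n p) \<in> carrier D"
    by (intro D.a_closed D.smult_closed) auto
  with insert show ?case by simp
qed (use D.zero_closed in simp_all)

lemma linear_form_sum_D: "linear_form D lf \<Longrightarrow> (\<And>i. i \<in> I \<Longrightarrow> g i \<in> carrier D) \<Longrightarrow>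
    lf (\<lambda>n p. \<Sum>i\<in>I. c i * g i n p) = (\<Sum>i\<in>I. c i * lf (g i))"
proof (induction I rule: infinite_finite_induct)
  case (insert i I)
  have "lf (c i \<odot>\<^bsub>D\<^esub> g i \<oplus>\<^bsub>D\<^esub> (\<lambda>n p. \<Sum>i\<in>I. c i * g i n p)) = c i * lf (g i) + lf (\<lambda>n p. \<Sum>i\<in>I. c i * g i n p)"
    using insert.prems D_sum_in[of I g c] linear_formD[OF insert.prems(1)] D.smult_closed[of "g i" "c i"] by auto
  with insert show ?case by simp
qed (use D.linear_form_at_zero in simp_all)

text \<open>The dual basis prescribes the coordinates of \<open>x\<close> arity by arity. No
  condition links different arities, since a form in the graded dual involves only finitely many of
  them; so \<open>x\<close> is found in the product rather than in the sum of the spaces.\<close>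

lemma linear_form_is_eval:
  assumes "linear_form D lf"
  obtains x where "x \<in> fams" "\<And>f. f \<in> carrier D \<Longrightarrow> lf f = eval f x"
proof
  define x where "x n = (\<Sum>b\<in>basis n. scal \<P> (lf (bd (n, b))) b)" for n
  show "x \<in> fams" by (auto simp: completion_def x_def basis_in intro!: ops_sum)
  fix f assume f: "f \<in> carrier D"
  obtain N where N: "\<forall>m>N. f m = (\<lambda>_. 0)" using D_bound[OF f] by blast
  have "lf f = lf (\<lambda>n p. \<Sum>i\<in>idx N. eval f (be i) * bd i n p)" using dual_expand[OF f N] by simp
  also have "\<dots> = (\<Sum>i\<in>idx N. eval f (be i) * lf (bd i))"
    by (rule linear_form_sum_D[OF assms bd_in])
  also have "\<dots> = (\<Sum>n\<le>N. \<Sum>b\<in>basis n. f n b * lf (bd (n, b)))" by (simp add: sum_idx eval_be f)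
  also have "\<dots> = (\<Sum>n\<le>N. f n (x n))"
  proof (rule sum.cong[OF refl])
    fix n
    have "f n (x n) = (\<Sum>b\<in>basis n. f n (scal \<P> (lf (bd (n, b))) b))"
      unfolding x_def by (intro D_sum f) (simp add: basis_in)
    also have "\<dots> = (\<Sum>b\<in>basis n. f n b * lf (bd (n, b)))"
      by (intro sum.cong) (auto simp: D_lin(2)[OF f] basis_in)
    finally show "(\<Sum>b\<in>basis n. f n b * lf (bd (n, b))) = f n (x n)" by simp
  qed
  finally show "lf f = eval f x" by (simp add: eval_bound[OF N])
qed

lemma eval_inj:
  assumes "x \<in> fams" "y \<in> fams" "\<And>f. f \<in> carrier D \<Longrightarrow> eval f x = eval f y" shows "x = y"
proof
  fix n
  have "coord n b (x n) = coord n b (y n)" for b using assms(3)[OF bd_in, of "(n, b)"] by (simp add: eval_bd)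
  then show "x n = y n"
    using coord_expand[OF completionD[OF assms(1), of n]] coord_expand[OF completionD[OF assms(2), of n]] by simp
qed


subsection \<open>Averaging over the symmetric groups\<close>

text \<open>The Reynolds operator; characteristic 0 makes \<open>fact n\<close> invertible.
  \<open>Rey\<close> is its transpose on forms.\<close>

definition avg :: "nat \<Rightarrow> 'a \<Rightarrow> 'a"
  where "avg n p = scal \<P> (inverse (fact n)) (\<Sum>\<sigma> | \<sigma> permutes {..<n}. act \<P> n \<sigma> p)"

definition avgf :: "'a fam \<Rightarrow> 'a fam" where "avgf x = (\<lambda>n. avg n (x n))"

definition Rey :: "('k, 'a) dual \<Rightarrow> ('k, 'a) dual"
  where "Rey f = (\<lambda>n p. if p \<in> ops \<P> n then f n (avg n p) else 0)"

lemma avg_in: "p \<in> ops \<P> n \<Longrightarrow> avg n p \<in> ops \<P> n"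
  unfolding avg_def by (intro ops_closed(3) ops_sum act_closed) auto

lemma avgf_in: "x \<in> fams \<Longrightarrow> avgf x \<in> fams"
  by (simp add: completion_def avgf_def avg_in)

lemma card_perms: "card {\<sigma>. \<sigma> permutes {..<n}} = fact n"
  by (rule card_permutations) auto

text \<open>The difference is the mean of the differences
  \<open>p - act \<P> n \<sigma> p\<close>.\<close>

lemma avg_W: "p \<in> ops \<P> n \<Longrightarrow> p - avg n p \<in> W n"
proof -
  assume p: "p \<in> ops \<P> n"
  let ?S = "{\<sigma>. \<sigma> permutes {..<n}}"
  have "(\<Sum>\<sigma>\<in>?S. p) = scal \<P> (fact n) p"
    using V.scale_sum_left[of "\<lambda>_. 1" ?S p] by (simp add: card_perms)
  then have "p = scal \<P> (inverse (fact n)) (\<Sum>\<sigma>\<in>?S. p)" by simp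
  then have "p - avg n p = scal \<P> (inverse (fact n)) (\<Sum>\<sigma>\<in>?S. p - act \<P> n \<sigma> p)"
    unfolding avg_def sum_subtractf V.scale_right_diff_distrib by simp
  moreover have "p - act \<P> n \<sigma> p \<in> W n" if "\<sigma> permutes {..<n}" for \<sigma>
    using V.subspace_neg[OF W_subspace W_gen[OF that p]] by simp
  ultimately show ?thesis
    by (simp only:) (intro V.subspace_scale[OF W_subspace] V.subspace_sum[OF W_subspace], simp)
qed

lemma avg_act: "\<tau> permutes {..<n} \<Longrightarrow> p \<in> ops \<P> n \<Longrightarrow> avg n (act \<P> n \<tau> p) = avg n p"
proof -
  assume \<tau>: "\<tau> permutes {..<n}" and p: "p \<in> ops \<P> n"
  have "(\<Sum>\<sigma> | \<sigma> permutes {..<n}. act \<P> n \<sigma> (act \<P> n \<tau> p)) = (\<Sum>\<sigma> | \<sigma> permutes {..<n}. act \<P> n (\<tau> \<circ> \<sigma>) p)"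
    by (intro sum.cong refl act_act[OF \<tau> _ p]) simp
  also have "\<dots> = (\<Sum>\<sigma> | \<sigma> permutes {..<n}. act \<P> n \<sigma> p)"
    using setum_permutations_compose_left[OF \<tau>, of "\<lambda>\<sigma>. act \<P> n \<sigma> p"] by simp
  finally show ?thesis by (simp add: avg_def)
qed

lemma avg_add: "p \<in> ops \<P> n \<Longrightarrow> q \<in> ops \<P> n \<Longrightarrow> avg n (p + q) = avg n p + avg n q"
  and avg_scale: "p \<in> ops \<P> n \<Longrightarrow> avg n (scal \<P> c p) = scal \<P> c (avg n p)"
  by (simp_all add: avg_def act_add act_scale sum.distrib V.scale_right_distrib V.scale_sum_right[symmetric] mult.commute)

lemma inv_dual_sub: "inv_dual \<P> U \<subseteq> carrier (graded_dual \<P> U)"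
  by (auto simp: inv_dual_def)

lemma Rey_inv: "f \<in> carrier D \<Longrightarrow> Rey f \<in> inv_dual \<P> (ops \<P>)"
proof -
  assume f: "f \<in> carrier D"
  have "{n. Rey f n \<noteq> (\<lambda>_. 0)} \<subseteq> {n. f n \<noteq> (\<lambda>_. 0)}" by (auto simp: Rey_def)
  then have "Rey f \<in> carrier D"
    using D_fin[OF f] by (auto simp: gd_carrier_iff Rey_def avg_add avg_scale avg_in D_lin[OF f] intro: finite_subset)
  then show ?thesis by (simp add: inv_dual_def Rey_def avg_act act_closed)
qed

lemma eval_Rey: "f \<in> carrier D \<Longrightarrow> x \<in> fams \<Longrightarrow> eval (Rey f) x = eval f (avgf x)"
proof -
  assume f: "f \<in> carrier D" and x: "x \<in> fams"
  obtain N where N: "\<forall>m>N. f m = (\<lambda>_. 0)" using D_bound[OF f] by blast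
  then have "\<forall>m>N. Rey f m = (\<lambda>_. 0)" by (auto simp: Rey_def)
  then show ?thesis using N x by (simp add: eval_bound Rey_def avgf_def completionD)
qed

lemma inv_W: "f \<in> inv_dual \<P> (ops \<P>) \<Longrightarrow> w \<in> W n \<Longrightarrow> f n w = 0"
proof -
  assume f: "f \<in> inv_dual \<P> (ops \<P>)" and w: "w \<in> W n"
  have fD: "f \<in> carrier D" using f inv_dual_sub by blast
  show "f n w = 0" using w
  proof (induction rule: W_induct)
    case (step c \<sigma> p v)
    have "f n (act \<P> n \<sigma> p) = f n p" using f step by (auto simp: inv_dual_def)
    with step show ?case by (simp add: D_lin[OF fD] D_diff[OF fD] act_closed)
  qed (simp add: fD)
qed

lemma inv_eval_cong:
  assumes "f \<in> inv_dual \<P> (ops \<P>)" "x \<in> fams" "y \<in> fams" "\<And>n. x n - y n \<in> W n"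
  shows "eval f x = eval f y"
proof -
  have fD: "f \<in> carrier D" using assms inv_dual_sub by blast
  have "f n (x n) = f n (y n)" for n
    using inv_W[OF assms(1,4), of n] D_diff[OF fD completionD[OF assms(2)] completionD[OF assms(3)]] by simp
  then show ?thesis by (simp add: eval_def)
qed

text \<open>The forms \<open>Rey f\<close> are invariant and evaluate as \<open>f\<close> at the
  average, so invariant forms determine \<open>avgf x\<close>; and \<open>x\<close> differs from
  \<open>avgf x\<close> by elements of the kernel. This is the duality between invariants and
  coinvariants.\<close>

lemma coinv_class_iff_inv:
  assumes "x \<in> fams" "y \<in> fams"
  shows "coinv_class \<P> (ops \<P>) x = coinv_class \<P> (ops \<P>) y \<longleftrightarrow>
    (\<forall>f\<in>inv_dual \<P> (ops \<P>). eval f x = eval f y)"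
proof
  assume "coinv_class \<P> (ops \<P>) x = coinv_class \<P> (ops \<P>) y"
  then show "\<forall>f\<in>inv_dual \<P> (ops \<P>). eval f x = eval f y"
    using inv_eval_cong assms by (auto simp: coinv_class_eq_iff)
next
  assume eq: "\<forall>f\<in>inv_dual \<P> (ops \<P>). eval f x = eval f y"
  have "avgf x = avgf y"
    by (rule eval_inj) (use eq assms Rey_inv in \<open>auto simp: avgf_in eval_Rey[symmetric]\<close>)
  then have "avg n (x n) = avg n (y n)" for n by (simp add: avgf_def fun_eq_iff)
  then have "x n - y n \<in> W n" for n
    using V.subspace_diff[OF W_subspace avg_W[OF completionD[OF assms(1), of n]] avg_W[OF completionD[OF assms(2), of n]]]
    by simp
  then show "coinv_class \<P> (ops \<P>) x = coinv_class \<P> (ops \<P>) y" by (simp add: coinv_class_eq_iff)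
qed

end


section \<open>Coproducts on the tensor algebra of the graded dual\<close>

text \<open>Exhibits the convolution of two characters as the coproduct followed by an algebra
  morphism, so that it can be computed on generators.\<close>

lemma char_tensor_alg_hom:
  assumes "kalg A" "\<chi> \<in> alg_hom A scalars" "\<psi> \<in> alg_hom A scalars"
  shows "(\<lambda>t. t (\<lambda>u v. \<chi> u * \<psi> v)) \<in> alg_hom (tensor_prod A A) scalars"
proof (rule alg_homI)
  interpret A: kalg A by fact
  interpret two_algs A A by unfold_locales
  have bil: "(\<lambda>u v. \<chi> u * \<psi> v) \<in> bilinear_forms A A"
    by (intro bil_prod alg_hom_scalars_linear assms)
  show "\<one>\<^bsub>tensor_prod A A\<^esub> (\<lambda>u v. \<chi> u * \<psi> v) = \<one>\<^bsub>scalars\<^esub>"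
    using bil alg_homD(4)[OF assms(2)] alg_homD(4)[OF assms(3)] by (simp add: pure_tensor_def)
  fix s t assume "s \<in> carrier (tensor_prod A A)" "t \<in> carrier (tensor_prod A A)"
  then have s: "s \<in> tensors A A (carrier A) (carrier A)" and t: "t \<in> tensors A A (carrier A) (carrier A)" by auto
  have "(s \<otimes>\<^bsub>tensor_prod A A\<^esub> t) (\<lambda>u v. \<chi> u * \<psi> v) =
      s (\<lambda>a b. t (\<lambda>c d. \<chi> (a \<otimes>\<^bsub>A\<^esub> c) * \<psi> (b \<otimes>\<^bsub>A\<^esub> d)))" using bil by simp
  also have "\<dots> = s (\<lambda>a b. t (\<lambda>u v. \<chi> u * \<psi> v) * (\<chi> a * \<psi> b))"
  proof (rule tensors_cong[OF s tensor_mult_inner[OF t bil] bil_scale[OF bil]])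
    fix a b assume ab: "a \<in> carrier A" "b \<in> carrier A"
    have "t (\<lambda>c d. \<chi> (a \<otimes>\<^bsub>A\<^esub> c) * \<psi> (b \<otimes>\<^bsub>A\<^esub> d)) = t (\<lambda>c d. (\<chi> a * \<psi> b) * (\<chi> c * \<psi> d))"
      using ab by (intro tensors_cong[OF t bil_shift[OF bil] bil_scale[OF bil]])
        (simp_all add: alg_homD(3)[OF assms(2)] alg_homD(3)[OF assms(3)])
    also have "\<dots> = (\<chi> a * \<psi> b) * t (\<lambda>u v. \<chi> u * \<psi> v)" by (rule tensors_scale_form[OF t bil])
    finally show "t (\<lambda>c d. \<chi> (a \<otimes>\<^bsub>A\<^esub> c) * \<psi> (b \<otimes>\<^bsub>A\<^esub> d)) = t (\<lambda>u v. \<chi> u * \<psi> v) * (\<chi> a * \<psi> b)"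
      by (simp add: mult.commute)
  qed
  also have "\<dots> = t (\<lambda>u v. \<chi> u * \<psi> v) * s (\<lambda>u v. \<chi> u * \<psi> v)" by (rule tensors_scale_form[OF s bil])
  finally show "(s \<otimes>\<^bsub>tensor_prod A A\<^esub> t) (\<lambda>u v. \<chi> u * \<psi> v) =
      s (\<lambda>u v. \<chi> u * \<psi> v) \<otimes>\<^bsub>scalars\<^esub> t (\<lambda>u v. \<chi> u * \<psi> v)" by (simp add: mult.commute)
qed simp_all

text \<open>The multilinear form that induces the character of \<open>x\<close>;
  \<open>word_form (replicate k x)\<close> is its part of degree \<open>k\<close>.\<close>

definition char_form :: "'a fam \<Rightarrow> ('k::field, 'a) dual list \<Rightarrow> 'k"
  where "char_form x fs = (\<Prod>f\<leftarrow>fs. eval f x)"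

lemma word_form_simps [simp]:
  "word_form [] [] = 1" "word_form [] (f # fs) = 0" "word_form (x # xs) [] = 0"
  "word_form (x # xs) (f # fs) = eval f x * word_form xs fs"
  by (simp_all add: word_form_def)

lemma word_form_length: "length fs \<noteq> length xs \<Longrightarrow> word_form xs fs = 0"
  by (simp add: word_form_def)

lemma word_form_replicate: "word_form (replicate k x) fs = (if length fs = k then char_form x fs else 0)"
proof (induction fs arbitrary: k)
  case Nil
  then show ?case by (cases k) (simp_all add: char_form_def)
next
  case (Cons f fs)
  then show ?case by (cases k) (simp_all add: char_form_def)
qed

lemma word_form_append:
  "length fs = length xs \<Longrightarrow> word_form (xs @ ys) (fs @ gs) = word_form xs fs * word_form ys gs"
  by (induction fs xs rule: list_induct2) (simp_all add: mult.assoc)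

lemma lists_length_Suc: "{w. set w \<subseteq> A \<and> length w = Suc n} = set_Cons A {w. set w \<subseteq> A \<and> length w = n}"
  by (auto simp: set_Cons_def length_Suc_conv)

context operad_fin
begin

abbreviation "T \<equiv> tensor_algebra D"
abbreviation "mf \<equiv> multilinear_forms D"
abbreviation "gn \<equiv> \<lambda>f. word D [f]"

sublocale T: kalg T by (rule D.kalg_TV)
sublocale TT: two_algs T T by unfold_locales

lemma char_form_mf: "char_form x \<in> mf"
proof -
  have "linear_form D (\<lambda>v. char_form x u * (eval v x * char_form x w))" for u w
    by (intro linear_form_scale linear_form_scale' eval_linear_form)
  then show ?thesis by (simp add: multilinear_forms_def char_form_def)
qed

lemma word_form_mf: "word_form X \<in> mf"
proof -
  have "linear_form D (\<lambda>v. word_form X (u @ v # w))" for u w :: "('k, 'a) dual list"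
  proof (cases "length u < length X")
    case True
    define X1 y X2 where X: "X1 = take (length u) X" "y = X ! length u" "X2 = drop (Suc (length u)) X"
    have "X = X1 @ y # X2" using True by (simp add: X id_take_nth_drop)
    moreover have "length u = length X1" using True by (simp add: X)
    ultimately have "(\<lambda>v. word_form X (u @ v # w)) = (\<lambda>v. word_form X1 u * (eval v y * word_form X2 w))"
      by (simp add: word_form_append)
    then show ?thesis by (simp add: linear_form_scale linear_form_scale' eval_linear_form)
  next
    case False
    then have "(\<lambda>v. word_form X (u @ v # w)) = (\<lambda>v. 0)" by (intro ext word_form_length) auto
    then show ?thesis by (simp add: linear_form_zero)
  qed
  then show ?thesis by (simp add: multilinear_forms_def)
qed

lemma eval_mf_linear: "\<phi> \<in> mf \<Longrightarrow> linear_form T (\<lambda>a. a \<phi>)"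
  by (auto simp: linear_form_def)

section \<open>Finiteness bounds and coordinates in the tensor algebra\<close>

definition DN :: "nat \<Rightarrow> ('k, 'a) dual set" where "DN N = {f \<in> carrier D. \<forall>n>N. f n = (\<lambda>_. 0)}"

lemma DN_mono: "N \<le> N' \<Longrightarrow> DN N \<subseteq> DN N'" by (auto simp: DN_def)

lemma list_in_DN: "fs \<in> lists (carrier D) \<Longrightarrow> \<exists>N. fs \<in> lists (DN N)"
proof (induction fs)
  case (Cons f fs)
  then obtain N where N: "fs \<in> lists (DN N)" by auto
  obtain N' where "f \<in> DN N'" using D_bound[of f] Cons.prems by (auto simp: DN_def)
  then show ?case
    using N DN_mono[of N "max N N'"] DN_mono[of N' "max N N'"] by (intro exI[of _ "max N N'"]) auto
qed simp

text \<open>An element of \<open>T\<close> is a finite combination of words whose letters have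
  bounded arity; a single \<open>N\<close> bounds all lengths and arities.\<close>

lemma ta_bounded:
  assumes "a \<in> carrier T"
  shows "\<exists>N. \<forall>\<phi>\<in>mf. \<forall>\<psi>\<in>mf. (\<forall>fs\<in>lists (DN N). length fs \<le> N \<longrightarrow> \<phi> fs = \<psi> fs) \<longrightarrow> a \<phi> = a \<psi>"
  using assms
proof (induction rule: D.ta_induct)
  case (add c vs a)
  then obtain N where N: "\<And>\<phi> \<psi>. \<phi> \<in> mf \<Longrightarrow> \<psi> \<in> mf \<Longrightarrow> (\<forall>fs\<in>lists (DN N). length fs \<le> N \<longrightarrow> \<phi> fs = \<psi> fs) \<Longrightarrow> a \<phi> = a \<psi>"
    by blast
  obtain N' where N': "vs \<in> lists (DN N')" using list_in_DN add by blast
  let ?M = "max (max N N') (length vs)"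
  have mono: "lists (DN N) \<subseteq> lists (DN ?M)" "lists (DN N') \<subseteq> lists (DN ?M)"
    by (intro lists_mono DN_mono; simp)+
  show ?case
  proof (intro exI[of _ ?M] ballI impI)
    fix \<phi> \<psi> assume mf: "\<phi> \<in> mf" "\<psi> \<in> mf" and eq: "\<forall>fs\<in>lists (DN ?M). length fs \<le> ?M \<longrightarrow> \<phi> fs = \<psi> fs"
    have "a \<phi> = a \<psi>"
    proof (rule N[OF mf], intro ballI impI)
      fix fs assume "fs \<in> lists (DN N)" "length fs \<le> N"
      then show "\<phi> fs = \<psi> fs" using eq mono(1) by (meson le_max_iff_disj subsetD)
    qed
    moreover have "vs \<in> lists (DN ?M)" using N' mono(2) by blast
    then have "\<phi> vs = \<psi> vs" using eq by simp
    ultimately show "(c \<odot>\<^bsub>T\<^esub> word D vs \<oplus>\<^bsub>T\<^esub> a) \<phi> = (c \<odot>\<^bsub>T\<^esub> word D vs \<oplus>\<^bsub>T\<^esub> a) \<psi>"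
      using mf by (simp add: D.word_eval)
  qed
qed auto

lemma ta_boundedE:
  assumes "a \<in> carrier T"
  obtains N where "\<And>N' \<phi> \<psi>. N \<le> N' \<Longrightarrow> \<phi> \<in> mf \<Longrightarrow> \<psi> \<in> mf \<Longrightarrow>
    (\<And>fs. fs \<in> lists (DN N') \<Longrightarrow> length fs \<le> N' \<Longrightarrow> \<phi> fs = \<psi> fs) \<Longrightarrow> a \<phi> = a \<psi>"
proof -
  obtain N where N: "\<And>\<phi> \<psi>. \<phi> \<in> mf \<Longrightarrow> \<psi> \<in> mf \<Longrightarrow> (\<forall>fs\<in>lists (DN N). length fs \<le> N \<longrightarrow> \<phi> fs = \<psi> fs) \<Longrightarrow> a \<phi> = a \<psi>"
    using ta_bounded[OF assms] by blast
  show thesis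
  proof (rule that)
    fix N' \<phi> \<psi> assume *: "N \<le> N'" "\<phi> \<in> mf" "\<psi> \<in> mf"
      "\<And>fs. fs \<in> lists (DN N') \<Longrightarrow> length fs \<le> N' \<Longrightarrow> \<phi> fs = \<psi> fs"
    show "a \<phi> = a \<psi>"
      using lists_mono[OF DN_mono[OF *(1)]] by (intro N *(2,3) ballI impI *(4)) (use *(1) in auto)
  qed
qed

lemma char_form_eq_sum: "length fs \<le> N \<Longrightarrow> char_form x fs = (\<Sum>k\<le>N. word_form (replicate k x) fs)"
  by (simp add: word_form_replicate)

text \<open>The form of the character is an infinite sum of its homogeneous parts; on a given
  element the bound on lengths cuts it off, uniformly in \<open>x\<close>.\<close>

lemma ta_char_form:
  assumes "a \<in> carrier T"
  obtains N where "\<And>N' x. N \<le> N' \<Longrightarrow> a (char_form x) = (\<Sum>k\<le>N'. a (word_form (replicate k x)))"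
proof -
  obtain N where N: "\<And>N' \<phi> \<psi>. N \<le> N' \<Longrightarrow> \<phi> \<in> mf \<Longrightarrow> \<psi> \<in> mf \<Longrightarrow>
    (\<And>fs. fs \<in> lists (DN N') \<Longrightarrow> length fs \<le> N' \<Longrightarrow> \<phi> fs = \<psi> fs) \<Longrightarrow> a \<phi> = a \<psi>"
    using ta_boundedE[OF assms] by blast
  show thesis
  proof (rule that)
    fix N' x assume "N \<le> N'"
    then have "a (char_form x) = a (\<lambda>fs. \<Sum>k\<le>N'. word_form (replicate k x) fs)"
      by (rule N) (auto intro: char_form_mf word_form_mf mf_sum simp: char_form_eq_sum)
    then show "a (char_form x) = (\<Sum>k\<le>N'. a (word_form (replicate k x)))"
      by (simp add: ta_sum_form[OF assms] word_form_mf)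
  qed
qed

definition wds :: "nat \<Rightarrow> nat \<Rightarrow> (nat \<times> 'a) list set"
  where "wds N k = {w. set w \<subseteq> idx N \<and> length w = k}"

lemma finite_wds [simp]: "finite (wds N k)"
  by (simp add: wds_def finite_lists_length_eq)

lemma sum_wds_Suc: "(\<Sum>w\<in>wds N (Suc k). g w) = (\<Sum>i\<in>idx N. \<Sum>w\<in>wds N k. g (i # w))"
  unfolding wds_def lists_length_Suc sum_set_Cons ..

lemma wds_0: "wds N 0 = {[]}" by (auto simp: wds_def)

lemma mf_expand:
  assumes "\<phi> \<in> mf" "fs \<in> lists (DN N)"
  shows "\<phi> fs = (\<Sum>w\<in>wds N (length fs). \<phi> (map bd w) * word_form (map be w) fs)"
  using assms
proof (induction fs arbitrary: \<phi>)
  case Nil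
  then show ?case by (simp add: wds_0)
next
  case (Cons f fs)
  have f: "f \<in> carrier D" "\<forall>n>N. f n = (\<lambda>_. 0)" and fs: "fs \<in> lists (DN N)" using Cons.prems by (auto simp: DN_def)
  have fsD: "fs \<in> lists (carrier D)" using fs by (auto simp: DN_def)
  have lin: "linear_form D (\<lambda>v. \<phi> (v # fs))" using mfD[OF Cons.prems(1), of "[]" fs] fsD by simp
  have "\<phi> (f # fs) = \<phi> ((\<lambda>n p. \<Sum>i\<in>idx N. eval f (be i) * bd i n p) # fs)"
    using dual_expand[OF f] by simp
  also have "\<dots> = (\<Sum>i\<in>idx N. eval f (be i) * \<phi> (bd i # fs))"
    by (rule linear_form_sum_D[OF lin bd_in])
  also have "\<dots> = (\<Sum>i\<in>idx N. \<Sum>w\<in>wds N (length fs). \<phi> (map bd (i # w)) * word_form (map be (i # w)) (f # fs))"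
  proof (rule sum.cong[OF refl])
    fix i
    have "(\<lambda>v. \<phi> ([bd i] @ v)) \<in> mf" by (rule mf_prefix[OF Cons.prems(1)]) (simp add: bd_in)
    then have "\<phi> (bd i # fs) = (\<Sum>w\<in>wds N (length fs). \<phi> (bd i # map bd w) * word_form (map be w) fs)"
      using Cons.IH[of "\<lambda>v. \<phi> ([bd i] @ v)"] fs by simp
    then show "eval f (be i) * \<phi> (bd i # fs) =
        (\<Sum>w\<in>wds N (length fs). \<phi> (map bd (i # w)) * word_form (map be (i # w)) (f # fs))"
      by (simp add: sum_distrib_left mult.left_commute)
  qed
  finally show ?case by (simp add: sum_wds_Suc)
qed

definition Wd :: "nat \<Rightarrow> (nat \<times> 'a) list set" where "Wd N = (\<Union>k\<le>N. wds N k)"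

lemma finite_Wd [simp]: "finite (Wd N)" by (simp add: Wd_def)

lemma sum_Wd: "(\<Sum>w\<in>Wd N. g w) = (\<Sum>k\<le>N. \<Sum>w\<in>wds N k. g w)"
  unfolding Wd_def by (rule sum.UNION_disjoint) (auto simp: wds_def finite_lists_length_eq)

lemma Wd_lists: "w \<in> Wd N \<Longrightarrow> map be w \<in> lists (finite_fams \<P>)" "map bd w \<in> lists (carrier D)"
  by (auto simp: Wd_def wds_def bd_in intro!: be_in[of _ N])

abbreviation word_forms :: "(('k, 'a) dual_tens \<Rightarrow> 'k) set"
  where "word_forms \<equiv> (\<lambda>X a. a (word_form X)) ` lists (finite_fams \<P>)"

text \<open>Words in the families \<open>be i\<close> read off coordinates with respect to words in
  the dual basis, and the bound \<open>N\<close> reduces any multilinear form, as far as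
  \<open>a\<close> can see it, to finitely many coordinates.\<close>

lemma separating_word_forms: "separating T word_forms"
  unfolding separating_def
proof (intro conjI ballI impI)
  fix \<phi> assume "\<phi> \<in> word_forms"
  then show "linear_form T \<phi>" by (auto intro: eval_mf_linear word_form_mf)
next
  fix a assume a: "a \<in> carrier T" and "\<forall>\<phi>\<in>word_forms. \<phi> a = 0"
  then have "\<forall>X\<in>lists (finite_fams \<P>). a (word_form X) = 0" by (simp only: ball_simps)
  then have zero: "a (word_form X) = 0" if "X \<in> lists (finite_fams \<P>)" for X using that by (rule bspec)
  obtain N where N: "\<And>N' \<phi> \<psi>. N \<le> N' \<Longrightarrow> \<phi> \<in> mf \<Longrightarrow> \<psi> \<in> mf \<Longrightarrow>
    (\<And>fs. fs \<in> lists (DN N') \<Longrightarrow> length fs \<le> N' \<Longrightarrow> \<phi> fs = \<psi> fs) \<Longrightarrow> a \<phi> = a \<psi>"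
    using ta_boundedE[OF a] by blast
  show "a = \<zero>\<^bsub>T\<^esub>"
  proof (rule ta_eqI[OF a T.zero_closed])
    fix \<phi> assume \<phi>: "\<phi> \<in> mf"
    have "a \<phi> = a (\<lambda>fs. \<Sum>w\<in>Wd N. \<phi> (map bd w) * word_form (map be w) fs)"
    proof (rule N[OF order.refl \<phi> mf_sum])
      fix fs assume fs: "fs \<in> lists (DN N)" "length fs \<le> N"
      have "(\<Sum>w\<in>Wd N. \<phi> (map bd w) * word_form (map be w) fs) =
          (\<Sum>k\<le>N. if k = length fs then (\<Sum>w\<in>wds N (length fs). \<phi> (map bd w) * word_form (map be w) fs) else 0)"
        unfolding sum_Wd by (intro sum.cong refl) (auto simp: wds_def word_form_length intro!: sum.neutral)
      also have "\<dots> = \<phi> fs" using fs mf_expand[OF \<phi> fs(1)] by (simp add: sum.delta)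
      finally show "\<phi> fs = (\<Sum>w\<in>Wd N. \<phi> (map bd w) * word_form (map be w) fs)" by simp
    qed (intro mf_scale word_form_mf)
    also have "\<dots> = (\<Sum>w\<in>Wd N. \<phi> (map bd w) * a (word_form (map be w)))"
      by (simp add: ta_sum_form[OF a] ta_scale_form[OF a] mf_scale word_form_mf)
    also have "\<dots> = 0" using zero Wd_lists(1) by (intro sum.neutral) simp
    finally show "a \<phi> = \<zero>\<^bsub>T\<^esub> \<phi>" by simp
  qed
qed

text \<open>What the pairing with an element of \<open>T\<close> looks like as a function of words,
  with \<open>N\<close> as a common bound on arities and lengths; \<open>fam_form_represent\<close>
  is the converse.\<close>

definition fam_form :: "nat \<Rightarrow> ('a fam list \<Rightarrow> 'k) \<Rightarrow> bool"
  where "fam_form N G \<longleftrightarrow> (\<forall>us\<in>lists fams. \<forall>ws\<in>lists fams. \<forall>v\<in>fams.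
      (\<forall>v'\<in>fams. G (us @ (v + v') # ws) = G (us @ v # ws) + G (us @ v' # ws)) \<and>
      (\<forall>c. G (us @ (\<lambda>n. scal \<P> c (v n)) # ws) = c * G (us @ v # ws)) \<and>
      (\<forall>v'\<in>fams. (\<forall>n\<le>N. v n = v' n) \<longrightarrow> G (us @ v # ws) = G (us @ v' # ws))) \<and>
    (\<forall>X\<in>lists fams. length X > N \<longrightarrow> G X = 0)"

lemma fam_formD:
  assumes "fam_form N G" "us \<in> lists fams" "ws \<in> lists fams" "v \<in> fams"
  shows "v' \<in> fams \<Longrightarrow> G (us @ (v + v') # ws) = G (us @ v # ws) + G (us @ v' # ws)"
    and "G (us @ (\<lambda>n. scal \<P> c (v n)) # ws) = c * G (us @ v # ws)"
    and "v' \<in> fams \<Longrightarrow> (\<And>n. n \<le> N \<Longrightarrow> v n = v' n) \<Longrightarrow> G (us @ v # ws) = G (us @ v' # ws)"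
  using assms unfolding fam_form_def by blast+

lemma fam_form_at:
  assumes G: "fam_form N G" and us: "us \<in> lists fams" and ws: "ws \<in> lists fams" and x: "x \<in> fams"
  shows "G (us @ x # ws) = (\<Sum>i\<in>idx N. eval (bd i) x * G (us @ be i # ws))"
proof -
  let ?x = "\<lambda>n. if n \<le> N then x n else 0"
  have "?x \<in> fams" using x by (auto simp: completion_def)
  then have "G (us @ x # ws) = G (us @ ?x # ws)" by (rule fam_formD(3)[OF G us ws x]) simp
  also have "\<dots> = G (us @ (\<lambda>n. \<Sum>i\<in>idx N. scal \<P> (eval (bd i) x) (be i n)) # ws)"
    using fam_expand[OF x] by simp
  also have "\<dots> = (\<Sum>i\<in>idx N. eval (bd i) x * G (us @ be i # ws))"
  proof -
    have be: "be i \<in> fams" if "i \<in> idx N" for i using be_in[OF that] finite_fams_sub by blast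
    \<comment> \<open>The value at the zero family is obtained from homogeneity with the scalar
      0.\<close>
    have "G (us @ (\<lambda>n. scal \<P> 0 (x n)) # ws) = 0 * G (us @ x # ws)" by (rule fam_formD(2)[OF G us ws x])
    then have z: "G (us @ (\<lambda>n. 0) # ws) = 0" by simp
    have "G (us @ (\<lambda>n. \<Sum>i\<in>I. scal \<P> (c i) (be i n)) # ws) = (\<Sum>i\<in>I. c i * G (us @ be i # ws))"
      if "finite I" "I \<subseteq> idx N" for I c
      using that
    proof (induction I rule: finite_induct)
      case (insert i I)
      have i: "be i \<in> fams" and I: "(\<lambda>n. \<Sum>i\<in>I. scal \<P> (c i) (be i n)) \<in> fams"
        using insert.prems be by (auto intro!: fams_sum fams_scale)
      have "G (us @ ((\<lambda>n. scal \<P> (c i) (be i n)) + (\<lambda>n. \<Sum>i\<in>I. scal \<P> (c i) (be i n))) # ws) =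
          G (us @ (\<lambda>n. scal \<P> (c i) (be i n)) # ws) + G (us @ (\<lambda>n. \<Sum>i\<in>I. scal \<P> (c i) (be i n)) # ws)"
        by (rule fam_formD(1)[OF G us ws fams_scale[OF i] I])
      moreover have "G (us @ (\<lambda>n. scal \<P> (c i) (be i n)) # ws) = c i * G (us @ be i # ws)"
        by (rule fam_formD(2)[OF G us ws i])
      ultimately show ?case using insert by (simp add: plus_fun_def)
    qed (simp add: z)
    then show ?thesis by simp
  qed
  finally show ?thesis .
qed

lemma fam_form_expand:
  assumes G: "fam_form N G" and "X \<in> lists fams" "us \<in> lists fams"
  shows "G (us @ X) = (\<Sum>w\<in>wds N (length X). G (us @ map be w) * word_form X (map bd w))"
  using assms(2,3)
proof (induction X arbitrary: us rule: list.induct)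
  case Nil
  then show ?case by (simp add: wds_0)
next
  case (Cons x X)
  have "G (us @ x # X) = (\<Sum>i\<in>idx N. eval (bd i) x * G ((us @ [be i]) @ X))"
    using fam_form_at[OF G Cons.prems(2), of X x] Cons.prems(1) by simp
  also have "\<dots> = (\<Sum>i\<in>idx N. \<Sum>w\<in>wds N (length X). G (us @ map be (i # w)) * word_form (x # X) (map bd (i # w)))"
  proof (rule sum.cong[OF refl])
    fix i assume "i \<in> idx N"
    then have "us @ [be i] \<in> lists fams" using Cons.prems(2) be_in[of i N] finite_fams_sub by auto
    then have "G ((us @ [be i]) @ X) = (\<Sum>w\<in>wds N (length X). G ((us @ [be i]) @ map be w) * word_form X (map bd w))"
      using Cons.prems(1) by (intro Cons.IH) auto
    then show "eval (bd i) x * G ((us @ [be i]) @ X) =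
        (\<Sum>w\<in>wds N (length X). G (us @ map be (i # w)) * word_form (x # X) (map bd (i # w)))"
      by (simp add: sum_distrib_left mult.left_commute)
  qed
  finally show ?case by (simp add: sum_wds_Suc)
qed

text \<open>The values of \<open>G\<close> on words of basis families are the coordinates of the
  element sought.\<close>

lemma fam_form_represent:
  assumes G: "fam_form N G"
  obtains a where "a \<in> carrier T" "\<And>X. X \<in> lists fams \<Longrightarrow> a (word_form X) = G X"
proof
  define a where "a = (\<lambda>\<phi>. \<Sum>w\<in>Wd N. G (map be w) * word D (map bd w) \<phi>)"
  show "a \<in> carrier T"
    unfolding a_def using Wd_lists(2) by (intro D.ta_sum D.ta_scale D.word_in) auto
  fix X assume X: "X \<in> lists fams"
  have "a (word_form X) = (\<Sum>k\<le>N. \<Sum>w\<in>wds N k. G (map be w) * word_form X (map bd w))"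
    by (simp add: a_def D.word_eval word_form_mf sum_Wd)
  also have "\<dots> = (\<Sum>k\<le>N. if k = length X then G X else 0)"
  proof (intro sum.cong refl)
    fix k show "(\<Sum>w\<in>wds N k. G (map be w) * word_form X (map bd w)) = (if k = length X then G X else 0)"
      using fam_form_expand[OF G X, of "[]"]
      by (auto simp: wds_def word_form_length intro!: sum.neutral)
  qed
  also have "\<dots> = G X" using G X by (auto simp: sum.delta fam_form_def)
  finally show "a (word_form X) = G X" .
qed

lemma pairing_eq_0:
  assumes t: "t \<in> carrier (tensor_prod T T)"
    and "\<And>X Y. X \<in> lists (finite_fams \<P>) \<Longrightarrow> Y \<in> lists (finite_fams \<P>) \<Longrightarrow> pairing t X Y = 0"
  shows "t = (\<lambda>\<beta>. 0)"
  by (rule separating_tensor[OF T.kspace_axioms T.kspace_axioms separating_word_forms separating_word_forms])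
    (use assms in \<open>auto simp: pairing_def\<close>)

lemma pairing_inj:
  assumes s: "s \<in> carrier (tensor_prod T T)" and t: "t \<in> carrier (tensor_prod T T)"
    and eq: "\<And>X Y. X \<in> lists (finite_fams \<P>) \<Longrightarrow> Y \<in> lists (finite_fams \<P>) \<Longrightarrow> pairing s X Y = pairing t X Y"
  shows "s = t"
proof -
  interpret Q: kalg "tensor_prod T T" by (rule TT.kalg_tensor_prod)
  have m: "s \<oplus>\<^bsub>tensor_prod T T\<^esub> (- 1) \<odot>\<^bsub>tensor_prod T T\<^esub> t \<in> carrier (tensor_prod T T)"
    using s t by (intro Q.a_closed Q.smult_closed)
  have "s \<oplus>\<^bsub>tensor_prod T T\<^esub> (- 1) \<odot>\<^bsub>tensor_prod T T\<^esub> t = (\<lambda>\<beta>. 0)"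
    by (rule pairing_eq_0[OF m]) (use eq in \<open>auto simp: pairing_def\<close>)
  then show ?thesis by (auto simp: fun_eq_iff)
qed

section \<open>Characters of the tensor algebra as families\<close>

definition chi :: "'a fam \<Rightarrow> ('k, 'a) dual_tens \<Rightarrow> 'k"
  where "chi x = (\<lambda>a\<in>carrier T. a (char_form x))"

lemma chi_word: "fs \<in> lists (carrier D) \<Longrightarrow> chi x (word D fs) = (\<Prod>f\<leftarrow>fs. eval f x)"
  using D.word_in[of fs] D.word_eval[OF char_form_mf, of fs x] by (simp add: chi_def char_form_def del: ta_simps)

lemma chi_alg_hom: "chi x \<in> alg_hom T scalars"
proof (rule D.alg_hom_TI[OF kalg_scalars])
  fix a b assume a: "a \<in> carrier T" and b: "b \<in> carrier T"
  show "chi x (a \<oplus>\<^bsub>T\<^esub> b) = chi x a \<oplus>\<^bsub>scalars\<^esub> chi x b"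
    using T.a_closed[OF a b] a b by (simp add: chi_def del: ta_simps(1))
  show "chi x (c \<odot>\<^bsub>T\<^esub> a) = c \<odot>\<^bsub>scalars\<^esub> chi x a" for c
    using T.smult_closed[OF a, of c] a by (simp add: chi_def del: ta_simps(1))
next
  fix u v assume "u \<in> lists (carrier D)" "v \<in> lists (carrier D)"
  then show "chi x (word D (u @ v)) = chi x (word D u) \<otimes>\<^bsub>scalars\<^esub> chi x (word D v)"
    by (simp add: chi_word)
next
  show "chi x (word D []) = \<one>\<^bsub>scalars\<^esub>" by (simp add: chi_word)
qed simp

lemma chi_gen: "f \<in> carrier D \<Longrightarrow> chi x (gn f) = eval f x"
  using chi_word[of "[f]" x] by simp

lemma T_carrier_with: "characters (with_coprod T d) = alg_hom T scalars \<inter> extensional (carrier T)"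
  by (simp add: characters_def)

lemma gn_linear: "f \<in> carrier D \<Longrightarrow> g \<in> carrier D \<Longrightarrow> gn (f \<oplus>\<^bsub>D\<^esub> g) = gn f \<oplus>\<^bsub>T\<^esub> gn g"
  "f \<in> carrier D \<Longrightarrow> gn (c \<odot>\<^bsub>D\<^esub> f) = c \<odot>\<^bsub>T\<^esub> gn f"
  using mfD[of _ D "[]" "[]"] by (auto simp: word_def fun_eq_iff linear_form_def)

lemma gn_in: "f \<in> carrier D \<Longrightarrow> gn f \<in> carrier T"
  by (rule D.word_in) simp

lemma chi_bij: "bij_betw chi fams (characters (with_coprod T d))"
proof (rule bij_betw_imageI)
  show "inj_on chi fams"
  proof (rule inj_onI)
    fix x y assume "x \<in> fams" "y \<in> fams" "chi x = chi y"
    then show "x = y" using eval_inj chi_gen by metis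
  qed
  show "chi ` fams = characters (with_coprod T d)"
  proof (intro equalityI subsetI)
    fix \<xi> assume "\<xi> \<in> chi ` fams"
    then show "\<xi> \<in> characters (with_coprod T d)"
      using chi_alg_hom by (auto simp: T_carrier_with) (simp add: chi_def)
  next
    fix \<xi> assume "\<xi> \<in> characters (with_coprod T d)"
    then have \<xi>: "\<xi> \<in> alg_hom T scalars" "\<xi> \<in> extensional (carrier T)" by (auto simp: T_carrier_with simp del: ta_simps)
    have "linear_form D (\<lambda>f. \<xi> (gn f))"
      unfolding linear_form_def using gn_in gn_linear alg_homD[OF \<xi>(1)] by (simp del: ta_simps gd_simps)
    then obtain x where x: "x \<in> fams" "\<And>f. f \<in> carrier D \<Longrightarrow> \<xi> (gn f) = eval f x"
      using linear_form_is_eval by blast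
    have "\<xi> = chi x"
    proof (rule extensionalityI[of _ "carrier T"])
      show "chi x \<in> extensional (carrier T)" by (simp add: chi_def)
      fix a assume "a \<in> carrier T"
      then show "\<xi> a = chi x a"
        by (rule D.alg_hom_T_eq[OF \<xi>(1) chi_alg_hom, rotated]) (simp add: x chi_gen)
    qed (rule \<xi>)
    then show "\<xi> \<in> chi ` fams" using x by blast
  qed
qed

text \<open>The coproduct is known through its pairings with words only, so a character in the first
  factor has to be resolved into homogeneous parts. The bound depends on \<open>t\<close> alone and
  serves all \<open>x\<close> and \<open>\<psi>\<close>.\<close>

lemma tensor_chi_left:
  assumes t: "t \<in> carrier (tensor_prod T T)"
  obtains N where "\<And>N' x \<psi>. N \<le> N' \<Longrightarrow> linear_form T \<psi> \<Longrightarrow>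
    t (\<lambda>u v. chi x u * \<psi> v) = (\<Sum>k\<le>N'. t (\<lambda>u v. u (word_form (replicate k x)) * \<psi> v))"
proof -
  obtain ps where ps: "set ps \<subseteq> carrier T \<times> carrier T" "t = tsum T T ps" using t by (auto elim: tensorsE)
  have "\<exists>N. \<forall>p\<in>set ps. \<forall>N'\<ge>N. \<forall>x. fst p (char_form x) = (\<Sum>k\<le>N'. fst p (word_form (replicate k x)))"
    using ps(1)
  proof (induction ps)
    case (Cons p ps)
    then obtain N where N: "\<forall>p\<in>set ps. \<forall>N'\<ge>N. \<forall>x. fst p (char_form x) = (\<Sum>k\<le>N'. fst p (word_form (replicate k x)))"
      by auto
    have "fst p \<in> carrier T" using Cons.prems by (auto simp del: ta_simps)
    then obtain M where "\<And>N' x. M \<le> N' \<Longrightarrow> fst p (char_form x) = (\<Sum>k\<le>N'. fst p (word_form (replicate k x)))"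
      using ta_char_form[of "fst p"] by blast
    with N show ?case by (intro exI[of _ "max M N"]) (auto simp del: ta_simps)
  qed simp
  then obtain N where N: "\<And>p N' x. p \<in> set ps \<Longrightarrow> N \<le> N' \<Longrightarrow> fst p (char_form x) = (\<Sum>k\<le>N'. fst p (word_form (replicate k x)))"
    by blast
  show thesis
  proof (rule that)
    fix N' x \<psi> assume N': "N \<le> N'" and \<psi>: "linear_form T \<psi>"
    have bil: "(\<lambda>u v. u (word_form (replicate k x)) * \<psi> v) \<in> bilinear_forms T T" for k
      by (intro bil_prod eval_mf_linear word_form_mf \<psi>)
    have "t (\<lambda>u v. chi x u * \<psi> v) = (\<Sum>(u, v)\<leftarrow>ps. chi x u * \<psi> v)"
      using bil_prod[OF alg_hom_scalars_linear[OF chi_alg_hom] \<psi>] by (simp add: ps(2) tsum_def)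
    also have "\<dots> = (\<Sum>(u, v)\<leftarrow>ps. \<Sum>k\<le>N'. u (word_form (replicate k x)) * \<psi> v)"
    proof (rule arg_cong[where f = sum_list], rule map_cong[OF refl])
      fix p assume p: "p \<in> set ps"
      then have "fst p \<in> carrier T" using ps(1) by (auto simp del: ta_simps)
      then show "(case p of (u, v) \<Rightarrow> chi x u * \<psi> v) = (case p of (u, v) \<Rightarrow> \<Sum>k\<le>N'. u (word_form (replicate k x)) * \<psi> v)"
        using N[OF p N', of x] by (simp add: chi_def case_prod_unfold sum_distrib_right del: ta_simps)
    qed
    also have "\<dots> = t (\<lambda>u v. \<Sum>k\<le>N'. u (word_form (replicate k x)) * \<psi> v)"
      using bil_sum[where I = "{..N'}", OF bil] by (simp add: ps(2) tsum_def)
    also have "\<dots> = (\<Sum>k\<le>N'. t (\<lambda>u v. u (word_form (replicate k x)) * \<psi> v))"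
      using t by (intro tensors_sum_form[of t T T "carrier T" "carrier T"] bil) (simp del: ta_simps)
    finally show "t (\<lambda>u v. chi x u * \<psi> v) = (\<Sum>k\<le>N'. t (\<lambda>u v. u (word_form (replicate k x)) * \<psi> v))" .
  qed
qed

lemma tensor_chi_right:
  assumes t: "t \<in> carrier (tensor_prod T T)"
  obtains N where "\<And>N' x \<psi>. N \<le> N' \<Longrightarrow> linear_form T \<psi> \<Longrightarrow>
    t (\<lambda>u v. \<psi> u * chi x v) = (\<Sum>k\<le>N'. t (\<lambda>u v. \<psi> u * v (word_form (replicate k x))))"
proof -
  obtain ps where ps: "set ps \<subseteq> carrier T \<times> carrier T" "t = tsum T T ps" using t by (auto elim: tensorsE)
  \<comment> \<open>The tensor with its factors exchanged, which reduces the claim to the other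
    side.\<close>
  let ?s = "tsum T T (map prod.swap ps)"
  have "set (map prod.swap ps) \<subseteq> carrier T \<times> carrier T" using ps(1) by (auto simp del: ta_simps)
  from tensors_tsumI[OF this] have s: "?s \<in> carrier (tensor_prod T T)" by (simp del: ta_simps)
  have swap: "t (\<lambda>u v. \<beta> v u) = ?s \<beta>" if \<beta>: "\<beta> \<in> bilinear_forms T T" for \<beta>
  proof -
    have "(\<lambda>u v. \<beta> v u) \<in> bilinear_forms T T" using \<beta> by (auto simp: bilinear_forms_def)
    then show ?thesis using \<beta> by (simp add: ps(2) tsum_def o_def case_prod_unfold)
  qed
  obtain N where N: "\<And>N' x \<psi>. N \<le> N' \<Longrightarrow> linear_form T \<psi> \<Longrightarrow>
    ?s (\<lambda>u v. chi x u * \<psi> v) = (\<Sum>k\<le>N'. ?s (\<lambda>u v. u (word_form (replicate k x)) * \<psi> v))"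
    using tensor_chi_left[OF s] by blast
  show thesis
  proof (rule that)
    fix N' x \<psi> assume N': "N \<le> N'" and \<psi>: "linear_form T \<psi>"
    show "t (\<lambda>u v. \<psi> u * chi x v) = (\<Sum>k\<le>N'. t (\<lambda>u v. \<psi> u * v (word_form (replicate k x))))"
      using N[OF N' \<psi>, of x] swap[OF bil_prod[OF alg_hom_scalars_linear[OF chi_alg_hom] \<psi>]]
        swap[OF bil_prod[OF eval_mf_linear[OF word_form_mf] \<psi>]]
      by (simp add: mult.commute)
  qed
qed


text \<open>For a map \<open>br\<close> sending a pair of words over \<open>P\<close> to an element of \<open>P\<close>, the transpose
  defines a coproduct on \<open>T(P\<^sup>*)\<close>; both coproducts on \<open>T(P\<^sup>*)\<close> are instances.\<close>

definition coprod_data :: "('a fam list \<Rightarrow> 'a fam list \<Rightarrow> 'a fam) \<Rightarrow> bool"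
  where "coprod_data br \<longleftrightarrow>
    (\<forall>X\<in>lists fams. \<forall>Y\<in>lists fams. br X Y \<in> fams) \<and>
    (\<forall>X Y. length X \<ge> 2 \<longrightarrow> br X Y = 0) \<and>
    (\<forall>X\<in>lists fams. \<forall>us\<in>lists fams. \<forall>ws\<in>lists fams. \<forall>v\<in>fams.
      (\<forall>v'\<in>fams. br X (us @ (v + v') # ws) = br X (us @ v # ws) + br X (us @ v' # ws)) \<and>
      (\<forall>c. br X (us @ (\<lambda>n. scal \<P> c (v n)) # ws) = (\<lambda>n. scal \<P> c (br X (us @ v # ws) n))) \<and>
      (\<forall>v'\<in>fams. \<forall>n. (\<forall>m\<le>n. v m = v' m) \<longrightarrow> br X (us @ v # ws) n = br X (us @ v' # ws) n)) \<and>
    (\<forall>Y\<in>lists fams. \<forall>v\<in>fams.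
      (\<forall>v'\<in>fams. br [v + v'] Y = br [v] Y + br [v'] Y) \<and>
      (\<forall>c. br [\<lambda>n. scal \<P> c (v n)] Y = (\<lambda>n. scal \<P> c (br [v] Y n))) \<and>
      (\<forall>v'\<in>fams. \<forall>n. (\<forall>m\<le>n. v m = v' m) \<longrightarrow> br [v] Y n = br [v'] Y n)) \<and>
    (\<forall>X\<in>lists fams. \<forall>Y\<in>lists fams. \<forall>n<length Y. br X Y n = 0)"

lemma coprod_dataD:
  assumes "coprod_data br"
  shows "X \<in> lists fams \<Longrightarrow> Y \<in> lists fams \<Longrightarrow> br X Y \<in> fams"
    and "length X \<ge> 2 \<Longrightarrow> br X Y = 0"
    and "X \<in> lists fams \<Longrightarrow> us \<in> lists fams \<Longrightarrow> ws \<in> lists fams \<Longrightarrow> v \<in> fams \<Longrightarrow> v' \<in> fams \<Longrightarrow>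
      br X (us @ (v + v') # ws) = br X (us @ v # ws) + br X (us @ v' # ws)"
    and "X \<in> lists fams \<Longrightarrow> us \<in> lists fams \<Longrightarrow> ws \<in> lists fams \<Longrightarrow> v \<in> fams \<Longrightarrow>
      br X (us @ (\<lambda>n. scal \<P> c (v n)) # ws) = (\<lambda>n. scal \<P> c (br X (us @ v # ws) n))"
    and "X \<in> lists fams \<Longrightarrow> us \<in> lists fams \<Longrightarrow> ws \<in> lists fams \<Longrightarrow> v \<in> fams \<Longrightarrow> v' \<in> fams \<Longrightarrow>
      \<forall>m\<le>n. v m = v' m \<Longrightarrow> br X (us @ v # ws) n = br X (us @ v' # ws) n"
    and "Y \<in> lists fams \<Longrightarrow> v \<in> fams \<Longrightarrow> v' \<in> fams \<Longrightarrow> br [v + v'] Y = br [v] Y + br [v'] Y"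
    and "Y \<in> lists fams \<Longrightarrow> v \<in> fams \<Longrightarrow> br [\<lambda>n. scal \<P> c (v n)] Y = (\<lambda>n. scal \<P> c (br [v] Y n))"
    and "Y \<in> lists fams \<Longrightarrow> v \<in> fams \<Longrightarrow> v' \<in> fams \<Longrightarrow> \<forall>m\<le>n. v m = v' m \<Longrightarrow> br [v] Y n = br [v'] Y n"
    and "X \<in> lists fams \<Longrightarrow> Y \<in> lists fams \<Longrightarrow> n < length Y \<Longrightarrow> br X Y n = 0"
proof -
  note h = assms[unfolded coprod_data_def]
  note h1 = conjunct1[OF h] and t1 = conjunct2[OF h]
  note h2 = conjunct1[OF t1] and t2 = conjunct2[OF t1]
  note h3 = conjunct1[OF t2] and t3 = conjunct2[OF t2]
  note h4 = conjunct1[OF t3] and h5 = conjunct2[OF t3]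
  show "X \<in> lists fams \<Longrightarrow> Y \<in> lists fams \<Longrightarrow> br X Y \<in> fams" by (rule bspec[OF bspec[OF h1]])
  show "length X \<ge> 2 \<Longrightarrow> br X Y = 0" by (rule mp[OF spec[OF spec[OF h2]]])
  show "X \<in> lists fams \<Longrightarrow> Y \<in> lists fams \<Longrightarrow> n < length Y \<Longrightarrow> br X Y n = 0"
    by (rule mp[OF spec[OF bspec[OF bspec[OF h5]]]])
  { assume "X \<in> lists fams" "us \<in> lists fams" "ws \<in> lists fams" "v \<in> fams"
    note k = bspec[OF bspec[OF bspec[OF bspec[OF h3 this(1)] this(2)] this(3)] this(4)]
    show "br X (us @ (\<lambda>n. scal \<P> c (v n)) # ws) = (\<lambda>n. scal \<P> c (br X (us @ v # ws) n))"
      by (rule spec[OF conjunct1[OF conjunct2[OF k]]])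
    assume v': "v' \<in> fams"
    show "br X (us @ (v + v') # ws) = br X (us @ v # ws) + br X (us @ v' # ws)"
      by (rule bspec[OF conjunct1[OF k] v'])
    show "\<forall>m\<le>n. v m = v' m \<Longrightarrow> br X (us @ v # ws) n = br X (us @ v' # ws) n"
      by (rule mp[OF spec[OF bspec[OF conjunct2[OF conjunct2[OF k]] v']]]) }
  { assume "Y \<in> lists fams" "v \<in> fams"
    note k = bspec[OF bspec[OF h4 this(1)] this(2)]
    show "br [\<lambda>n. scal \<P> c (v n)] Y = (\<lambda>n. scal \<P> c (br [v] Y n))"
      by (rule spec[OF conjunct1[OF conjunct2[OF k]]])
    assume v': "v' \<in> fams"
    show "br [v + v'] Y = br [v] Y + br [v'] Y" by (rule bspec[OF conjunct1[OF k] v'])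
    show "\<forall>m\<le>n. v m = v' m \<Longrightarrow> br [v] Y n = br [v'] Y n"
      by (rule mp[OF spec[OF bspec[OF conjunct2[OF conjunct2[OF k]] v']]]) }
qed

lemma coprod_data_fam_form:
  assumes br: "coprod_data br" and f: "f \<in> carrier D" and N: "\<forall>n>N. f n = (\<lambda>_. 0)" and X: "X \<in> lists fams"
  shows "fam_form N (\<lambda>Y. eval f (br X Y))"
  unfolding fam_form_def
proof (intro conjI ballI allI impI)
  fix us ws v assume w: "us \<in> lists fams" "ws \<in> lists fams" and v: "v \<in> fams"
  have l: "us @ v # ws \<in> lists fams" if "v \<in> fams" for v using w that by simp
  show "eval f (br X (us @ (v + v') # ws)) = eval f (br X (us @ v # ws)) + eval f (br X (us @ v' # ws))"
    if v': "v' \<in> fams" for v'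
    unfolding coprod_dataD(3)[OF br X w v v'] by (intro eval_add f coprod_dataD(1)[OF br X] l v v')
  show "eval f (br X (us @ (\<lambda>n. scal \<P> c (v n)) # ws)) = c * eval f (br X (us @ v # ws))" for c
    unfolding coprod_dataD(4)[OF br X w v] by (intro eval_scale f coprod_dataD(1)[OF br X] l v)
  show "eval f (br X (us @ v # ws)) = eval f (br X (us @ v' # ws))" if "v' \<in> fams" "\<forall>n\<le>N. v n = v' n" for v'
    by (rule eval_cong[OF N]) (use that in \<open>intro coprod_dataD(5)[OF br X w v], auto\<close>)
next
  fix Y assume "Y \<in> lists fams" "length Y > N"
  then show "eval f (br X Y) = 0"
    unfolding eval_bound[OF N] using f by (intro sum.neutral) (simp add: coprod_dataD(9)[OF br X])
qed

text \<open>Words of length other than 1 get the value 0, and \<open>N > 0\<close> keeps words of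
  length 1 within the length bound of \<open>fam_form\<close>.\<close>

lemma coprod_data_left:
  assumes br: "coprod_data br" and f: "f \<in> carrier D" and N: "\<forall>n>N. f n = (\<lambda>_. 0)" and Y: "Y \<in> lists fams" and N0: "N > 0"
  shows "fam_form N (\<lambda>X. if length X = 1 then eval f (br X Y) else 0)"
  unfolding fam_form_def
proof (intro conjI ballI allI impI)
  fix us ws v assume w: "us \<in> lists fams" "ws \<in> lists fams" and v: "v \<in> fams"
  let ?G = "\<lambda>X. if length X = 1 then eval f (br X Y) else 0"
  have c: "br [v] Y \<in> fams" if "v \<in> fams" for v using that by (intro coprod_dataD(1)[OF br _ Y]) simp
  show "?G (us @ (v + v') # ws) = ?G (us @ v # ws) + ?G (us @ v' # ws)" if v': "v' \<in> fams" for v'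
    using coprod_dataD(6)[OF br Y v v'] eval_add[OF f c[OF v] c[OF v']] by auto
  show "?G (us @ (\<lambda>n. scal \<P> c (v n)) # ws) = c * ?G (us @ v # ws)" for c
    using coprod_dataD(7)[OF br Y v] eval_scale[OF f c[OF v]] by auto
  show "?G (us @ v # ws) = ?G (us @ v' # ws)" if "v' \<in> fams" "\<forall>n\<le>N. v n = v' n" for v'
  proof -
    have "eval f (br [v] Y) = eval f (br [v'] Y)"
      by (rule eval_cong[OF N]) (use that in \<open>intro coprod_dataD(8)[OF br Y v], auto\<close>)
    then show ?thesis by auto
  qed
qed (use N0 in auto)

text \<open>As \<open>br\<close> vanishes on left words of length at least 2, the left factors
  needed are the unit and the letters of the dual basis; for each of them the right factor
  represents the form obtained by fixing the left word. The term with the unit is dropped if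
  \<open>br []\<close> vanishes, which puts the tensor into the subspace that
  \<open>coprod_star\<close> requires.\<close>

lemma ex_gcop:
  assumes br: "coprod_data br" and f: "f \<in> carrier D"
  shows "\<exists>t\<in>carrier (tensor_prod T T). (\<forall>X\<in>lists fams. \<forall>Y\<in>lists fams. pairing t X Y = eval f (br X Y)) \<and>
    ((\<forall>Y\<in>lists fams. br [] Y = 0) \<longrightarrow> t \<in> tensors T T (gn ` carrier D) (carrier T))"
proof -
  obtain N0 where N0: "\<forall>n>N0. f n = (\<lambda>_. 0)" using D_bound[OF f] by blast
  \<comment> \<open>The successor ensures \<open>N > 0\<close>, as \<open>coprod_data_left\<close>
    demands.\<close>
  define N where "N = Suc N0"
  have N: "\<forall>n>N. f n = (\<lambda>_. 0)" "N > 0" using N0 by (auto simp: N_def)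
  have "\<forall>X. \<exists>a. X \<in> lists fams \<longrightarrow> a \<in> carrier T \<and> (\<forall>Y\<in>lists fams. a (word_form Y) = eval f (br X Y))"
    using fam_form_represent[OF coprod_data_fam_form[OF br f N(1)]] by metis
  from choice[OF this] obtain a where a: "\<And>X. X \<in> lists fams \<Longrightarrow> a X \<in> carrier T"
    "\<And>X Y. X \<in> lists fams \<Longrightarrow> Y \<in> lists fams \<Longrightarrow> a X (word_form Y) = eval f (br X Y)" by blast
  have be: "[be i] \<in> lists fams" if "i \<in> idx N" for i using be_in[OF that] finite_fams_sub by auto
  let ?p = "pure_tensor T T"
  define t1 where "t1 = (\<lambda>\<beta>. \<Sum>i\<in>idx N. ?p (gn (bd i)) (a [be i]) \<beta>)"
  define t where "t = (if \<forall>Y\<in>lists fams. br [] Y = 0 then t1 else (\<lambda>\<beta>. ?p \<one>\<^bsub>T\<^esub> (a []) \<beta> + t1 \<beta>))"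
  have t1: "t1 \<in> tensors T T (gn ` carrier D) (carrier T)"
    unfolding t1_def using a(1)[OF be] bd_in by (intro tensors_sum pure_tensor_in) auto
  have gsub: "gn ` carrier D \<subseteq> carrier T" using gn_in by blast
  have t1': "t1 \<in> tensors T T (carrier T) (carrier T)" using tensors_mono[OF gsub order.refl] t1 by blast
  have "?p \<one>\<^bsub>T\<^esub> (a []) \<in> tensors T T (carrier T) (carrier T)"
    by (intro pure_tensor_in a(1) T.one_closed) simp
  then have t: "t \<in> carrier (tensor_prod T T)" using t1' by (auto simp: t_def intro!: tensors_add simp del: ta_simps)
  have bil: "(\<lambda>u v. u (word_form X) * v (word_form Y)) \<in> bilinear_forms T T" for X Y
    by (intro bil_prod eval_mf_linear word_form_mf)
  have "pairing t X Y = eval f (br X Y)" if X: "X \<in> lists fams" and Y: "Y \<in> lists fams" for X Y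
  proof -
    have p1: "pairing t1 X Y = (\<Sum>i\<in>idx N. word_form X [bd i] * eval f (br [be i] Y))"
      unfolding pairing_def t1_def pure_tensor_def if_P[OF bil]
      by (intro sum.cong refl) (simp add: D.word_eval word_form_mf a(2)[OF be Y])
    have p2: "pairing (?p \<one>\<^bsub>T\<^esub> (a [])) X Y = word_form X [] * eval f (br [] Y)"
      unfolding pairing_def pure_tensor_def if_P[OF bil] using a(2)[OF _ Y, of "[]"]
      by (simp add: D.word_eval word_form_mf)
    consider "X = []" | x where "X = [x]" "x \<in> fams" | "length X \<ge> 2"
      using X by (cases X rule: list.exhaust; cases "tl X") auto
    then show ?thesis
    proof cases
      case 1
      then have "pairing t1 X Y = 0" using p1 by simp
      then show ?thesis using p2 1 Y f by (auto simp: t_def pairing_def)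
    next
      case (2 x)
      have "pairing (?p \<one>\<^bsub>T\<^esub> (a [])) X Y = 0" using p2 2 by simp
      then have "pairing t X Y = pairing t1 X Y" by (auto simp: t_def pairing_def)
      also have "\<dots> = eval f (br [x] Y)"
        using fam_form_at[OF coprod_data_left[OF br f N(1) Y N(2)], of "[]" "[]" x] 2 p1 by simp
      finally show ?thesis using 2 by simp
    next
      case 3
      then obtain x y Z where "X = x # y # Z" by (metis Suc_1 Suc_le_length_iff One_nat_def)
      then show ?thesis using 3 p1 p2 coprod_dataD(2)[OF br 3] f by (auto simp: t_def pairing_def)
    qed
  qed
  then show ?thesis using t t1 by (intro bexI[of _ t]) (auto simp: t_def)
qed

definition gcop :: "('a fam list \<Rightarrow> 'a fam list \<Rightarrow> 'a fam) \<Rightarrow> ('k, 'a) dual \<Rightarrow> ('k, ('k, 'a) dual_tens, ('k, 'a) dual_tens) tensor"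
  where "gcop br f = (SOME t. t \<in> carrier (tensor_prod T T) \<and>
    (\<forall>X\<in>lists fams. \<forall>Y\<in>lists fams. pairing t X Y = eval f (br X Y)) \<and>
    ((\<forall>Y\<in>lists fams. br [] Y = 0) \<longrightarrow> t \<in> tensors T T (gn ` carrier D) (carrier T)))"

lemma gcop:
  assumes "coprod_data br" "f \<in> carrier D"
  shows "gcop br f \<in> carrier (tensor_prod T T)"
    and "X \<in> lists fams \<Longrightarrow> Y \<in> lists fams \<Longrightarrow> pairing (gcop br f) X Y = eval f (br X Y)"
    and "(\<And>Y. Y \<in> lists fams \<Longrightarrow> br [] Y = 0) \<Longrightarrow> gcop br f \<in> tensors T T (gn ` carrier D) (carrier T)"
proof -
  have "\<exists>t. t \<in> carrier (tensor_prod T T) \<and>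
    (\<forall>X\<in>lists fams. \<forall>Y\<in>lists fams. pairing t X Y = eval f (br X Y)) \<and>
    ((\<forall>Y\<in>lists fams. br [] Y = 0) \<longrightarrow> t \<in> tensors T T (gn ` carrier D) (carrier T))"
    using ex_gcop[OF assms] by blast
  note * = someI_ex[OF this, folded gcop_def]
  show "gcop br f \<in> carrier (tensor_prod T T)"
    "X \<in> lists fams \<Longrightarrow> Y \<in> lists fams \<Longrightarrow> pairing (gcop br f) X Y = eval f (br X Y)"
    "(\<And>Y. Y \<in> lists fams \<Longrightarrow> br [] Y = 0) \<Longrightarrow> gcop br f \<in> tensors T T (gn ` carrier D) (carrier T)"
    using * by blast+
qed

lemma finite_lists_sub: "X \<in> lists (finite_fams \<P>) \<Longrightarrow> X \<in> lists fams"
  using lists_mono[OF finite_fams_sub] by blast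

lemma tensor_lift_gcop:
  assumes br: "coprod_data br" shows "tensor_lift D T T (gcop br)"
proof (intro tensor_lift.intro tensor_lift_axioms.intro)
  interpret Q: kalg "tensor_prod T T" by (rule TT.kalg_tensor_prod)
  fix f assume f: "f \<in> carrier D"
  show "gcop br f \<in> carrier (tensor_prod T T)" by (rule gcop(1)[OF br f])
  show "gcop br (c \<odot>\<^bsub>D\<^esub> f) = c \<odot>\<^bsub>tensor_prod T T\<^esub> gcop br f" for c
  proof (rule pairing_inj)
    show "gcop br (c \<odot>\<^bsub>D\<^esub> f) \<in> carrier (tensor_prod T T)" by (intro gcop(1) br D.smult_closed f)
    show "c \<odot>\<^bsub>tensor_prod T T\<^esub> gcop br f \<in> carrier (tensor_prod T T)" by (intro Q.smult_closed gcop(1) br f)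
    fix X Y assume "X \<in> lists (finite_fams \<P>)" "Y \<in> lists (finite_fams \<P>)"
    then have *: "X \<in> lists fams" "Y \<in> lists fams" using finite_lists_sub by auto
    show "pairing (gcop br (c \<odot>\<^bsub>D\<^esub> f)) X Y = pairing (c \<odot>\<^bsub>tensor_prod T T\<^esub> gcop br f) X Y"
      using gcop(2)[OF br f *] gcop(2)[OF br D.smult_closed[OF f] *, of c]
        linear_formD(2)[OF eval_linear_form f] by (simp add: pairing_def del: gd_simps)
  qed
  fix g assume g: "g \<in> carrier D"
  show "gcop br (f \<oplus>\<^bsub>D\<^esub> g) = gcop br f \<oplus>\<^bsub>tensor_prod T T\<^esub> gcop br g"
  proof (rule pairing_inj)
    show "gcop br (f \<oplus>\<^bsub>D\<^esub> g) \<in> carrier (tensor_prod T T)" by (intro gcop(1) br D.a_closed f g)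
    show "gcop br f \<oplus>\<^bsub>tensor_prod T T\<^esub> gcop br g \<in> carrier (tensor_prod T T)" by (intro Q.a_closed gcop(1) br f g)
    fix X Y assume "X \<in> lists (finite_fams \<P>)" "Y \<in> lists (finite_fams \<P>)"
    then have *: "X \<in> lists fams" "Y \<in> lists fams" using finite_lists_sub by auto
    show "pairing (gcop br (f \<oplus>\<^bsub>D\<^esub> g)) X Y = pairing (gcop br f \<oplus>\<^bsub>tensor_prod T T\<^esub> gcop br g) X Y"
      using gcop(2)[OF br f *] gcop(2)[OF br g *] gcop(2)[OF br D.a_closed[OF f g] *]
        linear_formD(1)[OF eval_linear_form f g] by (simp add: pairing_def del: gd_simps)
  qed
qed unfold_locales

definition Dlt :: "('a fam list \<Rightarrow> 'a fam list \<Rightarrow> 'a fam) \<Rightarrow> ('k, 'a) dual_tens \<Rightarrow> ('k, ('k, 'a) dual_tens, ('k, 'a) dual_tens) tensor"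
  where "Dlt br = restrict (tensor_lift.lift T T (gcop br)) (carrier T)"

lemma Dlt:
  assumes br: "coprod_data br"
  shows "Dlt br \<in> extensional (carrier T)" "Dlt br \<in> alg_hom T (tensor_prod T T)"
    and "f \<in> carrier D \<Longrightarrow> Dlt br (gn f) = gcop br f"
proof -
  interpret L: tensor_lift D T T "gcop br" by (rule tensor_lift_gcop[OF br])
  show "Dlt br \<in> extensional (carrier T)" by (simp add: Dlt_def)
  show "Dlt br \<in> alg_hom T (tensor_prod T T)"
    unfolding Dlt_def
    by (rule alg_homI; simp only: restrict_apply' alg_homD[OF L.lift_alg_hom] T.a_closed T.m_closed T.smult_closed T.one_closed)
  show "f \<in> carrier D \<Longrightarrow> Dlt br (gn f) = gcop br f"
    unfolding Dlt_def using L.lift_gen gn_in by (simp del: ta_simps)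
qed

text \<open>An algebra morphism on \<open>T\<close> is fixed by its values on letters, and these are
  fixed by their pairings.\<close>

lemma Dlt_unique:
  assumes br: "coprod_data br" and "\<Delta> \<in> extensional (carrier T)" and h: "\<Delta> \<in> alg_hom T (tensor_prod T T)"
    and pr: "\<And>f X Y. f \<in> carrier D \<Longrightarrow> X \<in> lists (finite_fams \<P>) \<Longrightarrow> Y \<in> lists (finite_fams \<P>) \<Longrightarrow>
      pairing (\<Delta> (gn f)) X Y = eval f (br X Y)"
  shows "\<Delta> = Dlt br"
proof (rule extensionalityI[OF assms(2) Dlt(1)[OF br]])
  fix a assume "a \<in> carrier T"
  then show "\<Delta> a = Dlt br a"
  proof (rule D.alg_hom_T_eq[OF h Dlt(2)[OF br], rotated])
    fix f assume f: "f \<in> carrier D"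
    show "\<Delta> (gn f) = Dlt br (gn f)"
      unfolding Dlt(3)[OF br f]
      by (rule pairing_inj[OF alg_homD(1)[OF h gn_in[OF f]] gcop(1)[OF br f]])
        (use pr[OF f] gcop(2)[OF br f] finite_lists_sub in auto)
  qed
qed

text \<open>A pair of characters is resolved into homogeneous parts, so convolution appears as a
  double sum over lengths. The cutoff \<open>L\<close> is dictated by the tensor at hand; hence the
  conditions on \<open>br\<close> are stated for every \<open>L\<close> not below the arity.\<close>

lemma Dlt_points:
  assumes br: "coprod_data br" and G: "monoid G" "carrier G = fams"
    and mul: "\<And>x y n L. x \<in> fams \<Longrightarrow> y \<in> fams \<Longrightarrow> n \<le> L \<Longrightarrow>
      (x \<otimes>\<^bsub>G\<^esub> y) n = (\<Sum>k\<le>L. \<Sum>l\<le>L. br (replicate k x) (replicate l y) n)"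
    and ul: "\<And>Y n L. Y \<in> lists fams \<Longrightarrow> n \<le> L \<Longrightarrow>
      (\<Sum>k\<le>L. br (replicate k \<one>\<^bsub>G\<^esub>) Y n) = (if length Y = 1 then hd Y n else 0)"
    and ur: "\<And>X n L. X \<in> lists fams \<Longrightarrow> n \<le> L \<Longrightarrow>
      (\<Sum>l\<le>L. br X (replicate l \<one>\<^bsub>G\<^esub>) n) = (if length X = 1 then hd X n else 0)"
  shows "points (with_coprod T (Dlt br)) G chi"
proof -
  interpret G: monoid G by fact
  let ?H = "with_coprod T (Dlt br)"
  have bialg: "bialg ?H" using Dlt(2)[OF br] T.kalg_axioms by (simp add: bialg_def)
  have e: "\<one>\<^bsub>G\<^esub> \<in> fams" using G.one_closed G(2) by simp
  have rep: "replicate k x \<in> lists fams" if "x \<in> fams" for k x using that by auto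
  have single: "eval f (\<lambda>n. if length Y = 1 then hd Y n else 0) = word_form Y [f]" if "f \<in> carrier D" for f Y
  proof (cases "length Y = 1")
    case True
    then obtain y where "Y = [y]" by (auto simp: length_Suc_conv)
    then show ?thesis by simp
  next
    case False
    then show ?thesis using that by (simp add: word_form_length)
  qed
  have evs: "eval f (\<lambda>n. \<Sum>i\<in>I. z i n) = (\<Sum>i\<in>I. eval f (z i))" if "f \<in> carrier D" "\<And>i. i \<in> I \<Longrightarrow> z i \<in> fams" for f I and z :: "nat \<Rightarrow> 'a fam"
    by (rule eval_sum[OF that])
  have "counital ?H (chi \<one>\<^bsub>G\<^esub>) a" if "a \<in> carrier T" for a
    using that
  proof (induction rule: D.ta_gen_induct)
    case one
    then show ?case using counital_one[OF bialg, of "chi \<one>\<^bsub>G\<^esub>"] chi_alg_hom by (simp del: ta_simps)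
  next
    case (add b c)
    then show ?case using counital_linear(2)[OF bialg, of b _ c] by (simp del: ta_simps)
  next
    case (scale k b)
    then show ?case using counital_linear(1)[OF bialg, of b] by (simp del: ta_simps)
  next
    case (gen f b)
    let ?t = "gcop br f"
    have t: "?t \<in> carrier (tensor_prod T T)" by (rule gcop(1)[OF br gen(1)])
    obtain NL where NL: "\<And>N' x \<psi>. NL \<le> N' \<Longrightarrow> linear_form T \<psi> \<Longrightarrow>
      ?t (\<lambda>u v. chi x u * \<psi> v) = (\<Sum>k\<le>N'. ?t (\<lambda>u v. u (word_form (replicate k x)) * \<psi> v))"
      using tensor_chi_left[OF t] by blast
    obtain NR where NR: "\<And>N' x \<psi>. NR \<le> N' \<Longrightarrow> linear_form T \<psi> \<Longrightarrow>
      ?t (\<lambda>u v. \<psi> u * chi x v) = (\<Sum>k\<le>N'. ?t (\<lambda>u v. \<psi> u * v (word_form (replicate k x))))"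
      using tensor_chi_right[OF t] by blast
    obtain N where N: "\<forall>n>N. f n = (\<lambda>_. 0)" using D_bound[OF gen(1)] by blast
    \<comment> \<open>Large enough for the homogeneous parts in both factors and for all arities
      seen by \<open>f\<close>.\<close>
    let ?L = "max N (max NL NR)"
    \<comment> \<open>Word pairings separate \<open>T\<close>, so they suffice to obtain the counit
      equation for all linear forms.\<close>
    have "counital ?H (chi \<one>\<^bsub>G\<^esub>) (gn f)"
    proof (rule counital_separating)
      show "kspace ?H" using bialg by (simp add: bialg_def kalg_def)
      show "coprod ?H (gn f) \<in> carrier (tensor_prod ?H ?H)" using t Dlt(3)[OF br gen(1)] by (simp del: ta_simps)
      show "linear_form ?H (chi \<one>\<^bsub>G\<^esub>)" using alg_hom_scalars_linear[OF chi_alg_hom] by simp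
      show "separating ?H word_forms" using separating_word_forms by (simp add: separating_def)
      show "gn f \<in> carrier ?H" using gn_in[OF gen(1)] by (simp del: ta_simps)
      fix \<phi> assume "\<phi> \<in> word_forms"
      then obtain X where X: "X \<in> lists fams" "\<phi> = (\<lambda>a. a (word_form X))" using finite_lists_sub by blast
      have \<phi>: "linear_form T \<phi>" unfolding X(2) by (intro eval_mf_linear word_form_mf)
      have val: "\<phi> (gn f) = word_form X [f]" by (simp add: X(2) D.word_eval word_form_mf)
      have "?t (\<lambda>u v. chi \<one>\<^bsub>G\<^esub> u * \<phi> v) = (\<Sum>k\<le>?L. pairing ?t (replicate k \<one>\<^bsub>G\<^esub>) X)"
        unfolding pairing_def by (subst NL[OF _ \<phi>, of ?L]) (auto simp: X(2))
      also have "\<dots> = (\<Sum>k\<le>?L. eval f (br (replicate k \<one>\<^bsub>G\<^esub>) X))"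
        by (intro sum.cong refl gcop(2)[OF br gen(1)] rep e X)
      also have "\<dots> = eval f (\<lambda>n. \<Sum>k\<le>?L. br (replicate k \<one>\<^bsub>G\<^esub>) X n)"
        by (intro evs[symmetric] gen(1) coprod_dataD(1)[OF br] rep e X)
      also have "\<dots> = eval f (\<lambda>n. if length X = 1 then hd X n else 0)"
        by (rule eval_cong[OF N]) (rule ul[OF X(1)], simp)
      finally show "coprod ?H (gn f) (\<lambda>u v. chi \<one>\<^bsub>G\<^esub> u * \<phi> v) = \<phi> (gn f)"
        using single[OF gen(1), of X] by (simp add: Dlt(3)[OF br gen(1)] val del: ta_simps)
      have "?t (\<lambda>u v. \<phi> u * chi \<one>\<^bsub>G\<^esub> v) = (\<Sum>k\<le>?L. pairing ?t X (replicate k \<one>\<^bsub>G\<^esub>))"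
        unfolding pairing_def by (subst NR[OF _ \<phi>, of ?L]) (auto simp: X(2))
      also have "\<dots> = (\<Sum>k\<le>?L. eval f (br X (replicate k \<one>\<^bsub>G\<^esub>)))"
        by (intro sum.cong refl gcop(2)[OF br gen(1)] rep e X)
      also have "\<dots> = eval f (\<lambda>n. \<Sum>k\<le>?L. br X (replicate k \<one>\<^bsub>G\<^esub>) n)"
        by (intro evs[symmetric] gen(1) coprod_dataD(1)[OF br] rep e X)
      also have "\<dots> = eval f (\<lambda>n. if length X = 1 then hd X n else 0)"
        by (rule eval_cong[OF N]) (rule ur[OF X(1)], simp)
      finally show "coprod ?H (gn f) (\<lambda>u v. \<phi> u * chi \<one>\<^bsub>G\<^esub> v) = \<phi> (gn f)"
        using single[OF gen(1), of X] by (simp add: Dlt(3)[OF br gen(1)] val del: ta_simps)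
    qed
    then show ?case
      using counital_mult[OF bialg, of "chi \<one>\<^bsub>G\<^esub>" "gn f" b] chi_alg_hom gn_in[OF gen(1)] gen by (simp del: ta_simps)
  qed
  moreover have "Dlt br a (\<lambda>u v. chi x u * chi y v) = chi (x \<otimes>\<^bsub>G\<^esub> y) a"
    if x: "x \<in> fams" and y: "y \<in> fams" and a: "a \<in> carrier T" for x y a
    using a
  proof (rule D.alg_hom_T_eq[OF alg_hom_comp[OF Dlt(2)[OF br] char_tensor_alg_hom[OF T.kalg_axioms chi_alg_hom chi_alg_hom]] chi_alg_hom, rotated])
    fix f assume f: "f \<in> carrier D"
    let ?t = "gcop br f"
    have t: "?t \<in> carrier (tensor_prod T T)" by (rule gcop(1)[OF br f])
    obtain NL where NL: "\<And>N' x \<psi>. NL \<le> N' \<Longrightarrow> linear_form T \<psi> \<Longrightarrow>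
      ?t (\<lambda>u v. chi x u * \<psi> v) = (\<Sum>k\<le>N'. ?t (\<lambda>u v. u (word_form (replicate k x)) * \<psi> v))"
      using tensor_chi_left[OF t] by blast
    obtain NR where NR: "\<And>N' x \<psi>. NR \<le> N' \<Longrightarrow> linear_form T \<psi> \<Longrightarrow>
      ?t (\<lambda>u v. \<psi> u * chi x v) = (\<Sum>k\<le>N'. ?t (\<lambda>u v. \<psi> u * v (word_form (replicate k x))))"
      using tensor_chi_right[OF t] by blast
    obtain N where N: "\<forall>n>N. f n = (\<lambda>_. 0)" using D_bound[OF f] by blast
    let ?L = "max N (max NL NR)"
    have "?t (\<lambda>u v. chi x u * chi y v) = (\<Sum>k\<le>?L. ?t (\<lambda>u v. u (word_form (replicate k x)) * chi y v))"
      by (rule NL) (simp_all add: alg_hom_scalars_linear[OF chi_alg_hom])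
    also have "\<dots> = (\<Sum>k\<le>?L. \<Sum>l\<le>?L. pairing ?t (replicate k x) (replicate l y))"
      unfolding pairing_def by (intro sum.cong refl NR eval_mf_linear word_form_mf) simp
    also have "\<dots> = (\<Sum>k\<le>?L. \<Sum>l\<le>?L. eval f (br (replicate k x) (replicate l y)))"
      by (intro sum.cong refl gcop(2)[OF br f] rep x y)
    also have "\<dots> = (\<Sum>k\<le>?L. eval f (\<lambda>n. \<Sum>l\<le>?L. br (replicate k x) (replicate l y) n))"
      by (intro sum.cong refl evs[symmetric] f coprod_dataD(1)[OF br] rep x y)
    also have "\<dots> = eval f (\<lambda>n. \<Sum>k\<le>?L. \<Sum>l\<le>?L. br (replicate k x) (replicate l y) n)"
      by (intro evs[symmetric] f fams_sum coprod_dataD(1)[OF br] rep x y)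
    also have "\<dots> = eval f (x \<otimes>\<^bsub>G\<^esub> y)"
      by (rule eval_cong[OF N]) (rule mul[OF x y, symmetric], simp)
    finally show "Dlt br (gn f) (\<lambda>u v. chi x u * chi y v) = chi (x \<otimes>\<^bsub>G\<^esub> y) (gn f)"
      by (simp add: Dlt(3)[OF br f] chi_gen[OF f])
  qed
  ultimately show ?thesis
    using bialg G chi_bij by (simp add: points_def del: ta_simps)
qed


subsection \<open>The coproduct dual to the operadic composition\<close>

text \<open>The value 0 on left words of length other than 1 encodes that the coproduct of a letter
  has letters as left factors.\<close>

definition br_star :: "'a fam list \<Rightarrow> 'a fam list \<Rightarrow> 'a fam"
  where "br_star X Y = (if length X = 1 then fam_comp \<P> (hd X) Y else 0)"

lemma nth_replace: "i \<noteq> length us \<Longrightarrow> (us @ v # ws) ! i = (us @ v' # ws) ! i"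
  by (auto simp: nth_append nth_Cons split: nat.splits)

lemma fam_comp_cong_right: "\<forall>m\<le>n. v m = v' m \<Longrightarrow> fam_comp \<P> x (us @ v # ws) n = fam_comp \<P> x (us @ v' # ws) n"
proof (rule fam_comp_cong)
  fix i m assume "\<forall>m\<le>n. v m = v' m" "m \<le> n"
  then show "((us @ v # ws) ! i) m = ((us @ v' # ws) ! i) m"
    using nth_replace[of i us v ws v'] by (cases "i = length us") auto
qed simp_all

lemma fam_comp_cong_left:
  assumes "x \<in> fams" "x' \<in> fams" "set ys \<subseteq> fams" "\<forall>m\<le>n. x m = x' m"
  shows "fam_comp \<P> x ys n = fam_comp \<P> x' ys n"
proof (cases "length ys \<le> n")
  case True
  then show ?thesis using assms by (intro fam_comp_cong) auto
qed (simp add: fam_comp_vanish assms)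

lemma coprod_data_star: "coprod_data br_star"
proof -
  have hd1: "hd X \<in> fams" if "X \<in> lists fams" "length X = 1" for X
    using that by (auto simp: length_Suc_conv)
  have s: "set ys \<subseteq> fams" if "ys \<in> lists fams" for ys using that by auto
  show ?thesis
    unfolding coprod_data_def br_star_def
    by (auto simp: fam_comp_closed hd1 fam_comp_add_right fam_comp_scale_right fam_comp_add_left
        fam_comp_scale_left fam_comp_vanish s fams_zero intro: fam_comp_cong_right fam_comp_cong_left)
qed

lemma sum_atMost_0_1:
  assumes "\<And>k. k \<ge> 2 \<Longrightarrow> g k = 0"
  shows "(\<Sum>k\<le>L. g k) = g 0 + (if L \<ge> 1 then g (1::nat) else (0 :: 'b::comm_monoid_add))"
proof (cases "L \<ge> 1")
  case True
  have "(\<Sum>k\<le>L. g k) = (\<Sum>k\<in>{0, 1}. g k)"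
    by (rule sum.mono_neutral_right) (use True assms in auto)
  then show ?thesis using True by simp
next
  case False
  then have "L = 0" by simp
  then show ?thesis by simp
qed

text \<open>Terms with more than \<open>n\<close> inputs vanish, and so does the term without
  inputs, because \<open>x 0 = 0\<close>.\<close>

lemma diamond_sum_le:
  assumes "x \<in> fams" "y \<in> fams" "n \<le> L"
  shows "(\<Sum>l\<le>L. fam_comp \<P> x (replicate l y) n) = diamond \<P> x y n"
proof -
  have z: "fam_comp \<P> x [] n = 0" using fams_0[OF assms(1)] by (simp add: fam_comp_def comp_zero_left)
  show ?thesis
    unfolding diamond_def
    by (rule sum.mono_neutral_right) (use assms z fam_comp_vanish[OF assms(1), of "replicate l y" n for l] in \<open>auto simp: not_le Suc_le_eq\<close>)
qed

lemma coprod_star_eq: "coprod_star \<P> = Dlt br_star"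
  unfolding coprod_star_def Let_def
proof (rule the_equality, intro conjI ballI)
  note br = coprod_data_star
  show "Dlt br_star \<in> extensional (carrier T)" "Dlt br_star \<in> alg_hom T (tensor_prod T T)" by (rule Dlt[OF br])+
  fix f assume f: "f \<in> carrier D"
  show "Dlt br_star (gn f) \<in> tensors T T (gn ` carrier D) (carrier T)"
    unfolding Dlt(3)[OF br f] by (rule gcop(3)[OF br f]) (simp add: br_star_def)
  fix q qs assume "q \<in> finite_fams \<P>" "qs \<in> lists (finite_fams \<P>)"
  then show "pairing (Dlt br_star (gn f)) [q] qs = eval f (fam_comp \<P> q qs)"
    using gcop(2)[OF br f, of "[q]" qs] finite_lists_sub finite_fams_sub by (auto simp: Dlt(3)[OF br f] br_star_def)
next
  fix \<Delta> assume \<Delta>: "\<Delta> \<in> extensional (carrier T) \<and> \<Delta> \<in> alg_hom T (tensor_prod T T) \<and>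
    (\<forall>f\<in>carrier D. \<Delta> (gn f) \<in> tensors T T (gn ` carrier D) (carrier T) \<and>
      (\<forall>q\<in>finite_fams \<P>. \<forall>qs\<in>lists (finite_fams \<P>). pairing (\<Delta> (gn f)) [q] qs = eval f (fam_comp \<P> q qs)))"
  show "\<Delta> = Dlt br_star"
  proof (rule Dlt_unique[OF coprod_data_star])
    fix f X Y assume f: "f \<in> carrier D" and XY: "X \<in> lists (finite_fams \<P>)" "Y \<in> lists (finite_fams \<P>)"
    show "pairing (\<Delta> (gn f)) X Y = eval f (br_star X Y)"
    proof (cases "length X = 1")
      case True
      then obtain q where "X = [q]" by (auto simp: length_Suc_conv)
      then show ?thesis using \<Delta> f XY by (simp add: br_star_def)
    next
      case False
      \<comment> \<open>The description of \<open>coprod_star\<close> prescribes no pairing with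
        these \<open>X\<close>; the vanishing comes from the left factors being letters.\<close>
      have "\<Delta> (gn f) \<in> tensors T T (gn ` carrier D) (carrier T)" using \<Delta> f by blast
      moreover have "(\<lambda>u v. u (word_form X) * v (word_form Y)) \<in> bilinear_forms T T"
        by (intro bil_prod eval_mf_linear word_form_mf)
      moreover have "(\<lambda>u v. 0) \<in> bilinear_forms T T" by (simp add: bilinear_forms_def linear_form_zero)
      moreover have "u (word_form X) * v (word_form Y) = 0" if "u \<in> gn ` carrier D" for u v
        using that False by (auto simp: D.word_eval word_form_mf word_form_length)
      ultimately have "pairing (\<Delta> (gn f)) X Y = \<Delta> (gn f) (\<lambda>u v. 0)"
        unfolding pairing_def by (rule tensors_cong)
      also have "\<dots> = 0"
        using \<open>\<Delta> (gn f) \<in> _\<close> by (rule tensorsE) (simp add: tsum_def case_prod_unfold)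
      finally show ?thesis using False f by (simp add: br_star_def)
    qed
  qed (use \<Delta> in auto)
qed

lemma points_star: "points (boldD_star \<P>) (M \<P>) chi"
  unfolding boldD_star_def coprod_star_eq
proof (rule Dlt_points[OF coprod_data_star monoid_M])
  fix x y n L assume xy: "x \<in> fams" "y \<in> fams" "n \<le> (L :: nat)"
  have "(\<Sum>k\<le>L. \<Sum>l\<le>L. br_star (replicate k x) (replicate l y) n) =
      (if L \<ge> 1 then \<Sum>l\<le>L. fam_comp \<P> x (replicate l y) n else 0)"
    by (subst sum_atMost_0_1) (auto simp: br_star_def)
  \<comment> \<open>If \<open>L = 0\<close>, the sum stops before left words of length 1, but then
    \<open>n = 0\<close>, where families vanish.\<close>
  also have "\<dots> = diamond \<P> x y n"
    using diamond_sum_le[OF xy] xy fams_0[OF diamond_closed[OF xy(1,2)]] by (cases "L = 0") auto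
  finally show "(x \<otimes>\<^bsub>M \<P>\<^esub> y) n = (\<Sum>k\<le>L. \<Sum>l\<le>L. br_star (replicate k x) (replicate l y) n)" by simp
next
  fix Y n L assume Y: "Y \<in> lists fams" and nL: "n \<le> (L :: nat)"
  have "(\<Sum>k\<le>L. br_star (replicate k (unit_fam \<P>)) Y n) = (if L \<ge> 1 then fam_comp \<P> (unit_fam \<P>) Y n else 0)"
    by (subst sum_atMost_0_1) (auto simp: br_star_def)
  also have "\<dots> = (if length Y = 1 then hd Y n else 0)"
  proof (cases "length Y = 1")
    case True
    then obtain y where y: "Y = [y]" "y \<in> fams" using Y by (auto simp: length_Suc_conv)
    have "fam_comp \<P> (unit_fam \<P>) [y] n = y n"
    proof -
      have "{ms. length ms = Suc 0 \<and> sum_list ms = n} = {[n]}" by (auto simp: length_Suc_conv)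
      then show ?thesis using comp_unt_left[OF completionD[OF y(2), of n]] by (simp add: fam_comp_def unit_fam_def)
    qed
    moreover have "y n = 0" if "L = 0" using that nL fams_0[OF y(2)] by simp
    ultimately show ?thesis using y by (cases "L = 0") auto
  next
    case False
    have "fam_comp \<P> (unit_fam \<P>) Y n = 0"
    proof -
      have "set Y \<subseteq> fams" using Y by auto
      then show ?thesis unfolding fam_comp_eq comp_term_def using False
        by (intro sum.neutral ballI) (simp add: unit_fam_def comp_zero_left[OF tagged_zip])
    qed
    then show ?thesis using False by simp
  qed
  finally show "(\<Sum>k\<le>L. br_star (replicate k \<one>\<^bsub>M \<P>\<^esub>) Y n) = (if length Y = 1 then hd Y n else 0)" by simp
next
  fix X n L assume X: "X \<in> lists fams" and nL: "n \<le> (L :: nat)"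
  show "(\<Sum>l\<le>L. br_star X (replicate l \<one>\<^bsub>M \<P>\<^esub>) n) = (if length X = 1 then hd X n else 0)"
  proof (cases "length X = 1")
    case True
    then obtain x where x: "X = [x]" "x \<in> fams" using X by (auto simp: length_Suc_conv)
    then show ?thesis using diamond_sum_le[OF x(2) unit_fam_in nL] diamond_unit_right[OF x(2)] by (simp add: br_star_def)
  qed (simp add: br_star_def)
qed simp


subsection \<open>The coproduct dual to the bracket\<close>

definition circ_list :: "nat set \<Rightarrow> 'a fam list \<Rightarrow> nat \<Rightarrow> 'a fam list"
  where "circ_list S ys n = map (\<lambda>i. if i \<in> S then ys ! card {j \<in> S. j < i} else unit_fam \<P>) [0..<n]"

lemma circ_at_eq: "circ_at \<P> x n S ys = fam_comp \<P> x (circ_list S ys n)"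
  by (simp add: circ_at_def circ_list_def)

text \<open>Ranks are what \<open>circ_at\<close> uses to select entries; each entry of the inserted
  list is thus used at exactly one position.\<close>

lemma rank_bij:
  assumes "finite (S :: nat set)"
  shows "bij_betw (\<lambda>i. card {j \<in> S. j < i}) S {..<card S}"
proof -
  have less: "card {j \<in> S. j < i} < card {j \<in> S. j < i'}" if "i \<in> S" "i < i'" for i i'
    using assms that by (intro psubset_card_mono) auto
  have inj: "inj_on (\<lambda>i. card {j \<in> S. j < i}) S"
  proof (rule inj_onI)
    fix i i' assume "i \<in> S" "i' \<in> S" "card {j \<in> S. j < i} = card {j \<in> S. j < i'}"
    then show "i = i'" using less[of i i'] less[of i' i] by (cases i i' rule: linorder_cases) auto
  qed
  moreover have "(\<lambda>i. card {j \<in> S. j < i}) ` S = {..<card S}"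
  proof (rule card_subset_eq)
    show "(\<lambda>i. card {j \<in> S. j < i}) ` S \<subseteq> {..<card S}"
      using assms by (auto intro!: psubset_card_mono)
    show "card ((\<lambda>i. card {j \<in> S. j < i}) ` S) = card {..<card S}" using card_image[OF inj] by simp
  qed simp
  ultimately show ?thesis by (rule bij_betw_imageI)
qed

lemma circ_list_in:
  assumes "S \<subseteq> {..<n}" "card S = length ys" "ys \<in> lists fams"
  shows "set (circ_list S ys n) \<subseteq> fams"
proof -
  have "finite S" using assms(1) finite_subset by blast
  then have "card {j \<in> S. j < i} < length ys" if "i \<in> S" for i
    using bij_betwE[OF rank_bij] that assms(2) by fastforce
  then show ?thesis using assms(3) unit_fam_in by (auto simp: circ_list_def)
qed

text \<open>A single entry occupies a single slot, the one whose rank is the index of the entry; so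
  linearity and locality in an entry reduce to those of \<open>fam_comp\<close> in a slot.\<close>

lemma circ_list_split:
  assumes S: "S \<subseteq> {..<n}" "card S = Suc (length us + length ws)" and w: "us \<in> lists fams" "ws \<in> lists fams"
  obtains A B where "A \<in> lists fams" "B \<in> lists fams" "\<And>v. circ_list S (us @ v # ws) n = A @ v # B"
proof -
  have fin: "finite S" using S(1) finite_subset by blast
  let ?r = "\<lambda>i. card {j \<in> S. j < i}"
  note bij = rank_bij[OF fin]
  have "length us \<in> ?r ` S" using S(2) bij by (auto simp: bij_betw_def)
  then obtain i where i: "i \<in> S" "?r i = length us" by auto
  have other: "?r j \<noteq> length us" if "j \<in> S" "j \<noteq> i" for j
    using inj_onD[OF bij_betw_imp_inj_on[OF bij], of j i] that i by auto
  let ?l = "circ_list S (us @ 0 # ws) n"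
  have in_n: "i < n" using i S by auto
  have len: "length (circ_list S ys n) = n" for ys by (simp add: circ_list_def)
  have "circ_list S (us @ v # ws) n = take i ?l @ v # drop (Suc i) ?l" for v
  proof -
    have "circ_list S (us @ v # ws) n = ?l[i := v]"
    proof (rule nth_equalityI)
      fix j assume "j < length (circ_list S (us @ v # ws) n)"
      then have j: "j < n" by (simp add: len)
      show "circ_list S (us @ v # ws) n ! j = ?l[i := v] ! j"
      proof (cases "j = i")
        case True
        then show ?thesis using j i by (simp add: circ_list_def)
      next
        case False
        then show ?thesis using j other[of j] nth_replace[of "?r j" us v ws 0] by (simp add: circ_list_def)
      qed
    qed (simp add: len)
    also have "\<dots> = take i ?l @ v # drop (Suc i) ?l" by (rule upd_conv_take_nth_drop) (simp add: len in_n)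
    finally show ?thesis .
  qed
  moreover have "set ?l \<subseteq> fams" using S w fams_zero by (intro circ_list_in) auto
  then have "take i ?l \<in> lists fams" "drop (Suc i) ?l \<in> lists fams"
    using set_take_subset[of i ?l] set_drop_subset[of "Suc i" ?l] by blast+
  ultimately show thesis by (rule that[rotated 2])
qed

lemma bracket_one: "bracket \<P> [p] ys = (\<lambda>N. \<Sum>n=1..N. \<Sum>S | S \<subseteq> {..<n} \<and> card S = length ys. circ_at \<P> p n S ys N)"
  by simp

lemma bracket_nil: "bracket \<P> [] Y = (if length Y = 1 then hd Y else 0)"
  by (cases Y; cases "tl Y") (auto simp: zero_fun_def)

lemma bracket_many: "length X \<ge> 2 \<Longrightarrow> bracket \<P> X Y = 0"
  by (cases X; cases "tl X") (auto simp: zero_fun_def)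

lemma coprod_data_prime: "coprod_data (bracket \<P>)"
proof -
  have bins: "bracket \<P> [p] Y \<in> fams" if "p \<in> fams" "Y \<in> lists fams" for p Y
    unfolding bracket_one circ_at_eq
    using that circ_list_in[of _ _ Y] completionD[OF fam_comp_closed]
    by (subst completion_def) (auto intro!: ops_sum)
  have cases: "P X" if "X \<in> lists fams" "P []" "\<And>x. x \<in> fams \<Longrightarrow> P [x]" "\<And>X. length X \<ge> 2 \<Longrightarrow> P X" for P and X :: "'a fam list"
    using that by (cases X; cases "tl X") auto
  have single: "length (us @ v # ws) = 1 \<longleftrightarrow> us = [] \<and> ws = []" for us ws and v :: "'a fam" by auto
  show ?thesis
    unfolding coprod_data_def
  proof (intro conjI ballI allI impI)
    fix X Y assume X: "X \<in> lists fams" and Y: "Y \<in> lists fams"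
    show "bracket \<P> X Y \<in> fams"
      by (rule cases[OF X]) (use Y bins in \<open>auto simp: bracket_nil bracket_many fams_zero fams_zero[unfolded zero_fun_def] length_Suc_conv simp del: bracket.simps\<close>)
    fix n assume n: "n < length Y"
    show "bracket \<P> X Y n = 0"
    proof (rule cases[OF X])
      show "bracket \<P> [] Y n = 0" using n Y fams_0 by (auto simp: bracket_nil length_Suc_conv simp del: bracket.simps)
      fix x
      \<comment> \<open>An operation of arity at most \<open>n\<close> has fewer slots than
        \<open>Y\<close> has entries.\<close>
      have "{S. S \<subseteq> {..<m} \<and> card S = length Y} = {}" if m: "m \<in> {1..n}" for m
      proof -
        have "card S \<noteq> length Y" if "S \<subseteq> {..<m}" for S using card_mono[OF _ that] m n by simp
        then show ?thesis by blast
      qed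
      then show "bracket \<P> [x] Y n = 0" unfolding bracket_one by (intro sum.neutral ballI) (simp only: empty_iff)
    qed (simp add: bracket_many)
  next
    fix X Y :: "'a fam list" assume "length X \<ge> 2"
    then show "bracket \<P> X Y = 0" by (rule bracket_many)
  next
    fix X us ws v v' assume X: "X \<in> lists fams" and w: "us \<in> lists fams" "ws \<in> lists fams" and v: "v \<in> fams" and v': "v' \<in> fams"
    have w': "set us \<subseteq> fams" "set ws \<subseteq> fams" using w by auto
    show "bracket \<P> X (us @ (v + v') # ws) = bracket \<P> X (us @ v # ws) + bracket \<P> X (us @ v' # ws)"
    proof (rule cases[OF X])
      fix x assume x: "x \<in> fams"
      show "bracket \<P> [x] (us @ (v + v') # ws) = bracket \<P> [x] (us @ v # ws) + bracket \<P> [x] (us @ v' # ws)"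
      proof
        fix N
        have "circ_at \<P> x n S (us @ (v + v') # ws) N = circ_at \<P> x n S (us @ v # ws) N + circ_at \<P> x n S (us @ v' # ws) N"
          if S: "S \<subseteq> {..<n}" "card S = Suc (length us + length ws)" for n S
        proof -
          obtain A B where AB: "A \<in> lists fams" "B \<in> lists fams" "\<And>v. circ_list S (us @ v # ws) n = A @ v # B"
            using circ_list_split[OF S w] by blast
          then show ?thesis using fam_comp_add_right[OF x _ _ v v', of A B] AB(1,2) by (simp add: circ_at_eq AB(3) lists_eq_set)
        qed
        then show "bracket \<P> [x] (us @ (v + v') # ws) N = (bracket \<P> [x] (us @ v # ws) + bracket \<P> [x] (us @ v' # ws)) N"
          unfolding bracket_one plus_fun_apply sum.distrib[symmetric] by (intro sum.cong refl) (simp add: sum.distrib)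
      qed
    qed (auto simp: bracket_nil bracket_many single simp del: bracket.simps)
  next
    fix X us ws v c assume X: "X \<in> lists fams" and w: "us \<in> lists fams" "ws \<in> lists fams" and v: "v \<in> fams"
    show "bracket \<P> X (us @ (\<lambda>n. scal \<P> c (v n)) # ws) = (\<lambda>n. scal \<P> c (bracket \<P> X (us @ v # ws) n))"
    proof (rule cases[OF X])
      fix x assume x: "x \<in> fams"
      show "bracket \<P> [x] (us @ (\<lambda>n. scal \<P> c (v n)) # ws) = (\<lambda>n. scal \<P> c (bracket \<P> [x] (us @ v # ws) n))"
      proof
        fix N
        have circ: "circ_at \<P> x n S (us @ (\<lambda>n. scal \<P> c (v n)) # ws) N = scal \<P> c (circ_at \<P> x n S (us @ v # ws) N)"
          if S: "S \<subseteq> {..<n}" "card S = Suc (length us + length ws)" for n S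
        proof -
          obtain A B where AB: "A \<in> lists fams" "B \<in> lists fams" "\<And>v. circ_list S (us @ v # ws) n = A @ v # B"
            using circ_list_split[OF S w] by blast
          then show ?thesis using fam_comp_scale_right[OF x _ _ v, of A B c] AB(1,2) by (simp add: circ_at_eq AB(3) lists_eq_set)
        qed
        then show "bracket \<P> [x] (us @ (\<lambda>n. scal \<P> c (v n)) # ws) N = scal \<P> c (bracket \<P> [x] (us @ v # ws) N)"
          unfolding bracket_one V.scale_sum_right by (intro sum.cong refl circ) auto
      qed
    qed (auto simp: bracket_nil bracket_many single simp del: bracket.simps)
  next
    fix X us ws v v' n assume X: "X \<in> lists fams" and w: "us \<in> lists fams" "ws \<in> lists fams" and v: "v \<in> fams" "v' \<in> fams"
      and eq: "\<forall>m\<le>n. v m = v' m"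
    show "bracket \<P> X (us @ v # ws) n = bracket \<P> X (us @ v' # ws) n"
    proof (rule cases[OF X])
      fix x assume x: "x \<in> fams"
      have circ: "circ_at \<P> x k S (us @ v # ws) n = circ_at \<P> x k S (us @ v' # ws) n"
        if S: "S \<subseteq> {..<k}" "card S = Suc (length us + length ws)" for k S
      proof -
        obtain A B where AB: "A \<in> lists fams" "B \<in> lists fams" "\<And>v. circ_list S (us @ v # ws) k = A @ v # B"
          using circ_list_split[OF S w] by blast
        then show ?thesis using fam_comp_cong_right[OF eq, of x A B] by (simp add: circ_at_eq AB(3))
      qed
      then show "bracket \<P> [x] (us @ v # ws) n = bracket \<P> [x] (us @ v' # ws) n"
        unfolding bracket_one by (intro sum.cong refl circ) auto
    qed (use eq in \<open>auto simp: bracket_nil bracket_many single simp del: bracket.simps\<close>)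
  next
    fix Y v v' assume Y: "Y \<in> lists fams" and v: "v \<in> fams" "v' \<in> fams"
    show "bracket \<P> [v + v'] Y = bracket \<P> [v] Y + bracket \<P> [v'] Y"
    proof
      fix N show "bracket \<P> [v + v'] Y N = (bracket \<P> [v] Y + bracket \<P> [v'] Y) N"
        unfolding bracket_one plus_fun_apply sum.distrib[symmetric] circ_at_eq
        using circ_list_in[OF _ _ Y] v by (intro sum.cong refl) (simp add: fam_comp_add_left[unfolded plus_fun_def])
    qed
  next
    fix Y v c assume Y: "Y \<in> lists fams" and v: "v \<in> fams"
    show "bracket \<P> [\<lambda>n. scal \<P> c (v n)] Y = (\<lambda>n. scal \<P> c (bracket \<P> [v] Y n))"
    proof
      fix N show "bracket \<P> [\<lambda>n. scal \<P> c (v n)] Y N = scal \<P> c (bracket \<P> [v] Y N)"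
        unfolding bracket_one V.scale_sum_right circ_at_eq
        using circ_list_in[OF _ _ Y] v by (intro sum.cong refl) (simp add: fam_comp_scale_left)
    qed
  next
    fix Y v v' n assume Y: "Y \<in> lists fams" and v: "v \<in> fams" "v' \<in> fams" and eq: "\<forall>m\<le>n. v m = v' m"
    show "bracket \<P> [v] Y n = bracket \<P> [v'] Y n"
      unfolding bracket_one circ_at_eq
      using circ_list_in[OF _ _ Y] v eq by (intro sum.cong refl fam_comp_cong_left) auto
  qed
qed

lemma coprod_prime_eq: "coprod_prime \<P> = Dlt (bracket \<P>)"
  unfolding coprod_prime_def Let_def
proof (rule the_equality, intro conjI ballI)
  note br = coprod_data_prime
  show "Dlt (bracket \<P>) \<in> extensional (carrier T)" "Dlt (bracket \<P>) \<in> alg_hom T (tensor_prod T T)" by (rule Dlt[OF br])+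
  fix f X Y assume "f \<in> carrier D" "X \<in> lists (finite_fams \<P>)" "Y \<in> lists (finite_fams \<P>)"
  then show "pairing (Dlt (bracket \<P>) (gn f)) X Y = eval f (bracket \<P> X Y)"
    using gcop(2)[OF br _ finite_lists_sub finite_lists_sub] by (simp add: Dlt(3)[OF br] del: bracket.simps)
next
  fix \<Delta> assume "\<Delta> \<in> extensional (carrier T) \<and> \<Delta> \<in> alg_hom T (tensor_prod T T) \<and>
      (\<forall>f\<in>carrier D. \<forall>X\<in>lists (finite_fams \<P>). \<forall>Y\<in>lists (finite_fams \<P>). pairing (\<Delta> (gn f)) X Y = eval f (bracket \<P> X Y))"
  then show "\<Delta> = Dlt (bracket \<P>)" by (intro Dlt_unique[OF coprod_data_prime]) auto
qed

lemma bracket_zero: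
  assumes "x \<in> fams" "l \<ge> 1" shows "bracket \<P> [x] (replicate l 0) = 0" "Y \<in> lists fams \<Longrightarrow> bracket \<P> [0] Y = 0"
proof -
  obtain k where k: "l = Suc k" using assms(2) by (cases l) auto
  \<comment> \<open>The zero family is written as a multiple by 0, so that homogeneity of the
    bracket applies.\<close>
  have z: "(\<lambda>n. scal \<P> 0 ((0 :: 'a fam) n)) = 0" by (simp add: fun_eq_iff)
  show "bracket \<P> [x] (replicate l 0) = 0"
  proof -
    have "replicate k 0 \<in> lists fams" using fams_zero by auto
    then have "bracket \<P> [x] ([] @ (\<lambda>n. scal \<P> 0 ((0 :: 'a fam) n)) # replicate k 0) =
        (\<lambda>n. scal \<P> 0 (bracket \<P> [x] ([] @ 0 # replicate k 0) n))"
      using assms(1) fams_zero fams_zero[unfolded zero_fun_def]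
      by (intro coprod_dataD(4)[OF coprod_data_prime]) simp_all
    then show ?thesis unfolding z by (simp add: k zero_fun_def del: bracket.simps)
  qed
  show "Y \<in> lists fams \<Longrightarrow> bracket \<P> [0] Y = 0"
    using coprod_dataD(7)[OF coprod_data_prime, of Y 0 0, unfolded z] fams_zero by (simp add: zero_fun_def del: bracket.simps)
qed

lemma points_prime: "points (boldD_prime \<P>) (M' \<P>) chi"
  unfolding boldD_prime_def coprod_prime_eq
proof (rule Dlt_points[OF coprod_data_prime monoid_M'])
  note [simp del] = bracket.simps
  fix x y n L assume xy: "x \<in> fams" "y \<in> fams" "n \<le> (L :: nat)"
  show "(x \<otimes>\<^bsub>M' \<P>\<^esub> y) n = (\<Sum>k\<le>L. \<Sum>l\<le>L. bracket \<P> (replicate k x) (replicate l y) n)"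
  proof (cases "L = 0")
    case True
    then show ?thesis using xy fams_0[OF diamond'_closed[OF xy(1,2)]] by (simp add: bracket_nil)
  next
    case False
    have "(\<Sum>k\<le>L. \<Sum>l\<le>L. bracket \<P> (replicate k x) (replicate l y) n) =
        (\<Sum>l\<le>L. bracket \<P> [] (replicate l y) n) + (\<Sum>l\<le>L. bracket \<P> [x] (replicate l y) n)"
      using False by (subst sum_atMost_0_1) (auto simp: bracket_many)
    also have "(\<Sum>l\<le>L. bracket \<P> [] (replicate l y) n) = y n"
      using False by (subst sum_atMost_0_1) (auto simp: bracket_nil)
    also have "(\<Sum>l\<le>L. bracket \<P> [x] (replicate l y) n) =
        (\<Sum>m=1..n. \<Sum>l\<le>L. \<Sum>S | S \<in> Pow {..<m} \<and> card S = l. circ_at \<P> x m S (replicate (card S) y) n)"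
      unfolding bracket_one by (subst sum.swap) (intro sum.cong refl, auto)
    \<comment> \<open>Sorting the subsets by cardinality loses none of them: they have at most
      \<open>m\<close> elements, and \<open>m \<le> n \<le> L\<close>.\<close>
    also have "\<dots> = (\<Sum>m=1..n. \<Sum>S\<in>Pow {..<m}. circ_at \<P> x m S (replicate (card S) y) n)"
    proof (rule sum.cong[OF refl], rule sum.group)
      fix m assume m: "m \<in> {1..n}"
      show "card ` Pow {..<m} \<subseteq> {..L}"
      proof (rule image_subsetI)
        fix S assume "S \<in> Pow {..<m}"
        then have "card S \<le> m" using card_mono[of "{..<m}" S] by simp
        then show "card S \<in> {..L}" using m xy(3) by simp
      qed
    qed auto
    finally show ?thesis by (simp add: diamond'_def)
  qed
next
  note [simp del] = bracket.simps
  fix Y n L assume Y: "Y \<in> lists fams" and nL: "n \<le> (L :: nat)"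
  show "(\<Sum>k\<le>L. bracket \<P> (replicate k \<one>\<^bsub>M' \<P>\<^esub>) Y n) = (if length Y = 1 then hd Y n else 0)"
    using bracket_zero(2)[OF fams_zero order.refl Y] by (subst sum_atMost_0_1) (auto simp: bracket_many bracket_nil)
next
  note [simp del] = bracket.simps
  fix X n L assume X: "X \<in> lists fams" and nL: "n \<le> (L :: nat)"
  consider "X = []" | x where "X = [x]" "x \<in> fams" | "length X \<ge> 2"
    using X by (cases X; cases "tl X") auto
  then show "(\<Sum>l\<le>L. bracket \<P> X (replicate l \<one>\<^bsub>M' \<P>\<^esub>) n) = (if length X = 1 then hd X n else 0)"
  proof cases
    case 1
    then show ?thesis by (auto simp: bracket_nil intro!: sum.neutral)
  next
    case (2 x)
    have "(\<Sum>l\<le>L. bracket \<P> X (replicate l \<one>\<^bsub>M' \<P>\<^esub>) n) = (\<Sum>l\<in>{0}. bracket \<P> X (replicate l \<one>\<^bsub>M' \<P>\<^esub>) n)"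
      by (rule sum.mono_neutral_right) (use 2 bracket_zero(1)[OF 2(2)] in auto)
    \<comment> \<open>Only the empty insertion survives, which fills every slot with the operadic
      unit.\<close>
    also have "\<dots> = (\<Sum>m=1..n. circ_at \<P> x m {} [] n)"
    proof -
      have "{S. S \<subseteq> {..<m} \<and> card S = 0} = {{}}" for m :: nat using finite_subset by fastforce
      then show ?thesis using 2 by (simp add: bracket_one)
    qed
    also have "\<dots> = diamond \<P> x (unit_fam \<P>) n"
      by (simp add: diamond_def circ_at_def map_replicate_const)
    also have "\<dots> = x n" using diamond_unit_right[OF 2(2)] by simp
    finally show ?thesis using 2 by simp
  next
    case 3
    then show ?thesis by (simp add: bracket_many)
  qed
qed simp

end


section \<open>Generated subalgebras\<close>

lemma subalgebra_gen_subset: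
  assumes "kalg A" "X \<subseteq> carrier A" shows "subalgebra_gen A X \<subseteq> carrier A"
proof
  interpret kalg A by fact
  fix a assume "a \<in> subalgebra_gen A X"
  then show "a \<in> carrier A" using assms(2) by induction auto
qed

lemma subalgebra_gen_image:
  assumes "kalg A" "X \<subseteq> carrier A" "h \<in> alg_hom A B" "a \<in> subalgebra_gen A X"
  shows "h a \<in> subalgebra_gen B (h ` X)"
  using assms(4)
proof induction
  case (1 x)
  then show ?case by (intro subalgebra_gen.intros(1)) simp
next
  case 2
  then show ?case using alg_homD(4)[OF assms(3)] subalgebra_gen.intros(2)[of B] by simp
next
  case (3 a b)
  then show ?case using subalgebra_gen_subset[OF assms(1,2)] alg_homD(2)[OF assms(3), of a b]
    subalgebra_gen.intros(3) by (metis subsetD)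
next
  case (4 a b)
  then show ?case using subalgebra_gen_subset[OF assms(1,2)] alg_homD(3)[OF assms(3), of a b]
    subalgebra_gen.intros(4) by (metis subsetD)
next
  case (5 a c)
  then show ?case using subalgebra_gen_subset[OF assms(1,2)] alg_homD(5)[OF assms(3), of a c]
    subalgebra_gen.intros(5) by (metis subsetD)
qed

lemma subalgebra_gen_least:
  assumes "X \<subseteq> subalgebra_gen A Y" shows "subalgebra_gen A X \<subseteq> subalgebra_gen A Y"
proof
  fix a assume "a \<in> subalgebra_gen A X"
  then show "a \<in> subalgebra_gen A Y" by induction (use assms in \<open>auto intro: subalgebra_gen.intros\<close>)
qed

lemma subalgebra_gen_mono: "X \<subseteq> Y \<Longrightarrow> subalgebra_gen A X \<subseteq> subalgebra_gen A Y"
  by (rule subalgebra_gen_least) (auto intro: subalgebra_gen.intros)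

lemma subalgebra_gen_zero:
  assumes "kalg A" shows "\<zero>\<^bsub>A\<^esub> \<in> subalgebra_gen A X"
proof -
  interpret kalg A by fact
  have "0 \<odot>\<^bsub>A\<^esub> \<one>\<^bsub>A\<^esub> \<in> subalgebra_gen A X" by (intro subalgebra_gen.intros)
  then show ?thesis by simp
qed

lemma alg_hom_agree:
  assumes "kalg A" "X \<subseteq> carrier A" "h \<in> alg_hom A B" "h' \<in> alg_hom A B"
    and "\<And>x. x \<in> X \<Longrightarrow> h x = h' x" and "a \<in> subalgebra_gen A X"
  shows "h a = h' a"
  using assms(6)
proof induction
  case 2
  then show ?case using alg_homD(4)[OF assms(3)] alg_homD(4)[OF assms(4)] by simp
next
  case (3 a b)
  then have "a \<in> carrier A" "b \<in> carrier A" using subalgebra_gen_subset[OF assms(1,2)] by auto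
  with 3 show ?case by (simp add: alg_homD(2)[OF assms(3)] alg_homD(2)[OF assms(4)])
next
  case (4 a b)
  then have "a \<in> carrier A" "b \<in> carrier A" using subalgebra_gen_subset[OF assms(1,2)] by auto
  with 4 show ?case by (simp add: alg_homD(3)[OF assms(3)] alg_homD(3)[OF assms(4)])
next
  case (5 a c)
  then have "a \<in> carrier A" using subalgebra_gen_subset[OF assms(1,2)] by auto
  with 5 show ?case by (simp add: alg_homD(5)[OF assms(3)] alg_homD(5)[OF assms(4)])
qed (rule assms(5))

text \<open>The equations for words of one letter determine an algebra morphism on the generated
  subalgebra; those for longer words follow by multiplicativity.\<close>

lemma point_char_eq:
  assumes A: "kalg H" and \<chi>: "\<chi> \<in> characters H" and g: "\<And>f. f \<in> F \<Longrightarrow> g f \<in> carrier H"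
    and ev: "\<And>f. f \<in> F \<Longrightarrow> \<chi> (g f) = eval f x" and gen: "carrier H \<subseteq> subalgebra_gen H (g ` F)"
  shows "point_char H g F x = \<chi>"
  unfolding point_char_def
proof (rule the_equality, intro conjI ballI)
  interpret kalg H by fact
  have alg: "\<chi> \<in> alg_hom H scalars" using \<chi> by (simp add: characters_def)
  show "\<chi> \<in> characters H" by fact
  fix fs assume "fs \<in> lists F"
  then have "foldr (mult H) (map g fs) \<one>\<^bsub>H\<^esub> \<in> carrier H \<and> \<chi> (foldr (mult H) (map g fs) \<one>\<^bsub>H\<^esub>) = (\<Prod>f\<leftarrow>fs. eval f x)"
    by (induction fs) (simp_all add: g ev alg_homD(3)[OF alg] alg_homD(4)[OF alg])
  then show "\<chi> (foldr (mult H) (map g fs) \<one>\<^bsub>H\<^esub>) = (\<Prod>f\<leftarrow>fs. eval f x)" ..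
next
  interpret kalg H by fact
  fix \<xi> assume \<xi>: "\<xi> \<in> characters H \<and> (\<forall>fs\<in>lists F. \<xi> (foldr (mult H) (map g fs) \<one>\<^bsub>H\<^esub>) = (\<Prod>f\<leftarrow>fs. eval f x))"
  have eq: "\<xi> (g f) = \<chi> (g f)" if "f \<in> F" for f
    using bspec[OF conjunct2[OF \<xi>], of "[f]"] that by (simp add: g ev)
  show "\<xi> = \<chi>"
  proof (rule extensionalityI[of _ "carrier H"])
    show "\<xi> \<in> extensional (carrier H)" "\<chi> \<in> extensional (carrier H)" using \<xi> \<chi> by (auto simp: characters_def)
    fix a assume "a \<in> carrier H"
    then have a: "a \<in> subalgebra_gen H (g ` F)" using gen by blast
    have "\<xi> \<in> alg_hom H scalars" "\<chi> \<in> alg_hom H scalars" using \<xi> \<chi> by (simp_all add: characters_def)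
    then show "\<xi> a = \<chi> a"
      by (rule alg_hom_agree[OF A _ _ _ _ a, rotated]) (use eq g in blast)+
  qed
qed

lemma iso_cong:
  assumes "monoid G" "h \<in> iso G H" "\<And>x. x \<in> carrier G \<Longrightarrow> h' x = h x"
  shows "h' \<in> iso G H"
proof -
  interpret monoid G by fact
  have "h' \<in> hom G H" using assms(2,3) by (auto simp: iso_def hom_def Pi_def)
  moreover have "bij_betw h' (carrier G) (carrier H)"
    using assms(2) bij_betw_cong[of "carrier G" h' h] assms(3) by (auto simp: iso_def)
  ultimately show ?thesis by (rule isoI)
qed


section \<open>Points separate the elements of a polynomial algebra\<close>

locale comm_kalg = kalg Q for Q :: "('k::field_char_0, 'b, 'm) module_scheme" (structure) +
  assumes comm: "a \<in> carrier Q \<Longrightarrow> b \<in> carrier Q \<Longrightarrow> a \<otimes> b = b \<otimes> a"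
begin

text \<open>The value at \<open>z\<close> of the polynomial with coefficient list \<open>as\<close>,
  constant term first.\<close>

definition horner :: "'b \<Rightarrow> 'b list \<Rightarrow> 'b"
  where "horner z as = foldr (\<lambda>b s. b \<oplus> z \<otimes> s) as \<zero>"

lemma horner_simps [simp]: "horner z [] = \<zero>" "horner z (a # as) = a \<oplus> z \<otimes> horner z as"
  by (simp_all add: horner_def)

lemma horner_in: "z \<in> carrier Q \<Longrightarrow> set as \<subseteq> carrier Q \<Longrightarrow> horner z as \<in> carrier Q"
  by (induction as) auto

lemma horner_add:
  assumes z: "z \<in> carrier Q" and S: "S \<subseteq> carrier Q" "\<And>a b. a \<in> S \<Longrightarrow> b \<in> S \<Longrightarrow> a \<oplus> b \<in> S"
  shows "set as \<subseteq> S \<Longrightarrow> set bs \<subseteq> S \<Longrightarrow> \<exists>cs. set cs \<subseteq> S \<and> horner z as \<oplus> horner z bs = horner z cs"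
proof (induction as arbitrary: bs)
  case Nil
  then show ?case using S z by (intro exI[of _ bs]) (auto simp: horner_in)
next
  case (Cons a as)
  show ?case
  proof (cases bs)
    case Nil
    have "horner z (a # as) \<in> carrier Q" by (rule horner_in[OF z]) (use Cons.prems S(1) in blast)
    then show ?thesis using Nil Cons.prems by (intro exI[of _ "a # as"]) simp
  next
    case (Cons b bs')
    then obtain cs where cs: "set cs \<subseteq> S" "horner z as \<oplus> horner z bs' = horner z cs"
      using Cons.IH[of bs'] Cons.prems \<open>set (a # as) \<subseteq> S\<close> \<open>set bs \<subseteq> S\<close> by auto
    have in_Q: "a \<in> carrier Q" "b \<in> carrier Q" "horner z as \<in> carrier Q" "horner z bs' \<in> carrier Q"
      using \<open>set (a # as) \<subseteq> S\<close> \<open>set bs \<subseteq> S\<close> S(1) z Cons by (auto intro!: horner_in)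
    have "horner z (a # as) \<oplus> horner z bs = (a \<oplus> b) \<oplus> z \<otimes> (horner z as \<oplus> horner z bs')"
      using in_Q z by (simp add: Cons r_distr a_ac)
    then show ?thesis
      using cs S(2) \<open>set (a # as) \<subseteq> S\<close> \<open>set bs \<subseteq> S\<close> Cons by (intro exI[of _ "(a \<oplus> b) # cs"]) auto
  qed
qed

lemma horner_scale:
  assumes "z \<in> carrier Q" "b \<in> carrier Q"
  shows "set as \<subseteq> carrier Q \<Longrightarrow> b \<otimes> horner z as = horner z (map (mult Q b) as)"
proof (induction as)
  case (Cons a as)
  then have in_Q: "a \<in> carrier Q" "horner z as \<in> carrier Q" using assms by (auto intro!: horner_in)
  have "b \<otimes> (z \<otimes> horner z as) = z \<otimes> (b \<otimes> horner z as)"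
    using in_Q assms comm[of b z] by (simp flip: m_assoc)
  then show ?case using Cons in_Q assms by (simp add: r_distr)
qed (simp add: assms)

lemma horner_mult:
  assumes z: "z \<in> carrier Q" and S: "S \<subseteq> carrier Q" "\<And>a b. a \<in> S \<Longrightarrow> b \<in> S \<Longrightarrow> a \<oplus> b \<in> S"
    "\<And>a b. a \<in> S \<Longrightarrow> b \<in> S \<Longrightarrow> a \<otimes> b \<in> S" "\<zero> \<in> S"
  shows "set as \<subseteq> S \<Longrightarrow> set bs \<subseteq> S \<Longrightarrow> \<exists>cs. set cs \<subseteq> S \<and> horner z as \<otimes> horner z bs = horner z cs"
proof (induction as)
  case Nil
  then show ?case using S z by (intro exI[of _ "[]"]) (auto simp: horner_in)
next
  case (Cons a as)
  then obtain cs where cs: "set cs \<subseteq> S" "horner z as \<otimes> horner z bs = horner z cs" by auto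
  have in_Q: "a \<in> carrier Q" "horner z as \<in> carrier Q" "horner z bs \<in> carrier Q" "horner z cs \<in> carrier Q"
    using Cons.prems S(1) z cs(1) by (auto intro!: horner_in)
  have bs: "set bs \<subseteq> carrier Q" using Cons.prems S(1) by auto
  have "horner z (a # as) \<otimes> horner z bs = a \<otimes> horner z bs \<oplus> z \<otimes> (horner z as \<otimes> horner z bs)"
    using in_Q z by (simp add: l_distr m_assoc)
  also have "\<dots> = horner z (map (mult Q a) bs) \<oplus> horner z (\<zero> # cs)"
    using horner_scale[OF z in_Q(1) bs] in_Q z by (simp add: cs(2))
  finally have eq: "horner z (a # as) \<otimes> horner z bs = horner z (map (mult Q a) bs) \<oplus> horner z (\<zero> # cs)" .
  have "set (map (mult Q a) bs) \<subseteq> S" "set (\<zero> # cs) \<subseteq> S" using Cons.prems S cs by auto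
  from horner_add[OF z S(1,2) this] show ?case unfolding eq by blast
qed

text \<open>The algebra generated by one more element consists of polynomials in it over the smaller
  one; commutativity allows the coefficients to be collected.\<close>

lemma subalgebra_gen_horner:
  assumes z: "z \<in> carrier Q" and X: "X \<subseteq> carrier Q" and a: "a \<in> subalgebra_gen Q (insert z X)"
  shows "\<exists>as. set as \<subseteq> subalgebra_gen Q X \<and> a = horner z as"
  using a
proof induction
  let ?S = "subalgebra_gen Q X"
  have S: "?S \<subseteq> carrier Q" by (rule subalgebra_gen_subset[OF kalg_axioms X])
  have zS: "\<zero> \<in> ?S" by (rule subalgebra_gen_zero[OF kalg_axioms])
  note intr = subalgebra_gen.intros
  case (1 x)
  then show ?case
  proof
    assume "x = z"
    then show ?thesis using z zS by (intro exI[of _ "[\<zero>, \<one>]"]) (auto intro: intr)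
  next
    assume "x \<in> X"
    then show ?thesis using z X by (intro exI[of _ "[x]"]) (auto intro: intr)
  qed
next
  case 2
  then show ?case using z subalgebra_gen.intros(2)[of Q X] by (intro exI[of _ "[\<one>]"]) auto
next
  case (3 a b)
  then obtain as bs where "set as \<subseteq> subalgebra_gen Q X" "a = horner z as" "set bs \<subseteq> subalgebra_gen Q X" "b = horner z bs"
    by blast
  then show ?case
    using horner_add[OF z subalgebra_gen_subset[OF kalg_axioms X] subalgebra_gen.intros(3)] by metis
next
  case (4 a b)
  then obtain as bs where "set as \<subseteq> subalgebra_gen Q X" "a = horner z as" "set bs \<subseteq> subalgebra_gen Q X" "b = horner z bs"
    by blast
  then show ?case
    using horner_mult[OF z subalgebra_gen_subset[OF kalg_axioms X] subalgebra_gen.intros(3) subalgebra_gen.intros(4)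
        subalgebra_gen_zero[OF kalg_axioms]] by metis
next
  case (5 a c)
  then obtain as where as: "set as \<subseteq> subalgebra_gen Q X" "a = horner z as" by blast
  have "set as \<subseteq> carrier Q \<Longrightarrow> c \<odot> horner z as = horner z (map (\<lambda>a. c \<odot> a) as)"
  proof (induction as)
    case (Cons a as)
    then have "horner z as \<in> carrier Q" using z by (auto intro!: horner_in)
    then show ?case using Cons z smult_mult_right[OF z, of "horner z as" c] by (simp add: smult_r_distr)
  qed simp
  moreover have "set as \<subseteq> carrier Q" using as(1) subalgebra_gen_subset[OF kalg_axioms X] by blast
  ultimately show ?case
    using as by (intro exI[of _ "map (\<lambda>a. c \<odot> a) as"]) (auto intro!: subalgebra_gen.intros(5))
qed

lemma char_horner:
  assumes "\<chi> \<in> alg_hom Q scalars" "z \<in> carrier Q"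
  shows "set as \<subseteq> carrier Q \<Longrightarrow> \<chi> (horner z as) = poly (Poly (map \<chi> as)) (\<chi> z)"
proof (induction as)
  case Nil
  then show ?case using linear_form_at_zero[OF alg_hom_scalars_linear[OF assms(1)]] by simp
next
  case (Cons a as)
  then have "horner z as \<in> carrier Q" using assms(2) by (auto intro!: horner_in)
  with Cons assms(2) show ?case by (simp add: alg_homD(2)[OF assms(1)] alg_homD(3)[OF assms(1)])
qed

text \<open>Induction on the number of generators. Changing \<open>s\<close> at \<open>j\<close>
  alone moves the value of \<open>g j\<close> and leaves the values of the coefficients unchanged,
  so these are the coefficients of a polynomial in one variable with all values 0, and over an
  infinite field they vanish. As this holds for all \<open>s\<close>, the coefficients are 0 in
  \<open>Q\<close> by induction.\<close>

lemma poly_separation: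
  assumes "finite I" "g ` I \<subseteq> carrier Q" and "\<And>s :: 'i \<Rightarrow> 'k. \<xi> s \<in> alg_hom Q scalars"
    and "\<And>s i. i \<in> I \<Longrightarrow> \<xi> s (g i) = s i" and "a \<in> subalgebra_gen Q (g ` I)" and "\<And>s. \<xi> s a = 0"
  shows "a = \<zero>"
  using assms(1,2,4,5,6)
proof (induction I arbitrary: a rule: finite_induct)
  case empty
  have "\<exists>c. a = c \<odot> \<one>"
    using empty.prems(3)
  proof induction
    case 2
    then show ?case using smult_one[of \<one>] by (metis one_closed)
  next
    case (3 a b)
    then show ?case using smult_l_distr[OF one_closed] by metis
  next
    case (4 a b)
    then show ?case by (metis one_closed smult_closed smult_mult_left l_one smult_assoc)
  next
    case (5 a c)
    then show ?case by (metis one_closed smult_assoc)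
  qed simp
  then obtain c where c: "a = c \<odot> \<one>" ..
  \<comment> \<open>Without generators any assignment of values serves.\<close>
  have "\<xi> undefined a = c" unfolding c by (simp add: alg_homD(5)[OF assms(3)] alg_homD(4)[OF assms(3)])
  with empty.prems(4) c show ?case by simp
next
  case (insert j I)
  have X: "g ` I \<subseteq> carrier Q" and z: "g j \<in> carrier Q" using insert.prems by auto
  let ?S = "subalgebra_gen Q (g ` I)"
  have S: "?S \<subseteq> carrier Q" by (rule subalgebra_gen_subset[OF kalg_axioms X])
  obtain as where as: "set as \<subseteq> ?S" "a = horner (g j) as"
    using subalgebra_gen_horner[OF z X] insert.prems(3) by auto
  have asQ: "set as \<subseteq> carrier Q" using as(1) S by blast
  have zero: "\<xi> s b = 0" if b: "b \<in> set as" for s b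
  proof -
    have indep: "\<xi> (s(j := t)) c = \<xi> s c" if "c \<in> ?S" for c t
      by (rule alg_hom_agree[OF kalg_axioms X assms(3) assms(3) _ that]) (use insert in auto)
    have "poly (Poly (map (\<xi> s) as)) t = 0" for t
    proof -
      have "\<xi> (s(j := t)) a = poly (Poly (map (\<xi> (s(j := t))) as)) (\<xi> (s(j := t)) (g j))"
        unfolding as(2) by (rule char_horner[OF assms(3) z asQ])
      also have "map (\<xi> (s(j := t))) as = map (\<xi> s) as" using indep as(1) by (intro map_cong) auto
      also have "\<xi> (s(j := t)) (g j) = t" by (subst insert.prems(2)) simp_all
      finally show ?thesis using insert.prems(4) by simp
    qed
    then have "Poly (map (\<xi> s) as) = 0" using poly_all_0_iff_0 by blast
    moreover obtain k where k: "k < length as" "b = as ! k" using b by (auto simp: in_set_conv_nth)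
    have "coeff (Poly (map (\<xi> s) as)) k = \<xi> s b" using k by (simp add: coeff_Poly_eq nth_default_def)
    ultimately show ?thesis by simp
  qed
  have az: "b = \<zero>" if "b \<in> set as" for b
    by (rule insert.IH[OF X]) (use insert.prems(2) as(1) that zero in auto)
  have "set bs \<subseteq> {\<zero>} \<Longrightarrow> horner (g j) bs = \<zero>" for bs by (induction bs) (auto simp: z)
  then show ?case using az as(2) by blast
qed

end


section \<open>Subbialgebras\<close>

lemma kalg_sub:
  assumes "kalg A" "S \<subseteq> carrier A" "\<zero>\<^bsub>A\<^esub> \<in> S" "\<one>\<^bsub>A\<^esub> \<in> S"
    "\<And>a b. a \<in> S \<Longrightarrow> b \<in> S \<Longrightarrow> a \<oplus>\<^bsub>A\<^esub> b \<in> S" "\<And>a b. a \<in> S \<Longrightarrow> b \<in> S \<Longrightarrow> a \<otimes>\<^bsub>A\<^esub> b \<in> S"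
    "\<And>a c. a \<in> S \<Longrightarrow> c \<odot>\<^bsub>A\<^esub> a \<in> S"
  shows "kalg (A\<lparr>carrier := S\<rparr>)"
proof -
  interpret kalg A by fact
  have s: "a \<in> carrier A" if "a \<in> S" for a using that assms(2) by blast
  show ?thesis
    by (intro kalgI kspaceI)
      (simp_all add: assms s smult_l_distr smult_r_distr smult_assoc smult_one a_ac m_assoc l_distr r_distr
        smult_mult_left smult_mult_right)
qed

lemma linear_form_coprod_update [simp]:
  "linear_form (B\<lparr>coprod := \<delta>\<rparr>) = linear_form B"
  "bilinear_forms (B\<lparr>coprod := \<delta>\<rparr>) (B\<lparr>coprod := \<delta>\<rparr>) = bilinear_forms B B"
  "tensors (B\<lparr>coprod := \<delta>\<rparr>) (B\<lparr>coprod := \<delta>\<rparr>) = tensors B B"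
  "tensor_prod (B\<lparr>coprod := \<delta>\<rparr>) (B\<lparr>coprod := \<delta>\<rparr>) = tensor_prod B B"
  "alg_hom (B\<lparr>coprod := \<delta>\<rparr>) E = alg_hom B E"
  by (simp_all add: linear_form_def bilinear_forms_def tensor_prod_def tensors_def pure_tensor_def
      alg_hom_def ring_hom_def fun_eq_iff)

text \<open>Tensors over \<open>S\<close> and over \<open>H\<close> are functionals supported on
  different sets of bilinear forms, so the inclusion of the tensor squares is not an inclusion of
  sets but the map \<open>emb\<close>. The separating family is there to make \<open>emb\<close>
  injective.\<close>

locale sub_bialg =
  fixes H :: "('k::field, 'a) bialgebra" and S :: "'a set" and \<Lambda> :: "('a \<Rightarrow> 'k) set"
  assumes bialg: "bialg H" and S_sub: "S \<subseteq> carrier H" and S_one: "\<one>\<^bsub>H\<^esub> \<in> S"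
    and S_add: "a \<in> S \<Longrightarrow> b \<in> S \<Longrightarrow> a \<oplus>\<^bsub>H\<^esub> b \<in> S" and S_mult: "a \<in> S \<Longrightarrow> b \<in> S \<Longrightarrow> a \<otimes>\<^bsub>H\<^esub> b \<in> S"
    and S_scale: "a \<in> S \<Longrightarrow> c \<odot>\<^bsub>H\<^esub> a \<in> S" and sep: "separating H \<Lambda>"
    and ex: "a \<in> S \<Longrightarrow> \<exists>d\<in>tensors H H S S. d = coprod H a"
begin

sublocale H: kalg H using bialg by (simp add: bialg_def)

abbreviation "B \<equiv> H\<lparr>carrier := S\<rparr>"

lemma S_zero: "\<zero>\<^bsub>H\<^esub> \<in> S"
  using S_scale[OF S_one, of 0] by simp

lemma kalg_B: "kalg B"
  by (rule kalg_sub) (use H.kalg_axioms S_sub S_one S_add S_mult S_scale S_zero in auto)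

sublocale B: kalg B by (rule kalg_B)
sublocale BB: two_algs B B by unfold_locales

abbreviation "emb \<equiv> tensor_map H H (\<lambda>x. x) (\<lambda>x. x)"

lemma id_hom: "(\<lambda>x. x) \<in> alg_hom B H"
  by (rule alg_homI) (use S_sub in auto)

lemma emb_hom: "emb \<in> alg_hom (tensor_prod B B) (tensor_prod H H)"
  by (rule tensor_map_alg_hom[OF kalg_B kalg_B H.kalg_axioms H.kalg_axioms id_hom id_hom])

lemma linear_form_restrict: "linear_form H \<phi> \<Longrightarrow> linear_form B \<phi>"
  using S_sub by (simp add: linear_form_def subset_iff)

lemma separating_B: "separating B \<Lambda>"
  using sep S_sub linear_form_restrict unfolding separating_def by auto

lemma emb_eval: "linear_form H \<phi> \<Longrightarrow> linear_form H \<psi> \<Longrightarrow> emb t (\<lambda>x y. \<phi> x * \<psi> y) = t (\<lambda>x y. \<phi> x * \<psi> y)"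
  using bil_prod by (auto simp: tensor_map_def)

text \<open>\<open>emb\<close> keeps the values on products of linear forms of \<open>H\<close>, and
  a separating family on \<open>H\<close> still separates the elements of \<open>S\<close>.\<close>

lemma emb_inj:
  assumes "s \<in> carrier (tensor_prod B B)" "t \<in> carrier (tensor_prod B B)" "emb s = emb t"
  shows "s = t"
proof -
  interpret TB: kalg "tensor_prod B B" by (rule BB.kalg_tensor_prod)
  let ?d = "s \<oplus>\<^bsub>tensor_prod B B\<^esub> (- 1) \<odot>\<^bsub>tensor_prod B B\<^esub> t"
  have d: "?d \<in> carrier (tensor_prod B B)" using assms by (intro TB.a_closed TB.smult_closed)
  have "?d = (\<lambda>\<beta>. 0)"
  proof (rule separating_tensor[OF B.kspace_axioms B.kspace_axioms separating_B separating_B])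
    show "?d \<in> tensors B B (carrier B) (carrier B)" using d by simp
    fix \<phi> \<psi> assume "\<phi> \<in> \<Lambda>" "\<psi> \<in> \<Lambda>"
    then have lin: "linear_form H \<phi>" "linear_form H \<psi>" using sep by (auto simp: separating_def)
    show "?d (\<lambda>a b. \<phi> a * \<psi> b) = 0"
      using emb_eval[OF lin, of s] emb_eval[OF lin, of t] assms(3) by simp
  qed
  then show ?thesis by (auto simp: fun_eq_iff)
qed

lemma ex_delta: "a \<in> S \<Longrightarrow> \<exists>d\<in>carrier (tensor_prod B B). emb d = coprod H a"
proof -
  assume "a \<in> S"
  then have "coprod H a \<in> tensors H H S S" using ex by blast
  then obtain ps where ps: "set ps \<subseteq> S \<times> S" "coprod H a = tsum H H ps" by (rule tensorsE)
  have "emb (tsum B B ps) = tsum H H ps"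
    using tensor_map_tsum[OF id_hom id_hom, of ps] ps(1) by simp
  then show ?thesis using ps by (intro bexI[of _ "tsum B B ps"]) (auto intro: tensors_tsumI)
qed

definition delta :: "'a \<Rightarrow> ('k, 'a, 'a) tensor"
  where "delta = (\<lambda>a\<in>S. SOME d. d \<in> carrier (tensor_prod B B) \<and> emb d = coprod H a)"

lemma delta: "a \<in> S \<Longrightarrow> delta a \<in> carrier (tensor_prod B B)" "a \<in> S \<Longrightarrow> emb (delta a) = coprod H a"
proof -
  assume a: "a \<in> S"
  then have "\<exists>d. d \<in> carrier (tensor_prod B B) \<and> emb d = coprod H a" using ex_delta by blast
  from someI_ex[OF this] show "delta a \<in> carrier (tensor_prod B B)" "emb (delta a) = coprod H a"
    using a by (simp_all add: delta_def del: tp_simps)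
qed

lemma sub_bialgebra_eq: "sub_bialgebra H S = H\<lparr>carrier := S, coprod := delta\<rparr>"
proof -
  have "(THE \<delta>. \<delta> \<in> extensional S \<and> (\<forall>a\<in>S. \<delta> a \<in> carrier (tensor_prod B B) \<and> emb (\<delta> a) = coprod H a)) = delta"
  proof (rule the_equality)
    show "delta \<in> extensional S \<and> (\<forall>a\<in>S. delta a \<in> carrier (tensor_prod B B) \<and> emb (delta a) = coprod H a)"
      using delta by (auto simp del: tp_simps) (simp add: delta_def)
    fix \<delta> assume \<delta>: "\<delta> \<in> extensional S \<and> (\<forall>a\<in>S. \<delta> a \<in> carrier (tensor_prod B B) \<and> emb (\<delta> a) = coprod H a)"
    show "\<delta> = delta"
    proof (rule extensionalityI[of _ S])
      fix a assume a: "a \<in> S"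
      with \<delta> have *: "\<delta> a \<in> carrier (tensor_prod B B)" "emb (\<delta> a) = coprod H a" by blast+
      show "\<delta> a = delta a" by (rule emb_inj[OF *(1) delta(1)[OF a]]) (simp only: * delta(2)[OF a])
    qed (use \<delta> in blast, simp add: delta_def)
  qed
  then show ?thesis by (simp add: sub_bialgebra_def Let_def del: tp_simps)
qed

abbreviation "SB \<equiv> sub_bialgebra H S"

lemma SB_upd: "SB = B\<lparr>coprod := delta\<rparr>"
  by (simp add: sub_bialgebra_eq)

lemma SB_simps [simp]:
  "carrier SB = S" "mult SB = mult H" "one SB = one H" "zero SB = zero H" "add SB = add H"
  "module.smult SB = module.smult H" "coprod SB = delta"
  by (simp_all add: sub_bialgebra_eq)

lemma bialg_SB: "bialg SB"
proof -
  have cp: "coprod H \<in> alg_hom H (tensor_prod H H)" using bialg by (simp add: bialg_def)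
  interpret TB: kalg "tensor_prod B B" by (rule BB.kalg_tensor_prod)
  have s: "a \<in> carrier H" if "a \<in> S" for a using that S_sub by blast
  have "delta \<in> alg_hom B (tensor_prod B B)"
  proof (rule alg_homI)
    show "delta \<one>\<^bsub>B\<^esub> = \<one>\<^bsub>tensor_prod B B\<^esub>"
    proof (rule emb_inj)
      show "delta \<one>\<^bsub>B\<^esub> \<in> carrier (tensor_prod B B)" using delta(1)[OF S_one] by simp
      show "\<one>\<^bsub>tensor_prod B B\<^esub> \<in> carrier (tensor_prod B B)" by (rule TB.one_closed)
      show "emb (delta \<one>\<^bsub>B\<^esub>) = emb \<one>\<^bsub>tensor_prod B B\<^esub>"
        using delta(2)[OF S_one] alg_homD(4)[OF cp] alg_homD(4)[OF emb_hom] by simp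
    qed
    fix a assume "a \<in> carrier B"
    then have a: "a \<in> S" by simp
    note da = delta(1)[OF a]
    show "delta a \<in> carrier (tensor_prod B B)" by (rule da)
    show "delta (c \<odot>\<^bsub>B\<^esub> a) = c \<odot>\<^bsub>tensor_prod B B\<^esub> delta a" for c
    proof (rule emb_inj)
      show "delta (c \<odot>\<^bsub>B\<^esub> a) \<in> carrier (tensor_prod B B)" using delta(1)[OF S_scale[OF a]] by simp
      show "c \<odot>\<^bsub>tensor_prod B B\<^esub> delta a \<in> carrier (tensor_prod B B)" by (rule TB.smult_closed[OF da])
      show "emb (delta (c \<odot>\<^bsub>B\<^esub> a)) = emb (c \<odot>\<^bsub>tensor_prod B B\<^esub> delta a)"
        using delta(2)[OF S_scale[OF a, of c]] delta(2)[OF a] alg_homD(5)[OF cp s[OF a], of c]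
          alg_homD(5)[OF emb_hom da, of c] by (simp del: tp_simps)
    qed
    fix b assume "b \<in> carrier B"
    then have b: "b \<in> S" by simp
    note db = delta(1)[OF b]
    show "delta (a \<oplus>\<^bsub>B\<^esub> b) = delta a \<oplus>\<^bsub>tensor_prod B B\<^esub> delta b"
    proof (rule emb_inj)
      show "delta (a \<oplus>\<^bsub>B\<^esub> b) \<in> carrier (tensor_prod B B)" using delta(1)[OF S_add[OF a b]] by simp
      show "delta a \<oplus>\<^bsub>tensor_prod B B\<^esub> delta b \<in> carrier (tensor_prod B B)" by (rule TB.a_closed[OF da db])
      show "emb (delta (a \<oplus>\<^bsub>B\<^esub> b)) = emb (delta a \<oplus>\<^bsub>tensor_prod B B\<^esub> delta b)"
        using delta(2)[OF S_add[OF a b]] delta(2)[OF a] delta(2)[OF b] alg_homD(2)[OF cp s[OF a] s[OF b]]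
          alg_homD(2)[OF emb_hom da db] by (simp del: tp_simps)
    qed
    show "delta (a \<otimes>\<^bsub>B\<^esub> b) = delta a \<otimes>\<^bsub>tensor_prod B B\<^esub> delta b"
    proof (rule emb_inj)
      show "delta (a \<otimes>\<^bsub>B\<^esub> b) \<in> carrier (tensor_prod B B)" using delta(1)[OF S_mult[OF a b]] by simp
      show "delta a \<otimes>\<^bsub>tensor_prod B B\<^esub> delta b \<in> carrier (tensor_prod B B)" by (rule TB.m_closed[OF da db])
      show "emb (delta (a \<otimes>\<^bsub>B\<^esub> b)) = emb (delta a \<otimes>\<^bsub>tensor_prod B B\<^esub> delta b)"
        using delta(2)[OF S_mult[OF a b]] delta(2)[OF a] delta(2)[OF b] alg_homD(3)[OF cp s[OF a] s[OF b]]
          alg_homD(3)[OF emb_hom da db] by (simp del: tp_simps)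
    qed
  qed
  moreover have "kalg SB" by (rule kalg_cong[OF kalg_B]) simp_all
  ultimately show ?thesis unfolding bialg_def by (simp add: SB_upd del: tp_simps)
qed

lemma coprod_SB:
  assumes "linear_form H \<phi>" "linear_form H \<psi>" "a \<in> S"
  shows "coprod SB a (\<lambda>x y. \<phi> x * \<psi> y) = coprod H a (\<lambda>x y. \<phi> x * \<psi> y)"
  using emb_eval[OF assms(1,2), of "delta a"] delta(2)[OF assms(3)] by simp

lemma coprod_SB_in: "a \<in> S \<Longrightarrow> coprod SB a \<in> tensors SB SB S S"
  using delta(1)[of a] by (simp add: SB_upd)

lemma separating_SB: "separating SB \<Lambda>"
  using separating_B by (simp add: SB_upd separating_def)

lemma ideal_sub:
  assumes "ideal J H" shows "ideal (J \<inter> S) SB"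
proof -
  interpret J: kalg_ideal H J by (intro kalg_ideal.intro H.kalg_axioms assms)
  have ks: "kalg SB" using bialg_SB by (simp add: bialg_def)
  then interpret SBa: kalg SB .
  show ?thesis
  proof (rule idealI[OF SBa.ring_axioms])
    show "subgroup (J \<inter> S) (add_monoid SB)"
    proof (rule SBa.add.subgroupI)
      show "J \<inter> S \<noteq> {}" using S_zero additive_subgroup.zero_closed[OF J.is_additive_subgroup] by blast
      fix a assume a: "a \<in> J \<inter> S"
      have "\<ominus>\<^bsub>SB\<^esub> a = (- 1) \<odot>\<^bsub>H\<^esub> a" using SBa.uminus_smult[of a] a by simp
      then show "\<ominus>\<^bsub>SB\<^esub> a \<in> J \<inter> S" using a J.smult_in_ideal S_scale by auto
    qed (auto simp: additive_subgroup.a_closed[OF J.is_additive_subgroup] S_add S_sub[THEN subsetD])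
  qed (use S_sub J.I_l_closed J.I_r_closed S_mult in auto)
qed

end


section \<open>Identification of points with characters through generators\<close>

lemma points_point_char:
  assumes pts: "points H G \<chi>" and g: "\<And>f. f \<in> F \<Longrightarrow> g f \<in> carrier H"
    and ev: "\<And>x f. x \<in> carrier G \<Longrightarrow> f \<in> F \<Longrightarrow> \<chi> x (g f) = eval f x"
    and gen: "carrier H \<subseteq> subalgebra_gen H (g ` F)"
  shows "point_char H g F \<in> iso G (char_monoid H)"
proof (rule iso_cong[OF _ points_iso(2)[OF pts]])
  show "monoid G" using pts by (simp add: points_def)
  fix x assume x: "x \<in> carrier G"
  have "\<chi> x \<in> characters H" using pts x by (auto simp: points_def bij_betw_def)
  then show "point_char H g F x = \<chi> x"
    using pts x by (intro point_char_eq g ev gen) (auto simp: points_def bialg_def)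
qed

lemma ab_class_hom:
  assumes "bialg H"
  shows "ab_class H \<in> alg_hom H (abelianization H)" "carrier (abelianization H) = ab_class H ` carrier H"
proof -
  interpret bialg_quot H "commutator_ideal H" by (rule bialg_quot_abelianization[OF assms])
  have "ab_class H = \<pi>" by (simp add: ab_class_def fun_eq_iff)
  then show "ab_class H \<in> alg_hom H (abelianization H)" "carrier (abelianization H) = ab_class H ` carrier H"
    using pi_QB carrier_Q by (simp_all add: abelianization_def)
qed

lemma subalgebra_gen_onto:
  assumes "kalg A" "X \<subseteq> carrier A" "h \<in> alg_hom A B" "carrier B = h ` carrier A" "carrier A \<subseteq> subalgebra_gen A X"
  shows "carrier B \<subseteq> subalgebra_gen B (h ` X)"
proof
  fix b assume "b \<in> carrier B"
  then obtain a where a: "a \<in> carrier A" "b = h a" unfolding assms(4) by (rule imageE)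
  show "b \<in> subalgebra_gen B (h ` X)"
    unfolding a(2) by (rule subalgebra_gen_image[OF assms(1-3)]) (rule subsetD[OF assms(5) a(1)])
qed

lemma abelianization_point_char:
  assumes pts: "points H G \<chi>" and g: "\<And>f. f \<in> F \<Longrightarrow> g f \<in> carrier H"
    and ev: "\<And>x f. x \<in> carrier G \<Longrightarrow> f \<in> F \<Longrightarrow> \<chi> x (g f) = eval f x"
    and gen: "carrier H \<subseteq> subalgebra_gen H (g ` F)"
  shows "point_char (abelianization H) (\<lambda>f. ab_class H (g f)) F \<in> iso G (char_monoid (abelianization H))"
    and "monoid (char_monoid (abelianization H))"
    and "group G \<Longrightarrow> group (char_monoid (abelianization H))"
proof -
  obtain \<chi>' where \<chi>': "points (abelianization H) G \<chi>'"
    "\<And>x a. x \<in> carrier G \<Longrightarrow> a \<in> carrier H \<Longrightarrow> \<chi>' x (ab_class H a) = \<chi> x a"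
    using points_abelianization[OF pts] by blast
  have b: "bialg H" using pts by (simp add: points_def)
  have k: "kalg H" using b by (simp add: bialg_def)
  note ab = ab_class_hom[OF b]
  have "g ` F \<subseteq> carrier H" using g by blast
  from subalgebra_gen_onto[OF k this ab gen]
  have "carrier (abelianization H) \<subseteq> subalgebra_gen (abelianization H) ((\<lambda>f. ab_class H (g f)) ` F)"
    by (simp add: image_image)
  then show "point_char (abelianization H) (\<lambda>f. ab_class H (g f)) F \<in> iso G (char_monoid (abelianization H))"
    by (intro points_point_char[OF \<chi>'(1)]) (simp_all add: alg_homD(1)[OF ab(1)] g \<chi>'(2) ev)
  show "monoid (char_monoid (abelianization H))" by (rule points_iso(1)[OF \<chi>'(1)])
  show "group G \<Longrightarrow> group (char_monoid (abelianization H))" by (rule points_group[OF \<chi>'(1)])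
qed

context operad_fin
begin

lemma T_gen: "carrier T \<subseteq> subalgebra_gen T (gn ` carrier D)"
proof
  fix a assume "a \<in> carrier T"
  then show "a \<in> subalgebra_gen T (gn ` carrier D)"
    by (induction rule: D.ta_gen_induct) (auto intro: subalgebra_gen.intros simp del: ta_simps)
qed

lemma boldD_gen: "carrier (with_coprod T d) \<subseteq> subalgebra_gen (with_coprod T d) (gn ` carrier D)"
proof -
  have "(\<lambda>a. a) \<in> alg_hom T (with_coprod T d)" by (simp, rule alg_homI) auto
  moreover have "gn ` carrier D \<subseteq> carrier T" using gn_in by blast
  ultimately show ?thesis
    using subalgebra_gen_onto[OF T.kalg_axioms _ _ _ T_gen, of "\<lambda>a. a" "with_coprod T d"] by (simp del: ta_simps)
qed

section \<open>The symmetric algebra of the graded dual and its points\<close>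

abbreviation "Dst \<equiv> boldD_star \<P>"
abbreviation "Sd \<equiv> S_dual \<P>"
abbreviation "sg \<equiv> S_gen \<P>"
abbreviation "invD \<equiv> inv_dual \<P> (ops \<P>)"

lemma Dst_carrier: "carrier Dst = carrier T"
  by (simp add: boldD_star_def del: ta_simps)

lemma bialg_Dst: "bialg Dst"
  using points_star by (simp add: points_def)

definition chiS :: "'a fam \<Rightarrow> ('k, 'a) dual_tens set \<Rightarrow> 'k"
  where "chiS = (SOME \<chi>. points Sd (M \<P>) \<chi> \<and> (\<forall>x\<in>fams. \<forall>a\<in>carrier T. \<chi> x (ab_class Dst a) = chi x a))"

lemma chiS: "points Sd (M \<P>) chiS" "x \<in> fams \<Longrightarrow> a \<in> carrier T \<Longrightarrow> chiS x (ab_class Dst a) = chi x a"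
proof -
  have "\<exists>\<chi>. points Sd (M \<P>) \<chi> \<and> (\<forall>x\<in>fams. \<forall>a\<in>carrier T. \<chi> x (ab_class Dst a) = chi x a)"
    using points_abelianization[OF points_star] by (simp add: S_dual_def Dst_carrier del: ta_simps)
  note * = someI_ex[OF this, folded chiS_def]
  show "points Sd (M \<P>) chiS" "x \<in> fams \<Longrightarrow> a \<in> carrier T \<Longrightarrow> chiS x (ab_class Dst a) = chi x a"
    using * by blast+
qed

lemma bialg_Sd: "bialg Sd" using chiS(1) by (simp add: points_def)

lemma kalg_Sd: "kalg Sd" using bialg_Sd by (simp add: bialg_def)

sublocale Sd: comm_kalg Sd
proof (rule comm_kalg.intro[OF kalg_Sd], unfold_locales)
  interpret bialg_quot Dst "commutator_ideal Dst" by (rule bialg_quot_abelianization[OF bialg_Dst])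
  fix a b assume "a \<in> carrier Sd" "b \<in> carrier Sd"
  then show "a \<otimes>\<^bsub>Sd\<^esub> b = b \<otimes>\<^bsub>Sd\<^esub> a"
    using quot_commutator_comm[OF kalg_axioms, of a b] by (simp add: S_dual_def abelianization_def Q_def)
qed

lemma chiS_alg: "x \<in> fams \<Longrightarrow> chiS x \<in> alg_hom Sd scalars"
  using chiS(1) by (auto simp: points_def bij_betw_def characters_def)

lemma chiS_lin: "x \<in> fams \<Longrightarrow> linear_form Sd (chiS x)"
  by (rule alg_hom_scalars_linear[OF chiS_alg])

lemma ab_hom: "ab_class Dst \<in> alg_hom T Sd" "carrier Sd = ab_class Dst ` carrier T"
  using ab_class_hom[OF bialg_Dst] by (simp_all add: S_dual_def boldD_star_def del: ta_simps)

lemma sg_eq: "sg f = ab_class Dst (gn f)" by (simp add: S_gen_def)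

lemma sg_in: "f \<in> carrier D \<Longrightarrow> sg f \<in> carrier Sd"
  unfolding sg_eq by (rule alg_homD(1)[OF ab_hom(1) gn_in])

lemma sg_linear: "f \<in> carrier D \<Longrightarrow> g \<in> carrier D \<Longrightarrow> sg (f \<oplus>\<^bsub>D\<^esub> g) = sg f \<oplus>\<^bsub>Sd\<^esub> sg g"
  "f \<in> carrier D \<Longrightarrow> sg (c \<odot>\<^bsub>D\<^esub> f) = c \<odot>\<^bsub>Sd\<^esub> sg f"
  unfolding sg_eq by (simp_all only: gn_linear alg_homD(2)[OF ab_hom(1) gn_in gn_in] alg_homD(5)[OF ab_hom(1) gn_in])

lemma chiS_sg: "x \<in> fams \<Longrightarrow> f \<in> carrier D \<Longrightarrow> chiS x (sg f) = eval f x"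
  unfolding sg_eq by (simp only: chiS(2) gn_in chi_gen)

lemma Sd_gen: "carrier Sd \<subseteq> subalgebra_gen Sd (sg ` carrier D)"
proof -
  have "gn ` carrier D \<subseteq> carrier T" using gn_in by blast
  from subalgebra_gen_onto[OF T.kalg_axioms this ab_hom T_gen] show ?thesis by (simp add: image_image sg_eq)
qed

lemma eval_bd_be:
  assumes "i \<in> idx N" "j \<in> idx N" shows "eval (bd i) (be j) = (if i = j then 1 else 0)"
proof -
  obtain n b m c where ij: "i = (n, b)" "j = (m, c)" "b \<in> basis n" "c \<in> basis m"
    using assms by (auto simp: idx_def)
  have "coord n b 0 = 0" using V.representation_zero by (simp add: coord_def)
  moreover have "coord n b c = (if b = c then 1 else 0)" if "m = n"
    using V.representation_basis[OF basis(3)] ij that basis_in by (auto simp: coord_def)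
  ultimately show ?thesis by (auto simp: ij(1,2) eval_bd be_def)
qed

lemma idx_mono: "N \<le> N' \<Longrightarrow> idx N \<subseteq> idx N'" by (auto simp: idx_def)

text \<open>Brings each element within reach of \<open>poly_separation\<close>, which handles
  finitely many generators.\<close>

lemma Sd_finite_gen:
  assumes "a \<in> carrier Sd"
  shows "\<exists>N. a \<in> subalgebra_gen Sd ((\<lambda>i. sg (bd i)) ` idx N)"
proof -
  let ?G = "\<lambda>N. subalgebra_gen Sd ((\<lambda>i. sg (bd i)) ` idx N)"
  have mono: "?G N \<subseteq> ?G N'" if "N \<le> N'" for N N' by (intro subalgebra_gen_mono image_mono idx_mono that)
  have "a \<in> subalgebra_gen Sd (sg ` carrier D)" using assms Sd_gen by blast
  then show ?thesis
  proof induction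
    case (1 x)
    then obtain f where f: "f \<in> carrier D" "x = sg f" by blast
    obtain N where N: "\<forall>n>N. f n = (\<lambda>_. 0)" using D_bound[OF f(1)] by blast
    have "sg (\<lambda>n p. \<Sum>i\<in>I. c i * bd i n p) \<in> ?G N" if "finite I" "I \<subseteq> idx N" for I c
      using that
    proof (induction I rule: finite_induct)
      case empty
      have "sg (0 \<odot>\<^bsub>D\<^esub> \<zero>\<^bsub>D\<^esub>) = \<zero>\<^bsub>Sd\<^esub>" unfolding sg_linear(2)[OF D.zero_closed] by (rule Sd.zero_smult[OF sg_in[OF D.zero_closed]])
      then show ?case using subalgebra_gen_zero[OF kalg_Sd] by simp
    next
      case (insert i I)
      have "sg (c i \<odot>\<^bsub>D\<^esub> bd i \<oplus>\<^bsub>D\<^esub> (\<lambda>n p. \<Sum>i\<in>I. c i * bd i n p)) =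
          c i \<odot>\<^bsub>Sd\<^esub> sg (bd i) \<oplus>\<^bsub>Sd\<^esub> sg (\<lambda>n p. \<Sum>i\<in>I. c i * bd i n p)"
        by (simp only: sg_linear bd_in D_sum_in D.smult_closed)
      moreover have "\<dots> \<in> ?G N" using insert by (intro subalgebra_gen.intros(3,5)) (auto intro: subalgebra_gen.intros(1))
      ultimately show ?case using insert.hyps by simp
    qed
    from this[OF finite_idx order.refl, of "\<lambda>i. eval f (be i)"] have "sg f \<in> ?G N"
      by (simp only: dual_expand[OF f(1) N, symmetric])
    then show ?case unfolding f(2) by (rule exI)
  next
    case 2
    show ?case by (intro exI[of _ 0] subalgebra_gen.intros)
  next
    case (3 a b)
    then obtain N N' where "a \<in> ?G N" "b \<in> ?G N'" by blast
    then have "a \<in> ?G (max N N')" "b \<in> ?G (max N N')" using mono[of N "max N N'"] mono[of N' "max N N'"] by auto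
    then show ?case by (intro exI[of _ "max N N'"] subalgebra_gen.intros(3))
  next
    case (4 a b)
    then obtain N N' where "a \<in> ?G N" "b \<in> ?G N'" by blast
    then have "a \<in> ?G (max N N')" "b \<in> ?G (max N N')" using mono[of N "max N N'"] mono[of N' "max N N'"] by auto
    then show ?case by (intro exI[of _ "max N N'"] subalgebra_gen.intros(4))
  next
    case (5 a c)
    then show ?case by (blast intro: subalgebra_gen.intros(5))
  qed
qed

lemma separating_Sd: "separating Sd (chiS ` fams)"
  unfolding separating_def
proof (intro conjI ballI impI)
  show "linear_form Sd \<phi>" if "\<phi> \<in> chiS ` fams" for \<phi> using that chiS_lin by blast
  fix a assume a: "a \<in> carrier Sd" and zero: "\<forall>\<phi>\<in>chiS ` fams. \<phi> a = 0"
  obtain N where N: "a \<in> subalgebra_gen Sd ((\<lambda>i. sg (bd i)) ` idx N)" using Sd_finite_gen[OF a] by blast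
  \<comment> \<open>The family with prescribed coordinates \<open>s\<close>: the basis forms take
    independent values on families, as polynomial generators must.\<close>
  define xs where "xs s = (\<lambda>n. \<Sum>i\<in>idx N. scal \<P> (s i) (be i n))" for s
  have be: "be i \<in> fams" if "i \<in> idx N" for i using be_in[OF that] finite_fams_sub by blast
  have xs: "xs s \<in> fams" for s unfolding xs_def by (intro fams_sum fams_scale be)
  have ev: "eval (bd i) (xs s) = s i" if i: "i \<in> idx N" for i s
  proof -
    have "eval (bd i) (xs s) = (\<Sum>j\<in>idx N. s j * eval (bd i) (be j))"
      unfolding xs_def by (subst eval_sum[OF bd_in]) (auto simp: eval_scale[OF bd_in] be fams_scale)
    also have "\<dots> = (\<Sum>j\<in>idx N. if i = j then s j else 0)"
      by (intro sum.cong refl) (simp add: eval_bd_be[OF i])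
    also have "\<dots> = s i" using i by simp
    finally show ?thesis .
  qed
  show "a = \<zero>\<^bsub>Sd\<^esub>"
  proof (rule Sd.poly_separation[OF finite_idx _ _ _ N, where \<xi> = "\<lambda>s. chiS (xs s)"])
    show "(\<lambda>i. sg (bd i)) ` idx N \<subseteq> carrier Sd" using sg_in[OF bd_in] by blast
    show "chiS (xs s) \<in> alg_hom Sd scalars" for s by (rule chiS_alg[OF xs])
    show "chiS (xs s) (sg (bd i)) = s i" if "i \<in> idx N" for s i using chiS_sg[OF xs bd_in] ev[OF that] by simp
    show "chiS (xs s) a = 0" for s using zero xs by blast
  qed
qed


subsection \<open>The subbialgebra of invariants\<close>

abbreviation "S0 \<equiv> subalgebra_gen Sd (sg ` invD)"

lemma inv_sub: "invD \<subseteq> carrier D" by (rule inv_dual_sub)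

lemma sg_inv_sub: "sg ` invD \<subseteq> carrier Sd" using sg_in inv_sub by blast

lemma S0_sub: "S0 \<subseteq> carrier Sd" by (rule subalgebra_gen_subset[OF kalg_Sd sg_inv_sub])

lemma chiS_W:
  assumes "x \<in> fams" "y \<in> fams" "\<And>n. x n - y n \<in> W n" "a \<in> S0"
  shows "chiS x a = chiS y a"
  by (rule alg_hom_agree[OF kalg_Sd sg_inv_sub chiS_alg[OF assms(1)] chiS_alg[OF assms(2)] _ assms(4)])
    (use assms inv_eval_cong chiS_sg inv_sub in auto)

text \<open>\<open>b'\<close> is the image of \<open>b\<close> under the algebra morphism that
  extends \<open>Rey\<close>. Describing its effect on points avoids constructing that
  morphism.\<close>

lemma ex_rho: "b \<in> carrier Sd \<Longrightarrow> \<exists>b'\<in>S0. \<forall>x\<in>fams. chiS x b' = chiS (avgf x) b"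
proof -
  assume "b \<in> carrier Sd"
  then have "b \<in> subalgebra_gen Sd (sg ` carrier D)" using Sd_gen by blast
  then show ?thesis
  proof induction
    case (1 x)
    then obtain f where f: "f \<in> carrier D" "x = sg f" by blast
    have "sg (Rey f) \<in> S0" using Rey_inv[OF f(1)] by (intro subalgebra_gen.intros(1)) simp
    moreover have "chiS x (sg (Rey f)) = chiS (avgf x) (sg f)" if "x \<in> fams" for x
      using that f(1) Rey_inv[OF f(1)] inv_sub by (simp add: chiS_sg avgf_in eval_Rey subsetD)
    ultimately show ?case using f(2) by blast
  next
    case 2
    show ?case
      by (intro bexI[of _ "\<one>\<^bsub>Sd\<^esub>"] ballI subalgebra_gen.intros) (simp add: alg_homD(4)[OF chiS_alg] avgf_in)
  next
    case (3 a b)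
    then obtain a' b' where *: "a' \<in> S0" "b' \<in> S0" "\<And>x. x \<in> fams \<Longrightarrow> chiS x a' = chiS (avgf x) a"
      "\<And>x. x \<in> fams \<Longrightarrow> chiS x b' = chiS (avgf x) b" by blast
    have "a \<in> carrier Sd" "b \<in> carrier Sd" using 3 subalgebra_gen_subset[OF kalg_Sd, of "sg ` carrier D"] sg_in by blast+
    moreover have "a' \<in> carrier Sd" "b' \<in> carrier Sd" using * S0_sub by auto
    ultimately show ?case
      using * by (intro bexI[of _ "a' \<oplus>\<^bsub>Sd\<^esub> b'"] ballI subalgebra_gen.intros(3)) (simp_all add: alg_homD(2)[OF chiS_alg] avgf_in)
  next
    case (4 a b)
    then obtain a' b' where *: "a' \<in> S0" "b' \<in> S0" "\<And>x. x \<in> fams \<Longrightarrow> chiS x a' = chiS (avgf x) a"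
      "\<And>x. x \<in> fams \<Longrightarrow> chiS x b' = chiS (avgf x) b" by blast
    have "a \<in> carrier Sd" "b \<in> carrier Sd" using 4 subalgebra_gen_subset[OF kalg_Sd, of "sg ` carrier D"] sg_in by blast+
    moreover have "a' \<in> carrier Sd" "b' \<in> carrier Sd" using * S0_sub by auto
    ultimately show ?case
      using * by (intro bexI[of _ "a' \<otimes>\<^bsub>Sd\<^esub> b'"] ballI subalgebra_gen.intros(4)) (simp_all add: alg_homD(3)[OF chiS_alg] avgf_in)
  next
    case (5 a c)
    then obtain a' where *: "a' \<in> S0" "\<And>x. x \<in> fams \<Longrightarrow> chiS x a' = chiS (avgf x) a" by blast
    have "a \<in> carrier Sd" using 5 subalgebra_gen_subset[OF kalg_Sd, of "sg ` carrier D"] sg_in by blast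
    moreover have "a' \<in> carrier Sd" using * S0_sub by auto
    ultimately show ?case
      using * by (intro bexI[of _ "c \<odot>\<^bsub>Sd\<^esub> a'"] ballI subalgebra_gen.intros(5)) (simp_all add: alg_homD(5)[OF chiS_alg] avgf_in)
  qed
qed

lemma coprod_Sd_in: "a \<in> carrier Sd \<Longrightarrow> coprod Sd a \<in> tensors Sd Sd (carrier Sd) (carrier Sd)"
  using bialg_Sd alg_homD(1)[of "coprod Sd" Sd "tensor_prod Sd Sd" a] by (simp add: bialg_def)

lemma coprod_Sd_chi: "a \<in> carrier Sd \<Longrightarrow> x \<in> fams \<Longrightarrow> y \<in> fams \<Longrightarrow>
    coprod Sd a (\<lambda>u v. chiS x u * chiS y v) = chiS (diamond \<P> x y) a"
  using chiS(1) by (simp add: points_def)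

text \<open>The element of \<open>S \<otimes> S\<close> is obtained by averaging both factors; it is compared
  with \<open>\<Delta>(a)\<close> on pairs of points, where invariance under averaging is the congruence property
  of the composition.\<close>

lemma ex_invariant_coprod: "a \<in> S0 \<Longrightarrow> coprod Sd a \<in> tensors Sd Sd S0 S0"
proof -
  assume a: "a \<in> S0"
  then have aS: "a \<in> carrier Sd" using S0_sub by blast
  obtain ps where ps: "set ps \<subseteq> carrier Sd \<times> carrier Sd" "coprod Sd a = tsum Sd Sd ps"
    using coprod_Sd_in[OF aS] by (rule tensorsE)
  have "\<forall>b. \<exists>b'. b \<in> carrier Sd \<longrightarrow> b' \<in> S0 \<and> (\<forall>x\<in>fams. chiS x b' = chiS (avgf x) b)" using ex_rho by blast
  from choice[OF this] obtain \<rho> where \<rho>: "\<And>b. b \<in> carrier Sd \<Longrightarrow> \<rho> b \<in> S0"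
    "\<And>b x. b \<in> carrier Sd \<Longrightarrow> x \<in> fams \<Longrightarrow> chiS x (\<rho> b) = chiS (avgf x) b" by blast
  define qs where "qs = map (\<lambda>(u, v). (\<rho> u, \<rho> v)) ps"
  have qs: "set qs \<subseteq> S0 \<times> S0" using ps(1) \<rho>(1) by (auto simp: qs_def subset_iff)
  then have qsS: "set qs \<subseteq> carrier Sd \<times> carrier Sd" using S0_sub by blast
  interpret TS: kalg "tensor_prod Sd Sd" by (intro two_algs.kalg_tensor_prod two_algs.intro kalg_Sd)
  let ?d = "tsum Sd Sd qs \<oplus>\<^bsub>tensor_prod Sd Sd\<^esub> (- 1) \<odot>\<^bsub>tensor_prod Sd Sd\<^esub> coprod Sd a"
  have d: "?d \<in> carrier (tensor_prod Sd Sd)"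
    using tensors_tsumI[OF qsS] coprod_Sd_in[OF aS] by (intro TS.a_closed TS.smult_closed) simp_all
  have "?d = (\<lambda>\<beta>. 0)"
  proof (rule separating_tensor[OF Sd.kspace_axioms Sd.kspace_axioms separating_Sd separating_Sd])
    show "?d \<in> tensors Sd Sd (carrier Sd) (carrier Sd)" using d by simp
    fix \<phi> \<psi> assume "\<phi> \<in> chiS ` fams" "\<psi> \<in> chiS ` fams"
    then obtain x y where xy: "x \<in> fams" "y \<in> fams" "\<phi> = chiS x" "\<psi> = chiS y" by blast
    note bil = bil_prod[OF chiS_lin chiS_lin]
    have "tsum Sd Sd qs (\<lambda>u v. chiS x u * chiS y v) = (\<Sum>(u, v)\<leftarrow>ps. chiS x (\<rho> u) * chiS y (\<rho> v))"
      using bil[OF xy(1,2)] by (simp add: tsum_def qs_def o_def case_prod_unfold)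
    also have "\<dots> = (\<Sum>(u, v)\<leftarrow>ps. chiS (avgf x) u * chiS (avgf y) v)"
      by (rule tsum_cong[OF ps(1)]) (simp add: \<rho>(2) xy)
    also have "\<dots> = coprod Sd a (\<lambda>u v. chiS (avgf x) u * chiS (avgf y) v)"
      using bil[OF avgf_in[OF xy(1)] avgf_in[OF xy(2)]] by (simp add: ps(2) tsum_def)
    also have "\<dots> = chiS (diamond \<P> (avgf x) (avgf y)) a" by (rule coprod_Sd_chi[OF aS avgf_in avgf_in]) (rule xy)+
    also have "\<dots> = chiS (diamond \<P> x y) a"
    proof (rule chiS_W[OF diamond_closed diamond_closed _ a])
      have "avg n (z n) - z n \<in> W n" if "z \<in> fams" for z n
        using V.subspace_neg[OF W_subspace avg_W[OF completionD[OF that, of n]]] by simp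
      then show "diamond \<P> (avgf x) (avgf y) n - diamond \<P> x y n \<in> W n" for n
        using xy by (intro diamond_W avgf_in) (simp_all add: avgf_def)
    qed (use xy avgf_in in auto)
    also have "\<dots> = coprod Sd a (\<lambda>u v. chiS x u * chiS y v)" by (rule coprod_Sd_chi[OF aS xy(1,2), symmetric])
    finally show "?d (\<lambda>u v. \<phi> u * \<psi> v) = 0" by (simp add: xy)
  qed
  then have "coprod Sd a = tsum Sd Sd qs" by (auto simp: fun_eq_iff)
  then show ?thesis using tensors_tsumI[OF qs] by simp
qed

sublocale SB: sub_bialg Sd S0 "chiS ` fams"
proof
  show "bialg Sd" by (rule bialg_Sd)
  show "S0 \<subseteq> carrier Sd" by (rule S0_sub)
  show "separating Sd (chiS ` fams)" by (rule separating_Sd)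
  show "\<exists>d\<in>tensors Sd Sd S0 S0. d = coprod Sd a" if "a \<in> S0" for a using ex_invariant_coprod[OF that] by blast
qed (auto intro: subalgebra_gen.intros)

lemma D_star_eq: "D_star \<P> = SB.SB" by (simp add: D_star_def)

section \<open>Coinvariants as points of the algebra of invariants\<close>

abbreviation "pc \<equiv> coinv_class \<P> (ops \<P>)"
abbreviation "Qm \<equiv> quotient_monoid (M \<P>) pc (completion (coinv \<P> (ops \<P>)))"
abbreviation "Qm' \<equiv> quotient_monoid (M' \<P>) pc (completion (coinv \<P> (ops \<P>)))"
abbreviation "pp \<equiv> coinv_class \<P> (plus_ops \<P>)"
abbreviation "Qp \<equiv> quotient_monoid (M_plus \<P>) pp (completion (coinv \<P> (plus_ops \<P>)))"

lemma Qm: "monoid Qm" "pc \<in> epi (M \<P>) Qm" "pc (unit_fam \<P>) = \<one>\<^bsub>Qm\<^esub>"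
  using quotient_monoid_epi[OF monoid_M, of "completion (coinv \<P> (ops \<P>))" pc] diamond_W
  by (simp_all add: completion_coinv coinv_class_eq_iff)

lemma Qm': "monoid Qm'" "pc \<in> epi (M' \<P>) Qm'"
  using quotient_monoid_epi[OF monoid_M', of "completion (coinv \<P> (ops \<P>))" pc] diamond'_W
  by (simp_all add: completion_coinv coinv_class_eq_iff)

lemma Qp: "monoid Qp" "pp \<in> epi (M_plus \<P>) Qp" "pp 0 = \<one>\<^bsub>Qp\<^esub>"
proof -
  have cong: "pp (diamond_plus \<P> x y) = pp (diamond_plus \<P> x' y')"
    if "x \<in> pfams" "x' \<in> pfams" "y \<in> pfams" "y' \<in> pfams" "pp x = pp x'" "pp y = pp y'" for x x' y y'
  proof -
    have f: "x \<in> fams" "x' \<in> fams" "y \<in> fams" "y' \<in> fams" using that by (auto simp: pfams_iff)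
    have "x n - x' n \<in> W n" "y n - y' n \<in> W n" for n
      using that coinv_class_plus_eq_iff[of x x'] coinv_class_plus_eq_iff[of y y'] by (simp_all add: coinv_class_eq_iff)
    then have "diamond' \<P> x y n - diamond' \<P> x' y' n \<in> W n" for n by (intro diamond'_W f)
    then have "pc (diamond_plus \<P> x y) = pc (diamond_plus \<P> x' y')"
      using that by (simp add: coinv_class_eq_iff diamond_plus_diamond')
    then show ?thesis using that by (simp add: coinv_class_plus_eq_iff diamond_plus_closed)
  qed
  have 1: "completion (coinv \<P> (plus_ops \<P>)) = pp ` carrier (M_plus \<P>)" by (simp add: completion_coinv)
  have 2: "pp (x \<otimes>\<^bsub>M_plus \<P>\<^esub> y) = pp (x' \<otimes>\<^bsub>M_plus \<P>\<^esub> y')"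
    if "x \<in> carrier (M_plus \<P>)" "x' \<in> carrier (M_plus \<P>)" "y \<in> carrier (M_plus \<P>)" "y' \<in> carrier (M_plus \<P>)"
      "pp x = pp x'" "pp y = pp y'" for x x' y y'
    using cong[OF that[unfolded M_simps]] by (simp only: M_simps)
  note * = quotient_monoid_epi[OF monoid_M_plus 1]
  show "monoid Qp" by (rule *(1)[OF 2])
  show "pp \<in> epi (M_plus \<P>) Qp" by (rule *(2)[OF 2])
  show "pp 0 = \<one>\<^bsub>Qp\<^esub>" by (rule *(3)[OF 2, unfolded M_simps(9)])
qed

lemma Qm_carrier: "carrier Qm = pc ` fams" and Qp_carrier: "carrier Qp = pp ` pfams"
  by (simp_all add: quotient_monoid_def completion_coinv)

lemma Qm_mult: "x \<in> fams \<Longrightarrow> y \<in> fams \<Longrightarrow> pc x \<otimes>\<^bsub>Qm\<^esub> pc y = pc (diamond \<P> x y)"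
  using Qm(2) by (auto simp: epi_def hom_def)

lemma Qp_mult: "x \<in> pfams \<Longrightarrow> y \<in> pfams \<Longrightarrow> pp x \<otimes>\<^bsub>Qp\<^esub> pp y = pp (diamond_plus \<P> x y)"
  using Qp(2) by (auto simp: epi_def hom_def)

definition chiD :: "'a set fam \<Rightarrow> ('k, 'a) dual_tens set \<Rightarrow> 'k"
  where "chiD X = (\<lambda>a\<in>S0. chiS (inv_into fams pc X) a)"

lemma chiD: "x \<in> fams \<Longrightarrow> a \<in> S0 \<Longrightarrow> chiD (pc x) a = chiS x a"
proof -
  assume x: "x \<in> fams" and a: "a \<in> S0"
  let ?z = "inv_into fams pc (pc x)"
  have z: "?z \<in> fams" "pc ?z = pc x" using x by (simp_all add: inv_into_into f_inv_into_f)
  have "chiS ?z a = chiS x a"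
    by (rule chiS_W[OF z(1) x _ a]) (use z(2) in \<open>simp add: coinv_class_eq_iff\<close>)
  then show ?thesis using a by (simp add: chiD_def)
qed

lemma Rey_fix: "f \<in> invD \<Longrightarrow> Rey f = f"
proof (intro ext)
  fix n p assume f: "f \<in> invD"
  then have fD: "f \<in> carrier D" using inv_sub by blast
  show "Rey f n p = f n p"
    using inv_W[OF f avg_W, of p n] D_diff[OF fD _ avg_in, of p n] D_lin(3)[OF fD, of p n] by (auto simp: Rey_def)
qed

lemma Rey_linear: "f \<in> carrier D \<Longrightarrow> g \<in> carrier D \<Longrightarrow> Rey (f \<oplus>\<^bsub>D\<^esub> g) = Rey f \<oplus>\<^bsub>D\<^esub> Rey g"
  "Rey (c \<odot>\<^bsub>D\<^esub> f) = c \<odot>\<^bsub>D\<^esub> Rey f"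
  by (auto simp: Rey_def fun_eq_iff)

lemma D_star_gen: "carrier (D_star \<P>) \<subseteq> subalgebra_gen (D_star \<P>) (sg ` invD)"
proof
  fix a assume "a \<in> carrier (D_star \<P>)"
  then have "a \<in> S0" by (simp add: D_star_eq)
  then show "a \<in> subalgebra_gen (D_star \<P>) (sg ` invD)"
  proof induction
    case 2
    show ?case using subalgebra_gen.intros(2)[of "D_star \<P>" "sg ` invD"] by (simp add: D_star_eq)
  next
    case (3 a b)
    then show ?case using subalgebra_gen.intros(3)[of a "D_star \<P>" "sg ` invD" b] by (simp add: D_star_eq)
  next
    case (4 a b)
    then show ?case using subalgebra_gen.intros(4)[of a "D_star \<P>" "sg ` invD" b] by (simp add: D_star_eq)
  next
    case (5 a c)
    then show ?case using subalgebra_gen.intros(5)[of a "D_star \<P>" "sg ` invD" c] by (simp add: D_star_eq)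
  qed (rule subalgebra_gen.intros)
qed

lemma chiD_points: "points (D_star \<P>) Qm chiD"
proof -
  have id: "(\<lambda>x. x) \<in> alg_hom (D_star \<P>) Sd" by (rule alg_homI) (use S0_sub in \<open>auto simp: D_star_eq\<close>)
  have carr: "carrier (D_star \<P>) = S0" by (simp add: D_star_eq)
  have kD: "kalg (D_star \<P>)" using SB.bialg_SB by (simp add: D_star_eq bialg_def)
  have alg: "chiD (pc x) \<in> alg_hom (D_star \<P>) scalars" if x: "x \<in> fams" for x
  proof (rule alg_homI)
    note h = alg_homD[OF alg_hom_comp[OF id chiS_alg[OF x]]]
    interpret kD: kalg "D_star \<P>" by (rule kD)
    show "chiD (pc x) \<one>\<^bsub>D_star \<P>\<^esub> = \<one>\<^bsub>scalars\<^esub>" using h(4) chiD[OF x] kD.one_closed by (simp add: carr)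
    fix a b assume a: "a \<in> carrier (D_star \<P>)"
    then show "chiD (pc x) (c \<odot>\<^bsub>D_star \<P>\<^esub> a) = c \<odot>\<^bsub>scalars\<^esub> chiD (pc x) a" for c
      using h(5)[OF a, of c] chiD[OF x] kD.smult_closed[OF a, of c] by (simp add: carr)
    assume b: "b \<in> carrier (D_star \<P>)"
    show "chiD (pc x) (a \<oplus>\<^bsub>D_star \<P>\<^esub> b) = chiD (pc x) a \<oplus>\<^bsub>scalars\<^esub> chiD (pc x) b"
      using a b h(2)[OF a b] chiD[OF x] kD.a_closed[OF a b] by (simp add: carr)
    show "chiD (pc x) (a \<otimes>\<^bsub>D_star \<P>\<^esub> b) = chiD (pc x) a \<otimes>\<^bsub>scalars\<^esub> chiD (pc x) b"
      using a b h(3)[OF a b] chiD[OF x] kD.m_closed[OF a b] by (simp add: carr)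
  qed simp
  have ext: "chiD X \<in> extensional S0" for X by (simp add: chiD_def)
  have ch: "chiD (pc x) \<in> characters (D_star \<P>)" if "x \<in> fams" for x
    using alg[OF that] ext by (simp add: characters_def carr)
  have sgS0: "sg f \<in> S0" if "f \<in> invD" for f using that by (intro subalgebra_gen.intros(1)) simp
  have val: "chiD (pc x) (sg f) = eval f x" if "x \<in> fams" "f \<in> invD" for x f
    using chiD[OF that(1) sgS0[OF that(2)]] chiS_sg[OF that(1)] that(2) inv_sub by auto
  have lin: "linear_form (D_star \<P>) (chiS x)" "linear_form (D_star \<P>) (chiD (pc x))" if "x \<in> fams" for x
    using linear_form_comp[OF chiS_lin[OF that] id] alg_hom_scalars_linear[OF alg[OF that]] by simp_all
  have tens: "coprod (D_star \<P>) a \<in> tensors (D_star \<P>) (D_star \<P>) S0 S0" if "a \<in> S0" for a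
    using SB.coprod_SB_in[OF that] by (simp add: D_star_eq)
  have eqL: "coprod (D_star \<P>) a (\<lambda>u v. chiD (pc x) u * chiD (pc y) v) = chiS (diamond \<P> x y) a"
    if a: "a \<in> S0" and x: "x \<in> fams" and y: "y \<in> fams" for a x y
  proof -
    \<comment> \<open>\<open>chiD (pc x)\<close> and \<open>chiS x\<close> agree on the subalgebra;
      a tensor over it does not see how they differ outside.\<close>
    have "coprod (D_star \<P>) a (\<lambda>u v. chiD (pc x) u * chiD (pc y) v) = coprod (D_star \<P>) a (\<lambda>u v. chiS x u * chiS y v)"
      by (rule tensors_cong[OF tens[OF a] bil_prod[OF lin(2) lin(2)] bil_prod[OF lin(1) lin(1)]])
        (use x y chiD in auto)
    also have "\<dots> = coprod Sd a (\<lambda>u v. chiS x u * chiS y v)"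
      unfolding D_star_eq by (rule SB.coprod_SB[OF chiS_lin[OF x] chiS_lin[OF y] a])
    also have "\<dots> = chiS (diamond \<P> x y) a" using coprod_Sd_chi[OF _ x y] a S0_sub by blast
    finally show ?thesis .
  qed
  show ?thesis
    unfolding points_def
  proof (intro conjI ballI)
    show "bialg (D_star \<P>)" using SB.bialg_SB by (simp add: D_star_eq)
    show "monoid Qm" by (rule Qm(1))
    show "bij_betw chiD (carrier Qm) (characters (D_star \<P>))"
    proof (rule bij_betw_imageI)
      show "inj_on chiD (carrier Qm)"
      proof (rule inj_onI)
        fix X Y assume "X \<in> carrier Qm" "Y \<in> carrier Qm" and eq: "chiD X = chiD Y"
        then obtain x y where xy: "x \<in> fams" "y \<in> fams" "X = pc x" "Y = pc y" by (auto simp: Qm_carrier)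
        have "eval f x = eval f y" if "f \<in> invD" for f using val[OF xy(1) that] val[OF xy(2) that] eq xy by simp
        then show "X = Y" using coinv_class_iff_inv[OF xy(1,2)] xy by simp
      qed
      show "chiD ` carrier Qm = characters (D_star \<P>)"
      proof (intro equalityI subsetI)
        fix \<xi> assume "\<xi> \<in> chiD ` carrier Qm"
        then show "\<xi> \<in> characters (D_star \<P>)" using ch by (auto simp: Qm_carrier)
      next
        fix \<xi> assume "\<xi> \<in> characters (D_star \<P>)"
        then have \<xi>: "\<xi> \<in> alg_hom (D_star \<P>) scalars" "\<xi> \<in> extensional S0" by (auto simp: characters_def carr)
        have opsD: "add (D_star \<P>) = add Sd" "module.smult (D_star \<P>) = module.smult Sd" by (simp_all add: D_star_eq)
        have RS: "sg (Rey f) \<in> carrier (D_star \<P>)" "Rey f \<in> carrier D" if "f \<in> carrier D" for f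
          using sgS0[OF Rey_inv[OF that]] Rey_inv[OF that] inv_sub by (auto simp: carr)
        \<comment> \<open>Composition with \<open>Rey\<close> extends the values of
          \<open>\<xi>\<close> from invariant forms to all forms, so that
          \<open>linear_form_is_eval\<close> yields a family; on invariant forms \<open>Rey\<close>
          changes nothing.\<close>
        have "linear_form D (\<lambda>f. \<xi> (sg (Rey f)))"
          unfolding linear_form_def
        proof (intro conjI ballI allI)
          fix f g assume f: "f \<in> carrier D" and g: "g \<in> carrier D"
          show "\<xi> (sg (Rey (f \<oplus>\<^bsub>D\<^esub> g))) = \<xi> (sg (Rey f)) + \<xi> (sg (Rey g))"
            using alg_homD(2)[OF \<xi>(1) RS(1)[OF f] RS(1)[OF g]]
            by (simp add: Rey_linear(1)[OF f g] sg_linear(1)[OF RS(2)[OF f] RS(2)[OF g]] opsD del: gd_simps)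
        next
          fix c f assume f: "f \<in> carrier D"
          show "\<xi> (sg (Rey (c \<odot>\<^bsub>D\<^esub> f))) = c * \<xi> (sg (Rey f))"
            using alg_homD(5)[OF \<xi>(1) RS(1)[OF f], of c]
            by (simp add: Rey_linear(2) sg_linear(2)[OF RS(2)[OF f]] opsD del: gd_simps)
        qed
        then obtain x where x: "x \<in> fams" "\<And>f. f \<in> carrier D \<Longrightarrow> \<xi> (sg (Rey f)) = eval f x"
          using linear_form_is_eval by blast
        have e1: "\<xi> (sg f) = chiD (pc x) (sg f)" if "f \<in> invD" for f
          using x(2)[of f] that inv_sub val[OF x(1) that] by (auto simp: Rey_fix)
        have e2: "sg ` invD \<subseteq> carrier (D_star \<P>)" using sgS0 by (auto simp: carr)
        have e3: "a \<in> subalgebra_gen (D_star \<P>) (sg ` invD)" if "a \<in> S0" for a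
          using D_star_gen that by (auto simp: carr)
        have "\<xi> a = chiD (pc x) a" if "a \<in> S0" for a
          by (rule alg_hom_agree[OF kD e2 \<xi>(1) alg[OF x(1)] _ e3[OF that]]) (erule imageE, simp only: e1)
        then have "\<xi> = chiD (pc x)" by (intro extensionalityI[OF \<xi>(2) ext])
        then show "\<xi> \<in> chiD ` carrier Qm" using x(1) by (auto simp: Qm_carrier)
      qed
    qed
  next
    fix X Y a assume "X \<in> carrier Qm" "Y \<in> carrier Qm" and a: "a \<in> carrier (D_star \<P>)"
    then obtain x y where xy: "x \<in> fams" "y \<in> fams" "X = pc x" "Y = pc y" by (auto simp: Qm_carrier)
    show "coprod (D_star \<P>) a (\<lambda>u v. chiD X u * chiD Y v) = chiD (X \<otimes>\<^bsub>Qm\<^esub> Y) a"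
      using eqL[OF _ xy(1,2)] a chiD[OF diamond_closed[OF xy(1,2)]] by (simp add: xy Qm_mult carr)
  next
    fix a assume "a \<in> carrier (D_star \<P>)"
    then have a: "a \<in> S0" by (simp add: carr)
    show "counital (D_star \<P>) (chiD \<one>\<^bsub>Qm\<^esub>) a"
    proof (rule counital_separating)
      show "kspace (D_star \<P>)" using kD by (simp add: kalg_def)
      show "coprod (D_star \<P>) a \<in> carrier (tensor_prod (D_star \<P>) (D_star \<P>))" using tens[OF a] by (simp add: carr)
      show "linear_form (D_star \<P>) (chiD \<one>\<^bsub>Qm\<^esub>)" using lin(2)[OF unit_fam_in] by (simp add: Qm(3))
      show "separating (D_star \<P>) (chiS ` fams)" using SB.separating_SB by (simp add: D_star_eq)
      show "a \<in> carrier (D_star \<P>)" by fact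
      fix \<phi> assume "\<phi> \<in> chiS ` fams"
      then obtain x where x: "x \<in> fams" "\<phi> = chiS x" by blast
      note u = unit_fam_in
      have "coprod (D_star \<P>) a (\<lambda>u v. chiD \<one>\<^bsub>Qm\<^esub> u * chiS x v) = coprod (D_star \<P>) a (\<lambda>u v. chiD (pc (unit_fam \<P>)) u * chiD (pc x) v)"
        unfolding Qm(3)[symmetric]
        by (rule tensors_cong[OF tens[OF a] bil_prod[OF lin(2)[OF u] lin(1)[OF x(1)]] bil_prod[OF lin(2)[OF u] lin(2)[OF x(1)]]])
          (simp add: chiD x)
      then show "coprod (D_star \<P>) a (\<lambda>u v. chiD \<one>\<^bsub>Qm\<^esub> u * \<phi> v) = \<phi> a"
        by (simp add: x eqL[OF a u x(1)] diamond_unit_left)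
      have "coprod (D_star \<P>) a (\<lambda>u v. chiS x u * chiD \<one>\<^bsub>Qm\<^esub> v) = coprod (D_star \<P>) a (\<lambda>u v. chiD (pc x) u * chiD (pc (unit_fam \<P>)) v)"
        unfolding Qm(3)[symmetric]
        by (rule tensors_cong[OF tens[OF a] bil_prod[OF lin(1)[OF x(1)] lin(2)[OF u]] bil_prod[OF lin(2)[OF x(1)] lin(2)[OF u]]])
          (simp add: chiD x)
      then show "coprod (D_star \<P>) a (\<lambda>u v. \<phi> u * chiD \<one>\<^bsub>Qm\<^esub> v) = \<phi> a"
        by (simp add: x eqL[OF a x(1) u] diamond_unit_right)
    qed
  qed
qed

lemma chiD_point_char: "x \<in> fams \<Longrightarrow> chiD (pc x) = point_char (D_star \<P>) sg invD x"
proof -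
  assume x: "x \<in> fams"
  have ch: "chiD (pc x) \<in> characters (D_star \<P>)"
    using chiD_points x by (auto simp: points_def bij_betw_def Qm_carrier)
  have S: "sg f \<in> S0" if "f \<in> invD" for f using that by (intro subalgebra_gen.intros(1)) simp
  have "point_char (D_star \<P>) sg invD x = chiD (pc x)"
  proof (rule point_char_eq[OF _ ch _ _ D_star_gen])
    show "kalg (D_star \<P>)" using SB.bialg_SB by (simp add: D_star_eq bialg_def)
    show "sg f \<in> carrier (D_star \<P>)" if "f \<in> invD" for f using S[OF that] by (simp add: D_star_eq)
    show "chiD (pc x) (sg f) = eval f x" if "f \<in> invD" for f
      using chiD[OF x S[OF that]] chiS_sg[OF x] that inv_sub by auto
  qed
  then show ?thesis by simp
qed

end


lemma (in kalg_ideal) linear_form_factor: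
  assumes "linear_form A \<phi>" "\<And>a. a \<in> J \<Longrightarrow> \<phi> a = 0"
  shows "\<exists>\<psi>. linear_form Q \<psi> \<and> (\<forall>a\<in>carrier A. \<psi> (\<pi> a) = \<phi> a)"
proof -
  define \<psi> where "\<psi> X = \<phi> (SOME a. a \<in> carrier A \<and> \<pi> a = X)" for X
  have *: "\<psi> (\<pi> a) = \<phi> a" if a: "a \<in> carrier A" for a
  proof -
    define b where "b = (SOME b. b \<in> carrier A \<and> \<pi> b = \<pi> a)"
    have "\<exists>b. b \<in> carrier A \<and> \<pi> b = \<pi> a" using a by blast
    from someI_ex[OF this] have b: "b \<in> carrier A" "\<pi> b = \<pi> a" unfolding b_def by auto
    have "b \<ominus> a \<in> J" using b a by (simp add: pi_eq_iff)
    then have "\<phi> (b \<ominus> a) = 0" by (rule assms(2))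
    then show ?thesis using linear_form_minus[OF assms(1) b(1) a] by (simp add: \<psi>_def b_def)
  qed
  have "linear_form Q \<psi>"
    unfolding linear_form_def carrier_Q using assms(1) by (auto simp: pi_ops pi_smult * linear_form_def)
  then show ?thesis using * by blast
qed

lemma (in kalg_ideal) pi_scalar:
  assumes "a \<in> carrier A" "a \<ominus> (c \<odot> \<one>) \<in> J" shows "\<pi> a = c \<odot>\<^bsub>Q\<^esub> \<one>\<^bsub>Q\<^esub>"
  using assms pi_eq_iff[of a "c \<odot> \<one>"] by (simp add: pi_one pi_smult)

lemma subalgebra_gen_preimage:
  assumes "h \<in> alg_hom A B" "kalg A" "X \<subseteq> carrier A" "b \<in> subalgebra_gen B (h ` X)"
  shows "\<exists>a\<in>subalgebra_gen A X. h a = b"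
  using assms(4)
proof induction
  have sub: "a \<in> carrier A" if "a \<in> subalgebra_gen A X" for a
    using that subalgebra_gen_subset[OF assms(2,3)] by blast
  { case (1 x)
    then show ?case by (blast intro: subalgebra_gen.intros(1))
  next
    case 2
    show ?case using alg_homD(4)[OF assms(1)] subalgebra_gen.intros(2)[of A X] by blast
  next
    case (3 a b)
    then obtain a' b' where *: "a' \<in> subalgebra_gen A X" "b' \<in> subalgebra_gen A X" "h a' = a" "h b' = b" by blast
    show ?case
      by (rule bexI[OF _ subalgebra_gen.intros(3)[OF *(1,2)]]) (simp add: alg_homD(2)[OF assms(1)] sub *)
  next
    case (4 a b)
    then obtain a' b' where *: "a' \<in> subalgebra_gen A X" "b' \<in> subalgebra_gen A X" "h a' = a" "h b' = b" by blast
    show ?case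
      by (rule bexI[OF _ subalgebra_gen.intros(4)[OF *(1,2)]]) (simp add: alg_homD(3)[OF assms(1)] sub *)
  next
    case (5 a c)
    then obtain a' where *: "a' \<in> subalgebra_gen A X" "h a' = a" by blast
    show ?case
      by (rule bexI[OF _ subalgebra_gen.intros(5)[OF *(1), of c]]) (simp add: alg_homD(5)[OF assms(1)] sub *)
  }
qed

context operad_fin
begin

subsection \<open>Forms of arity one\<close>

abbreviation "U1 \<equiv> {f \<in> carrier D. \<forall>n. n \<noteq> 1 \<longrightarrow> f n = (\<lambda>_. 0)}"
abbreviation "Dp \<equiv> graded_dual \<P> (plus_ops \<P>)"
abbreviation fp :: "('k, 'a) dual \<Rightarrow> ('k, 'a) dual" where "fp f \<equiv> (\<lambda>n. if n \<noteq> 1 then f n else (\<lambda>_. 0))"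
abbreviation f1 :: "('k, 'a) dual \<Rightarrow> ('k, 'a) dual" where "f1 f \<equiv> (\<lambda>n. if n = 1 then f n else (\<lambda>_. 0))"

lemma D_filter: "f \<in> carrier D \<Longrightarrow> (\<lambda>n. if P n then f n else (\<lambda>_. 0)) \<in> carrier D"
  unfolding gd_carrier_iff by (auto elim: rev_finite_subset)

lemma f1_in: "f \<in> carrier D \<Longrightarrow> f1 f \<in> U1"
  using D_filter[of f "\<lambda>n. n = 1"] by simp

lemma f_split: "f = fp f \<oplus>\<^bsub>D\<^esub> f1 f"
  by (auto simp: fun_eq_iff)

lemma plus_ops_eq: "plus_ops \<P> n = (if n = 1 then {0} else ops \<P> n)"
  by (cases "n = 0") (auto simp: plus_ops_def ops_0)

lemma Dp_iff: "f \<in> carrier Dp \<longleftrightarrow> f \<in> carrier D \<and> f 1 = (\<lambda>_. 0)"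
proof
  assume f: "f \<in> carrier Dp"
  then have add: "\<And>n p q. p \<in> plus_ops \<P> n \<Longrightarrow> q \<in> plus_ops \<P> n \<Longrightarrow> f n (p + q) = f n p + f n q"
    and out: "\<And>n p. p \<notin> plus_ops \<P> n \<Longrightarrow> f n p = 0"
    by (auto simp: gd_carrier_iff)
  \<comment> \<open>At 0 the value vanishes by additivity, elsewhere because a form is 0 off its
    space.\<close>
  have "f 1 p = 0" for p using add[of 0 1 0] out[of p 1] by (cases "p = 0") (auto simp: plus_ops_eq)
  then have f1: "f 1 = (\<lambda>_. 0)" by blast
  have "(\<forall>p\<in>ops \<P> n. \<forall>q\<in>ops \<P> n. f n (p + q) = f n p + f n q) \<and>
      (\<forall>c. \<forall>p\<in>ops \<P> n. f n (scal \<P> c p) = c * f n p) \<and> (\<forall>p. p \<notin> ops \<P> n \<longrightarrow> f n p = 0)" for n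
    using f f1 by (cases "n = 1") (auto simp: gd_carrier_iff plus_ops_eq)
  then show "f \<in> carrier D \<and> f 1 = (\<lambda>_. 0)" using f f1 by (simp add: gd_carrier_iff)
next
  assume f: "f \<in> carrier D \<and> f 1 = (\<lambda>_. 0)"
  have "(\<forall>p\<in>plus_ops \<P> n. \<forall>q\<in>plus_ops \<P> n. f n (p + q) = f n p + f n q) \<and>
      (\<forall>c. \<forall>p\<in>plus_ops \<P> n. f n (scal \<P> c p) = c * f n p) \<and> (\<forall>p. p \<notin> plus_ops \<P> n \<longrightarrow> f n p = 0)" for n
    using f by (cases "n = 1") (auto simp: gd_carrier_iff plus_ops_eq)
  then show "f \<in> carrier Dp" using f by (simp add: gd_carrier_iff)
qed

lemma inv_plus_iff: "f \<in> inv_dual \<P> (plus_ops \<P>) \<longleftrightarrow> f \<in> invD \<and> f 1 = (\<lambda>_. 0)"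
proof -
  have "(\<forall>n \<sigma> p. \<sigma> permutes {..<n} \<longrightarrow> p \<in> plus_ops \<P> n \<longrightarrow> f n (act \<P> n \<sigma> p) = f n p) \<longleftrightarrow>
      (\<forall>n \<sigma> p. \<sigma> permutes {..<n} \<longrightarrow> p \<in> ops \<P> n \<longrightarrow> f n (act \<P> n \<sigma> p) = f n p)" if "f 1 = (\<lambda>_. 0)"
  proof (intro all_cong1)
    fix n \<sigma> p
    show "(\<sigma> permutes {..<n} \<longrightarrow> p \<in> plus_ops \<P> n \<longrightarrow> f n (act \<P> n \<sigma> p) = f n p) \<longleftrightarrow>
      (\<sigma> permutes {..<n} \<longrightarrow> p \<in> ops \<P> n \<longrightarrow> f n (act \<P> n \<sigma> p) = f n p)"
      using that by (cases "n = 1") (simp_all add: plus_ops_eq)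
  qed
  then show ?thesis unfolding inv_dual_def mem_Collect_eq Dp_iff by blast
qed

text \<open>The symmetric group on one letter is trivial. Hence the generators of the unit ideal
  already lie in the algebra of invariants.\<close>

lemma U1_inv: "f \<in> U1 \<Longrightarrow> f \<in> invD"
proof -
  assume f: "f \<in> U1"
  have "f n (act \<P> n \<sigma> p) = f n p" if "\<sigma> permutes {..<n}" "p \<in> ops \<P> n" for n \<sigma> p
  proof (cases "n = 1")
    case True
    then have "\<sigma> = id" using that(1) by (simp add: lessThan_Suc)
    then show ?thesis using that(2) by (simp add: act_id)
  next
    case False
    then show ?thesis using f by simp
  qed
  then show ?thesis using f by (simp add: inv_dual_def)
qed

lemma fp_inv: "f \<in> invD \<Longrightarrow> fp f \<in> invD"
  using D_filter[of f "\<lambda>n. n \<noteq> 1"] unfolding inv_dual_def by auto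

lemma be_ops: "p \<in> ops \<P> n \<Longrightarrow> be (n, p) \<in> fams"
  by (auto simp: be_def completion_def ops_closed(1))

lemma unit_fam_be: "unit_fam \<P> = be (1, unt \<P>)"
  by (auto simp: unit_fam_def be_def)

lemma eval_unit: "f \<in> carrier D \<Longrightarrow> eval f (unit_fam \<P>) = f 1 (unt \<P>)"
  by (simp only: unit_fam_be eval_be)

lemma eval_U1: "f \<in> U1 \<Longrightarrow> eval f x = f 1 (x 1)"
  by (subst eval_superset[of "{1}"]) auto

lemma shift_1: "shift y 1 = unt \<P> + y 1"
  by (simp add: shift_def unit_fam_def)

lemma shift_pfams_iff: "x \<in> fams \<Longrightarrow> x \<in> shift ` pfams \<longleftrightarrow> x 1 = unt \<P>"
proof
  assume x: "x \<in> fams" and 1: "x 1 = unt \<P>"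
  obtain y where y: "y \<in> fams" "x = shift y" using shift_surj[OF x] by blast
  have "y 1 = 0" using 1 unfolding y(2) shift_1 by simp
  then have "y \<in> pfams" using y(1) unfolding pfams_iff by blast
  then show "x \<in> shift ` pfams" unfolding y(2) by (rule imageI)
next
  assume "x \<in> fams" "x \<in> shift ` pfams"
  then obtain y where "y \<in> pfams" "x = shift y" by blast
  then show "x 1 = unt \<P>" unfolding pfams_iff using shift_1[of y] by simp
qed

lemma eval_shift: "f \<in> carrier D \<Longrightarrow> f 1 = (\<lambda>_. 0) \<Longrightarrow> y \<in> fams \<Longrightarrow> eval f (shift y) = eval f y"
  unfolding shift_def by (simp add: eval_add unit_fam_in eval_unit)

text \<open>Forms of arity one separate the operations of arity one; the family
  \<open>be (1, x 1)\<close> isolates the component in question.\<close>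

lemma unit_iff_U1:
  assumes x: "x \<in> fams" shows "x 1 = unt \<P> \<longleftrightarrow> (\<forall>f\<in>U1. eval f x = f 1 (unt \<P>))"
proof
  assume r: "\<forall>f\<in>U1. eval f x = f 1 (unt \<P>)"
  have "be (1, x 1) = unit_fam \<P>"
  proof (rule eval_inj[OF be_ops[OF completionD[OF x]] unit_fam_in])
    fix f assume f: "f \<in> carrier D"
    show "eval f (be (1, x 1)) = eval f (unit_fam \<P>)"
      using r[rule_format, OF f1_in[OF f]] eval_U1[OF f1_in[OF f], of x] by (simp only: eval_be[OF f] eval_unit[OF f] if_True simp_thms)
  qed
  then have "be (1, x 1) 1 = unit_fam \<P> 1" by simp
  then show "x 1 = unt \<P>" by (simp add: be_def unit_fam_def)
qed (auto simp: eval_U1)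


subsection \<open>The ideal identifying the unit with 1\<close>

lemma unit_ideal_eq: "unit_ideal \<P> A g = Idl\<^bsub>A\<^esub> ((\<lambda>f. g f \<ominus>\<^bsub>A\<^esub> (f 1 (unt \<P>) \<odot>\<^bsub>A\<^esub> \<one>\<^bsub>A\<^esub>)) ` U1)"
  unfolding unit_ideal_def by (rule arg_cong[where f = "genideal A"]) blast

lemma unit_ideal:
  assumes A: "kalg A" and g: "\<And>f. f \<in> carrier D \<Longrightarrow> g f \<in> carrier A"
  shows "ideal (unit_ideal \<P> A g) A"
    and "f \<in> U1 \<Longrightarrow> g f \<ominus>\<^bsub>A\<^esub> (f 1 (unt \<P>) \<odot>\<^bsub>A\<^esub> \<one>\<^bsub>A\<^esub>) \<in> unit_ideal \<P> A g"
    and "kalg B \<Longrightarrow> h \<in> alg_hom A B \<Longrightarrow> (\<And>f. f \<in> U1 \<Longrightarrow> h (g f) = f 1 (unt \<P>) \<odot>\<^bsub>B\<^esub> \<one>\<^bsub>B\<^esub>) \<Longrightarrow>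
      a \<in> unit_ideal \<P> A g \<Longrightarrow> h a = \<zero>\<^bsub>B\<^esub>"
proof -
  interpret kalg A by fact
  let ?S = "(\<lambda>f. g f \<ominus>\<^bsub>A\<^esub> (f 1 (unt \<P>) \<odot>\<^bsub>A\<^esub> \<one>\<^bsub>A\<^esub>)) ` U1"
  have S: "?S \<subseteq> carrier A" using g by auto
  show "ideal (unit_ideal \<P> A g) A" unfolding unit_ideal_eq by (rule genideal_ideal[OF S])
  show "f \<in> U1 \<Longrightarrow> g f \<ominus>\<^bsub>A\<^esub> (f 1 (unt \<P>) \<odot>\<^bsub>A\<^esub> \<one>\<^bsub>A\<^esub>) \<in> unit_ideal \<P> A g"
    unfolding unit_ideal_eq using genideal_self[OF S] by blast
  assume B: "kalg B" and h: "h \<in> alg_hom A B" and hg: "\<And>f. f \<in> U1 \<Longrightarrow> h (g f) = f 1 (unt \<P>) \<odot>\<^bsub>B\<^esub> \<one>\<^bsub>B\<^esub>"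
    and a: "a \<in> unit_ideal \<P> A g"
  interpret B: kalg B by fact
  show "h a = \<zero>\<^bsub>B\<^esub>"
  proof (rule alg_hom_Idl_zero[OF A B h S _ a[unfolded unit_ideal_eq]])
    fix s assume "s \<in> ?S"
    then obtain f where f: "f \<in> U1" "s = g f \<ominus>\<^bsub>A\<^esub> (f 1 (unt \<P>) \<odot>\<^bsub>A\<^esub> \<one>\<^bsub>A\<^esub>)" by blast
    then have gf: "g f \<in> carrier A" using g by simp
    have "h s = h (g f) \<ominus>\<^bsub>B\<^esub> (f 1 (unt \<P>) \<odot>\<^bsub>B\<^esub> \<one>\<^bsub>B\<^esub>)"
      unfolding f(2) alg_hom_minus[OF h B.kspace_axioms gf smult_closed[OF one_closed]] alg_homD(5)[OF h one_closed] alg_homD(4)[OF h] ..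
    also have "\<dots> = \<zero>\<^bsub>B\<^esub>" unfolding hg[OF f(1)] by (simp add: B.minus_zero_iff)
    finally show "h s = \<zero>\<^bsub>B\<^esub>" .
  qed
qed

text \<open>Stated for any \<open>J\<close> between the set of generators and the ideal they
  generate, so as to cover both the unit ideals themselves and the intersection of one with the
  invariants.\<close>

lemma char_vanish_iff:
  assumes A: "kalg A" and g: "\<And>f. f \<in> carrier D \<Longrightarrow> g f \<in> carrier A"
    and \<chi>: "\<chi> \<in> alg_hom A scalars" "\<And>f. f \<in> U1 \<Longrightarrow> \<chi> (g f) = eval f x" and x: "x \<in> fams"
    and J: "J \<subseteq> unit_ideal \<P> A g" "\<And>f. f \<in> U1 \<Longrightarrow> g f \<ominus>\<^bsub>A\<^esub> (f 1 (unt \<P>) \<odot>\<^bsub>A\<^esub> \<one>\<^bsub>A\<^esub>) \<in> J"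
  shows "(\<forall>a\<in>J. \<chi> a = 0) \<longleftrightarrow> x \<in> shift ` pfams"
proof -
  interpret kalg A by fact
  have "(\<forall>a\<in>J. \<chi> a = 0) \<longleftrightarrow> (\<forall>f\<in>U1. eval f x = f 1 (unt \<P>))"
  proof (intro iffI ballI)
    fix f assume v: "\<forall>a\<in>J. \<chi> a = 0" and f: "f \<in> U1"
    then have gf: "g f \<in> carrier A" using g by simp
    have "\<chi> (g f \<ominus>\<^bsub>A\<^esub> (f 1 (unt \<P>) \<odot>\<^bsub>A\<^esub> \<one>\<^bsub>A\<^esub>)) = 0" using v J(2)[OF f] by blast
    then show "eval f x = f 1 (unt \<P>)"
      unfolding linear_form_minus[OF alg_hom_scalars_linear[OF \<chi>(1)] gf smult_closed[OF one_closed]]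
      using alg_homD(5)[OF \<chi>(1) one_closed] alg_homD(4)[OF \<chi>(1)] \<chi>(2)[OF f] by simp
  next
    fix a assume "\<forall>f\<in>U1. eval f x = f 1 (unt \<P>)" and a: "a \<in> J"
    then have "\<chi> a = \<zero>\<^bsub>scalars\<^esub>"
      by (intro unit_ideal(3)[OF A g kalg_scalars \<chi>(1)]) (use J(1) \<chi>(2) in auto)
    then show "\<chi> a = 0" by simp
  qed
  then show ?thesis using unit_iff_U1[OF x] shift_pfams_iff[OF x] by simp
qed

text \<open>A form is the sum of its part of arity one and the rest, and the former becomes a scalar
  in \<open>B\<close>. The set \<open>F\<close> stands for all forms or for the invariant
  ones.\<close>

lemma splitting_gen:
  assumes A: "kalg A" and B: "kalg B" and F: "F \<subseteq> carrier D" "U1 \<subseteq> F" "\<And>f. f \<in> F \<Longrightarrow> fp f \<in> F"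
    and g: "\<And>f. f \<in> F \<Longrightarrow> g f \<in> carrier A" "\<And>f f'. f \<in> F \<Longrightarrow> f' \<in> F \<Longrightarrow> g (f \<oplus>\<^bsub>D\<^esub> f') = g f \<oplus>\<^bsub>A\<^esub> g f'"
    and gen: "carrier A \<subseteq> subalgebra_gen A (g ` F)"
    and h: "h \<in> alg_hom A B" "carrier B = h ` carrier A" "\<And>f. f \<in> U1 \<Longrightarrow> h (g f) = f 1 (unt \<P>) \<odot>\<^bsub>B\<^esub> \<one>\<^bsub>B\<^esub>"
  shows "carrier B \<subseteq> subalgebra_gen B ((\<lambda>f. h (g f)) ` {f \<in> F. f 1 = (\<lambda>_. 0)})"
proof -
  let ?G = "subalgebra_gen B ((\<lambda>f. h (g f)) ` {f \<in> F. f 1 = (\<lambda>_. 0)})"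
  have "g ` F \<subseteq> carrier A" using g(1) by blast
  from subalgebra_gen_onto[OF A this h(1,2) gen] have 1: "carrier B \<subseteq> subalgebra_gen B (h ` g ` F)" .
  have "h ` g ` F \<subseteq> ?G"
  proof
    fix b assume "b \<in> h ` g ` F"
    then obtain f where f: "f \<in> F" "b = h (g f)" by blast
    have f1: "f1 f \<in> U1" by (rule f1_in) (use f(1) F(1) in blast)
    then have f1F: "f1 f \<in> F" using F(2) by blast
    have "b = h (g (fp f \<oplus>\<^bsub>D\<^esub> f1 f))" unfolding f(2) f_split[symmetric] ..
    also have "\<dots> = h (g (fp f)) \<oplus>\<^bsub>B\<^esub> (f1 f 1 (unt \<P>) \<odot>\<^bsub>B\<^esub> \<one>\<^bsub>B\<^esub>)"
      unfolding g(2)[OF F(3)[OF f(1)] f1F] alg_homD(2)[OF h(1) g(1)[OF F(3)[OF f(1)]] g(1)[OF f1F]] h(3)[OF f1] ..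
    also have "\<dots> \<in> ?G"
      by (intro subalgebra_gen.intros(3) subalgebra_gen.intros(5) subalgebra_gen.intros(2) subalgebra_gen.intros(1) imageI)
        (use F(3)[OF f(1)] in simp)
    finally show "b \<in> ?G" .
  qed
  from subalgebra_gen_least[OF this] 1 show ?thesis by (rule order.trans[rotated])
qed


subsection \<open>The noncommutative Hopf algebra\<close>

abbreviation "Jb \<equiv> unit_ideal \<P> Dst gn"

lemma kalg_Dst: "kalg Dst" using bialg_Dst by (simp add: bialg_def)

lemma Dst_simps: "mult Dst = mult T" "one Dst = one T" "zero Dst = zero T" "add Dst = add T"
  "module.smult Dst = module.smult T" "coprod Dst = Dlt br_star"
  by (simp_all add: boldD_star_def coprod_star_eq del: ta_simps)

lemma gn_Dst: "f \<in> carrier D \<Longrightarrow> gn f \<in> carrier Dst"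
  unfolding Dst_carrier by (rule gn_in)

interpretation Jb: kalg_ideal Dst Jb
  by (intro kalg_ideal.intro kalg_Dst unit_ideal(1) gn_Dst)

lemma pi_gn_U1: "f \<in> U1 \<Longrightarrow> Jb.\<pi> (gn f) = f 1 (unt \<P>) \<odot>\<^bsub>Jb.Q\<^esub> \<one>\<^bsub>Jb.Q\<^esub>"
  by (intro Jb.pi_scalar gn_Dst unit_ideal(2) kalg_Dst) simp_all

lemma basis_0: "basis 0 = {}"
  using basis(2,3)[of 0] V.dependent_zero[of "basis 0"] by (auto simp: ops_0)

lemma bd_U1: "i \<in> idx 1 \<Longrightarrow> bd i \<in> U1"
proof -
  assume "i \<in> idx 1"
  then have "fst i = 1" using basis_0 by (auto simp: idx_def le_Suc_eq)
  then show ?thesis using bd_in[of i] by (simp add: bd_def)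
qed

lemma fam_comp_unit_left:
  assumes y: "y \<in> fams" shows "fam_comp \<P> (unit_fam \<P>) [y] = y"
proof
  fix n :: nat
  have "{ms. length ms = Suc 0 \<and> sum_list ms = n} = {[n]}" by (auto simp: length_Suc_conv)
  then show "fam_comp \<P> (unit_fam \<P>) [y] n = y n"
    using comp_unt_left[OF completionD[OF y, of n]] by (simp add: fam_comp_def unit_fam_def)
qed

text \<open>In total arity one a nonzero composite has a single input, of arity one, so the
  coproduct of \<open>f\<close> is dual to the multiplication of the operations of arity one,
  written in dual bases. An explicit tensor is called for because points do not separate
  \<open>T\<close>.\<close>

lemma gcop_U1:
  assumes f: "f \<in> U1"
  shows "gcop br_star f = (\<lambda>\<beta>. \<Sum>i\<in>idx 1. \<Sum>j\<in>idx 1. eval f (br_star [be i] [be j]) * pure_tensor T T (gn (bd i)) (gn (bd j)) \<beta>)"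
    (is "_ = ?t")
proof (rule pairing_inj)
  note br = coprod_data_star
  have fD: "f \<in> carrier D" and N: "\<forall>n>1. f n = (\<lambda>_. 0)" using f by auto
  show "gcop br_star f \<in> carrier (tensor_prod T T)" by (rule gcop(1)[OF br fD])
  have "?t \<in> tensors T T (carrier T) (carrier T)"
    by (intro tensors_sum tensors_scale pure_tensor_in gn_in bd_in T.smult_closed order.refl)
  then show "?t \<in> carrier (tensor_prod T T)" by (simp del: ta_simps)
  fix X Y assume "X \<in> lists (finite_fams \<P>)" "Y \<in> lists (finite_fams \<P>)"
  then have X: "X \<in> lists fams" and Y: "Y \<in> lists fams" using lists_mono[OF finite_fams_sub] by blast+
  have bil: "(\<lambda>u v. u (word_form X) * v (word_form Y)) \<in> bilinear_forms T T"
    by (intro bil_prod eval_mf_linear word_form_mf)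
  have be: "be i \<in> fams" if "i \<in> idx 1" for i using be_in[OF that] finite_fams_sub by blast
  have pt: "pairing ?t X Y = (\<Sum>i\<in>idx 1. \<Sum>j\<in>idx 1. eval f (br_star [be i] [be j]) * (word_form X [bd i] * word_form Y [bd j]))"
    unfolding pairing_def pure_tensor_def if_P[OF bil] by (simp add: D.word_eval word_form_mf)
  have "pairing ?t X Y = eval f (br_star X Y)"
  proof (cases "length X = 1 \<and> length Y = 1")
    case True
    then obtain x y where xy: "X = [x]" "Y = [y]" "x \<in> fams" "y \<in> fams" using X Y by (auto simp: length_Suc_conv)
    have "eval f (br_star [x] [y]) = (\<Sum>i\<in>idx 1. eval (bd i) x * eval f (br_star [be i] [y]))"
      using fam_form_at[OF coprod_data_left[OF br fD N, of "[y]"], of "[]" "[]" x] xy by simp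
    also have "\<dots> = (\<Sum>i\<in>idx 1. eval (bd i) x * (\<Sum>j\<in>idx 1. eval (bd j) y * eval f (br_star [be i] [be j])))"
      using fam_form_at[OF coprod_data_fam_form[OF br fD N], of _ "[]" "[]" y] be xy by (intro sum.cong refl) simp
    finally show ?thesis
      unfolding pt by (simp add: xy word_form_def sum_distrib_left ac_simps)
  next
    case False
    have "pairing ?t X Y = 0" unfolding pt using False by (intro sum.neutral ballI) (auto simp: word_form_def)
    moreover have "eval f (br_star X Y) = 0"
    proof (cases "length X = 1")
      case True
      then obtain x where x: "X = [x]" "x \<in> fams" using X by (auto simp: length_Suc_conv)
      have "fam_comp \<P> x Y 1 = 0"
      proof (cases "Y = []")
        case True
        then show ?thesis unfolding fam_comp_def by (intro sum.neutral) auto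
      next
        case False
        then show ?thesis using \<open>\<not> (length X = 1 \<and> length Y = 1)\<close> True Y x
          by (intro fam_comp_vanish) (auto simp: Suc_lessI)
      qed
      then show ?thesis using eval_U1[OF f] D_lin(2)[OF fD, of 0 1 0] by (simp add: br_star_def x ops_closed(1))
    next
      case False
      then show ?thesis using fD by (simp add: br_star_def)
    qed
    ultimately show ?thesis by simp
  qed
  then show "pairing (gcop br_star f) X Y = pairing ?t X Y" using gcop(2)[OF br fD X Y] by simp
qed

text \<open>Modulo the ideal a form of arity one becomes its value at I, so the tensor collapses to
  the value of \<open>f\<close> on the composite of I with itself, which is I.\<close>

lemma Jb_coideal_U1:
  assumes f: "f \<in> U1"
  shows "tensor_map Jb.Q Jb.Q Jb.\<pi> Jb.\<pi> (coprod Dst (gn f)) =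
    f 1 (unt \<P>) \<odot>\<^bsub>tensor_prod Jb.Q Jb.Q\<^esub> \<one>\<^bsub>tensor_prod Jb.Q Jb.Q\<^esub>"
proof
  fix \<beta>
  note br = coprod_data_star
  have fD: "f \<in> carrier D" and N: "\<forall>n>1. f n = (\<lambda>_. 0)" using f by auto
  have be: "be i \<in> fams" if "i \<in> idx 1" for i using be_in[OF that] finite_fams_sub by blast
  show "tensor_map Jb.Q Jb.Q Jb.\<pi> Jb.\<pi> (coprod Dst (gn f)) \<beta> =
    (f 1 (unt \<P>) \<odot>\<^bsub>tensor_prod Jb.Q Jb.Q\<^esub> \<one>\<^bsub>tensor_prod Jb.Q Jb.Q\<^esub>) \<beta>"
  proof (cases "\<beta> \<in> bilinear_forms Jb.Q Jb.Q")
    case True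
    interpret Q: kalg Jb.Q by (rule Jb.kalg_Q)
    let ?b = "\<beta> \<one>\<^bsub>Jb.Q\<^esub> \<one>\<^bsub>Jb.Q\<^esub>"
    have piT: "Jb.\<pi> \<in> alg_hom T Jb.Q" using Jb.pi_alg_hom by (simp add: boldD_star_def del: ta_simps)
    have bil: "(\<lambda>a b. \<beta> (Jb.\<pi> a) (Jb.\<pi> b)) \<in> bilinear_forms T T" by (rule bil_comp[OF True piT piT])
    have val: "\<beta> (Jb.\<pi> (gn (bd i))) (Jb.\<pi> (gn (bd j))) = eval (bd i) (unit_fam \<P>) * eval (bd j) (unit_fam \<P>) * ?b"
      if "i \<in> idx 1" "j \<in> idx 1" for i j
      unfolding pi_gn_U1[OF bd_U1[OF that(1)]] pi_gn_U1[OF bd_U1[OF that(2)]] eval_unit[OF bd_in]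
      using True by (simp add: bilinear_forms_def linear_form_def del: One_nat_def)
    have "tensor_map Jb.Q Jb.Q Jb.\<pi> Jb.\<pi> (coprod Dst (gn f)) \<beta> =
        (\<Sum>i\<in>idx 1. \<Sum>j\<in>idx 1. eval f (br_star [be i] [be j]) * (eval (bd i) (unit_fam \<P>) * eval (bd j) (unit_fam \<P>) * ?b))"
      unfolding Dst_simps Dlt(3)[OF br fD] gcop_U1[OF f] tensor_map_def if_P[OF True] pure_tensor_def if_P[OF bil]
      by (intro sum.cong refl) (simp only: val)
    also have "\<dots> = (\<Sum>i\<in>idx 1. eval (bd i) (unit_fam \<P>) * (\<Sum>j\<in>idx 1. eval (bd j) (unit_fam \<P>) * eval f (br_star [be i] [be j]))) * ?b"
      by (simp add: sum_distrib_left sum_distrib_right ac_simps)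
    \<comment> \<open>The scalars that the projection produces are the coordinates of I, so the sums
      over the dual bases reassemble into compositions with I, first on the right and then on the
      left.\<close>
    also have "\<dots> = (\<Sum>i\<in>idx 1. eval (bd i) (unit_fam \<P>) * eval f (br_star [be i] [unit_fam \<P>])) * ?b"
      using fam_form_at[OF coprod_data_fam_form[OF br fD N], of _ "[]" "[]" "unit_fam \<P>"] be unit_fam_in
      by (intro arg_cong[where f = "\<lambda>s. s * ?b"] sum.cong refl) simp
    also have "\<dots> = eval f (br_star [unit_fam \<P>] [unit_fam \<P>]) * ?b"
      using fam_form_at[OF coprod_data_left[OF br fD N, of "[unit_fam \<P>]"], of "[]" "[]" "unit_fam \<P>"] unit_fam_in by simp
    also have "\<dots> = f 1 (unt \<P>) * ?b"
      by (simp add: br_star_def fam_comp_unit_left[OF unit_fam_in] eval_unit[OF fD])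
    finally show ?thesis using True by (simp add: pure_tensor_def)
  qed (simp add: tensor_map_def pure_tensor_def)
qed

lemma bialg_quot_Jb: "bialg_quot Dst Jb"
proof (intro bialg_quot.intro bialg_quot_axioms.intro Jb.kalg_ideal_axioms bialg_Dst)
  fix a assume a: "a \<in> Jb"
  have cp: "coprod Dst \<in> alg_hom Dst (tensor_prod Dst Dst)" using bialg_Dst by (simp add: bialg_def)
  have th: "(\<lambda>a. tensor_map Jb.Q Jb.Q Jb.\<pi> Jb.\<pi> (coprod Dst a)) \<in> alg_hom Dst (tensor_prod Jb.Q Jb.Q)"
    by (rule alg_hom_comp[OF cp tensor_map_alg_hom[OF kalg_Dst kalg_Dst Jb.kalg_Q Jb.kalg_Q Jb.pi_alg_hom Jb.pi_alg_hom]])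
  have k: "kalg (tensor_prod Jb.Q Jb.Q)" by (intro two_algs.kalg_tensor_prod two_algs.intro Jb.kalg_Q)
  have "tensor_map Jb.Q Jb.Q Jb.\<pi> Jb.\<pi> (coprod Dst a) = \<zero>\<^bsub>tensor_prod Jb.Q Jb.Q\<^esub>"
    by (rule unit_ideal(3)[OF kalg_Dst gn_Dst k th Jb_coideal_U1 a])
  then show "tensor_map Jb.Q Jb.Q Jb.\<pi> Jb.\<pi> (coprod Dst a) = (\<lambda>_. 0)" by simp
qed

lemma M_plus_shift: "shift \<in> hom (M_plus \<P>) (M \<P>)" "inj_on shift (carrier (M_plus \<P>))" "shift \<one>\<^bsub>M_plus \<P>\<^esub> = \<one>\<^bsub>M \<P>\<^esub>"
proof -
  show "shift \<in> hom (M_plus \<P>) (M \<P>)"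
  proof (rule homI)
    fix x y assume "x \<in> carrier (M_plus \<P>)" "y \<in> carrier (M_plus \<P>)"
    then have p: "x \<in> pfams" "y \<in> pfams" by simp_all
    then have xy: "x \<in> fams" "y \<in> fams" by (simp_all add: pfams_iff)
    show "shift x \<in> carrier (M \<P>)" using shift_in[OF xy(1)] by simp
    show "shift (x \<otimes>\<^bsub>M_plus \<P>\<^esub> y) = shift x \<otimes>\<^bsub>M \<P>\<^esub> shift y"
      using shift_diamond'[OF xy] diamond_plus_diamond'[OF p] by simp
  qed
  show "inj_on shift (carrier (M_plus \<P>))" by (rule inj_on_subset[OF shift_inj subset_UNIV])
  show "shift \<one>\<^bsub>M_plus \<P>\<^esub> = \<one>\<^bsub>M \<P>\<^esub>" by (simp add: shift_def)
qed

lemma Bst: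
  obtains \<chi> where "points (boldB_star \<P>) (M_plus \<P>) \<chi>"
    "\<And>x f. x \<in> carrier (M_plus \<P>) \<Longrightarrow> f \<in> carrier Dp \<Longrightarrow> \<chi> x (boldB_gen \<P> f) = eval f x"
    "\<And>f. f \<in> carrier Dp \<Longrightarrow> boldB_gen \<P> f \<in> carrier (boldB_star \<P>)"
    "carrier (boldB_star \<P>) \<subseteq> subalgebra_gen (boldB_star \<P>) (boldB_gen \<P> ` carrier Dp)"
proof -
  interpret B: bialg_quot Dst Jb by (rule bialg_quot_Jb)
  have Bs: "boldB_star \<P> = B.QB" by (simp add: boldB_star_def)
  have Bg: "boldB_gen \<P> f = Jb.\<pi> (gn f)" for f by (simp add: boldB_gen_def)
  have im: "(\<forall>a\<in>Jb. chi x a = 0) \<longleftrightarrow> x \<in> shift ` carrier (M_plus \<P>)" if "x \<in> carrier (M \<P>)" for x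
    unfolding M_simps
  proof (rule char_vanish_iff[OF kalg_Dst gn_Dst])
    show "chi x \<in> alg_hom Dst scalars" using chi_alg_hom by (simp add: boldD_star_def del: ta_simps)
    show "chi x (gn f) = eval f x" if "f \<in> U1" for f using that chi_gen by simp
    show "gn f \<ominus>\<^bsub>Dst\<^esub> (f 1 (unt \<P>) \<odot>\<^bsub>Dst\<^esub> \<one>\<^bsub>Dst\<^esub>) \<in> Jb" if "f \<in> U1" for f
      by (rule unit_ideal(2)[OF kalg_Dst gn_Dst that])
  qed (use that in simp_all)
  obtain \<chi> where \<chi>: "points B.QB (M_plus \<P>) \<chi>"
    "\<And>x a. x \<in> carrier (M_plus \<P>) \<Longrightarrow> a \<in> carrier Dst \<Longrightarrow> \<chi> x (Jb.\<pi> a) = chi (shift x) a"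
    using B.points_quot[OF points_star monoid_M_plus M_plus_shift im] by blast
  show ?thesis
  proof (rule that)
    show "points (boldB_star \<P>) (M_plus \<P>) \<chi>" unfolding Bs by (rule \<chi>(1))
    fix f assume f: "f \<in> carrier Dp"
    then have fD: "f \<in> carrier D" "f 1 = (\<lambda>_. 0)" by (simp_all add: Dp_iff)
    show "boldB_gen \<P> f \<in> carrier (boldB_star \<P>)" unfolding Bs Bg B.QB_simps by (rule Jb.pi_in[OF gn_Dst[OF fD(1)]])
    fix x assume x: "x \<in> carrier (M_plus \<P>)"
    show "\<chi> x (boldB_gen \<P> f) = eval f x"
      unfolding Bg \<chi>(2)[OF x gn_Dst[OF fD(1)]] chi_gen[OF fD(1)] by (rule eval_shift[OF fD]) (use x in \<open>simp add: pfams_iff\<close>)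
  next
    have eq: "carrier Dp = {f \<in> carrier D. f 1 = (\<lambda>_. 0)}" by (auto simp: Dp_iff)
    have kB: "kalg B.QB" using B.bialg_QB by (simp add: bialg_def)
    show "carrier (boldB_star \<P>) \<subseteq> subalgebra_gen (boldB_star \<P>) (boldB_gen \<P> ` carrier Dp)"
      unfolding Bs Bg[abs_def] eq
    proof (rule splitting_gen[OF kalg_Dst kB order.refl _ _ _ _ _ B.pi_QB])
      show "carrier Dst \<subseteq> subalgebra_gen Dst (gn ` carrier D)" unfolding boldD_star_def by (rule boldD_gen)
      show "carrier B.QB = Jb.\<pi> ` carrier Dst" by (simp add: Jb.carrier_Q)
      show "Jb.\<pi> (gn f) = f 1 (unt \<P>) \<odot>\<^bsub>B.QB\<^esub> \<one>\<^bsub>B.QB\<^esub>" if "f \<in> U1" for f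
        using pi_gn_U1[OF that] by (simp only: B.QB_simps)
      show "gn (f \<oplus>\<^bsub>D\<^esub> f') = gn f \<oplus>\<^bsub>Dst\<^esub> gn f'" if "f \<in> carrier D" "f' \<in> carrier D" for f f'
        unfolding Dst_simps by (rule gn_linear(1)[OF that])
    qed (auto intro: gn_Dst D_filter)
  qed
qed


subsection \<open>The commutative Hopf algebra of invariants\<close>

abbreviation "Ju \<equiv> unit_ideal \<P> Sd sg"
abbreviation "Jd \<equiv> B_ideal \<P>"

interpretation Ju: kalg_ideal Sd Ju
  by (intro kalg_ideal.intro kalg_Sd unit_ideal(1) sg_in)

lemma pi_sg_U1: "f \<in> U1 \<Longrightarrow> Ju.\<pi> (sg f) = f 1 (unt \<P>) \<odot>\<^bsub>Ju.Q\<^esub> \<one>\<^bsub>Ju.Q\<^esub>"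
  by (intro Ju.pi_scalar sg_in unit_ideal(2) kalg_Sd) simp_all

lemma chiS_Ju:
  assumes "y \<in> pfams" "a \<in> Ju" shows "chiS (shift y) a = 0"
proof -
  have s: "shift y \<in> fams" using assms(1) by (simp add: pfams_iff shift_in)
  have "(\<forall>a\<in>Ju. chiS (shift y) a = 0) \<longleftrightarrow> shift y \<in> shift ` pfams"
  proof (rule char_vanish_iff[where g = sg, OF kalg_Sd sg_in chiS_alg[OF s] _ s order.refl])
    show "chiS (shift y) (sg f) = eval f (shift y)" if "f \<in> U1" for f using that by (simp add: chiS_sg[OF s])
    show "sg f \<ominus>\<^bsub>Sd\<^esub> (f 1 (unt \<P>) \<odot>\<^bsub>Sd\<^esub> \<one>\<^bsub>Sd\<^esub>) \<in> Ju" if "f \<in> U1" for f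
      by (rule unit_ideal(2)[where g = sg, OF kalg_Sd sg_in that])
  qed
  then show ?thesis using assms by blast
qed

text \<open>Modulo the ideal, every element is a polynomial in the generators of arity at least 2, whose
  value at a point does not depend on the component of arity 1.\<close>

lemma Ju_separated:
  assumes a: "a \<in> carrier Sd" and z: "\<And>y. y \<in> pfams \<Longrightarrow> chiS (shift y) a = 0"
  shows "a \<in> Ju"
proof -
  let ?X = "sg ` {f \<in> carrier D. f 1 = (\<lambda>_. 0)}"
  have X: "?X \<subseteq> carrier Sd" using sg_in by blast
  have "carrier Ju.Q \<subseteq> subalgebra_gen Ju.Q ((\<lambda>f. Ju.\<pi> (sg f)) ` {f \<in> carrier D. f 1 = (\<lambda>_. 0)})"
    by (rule splitting_gen[OF kalg_Sd Ju.kalg_Q order.refl _ _ sg_in sg_linear(1) Sd_gen Ju.pi_alg_hom Ju.carrier_Q pi_sg_U1])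
      (auto intro: D_filter)
  then have "Ju.\<pi> a \<in> subalgebra_gen Ju.Q (Ju.\<pi> ` ?X)" using Ju.pi_in[OF a] by (auto simp: image_image)
  from subalgebra_gen_preimage[OF Ju.pi_alg_hom kalg_Sd X this]
  obtain b where b: "b \<in> subalgebra_gen Sd ?X" "Ju.\<pi> b = Ju.\<pi> a" by blast
  have bS: "b \<in> carrier Sd" using b(1) subalgebra_gen_subset[OF kalg_Sd X] by blast
  have ba: "b \<ominus>\<^bsub>Sd\<^esub> a \<in> Ju" using b(2) Ju.pi_eq_iff[OF bS a] by simp
  have "chiS x b = 0" if x: "x \<in> fams" for x
  proof -
    \<comment> \<open>\<open>shift y\<close> agrees with \<open>x\<close> in every arity except 1,
      where it has the unit.\<close>
    define y where "y = (\<lambda>n. if n = 1 then 0 else x n)"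
    have yf: "y \<in> fams" using x by (auto simp: y_def completion_def ops_closed(1))
    then have y: "y \<in> pfams" unfolding pfams_iff by (simp add: y_def)
    have e: "eval f x = eval f (shift y)" if f: "f \<in> carrier D" "f 1 = (\<lambda>_. 0)" for f
    proof -
      have "eval f x = eval f y" unfolding eval_def by (rule sum.cong) (auto simp: y_def f(2)[unfolded One_nat_def])
      then show ?thesis by (simp only: eval_shift[OF f yf])
    qed
    have "chiS x b = chiS (shift y) b"
    proof (rule alg_hom_agree[OF kalg_Sd X chiS_alg[OF x] chiS_alg[OF shift_in[OF yf]] _ b(1)])
      fix u assume "u \<in> ?X"
      then obtain f where f: "f \<in> carrier D" "f 1 = (\<lambda>_. 0)" "u = sg f" by blast
      show "chiS x u = chiS (shift y) u"
        unfolding f(3) chiS_sg[OF x f(1)] chiS_sg[OF shift_in[OF yf] f(1)] by (rule e[OF f(1,2)])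
    qed
    also have "\<dots> = chiS (shift y) a"
      using chiS_Ju[OF y ba] Sd.linear_form_minus[OF chiS_lin[OF shift_in[OF yf]] bS a] by simp
    finally show ?thesis using z[OF y] by simp
  qed
  then have "b = \<zero>\<^bsub>Sd\<^esub>" using separating_Sd bS by (auto simp: separating_def)
  then have "Ju.\<pi> a = Ju.\<pi> \<zero>\<^bsub>Sd\<^esub>" using b(2) by simp
  then have "a \<ominus>\<^bsub>Sd\<^esub> \<zero>\<^bsub>Sd\<^esub> \<in> Ju" using Ju.pi_eq_iff[OF a Sd.zero_closed] by simp
  moreover have "a \<ominus>\<^bsub>Sd\<^esub> \<zero>\<^bsub>Sd\<^esub> = a" using a by (simp add: a_minus_def)
  ultimately show ?thesis by simp
qed

lemma D_star_simps: "carrier (D_star \<P>) = S0" "mult (D_star \<P>) = mult Sd" "one (D_star \<P>) = one Sd"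
  "zero (D_star \<P>) = zero Sd" "add (D_star \<P>) = add Sd" "module.smult (D_star \<P>) = module.smult Sd"
  by (simp_all add: D_star_eq)

lemma kalg_D_star: "kalg (D_star \<P>)" using SB.bialg_SB by (simp add: D_star_eq bialg_def)

lemma bialg_D_star: "bialg (D_star \<P>)" using SB.bialg_SB by (simp add: D_star_eq)

lemma Jd_eq: "Jd = Ju \<inter> S0" by (simp add: B_ideal_def D_star_simps)

interpretation Jd: kalg_ideal "D_star \<P>" Jd
proof (intro kalg_ideal.intro kalg_D_star)
  show "ideal Jd (D_star \<P>)" unfolding Jd_eq D_star_eq by (rule SB.ideal_sub[OF unit_ideal(1)[OF kalg_Sd sg_in]])
qed

lemma S0_in: "a \<in> S0 \<Longrightarrow> a \<in> carrier Sd" using S0_sub by blast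

lemma sg_S0: "f \<in> invD \<Longrightarrow> sg f \<in> S0" by (intro subalgebra_gen.intros(1)) simp

text \<open>Subtraction is defined through inverses in the carrier, so it is not visibly the same in
  a subalgebra; both versions are expressed by the scalar -1.\<close>

lemma Jd_minus: "a \<in> S0 \<Longrightarrow> b \<in> S0 \<Longrightarrow> a \<ominus>\<^bsub>D_star \<P>\<^esub> b = a \<ominus>\<^bsub>Sd\<^esub> b"
  using Jd.uminus_smult[of b] Sd.uminus_smult[of b] S0_in[of b] by (simp add: a_minus_def D_star_simps)

lemma Jd_gen: "f \<in> U1 \<Longrightarrow> sg f \<ominus>\<^bsub>Sd\<^esub> (f 1 (unt \<P>) \<odot>\<^bsub>Sd\<^esub> \<one>\<^bsub>Sd\<^esub>) \<in> Jd"
proof -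
  assume f: "f \<in> U1"
  have s: "sg f \<in> S0" "f 1 (unt \<P>) \<odot>\<^bsub>Sd\<^esub> \<one>\<^bsub>Sd\<^esub> \<in> S0"
    by (rule sg_S0[OF U1_inv[OF f]]) (intro subalgebra_gen.intros)
  have "sg f \<ominus>\<^bsub>D_star \<P>\<^esub> (f 1 (unt \<P>) \<odot>\<^bsub>Sd\<^esub> \<one>\<^bsub>Sd\<^esub>) \<in> carrier (D_star \<P>)"
    using s by (intro Jd.minus_closed) (simp_all add: D_star_simps)
  then show ?thesis
    unfolding Jd_eq Jd_minus[OF s] D_star_simps by (intro IntI unit_ideal(2)[OF kalg_Sd] sg_in f)
qed

lemma pi_Jd_U1: "f \<in> U1 \<Longrightarrow> Jd.\<pi> (sg f) = f 1 (unt \<P>) \<odot>\<^bsub>Jd.Q\<^esub> \<one>\<^bsub>Jd.Q\<^esub>"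
proof (rule Jd.pi_scalar)
  assume f: "f \<in> U1"
  have s: "sg f \<in> S0" "f 1 (unt \<P>) \<odot>\<^bsub>Sd\<^esub> \<one>\<^bsub>Sd\<^esub> \<in> S0"
    by (rule sg_S0[OF U1_inv[OF f]]) (intro subalgebra_gen.intros)
  show "sg f \<in> carrier (D_star \<P>)" using s by (simp add: D_star_simps)
  show "sg f \<ominus>\<^bsub>D_star \<P>\<^esub> (f 1 (unt \<P>) \<odot>\<^bsub>D_star \<P>\<^esub> \<one>\<^bsub>D_star \<P>\<^esub>) \<in> Jd"
    unfolding D_star_simps Jd_minus[OF s] by (rule Jd_gen[OF f])
qed

lemma linear_form_D_star: "linear_form Sd \<phi> \<Longrightarrow> linear_form (D_star \<P>) \<phi>"
  unfolding linear_form_def D_star_simps using S0_in by blast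

text \<open>\<open>Jd\<close> is an intersection without evident generators, so the projected
  coproduct is tested on points. By \<open>Ju_separated\<close> the points I + y separate the
  quotient, and a pair of them evaluates the coproduct of \<open>a\<close> as the point I + z at
  \<open>a\<close>, where z is the product of the two families under \<open>diamond_plus\<close>;
  this point kills \<open>Ju\<close>.\<close>

lemma bialg_quot_Jd: "bialg_quot (D_star \<P>) Jd"
proof (intro bialg_quot.intro bialg_quot_axioms.intro Jd.kalg_ideal_axioms bialg_D_star)
  fix a assume a: "a \<in> Jd"
  then have aJ: "a \<in> Ju" "a \<in> S0" by (auto simp: Jd_eq)
  let ?\<Lambda> = "{\<phi>. linear_form Jd.Q \<phi> \<and> (\<exists>y\<in>pfams. \<forall>a\<in>S0. \<phi> (Jd.\<pi> a) = chiS (shift y) a)}"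
  have ks: "kspace Jd.Q" using Jd.kalg_Q by (simp add: kalg_def)
  have sep: "separating Jd.Q ?\<Lambda>"
    unfolding separating_def
  proof (intro conjI ballI impI)
    fix X assume "X \<in> carrier Jd.Q" and z: "\<forall>\<phi>\<in>?\<Lambda>. \<phi> X = 0"
    then obtain b where b: "b \<in> S0" "X = Jd.\<pi> b" by (auto simp: Jd.carrier_Q D_star_simps)
    have "chiS (shift y) b = 0" if y: "y \<in> pfams" for y
    proof -
      have "shift y \<in> fams" using y by (simp add: pfams_iff shift_in)
      from linear_form_D_star[OF chiS_lin[OF this]]
      have "\<exists>\<psi>. linear_form Jd.Q \<psi> \<and> (\<forall>a\<in>carrier (D_star \<P>). \<psi> (Jd.\<pi> a) = chiS (shift y) a)"
        by (rule Jd.linear_form_factor) (use chiS_Ju[OF y] in \<open>simp add: Jd_eq\<close>)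
      then obtain \<psi> where \<psi>: "linear_form Jd.Q \<psi>" "\<forall>a\<in>S0. \<psi> (Jd.\<pi> a) = chiS (shift y) a"
        unfolding D_star_simps by blast
      then have "\<psi> \<in> ?\<Lambda>" using y by blast
      then have "\<psi> X = 0" using z by blast
      then show ?thesis using \<psi>(2) b by simp
    qed
    then have "b \<in> Jd" using Ju_separated[OF S0_in[OF b(1)]] b(1) by (simp add: Jd_eq)
    then have "Jd.\<pi> b = Jd" using Jd.pi_zero_iff[of b] b(1) by (simp add: D_star_simps)
    moreover have "Jd.\<pi> \<zero>\<^bsub>D_star \<P>\<^esub> = Jd" using Jd.pi_zero_iff[of "\<zero>\<^bsub>D_star \<P>\<^esub>"] Jd.zero_closed by simp
    ultimately show "X = \<zero>\<^bsub>Jd.Q\<^esub>" by (simp add: Jd.pi_zero b(2))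
  qed simp
  have cp: "coprod (D_star \<P>) a \<in> tensors (D_star \<P>) (D_star \<P>) (carrier (D_star \<P>)) (carrier (D_star \<P>))"
    using SB.coprod_SB_in[OF aJ(2)] unfolding D_star_simps(1) unfolding D_star_eq .
  show "tensor_map Jd.Q Jd.Q Jd.\<pi> Jd.\<pi> (coprod (D_star \<P>) a) = (\<lambda>_. 0)"
  proof (rule separating_tensor[OF ks ks sep sep])
    show "tensor_map Jd.Q Jd.Q Jd.\<pi> Jd.\<pi> (coprod (D_star \<P>) a) \<in> tensors Jd.Q Jd.Q (carrier Jd.Q) (carrier Jd.Q)"
      using tensor_map_in[OF Jd.pi_alg_hom Jd.pi_alg_hom cp] unfolding Jd.carrier_Q .
    fix \<phi> \<psi> assume "\<phi> \<in> ?\<Lambda>" "\<psi> \<in> ?\<Lambda>"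
    then obtain x y where l: "linear_form Jd.Q \<phi>" "linear_form Jd.Q \<psi>" and p: "x \<in> pfams" "y \<in> pfams"
      and v: "\<And>a. a \<in> S0 \<Longrightarrow> \<phi> (Jd.\<pi> a) = chiS (shift x) a" "\<And>a. a \<in> S0 \<Longrightarrow> \<psi> (Jd.\<pi> a) = chiS (shift y) a"
      by blast
    have f: "x \<in> fams" "y \<in> fams" using p by (simp_all add: pfams_iff)
    note s = shift_in[OF f(1)] shift_in[OF f(2)]
    have "tensor_map Jd.Q Jd.Q Jd.\<pi> Jd.\<pi> (coprod (D_star \<P>) a) (\<lambda>a b. \<phi> a * \<psi> b) =
        coprod (D_star \<P>) a (\<lambda>a b. \<phi> (Jd.\<pi> a) * \<psi> (Jd.\<pi> b))"
      unfolding tensor_map_def if_P[OF bil_prod[OF l]] ..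
    also have "\<dots> = coprod (D_star \<P>) a (\<lambda>a b. chiS (shift x) a * chiS (shift y) b)"
    proof (rule tensors_cong[OF cp])
      show "(\<lambda>a b. \<phi> (Jd.\<pi> a) * \<psi> (Jd.\<pi> b)) \<in> bilinear_forms (D_star \<P>) (D_star \<P>)"
        by (intro bil_prod linear_form_comp[OF _ Jd.pi_alg_hom] l)
      show "(\<lambda>a b. chiS (shift x) a * chiS (shift y) b) \<in> bilinear_forms (D_star \<P>) (D_star \<P>)"
        by (intro bil_prod linear_form_D_star chiS_lin s)
    qed (simp add: D_star_simps v)
    also have "\<dots> = coprod Sd a (\<lambda>a b. chiS (shift x) a * chiS (shift y) b)"
      unfolding D_star_eq by (rule SB.coprod_SB[OF chiS_lin[OF s(1)] chiS_lin[OF s(2)] aJ(2)])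
    also have "\<dots> = chiS (shift (diamond_plus \<P> x y)) a"
      unfolding coprod_Sd_chi[OF S0_in[OF aJ(2)] s] diamond_plus_diamond'[OF p] shift_diamond'[OF f] ..
    also have "\<dots> = 0" by (rule chiS_Ju[OF diamond_plus_closed[OF p] aJ(1)])
    finally show "tensor_map Jd.Q Jd.Q Jd.\<pi> Jd.\<pi> (coprod (D_star \<P>) a) (\<lambda>a b. \<phi> a * \<psi> b) = 0" .
  qed
qed

lemma pc_shift: "pc (shift x) = pc (shift y) \<longleftrightarrow> pc x = pc y"
  by (simp add: coinv_class_eq_iff shift_def)

definition pshift :: "'a set fam \<Rightarrow> 'a set fam"
  where "pshift X = pc (shift (inv_into pfams pp X))"

lemma pshift: "y \<in> pfams \<Longrightarrow> pshift (pp y) = pc (shift y)"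
proof -
  assume y: "y \<in> pfams"
  have z: "inv_into pfams pp (pp y) \<in> pfams" "pp (inv_into pfams pp (pp y)) = pp y"
    using y by (simp_all add: inv_into_into f_inv_into_f)
  then show ?thesis
    unfolding pshift_def pc_shift using coinv_class_plus_eq_iff[OF z(1) y] by blast
qed

lemma B_star_points:
  obtains \<chi> where "points (B_star \<P>) Qp \<chi>"
    "\<And>x. x \<in> pfams \<Longrightarrow> \<chi> (pp x) = point_char (B_star \<P>) (B_gen \<P>) (inv_dual \<P> (plus_ops \<P>)) x"
proof -
  interpret B: bialg_quot "D_star \<P>" Jd by (rule bialg_quot_Jd)
  have Bs: "B_star \<P> = B.QB" by (simp add: B_star_def)
  have Bg: "B_gen \<P> f = Jd.\<pi> (sg f)" for f by (simp add: B_gen_def)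
  have f: "x \<in> fams" "shift x \<in> fams" if "x \<in> pfams" for x using that by (simp_all add: pfams_iff shift_in)
  have h: "pshift \<in> hom Qp Qm"
  proof (rule homI)
    fix X Y assume "X \<in> carrier Qp" "Y \<in> carrier Qp"
    then obtain x y where xy: "x \<in> pfams" "y \<in> pfams" "X = pp x" "Y = pp y" by (auto simp: Qp_carrier)
    show "pshift X \<in> carrier Qm" using f xy by (simp add: pshift Qm_carrier)
    show "pshift (X \<otimes>\<^bsub>Qp\<^esub> Y) = pshift X \<otimes>\<^bsub>Qm\<^esub> pshift Y"
      unfolding xy(3,4) Qp_mult[OF xy(1,2)] pshift[OF xy(1)] pshift[OF xy(2)]
        Qm_mult[OF f(2)[OF xy(1)] f(2)[OF xy(2)]] shift_diamond'[OF f(1)[OF xy(1)] f(1)[OF xy(2)], symmetric]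
        diamond_plus_diamond'[OF xy(1,2), symmetric]
      by (rule pshift[OF diamond_plus_closed[OF xy(1,2)]])
  qed
  have inj: "inj_on pshift (carrier Qp)"
  proof (rule inj_onI)
    fix X Y assume "X \<in> carrier Qp" "Y \<in> carrier Qp" and eq: "pshift X = pshift Y"
    then obtain x y where xy: "x \<in> pfams" "y \<in> pfams" "X = pp x" "Y = pp y" by (auto simp: Qp_carrier)
    have "pc x = pc y" using eq unfolding xy(3,4) pshift[OF xy(1)] pshift[OF xy(2)] pc_shift .
    then show "X = Y" unfolding xy(3,4) coinv_class_plus_eq_iff[OF xy(1,2)] .
  qed
  have z: "0 \<in> pfams" by (simp add: pfams_iff fams_zero)
  have one: "pshift \<one>\<^bsub>Qp\<^esub> = \<one>\<^bsub>Qm\<^esub>"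
  proof -
    have "pshift \<one>\<^bsub>Qp\<^esub> = pc (shift 0)" unfolding Qp(3)[symmetric] by (rule pshift[OF z])
    also have "shift 0 = unit_fam \<P>" by (simp add: shift_def)
    finally show ?thesis by (simp only: Qm(3))
  qed
  have im: "(\<forall>a\<in>Jd. chiD X a = 0) \<longleftrightarrow> X \<in> pshift ` carrier Qp" if X: "X \<in> carrier Qm" for X
  proof -
    obtain x where x: "x \<in> fams" "X = pc x" using X unfolding Qm_carrier by blast
    have van: "(\<forall>a\<in>Jd. chiS x a = 0) \<longleftrightarrow> x \<in> shift ` pfams"
      by (rule char_vanish_iff[where g = sg, OF kalg_Sd sg_in chiS_alg[OF x(1)] _ x(1) _ Jd_gen])
        (simp_all add: chiS_sg[OF x(1)] Jd_eq)
    have "(\<forall>a\<in>Jd. chiD X a = 0) \<longleftrightarrow> (\<forall>a\<in>Jd. chiS x a = 0)"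
      unfolding x(2) by (intro ball_cong refl) (simp add: chiD[OF x(1)] Jd_eq)
    also have "\<dots> \<longleftrightarrow> x \<in> shift ` pfams"
      by (rule van)
    also have "\<dots> \<longleftrightarrow> X \<in> pshift ` carrier Qp"
    proof
      assume "x \<in> shift ` pfams"
      then obtain y where y: "y \<in> pfams" "x = shift y" by blast
      have "X = pshift (pp y)" unfolding x(2) y(2) pshift[OF y(1)] ..
      then show "X \<in> pshift ` carrier Qp" using y(1) unfolding Qp_carrier by blast
    next
      assume "X \<in> pshift ` carrier Qp"
      then obtain y where y: "y \<in> pfams" "X = pshift (pp y)" by (auto simp: Qp_carrier)
      \<comment> \<open>\<open>x\<close> is known only modulo the coinvariant kernel. Elements of
        \<open>Jd\<close> are polynomials in invariant forms and do not see the difference, and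
        vanishing on \<open>Jd\<close> forces the component of arity one to be I.\<close>
      have "chiS x a = 0" if a: "a \<in> Jd" for a
      proof -
        have aS: "a \<in> S0" "a \<in> Ju" using a by (simp_all add: Jd_eq)
        have "pc x = pc (shift y)" using x(2) y(2) pshift[OF y(1)] by simp
        then have "chiS x a = chiS (shift y) a"
          using chiD[OF x(1) aS(1)] chiD[OF f(2)[OF y(1)] aS(1)] by simp
        then show ?thesis using chiS_Ju[OF y(1) aS(2)] by simp
      qed
      then show "x \<in> shift ` pfams"
        unfolding van[symmetric] by blast
    qed
    finally show ?thesis .
  qed
  obtain \<chi> where \<chi>: "points B.QB Qp \<chi>"
    "\<And>X a. X \<in> carrier Qp \<Longrightarrow> a \<in> carrier (D_star \<P>) \<Longrightarrow> \<chi> X (Jd.\<pi> a) = chiD (pshift X) a"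
    using B.points_quot[OF chiD_points Qp(1) h inj one im] by blast
  have kB: "kalg B.QB" using B.bialg_QB by (simp add: bialg_def)
  have eq: "inv_dual \<P> (plus_ops \<P>) = {f \<in> invD. f 1 = (\<lambda>_. 0)}" by (auto simp: inv_plus_iff)
  have sD: "sg f \<in> carrier (D_star \<P>)" if "f \<in> invD" for f using sg_S0[OF that] by (simp add: D_star_simps)
  have gen: "carrier B.QB \<subseteq> subalgebra_gen B.QB (B_gen \<P> ` inv_dual \<P> (plus_ops \<P>))"
    unfolding Bg[abs_def] eq
  proof (rule splitting_gen[OF kalg_D_star kB inv_sub _ fp_inv sD _ D_star_gen B.pi_QB])
    show "carrier B.QB = Jd.\<pi> ` carrier (D_star \<P>)" by (simp add: Jd.carrier_Q)
    show "Jd.\<pi> (sg f) = f 1 (unt \<P>) \<odot>\<^bsub>B.QB\<^esub> \<one>\<^bsub>B.QB\<^esub>" if "f \<in> U1" for f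
      using pi_Jd_U1[OF that] by (simp only: B.QB_simps)
    show "sg (f \<oplus>\<^bsub>D\<^esub> f') = sg f \<oplus>\<^bsub>D_star \<P>\<^esub> sg f'" if "f \<in> invD" "f' \<in> invD" for f f'
      unfolding D_star_simps by (rule sg_linear(1)[OF subsetD[OF inv_sub that(1)] subsetD[OF inv_sub that(2)]])
  qed (use U1_inv in blast)
  show ?thesis
  proof (rule that)
    show "points (B_star \<P>) Qp \<chi>" unfolding Bs by (rule \<chi>(1))
    fix x assume x: "x \<in> pfams"
    have X: "pp x \<in> carrier Qp" using x unfolding Qp_carrier by (rule imageI)
    have "point_char B.QB (B_gen \<P>) (inv_dual \<P> (plus_ops \<P>)) x = \<chi> (pp x)"
    proof (rule point_char_eq[OF kB _ _ _ gen])
      show "\<chi> (pp x) \<in> characters B.QB" using \<chi>(1) X by (auto simp: points_def bij_betw_def)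
      fix f assume "f \<in> inv_dual \<P> (plus_ops \<P>)"
      then have i: "f \<in> invD" "f 1 = (\<lambda>_. 0)" by (simp_all add: inv_plus_iff)
      then have fD: "f \<in> carrier D" using inv_sub by blast
      show "B_gen \<P> f \<in> carrier B.QB" unfolding Bg B.QB_simps by (rule Jd.pi_in[OF sD[OF i(1)]])
      show "\<chi> (pp x) (B_gen \<P> f) = eval f x"
        unfolding Bg \<chi>(2)[OF X sD[OF i(1)]] pshift[OF x] chiD[OF f(2)[OF x] sg_S0[OF i(1)]] chiS_sg[OF f(2)[OF x] fD]
        by (rule eval_shift[OF fD i(2) f(1)[OF x]])
    qed
    then show "\<chi> (pp x) = point_char (B_star \<P>) (B_gen \<P>) (inv_dual \<P> (plus_ops \<P>)) x" unfolding Bs by simp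
  qed
qed

end

theorem proposition54:
  fixes \<P> :: "('k::field_char_0, 'a::ab_group_add) operad_data"
  assumes "operad \<P>"
    and "ops \<P> 0 = {0}"
    and "\<And>n. finite_dim \<P> (ops \<P> n)"
  shows
    "\<comment> \<open>1 (a)\<close>
     (monoid (M' \<P>) \<and> monoid (char_monoid (boldD_prime \<P>)) \<and>
      monoid (char_monoid (abelianization (boldD_prime \<P>))) \<and>
      point_char (boldD_prime \<P>) (gen \<P>) (carrier (graded_dual \<P> (ops \<P>)))
        \<in> iso (M' \<P>) (char_monoid (boldD_prime \<P>)) \<and>
      point_char (abelianization (boldD_prime \<P>)) (\<lambda>f. ab_class (boldD_prime \<P>) (gen \<P> f))
          (carrier (graded_dual \<P> (ops \<P>)))
        \<in> iso (M' \<P>) (char_monoid (abelianization (boldD_prime \<P>)))) \<and>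
     \<comment> \<open>1 (b)\<close>
     (monoid (M \<P>) \<and> monoid (char_monoid (boldD_star \<P>)) \<and>
      monoid (char_monoid (abelianization (boldD_star \<P>))) \<and>
      point_char (boldD_star \<P>) (gen \<P>) (carrier (graded_dual \<P> (ops \<P>)))
        \<in> iso (M \<P>) (char_monoid (boldD_star \<P>)) \<and>
      point_char (abelianization (boldD_star \<P>)) (\<lambda>f. ab_class (boldD_star \<P>) (gen \<P> f))
          (carrier (graded_dual \<P> (ops \<P>)))
        \<in> iso (M \<P>) (char_monoid (abelianization (boldD_star \<P>)))) \<and>
     \<comment> \<open>1 (c)\<close>
     M' \<P> \<cong> M \<P> \<and>
     \<comment> \<open>1 (d)\<close>
     (let \<pi> = coinv_class \<P> (ops \<P>); C = completion (coinv \<P> (ops \<P>));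
          Q = quotient_monoid (M \<P>) \<pi> C; Q' = quotient_monoid (M' \<P>) \<pi> C
      in monoid Q \<and> \<pi> \<in> epi (M \<P>) Q \<and> monoid Q' \<and> \<pi> \<in> epi (M' \<P>) Q' \<and>
         monoid (char_monoid (D_star \<P>)) \<and>
         (\<exists>\<Phi> \<in> iso Q (char_monoid (D_star \<P>)). \<forall>x\<in>carrier (M \<P>).
            \<Phi> (\<pi> x) = point_char (D_star \<P>) (S_gen \<P>) (inv_dual \<P> (ops \<P>)) x)) \<and>
     \<comment> \<open>2 (a)\<close>
     (group (M_plus \<P>) \<and> group (char_monoid (boldB_star \<P>)) \<and>
      group (char_monoid (abelianization (boldB_star \<P>))) \<and>
      point_char (boldB_star \<P>) (boldB_gen \<P>) (carrier (graded_dual \<P> (plus_ops \<P>)))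
        \<in> iso (M_plus \<P>) (char_monoid (boldB_star \<P>)) \<and>
      point_char (abelianization (boldB_star \<P>)) (\<lambda>f. ab_class (boldB_star \<P>) (boldB_gen \<P> f))
          (carrier (graded_dual \<P> (plus_ops \<P>)))
        \<in> iso (M_plus \<P>) (char_monoid (abelianization (boldB_star \<P>)))) \<and>
     \<comment> \<open>2 (b)\<close>
     (let \<pi> = coinv_class \<P> (plus_ops \<P>); C = completion (coinv \<P> (plus_ops \<P>));
          Q = quotient_monoid (M_plus \<P>) \<pi> C
      in group Q \<and> \<pi> \<in> epi (M_plus \<P>) Q \<and> group (char_monoid (B_star \<P>)) \<and>
         (\<exists>\<Phi> \<in> iso Q (char_monoid (B_star \<P>)). \<forall>x\<in>carrier (M_plus \<P>).
            \<Phi> (\<pi> x) = point_char (B_star \<P>) (B_gen \<P>) (inv_dual \<P> (plus_ops \<P>)) x))"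
proof -
  interpret operad_fin \<P>
    by (intro operad_fin.intro reduced_operad.intro reduced_operad_axioms.intro operad_fin_axioms.intro assms)
  have ev: "\<And>x f. f \<in> carrier D \<Longrightarrow> chi x (gn f) = eval f x" by (rule chi_gen)
  have gM': "carrier (boldD_prime \<P>) \<subseteq> subalgebra_gen (boldD_prime \<P>) (gn ` carrier D)"
    unfolding boldD_prime_def by (rule boldD_gen)
  have iM': "\<And>f. f \<in> carrier D \<Longrightarrow> gn f \<in> carrier (boldD_prime \<P>)"
    using gn_in by (simp add: boldD_prime_def del: ta_simps)
  have gM: "carrier Dst \<subseteq> subalgebra_gen Dst (gn ` carrier D)"
    unfolding boldD_star_def by (rule boldD_gen)
  have d: "monoid Qm" "pc \<in> epi (M \<P>) Qm" "monoid Qm'" "pc \<in> epi (M' \<P>) Qm'" "monoid (char_monoid (D_star \<P>))"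
    by (rule Qm(1,2) Qm'(1,2) points_iso(1)[OF chiD_points])+
  have d': "\<exists>\<Phi>\<in>iso Qm (char_monoid (D_star \<P>)). \<forall>x\<in>carrier (M \<P>). \<Phi> (pc x) = point_char (D_star \<P>) sg invD x"
    by (rule bexI[OF _ points_iso(2)[OF chiD_points]]) (simp add: chiD_point_char)
  obtain \<chi> where \<chi>: "points (boldB_star \<P>) (M_plus \<P>) \<chi>"
    "\<And>x f. x \<in> carrier (M_plus \<P>) \<Longrightarrow> f \<in> carrier Dp \<Longrightarrow> \<chi> x (boldB_gen \<P> f) = eval f x"
    "\<And>f. f \<in> carrier Dp \<Longrightarrow> boldB_gen \<P> f \<in> carrier (boldB_star \<P>)"
    "carrier (boldB_star \<P>) \<subseteq> subalgebra_gen (boldB_star \<P>) (boldB_gen \<P> ` carrier Dp)"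
    using Bst by blast
  obtain \<xi> where \<xi>: "points (B_star \<P>) Qp \<xi>"
    "\<And>x. x \<in> pfams \<Longrightarrow> \<xi> (pp x) = point_char (B_star \<P>) (B_gen \<P>) (inv_dual \<P> (plus_ops \<P>)) x"
    using B_star_points by blast
  have gQ: "group Qp"
    by (rule quotient_monoid_group[OF group_M_plus Qp(1,2)]) (simp add: Qp(3))
  have e: "group Qp" "pp \<in> epi (M_plus \<P>) Qp" "group (char_monoid (B_star \<P>))"
    by (rule gQ Qp(2) points_group[OF \<xi>(1) gQ])+
  have e': "\<exists>\<Phi>\<in>iso Qp (char_monoid (B_star \<P>)). \<forall>x\<in>carrier (M_plus \<P>).
      \<Phi> (pp x) = point_char (B_star \<P>) (B_gen \<P>) (inv_dual \<P> (plus_ops \<P>)) x"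
    by (rule bexI[OF _ points_iso(2)[OF \<xi>(1)]]) (simp add: \<xi>(2))
  show ?thesis
    unfolding Let_def
    by (intro conjI monoid_M' monoid_M points_iso(1)[OF points_prime] points_iso(1)[OF points_star]
        abelianization_point_char(1,2)[OF points_prime iM' ev gM'] points_point_char[OF points_prime iM' ev gM']
        abelianization_point_char(1,2)[OF points_star gn_Dst ev gM] points_point_char[OF points_star gn_Dst ev gM]
        is_isoI[OF shift_iso] d d' group_M_plus points_group[OF \<chi>(1) group_M_plus]
        points_point_char[OF \<chi>(1,3,2,4)] abelianization_point_char(1)[OF \<chi>(1,3,2,4)]
        abelianization_point_char(3)[OF \<chi>(1,3,2,4) group_M_plus] e e')
qed

end
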